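(* For a fixed $\delta>0$ and $f\in L^2(\Omega)$, $g\in L^2(\partial\Omega)$, there exists a unique solution $u_\delta\in L^2(\Omega)$ to the integral equation $$\frac{1}{\delta^2}\int_{\Omega}R_\delta(x,y)(u_\delta(x)-u_\delta(y))\,dy+\frac{2}{\delta}\int_{\partial\Omega}\bar R_\delta(x,y)(u_\delta(x)-g(y))\,dS_y=\int_\Omega \bar R_\delta(x,y)f(y)\,dy,\qquad x\in\Omega.$$ Moreover, $u_\delta\in H^1(\Omega)$, and there exists a constant $C>0$ independent of $\delta$ (and of $f,g$) such that $$\|u_\delta\|_{H^1(\Omega)}\le C\|f\|_{L^2(\Omega)}+\frac{C}{\sqrt{\delta}}\|g\|_{L^2(\partial\Omega)}.$$
   Context: $\Omega\subset\mathbb{R}^n$ is a bounded connected domain whose boundary $\partial\Omega$ is smooth enough; $dS_y$ is surface measure on $\partial\Omega$. The function $R:[0,\infty)\to[0,\infty)$ satisfies: $R\in C^1([0,\infty))$; $R(r)\ge 0$ and $R(r)=0$ for all $r>1$; there is $\gamma_0>0$ with $R(r)\ge\gamma_0$ for $0\le r\le \frac12$. Set $\bar R(r)=\int_r^{\infty}R(s)\,ds$. For $\delta>0$ put $$R_\delta(x,y)=\alpha_n\delta^{-n}R\left(\frac{|x-y|^2}{4\delta^2}\right),\qquad \bar R_\delta(x,y)=\alpha_n\delta^{-n}\bar R\left(\frac{|x-y|^2}{4\delta^2}\right),$$ where the constant $\alpha_n>0$ is chosen so that $\int_{\mathbb{R}^n}\bar R_\delta(x,y)\,dy=1$. The domain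 $\Omega$ and the function $R$ are fixed.
   Formalization: The bound is proved for 0<δ≤δ₀ with any fixed δ₀, and C may depend on δ₀; no single C works for all δ>0, since for g=0 and δ→∞ the solution grows like δ∫f/(2|∂Ω|). *)

theory Defs
  imports "HOL-Analysis.Analysis"
begin

section \<open>Surface measure\<close>

text \<open>
  Surface measure on a hypersurface is Hausdorff measure of codimension one, normalised by the
  volume of the unit ball so that it agrees with Lebesgue measure on Euclidean space of
  dimension \<open>k\<close>.  The empty set gets gauge 0 separately because \<open>0 ^ 0 = 1\<close>; with this, \<open>k = 0\<close>
  gives counting measure.  Boundedness is required since \<open>diameter\<close> is unspecified on unbounded
  sets.
\<close>

definition hausdorff_gauge :: "nat \<Rightarrow> 'a::metric_space set \<Rightarrow> ennreal" where
  "hausdorff_gauge k U =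
     (if U = {} then 0 else ennreal (unit_ball_vol (real k) * (diameter U / 2) ^ k))"

definition hausdorff_covers :: "real \<Rightarrow> 'a::metric_space set \<Rightarrow> (nat \<Rightarrow> 'a set) set" where
  "hausdorff_covers \<eta> A =
     {U. A \<subseteq> (\<Union>i. U i) \<and> (\<forall>i. bounded (U i) \<and> diameter (U i) \<le> \<eta>)}"

definition hausdorff_pre :: "nat \<Rightarrow> real \<Rightarrow> 'a::metric_space set \<Rightarrow> ennreal" where
  "hausdorff_pre k \<eta> A = (INF U\<in>hausdorff_covers \<eta> A. \<Sum>i. hausdorff_gauge k (U i))"

definition hausdorff_outer :: "nat \<Rightarrow> 'a::metric_space set \<Rightarrow> ennreal" where
  "hausdorff_outer k A = (SUP \<eta>\<in>{0<..}. hausdorff_pre k \<eta> A)"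

definition hausdorff_measure :: "nat \<Rightarrow> 'a::metric_space measure" where
  "hausdorff_measure k = measure_of UNIV (sets borel) (hausdorff_outer k)"

text \<open>
  \<open>measure_of\<close> yields the zero measure unless the set function is countably additive, so this is
  checked here: Hausdorff outer measure is a metric outer measure, hence a measure on Borel sets.
\<close>

lemma hausdorff_outer_empty: "hausdorff_outer k {} = 0"
proof -
  have "hausdorff_pre k \<eta> {} \<le> 0" if "\<eta> > 0" for \<eta> :: real
    unfolding hausdorff_pre_def
    by (rule INF_lower2[of "\<lambda>_. {}"]) (use that in \<open>auto simp: hausdorff_covers_def hausdorff_gauge_def\<close>)
  then show ?thesis
    unfolding hausdorff_outer_def by (metis (no_types, lifting) SUP_least greaterThan_iff le_zero_eq)
qed

lemma hausdorff_pre_mono: "A \<subseteq> B \<Longrightarrow> hausdorff_pre k \<eta> A \<le> hausdorff_pre k \<eta> B"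
  unfolding hausdorff_pre_def by (rule INF_superset_mono) (auto simp: hausdorff_covers_def)

lemma hausdorff_pre_antimono: "\<eta> \<le> \<theta> \<Longrightarrow> hausdorff_pre k \<theta> A \<le> hausdorff_pre k \<eta> A"
  unfolding hausdorff_pre_def
  by (rule INF_superset_mono) (auto simp: hausdorff_covers_def intro: order_trans)

lemma hausdorff_outer_mono: "A \<subseteq> B \<Longrightarrow> hausdorff_outer k A \<le> hausdorff_outer k B"
  unfolding hausdorff_outer_def by (rule SUP_mono) (auto intro: hausdorff_pre_mono)

lemma hausdorff_pre_le_outer: "\<eta> > 0 \<Longrightarrow> hausdorff_pre k \<eta> A \<le> hausdorff_outer k A"
  unfolding hausdorff_outer_def by (rule SUP_upper) auto

lemma hausdorff_pre_subadditive:
  "hausdorff_pre k \<eta> (\<Union>i. A i) \<le> (\<Sum>i. hausdorff_pre k \<eta> (A i))" for A :: "nat \<Rightarrow> _"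
proof (rule ennreal_le_epsilon)
  fix e :: real
  assume e: "0 < e" and fin: "(\<Sum>n. hausdorff_pre k \<eta> (A n)) < top"
  then have *: "\<And>n. hausdorff_pre k \<eta> (A n) < hausdorff_pre k \<eta> (A n) + e * (1/2)^Suc n"
    by (auto simp add: less_top dest!: ennreal_suminf_lessD)
  have "\<exists>U\<in>hausdorff_covers \<eta> (A n).
          (\<Sum>i. hausdorff_gauge k (U i)) < hausdorff_pre k \<eta> (A n) + e * (1/2)^Suc n" for n
    using *[of n] by (subst (asm) (1) hausdorff_pre_def) (simp only: INF_less_iff)
  then obtain B where B: "\<And>n. B n \<in> hausdorff_covers \<eta> (A n)"
    and Ble: "\<And>n. (\<Sum>i. hausdorff_gauge k (B n i)) < hausdorff_pre k \<eta> (A n) + e * (1/2)^Suc n"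
    by metis
  define C where "C = case_prod B o prod_decode"
  have "C \<in> hausdorff_covers \<eta> (\<Union>i. A i)"
  proof -
    have "x \<in> (\<Union>i. C i)" if x: "x \<in> A n" for x n
    proof -
      obtain i where "x \<in> B n i" using B[of n] x by (auto simp: hausdorff_covers_def)
      then have "x \<in> C (prod_encode (n, i))" by (simp add: C_def)
      then show ?thesis by blast
    qed
    moreover have "bounded (C i) \<and> diameter (C i) \<le> \<eta>" for i
      using B by (auto simp: hausdorff_covers_def C_def split: prod.split)
    ultimately show ?thesis by (auto simp: hausdorff_covers_def)
  qed
  then have "hausdorff_pre k \<eta> (\<Union>i. A i) \<le> (\<Sum>i. hausdorff_gauge k (C i))"
    unfolding hausdorff_pre_def by (rule INF_lower)
  also have "\<dots> = (\<Sum>n. \<Sum>i. hausdorff_gauge k (B n i))"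
    using suminf_ennreal_2dimen[where f = "\<lambda>p. hausdorff_gauge k (case_prod B p)"]
    by (simp add: C_def)
  also have "\<dots> \<le> (\<Sum>n. hausdorff_pre k \<eta> (A n) + e * (1/2) ^ Suc n)"
    by (intro suminf_le allI less_imp_le[OF Ble]) auto
  also have "... = (\<Sum>n. hausdorff_pre k \<eta> (A n)) + (\<Sum>n. ennreal e * ennreal ((1/2) ^ Suc n))"
    using \<open>0 < e\<close> by (subst suminf_add[symmetric])
                     (auto simp del: ennreal_suminf_cmult simp add: ennreal_mult[symmetric])
  also have "\<dots> = (\<Sum>n. hausdorff_pre k \<eta> (A n)) + e"
    unfolding ennreal_suminf_cmult
    by (subst suminf_ennreal_eq[OF zero_le_power power_half_series]) auto
  finally show "hausdorff_pre k \<eta> (\<Union>i. A i) \<le> (\<Sum>n. hausdorff_pre k \<eta> (A n)) + e" .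
qed

lemma hausdorff_outer_subadditive:
  "hausdorff_outer k (\<Union>i. A i) \<le> (\<Sum>i. hausdorff_outer k (A i))" for A :: "nat \<Rightarrow> _"
  unfolding hausdorff_outer_def[of k "\<Union>i. A i"]
proof (rule SUP_least)
  fix \<eta> :: real assume "\<eta> \<in> {0<..}"
  then show "hausdorff_pre k \<eta> (\<Union>i. A i) \<le> (\<Sum>i. hausdorff_outer k (A i))"
    by (intro order_trans[OF hausdorff_pre_subadditive] suminf_le)
       (auto intro: hausdorff_pre_le_outer)
qed

lemma hausdorff_outer_subadditive2:
  "hausdorff_outer k (A \<union> B) \<le> hausdorff_outer k A + hausdorff_outer k B"
proof -
  have "hausdorff_outer k (\<Union>i. binaryset A B i) \<le> (\<Sum>i. hausdorff_outer k (binaryset A B i))"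
    by (rule hausdorff_outer_subadditive)
  then show ?thesis
    by (simp add: UN_binaryset_eq suminf_binaryset_eq hausdorff_outer_empty)
qed

lemma hausdorff_outer_separated:
  fixes A B :: "'a::metric_space set"
  assumes d: "d > 0" and sep: "\<And>x y. x \<in> A \<Longrightarrow> y \<in> B \<Longrightarrow> d \<le> dist x y"
  shows "hausdorff_outer k A + hausdorff_outer k B \<le> hausdorff_outer k (A \<union> B)"
proof -
  have pre: "hausdorff_pre k \<eta> A + hausdorff_pre k \<eta> B \<le> hausdorff_pre k \<eta> (A \<union> B)"
    if \<eta>: "0 < \<eta>" "\<eta> < d" for \<eta>
    unfolding hausdorff_pre_def[of k \<eta> "A \<union> B"]
  proof (rule INF_greatest)
    fix U assume U: "U \<in> hausdorff_covers \<eta> (A \<union> B)"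
    define V where "V = (\<lambda>i. if U i \<inter> A = {} then {} else U i)"
    define W where "W = (\<lambda>i. if U i \<inter> A = {} then U i else {})"
    have "V \<in> hausdorff_covers \<eta> A"
      using U \<eta> unfolding hausdorff_covers_def V_def by (auto split: if_splits) blast
    moreover have "W \<in> hausdorff_covers \<eta> B"
    proof -
      have "U i \<inter> A = {}" if y: "y \<in> B" "y \<in> U i" for y i
      proof (rule ccontr)
        assume "U i \<inter> A \<noteq> {}"
        then obtain x where x: "x \<in> U i" "x \<in> A" by auto
        have "dist x y \<le> diameter (U i)"
          using U x y by (intro diameter_bounded_bound) (auto simp: hausdorff_covers_def)
        also have "\<dots> \<le> \<eta>" using U by (auto simp: hausdorff_covers_def)
        finally show False using sep[OF x(2) y(1)] \<eta> by simp
      qed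
      then have "B \<subseteq> (\<Union>i. W i)"
        using U unfolding hausdorff_covers_def W_def by auto blast
      then show ?thesis using U \<eta> unfolding hausdorff_covers_def W_def by auto
    qed
    ultimately have "hausdorff_pre k \<eta> A + hausdorff_pre k \<eta> B
        \<le> (\<Sum>i. hausdorff_gauge k (V i)) + (\<Sum>i. hausdorff_gauge k (W i))"
      unfolding hausdorff_pre_def by (intro add_mono INF_lower)
    also have "\<dots> = (\<Sum>i. hausdorff_gauge k (V i) + hausdorff_gauge k (W i))"
      by (rule suminf_add) auto
    also have "(\<lambda>i. hausdorff_gauge k (V i) + hausdorff_gauge k (W i)) = (\<lambda>i. hausdorff_gauge k (U i))"
      by (auto simp: V_def W_def hausdorff_gauge_def)
    finally show "hausdorff_pre k \<eta> A + hausdorff_pre k \<eta> B \<le> (\<Sum>i. hausdorff_gauge k (U i))" .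
  qed
  have "hausdorff_pre k \<eta> A + hausdorff_pre k \<theta> B \<le> hausdorff_outer k (A \<union> B)"
    if "0 < \<eta>" "0 < \<theta>" for \<eta> \<theta>
  proof -
    define r where "r = min (min \<eta> \<theta>) (d / 2)"
    have r: "0 < r" "r < d" "r \<le> \<eta>" "r \<le> \<theta>" using that d by (auto simp: r_def)
    have "hausdorff_pre k \<eta> A + hausdorff_pre k \<theta> B \<le> hausdorff_pre k r A + hausdorff_pre k r B"
      by (intro add_mono hausdorff_pre_antimono r)
    also have "\<dots> \<le> hausdorff_pre k r (A \<union> B)" by (rule pre[OF r(1,2)])
    also have "\<dots> \<le> hausdorff_outer k (A \<union> B)" by (rule hausdorff_pre_le_outer[OF r(1)])
    finally show ?thesis .
  qed
  then have "hausdorff_pre k \<eta> A + hausdorff_outer k B \<le> hausdorff_outer k (A \<union> B)"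
    if "0 < \<eta>" for \<eta>
    unfolding hausdorff_outer_def[of k B] using that
    by (subst ennreal_SUP_add_right) (auto intro!: SUP_least intro: gt_ex)
  then have "(SUP \<eta>\<in>{0<..}. hausdorff_pre k \<eta> A + hausdorff_outer k B) \<le> hausdorff_outer k (A \<union> B)"
    by (auto intro: SUP_least)
  then show ?thesis
    unfolding hausdorff_outer_def[of k A]
    by (subst (asm) ennreal_SUP_add_left) (auto intro: gt_ex)
qed

lemma hausdorff_outer_closed:
  fixes F A :: "'a::metric_space set"
  assumes F: "closed F"
  shows "hausdorff_outer k (A \<inter> F) + hausdorff_outer k (A - F) = hausdorff_outer k A"
proof (rule antisym)
  have "hausdorff_outer k ((A \<inter> F) \<union> (A - F)) \<le> hausdorff_outer k (A \<inter> F) + hausdorff_outer k (A - F)"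
    by (rule hausdorff_outer_subadditive2)
  then show "hausdorff_outer k A \<le> hausdorff_outer k (A \<inter> F) + hausdorff_outer k (A - F)"
    by (simp add: Un_Diff_Int Int_Diff_Un)
next
  let ?H = "hausdorff_outer k :: 'a set \<Rightarrow> ennreal"
  show "?H (A \<inter> F) + ?H (A - F) \<le> ?H A"
  proof (cases "F = {} \<or> ?H A = top")
    case True
    then show ?thesis by (auto simp: hausdorff_outer_empty)
  next
    case False
    then have ne: "F \<noteq> {}" and fin: "?H A < top" by (auto simp: less_top)
    define q where "q = (\<lambda>n. 1 / real (Suc n))"
    have q_pos: "q n > 0" for n by (simp add: q_def)
    have q_less: "q m < q n" if "n < m" for m n
      using that by (simp add: q_def field_simps)
    have q_le: "q m \<le> q n" if "n \<le> m" for m n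
      using that by (simp add: q_def field_simps)
    define E where "E = (\<lambda>n. {x \<in> A. q n \<le> infdist x F})"
    define D where "D = (\<lambda>n. E (Suc n) - E n)"
    have sepF: "?H (A \<inter> F) + ?H (E n) \<le> ?H A" for n
    proof -
      have "?H (A \<inter> F) + ?H (E n) \<le> ?H ((A \<inter> F) \<union> E n)"
      proof (rule hausdorff_outer_separated[OF q_pos[of n]])
        fix x y assume "x \<in> A \<inter> F" "y \<in> E n"
        then show "q n \<le> dist x y"
          using infdist_le[of x F y] by (auto simp: E_def dist_commute)
      qed
      also have "\<dots> \<le> ?H A" by (rule hausdorff_outer_mono) (auto simp: E_def)
      finally show ?thesis .
    qed
    have sepD: "?H X + ?H Y \<le> ?H (X \<union> Y)"
      if X: "X \<subseteq> E j" and Y: "Y \<subseteq> A - E m" and jm: "j < m" for X Y j m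
    proof (rule hausdorff_outer_separated)
      show "q j - q m > 0" using q_less[OF jm] by simp
      fix x y assume "x \<in> X" "y \<in> Y"
      then show "q j - q m \<le> dist x y"
        using X Y infdist_triangle[of x F y] by (force simp: E_def)
    qed
    have E_mono: "E n \<subseteq> E m" if "n \<le> m" for n m
      using q_le[OF that] by (auto simp: E_def)
    have part: "(\<Sum>i<N. ?H (D (2 * i + c))) \<le> ?H (\<Union>i<N. D (2 * i + c))" for N c
    proof (induction N)
      case (Suc N)
      have "(\<Sum>i<Suc N. ?H (D (2 * i + c)))
          \<le> ?H (\<Union>i<N. D (2 * i + c)) + ?H (D (2 * N + c))"
        using Suc by (simp add: add_right_mono)
      also have "\<dots> \<le> ?H ((\<Union>i<N. D (2 * i + c)) \<union> D (2 * N + c))"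
      proof (cases N)
        case 0
        then show ?thesis by (simp add: hausdorff_outer_empty)
      next
        case (Suc M)
        show ?thesis
        proof (rule sepD)
          show "(\<Union>i<N. D (2 * i + c)) \<subseteq> E (2 * M + c + 1)"
          proof
            fix x assume "x \<in> (\<Union>i<N. D (2 * i + c))"
            then obtain i where "i < N" "x \<in> E (Suc (2 * i + c))" by (auto simp: D_def)
            then show "x \<in> E (2 * M + c + 1)"
              using E_mono[of "Suc (2 * i + c)" "2 * M + c + 1"] Suc by auto
          qed
          show "D (2 * N + c) \<subseteq> A - E (2 * N + c)" by (auto simp: D_def E_def)
        qed (use Suc in auto)
      qed
      also have "(\<Union>i<N. D (2 * i + c)) \<union> D (2 * N + c) = (\<Union>i<Suc N. D (2 * i + c))"
        by (auto simp: lessThan_Suc)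
      finally show ?case .
    qed (simp add: hausdorff_outer_empty)
    have half: "(\<Sum>i<N. ?H (D (2 * i + c))) \<le> ?H A" for N c
      by (rule order_trans[OF part hausdorff_outer_mono]) (auto simp: D_def E_def)
    have "(\<Sum>i<n. ?H (D i)) \<le> ?H A + ?H A" for n
    proof -
      have "(\<Sum>i<n. ?H (D i)) \<le> (\<Sum>i<2 * n. ?H (D i))"
        by (rule sum_mono2) auto
      also have "\<dots> = (\<Sum>i<n. ?H (D (2 * i + 0))) + (\<Sum>i<n. ?H (D (2 * i + 1)))"
        by (induction n) (auto simp: ac_simps)
      also have "\<dots> \<le> ?H A + ?H A" by (intro add_mono half)
      finally show ?thesis .
    qed
    then have "(\<Sum>i. ?H (D i)) \<le> ?H A + ?H A"
      by (intro suminf_le_const) auto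
    also have "\<dots> < top" using fin by simp
    finally have sumfin: "(\<Sum>i. ?H (D i)) \<noteq> top" by simp
    have tail: "(\<lambda>n. \<Sum>i. ?H (D (i + n))) \<longlonglongrightarrow> 0"
    proof -
      have eq: "(\<Sum>i. ?H (D (i + n))) = (\<Sum>i. ?H (D i)) - (\<Sum>i<n. ?H (D i))" for n
      proof -
        have "(\<Sum>i<n. ?H (D i)) \<noteq> top"
          using sumfin sum_le_suminf[of "\<lambda>i. ?H (D i)" "{..<n}"]
          by (metis finite_lessThan summableI top_unique zero_le)
        then show ?thesis
          using suminf_offset[of "\<lambda>i. ?H (D i)" n] by (simp add: summableI)
      qed
      have "(\<lambda>n. (\<Sum>i. ?H (D i)) - (\<Sum>i<n. ?H (D i))) \<longlonglongrightarrow> (\<Sum>i. ?H (D i)) - (\<Sum>i. ?H (D i))"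
        using sumfin by (intro tendsto_diff_ennreal tendsto_const summable_LIMSEQ summableI) auto
      then show ?thesis using sumfin by (simp add: eq)
    qed
    have bound: "?H (A \<inter> F) + ?H (A - F) \<le> ?H A + (\<Sum>i. ?H (D (i + n)))" for n
    proof -
      have "A - F \<subseteq> E n \<union> (\<Union>i. D (i + n))"
      proof
        fix x assume x: "x \<in> A - F"
        then have "infdist x F > 0"
          using F ne by (metis DiffD2 in_closed_iff_infdist_zero infdist_nonneg less_eq_real_def)
        then obtain m where m: "q m < infdist x F"
          unfolding q_def using reals_Archimedean[of "infdist x F"] by (auto simp: inverse_eq_divide)
        then have ex: "x \<in> E m" using x by (simp add: E_def)
        show "x \<in> E n \<union> (\<Union>i. D (i + n))"
        proof (cases "x \<in> E n")
          case nE: False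
          define l where "l = (LEAST l. x \<in> E l)"
          have l: "x \<in> E l" unfolding l_def by (rule LeastI[of _ m]) (rule ex)
          have "n < l" using nE l E_mono[of l n] by force
          then obtain p where p: "l = Suc p" "n \<le> p" by (cases l) auto
          have "x \<notin> E p" using not_less_Least[of p "\<lambda>l. x \<in> E l"] p by (auto simp: l_def)
          then have "x \<in> D ((p - n) + n)" using l p by (simp add: D_def)
          then show ?thesis by blast
        qed auto
      qed
      then have "?H (A - F) \<le> ?H (E n \<union> (\<Union>i. D (i + n)))" by (rule hausdorff_outer_mono)
      also have "\<dots> \<le> ?H (E n) + ?H (\<Union>i. D (i + n))" by (rule hausdorff_outer_subadditive2)
      also have "\<dots> \<le> ?H (E n) + (\<Sum>i. ?H (D (i + n)))"
        by (intro add_left_mono hausdorff_outer_subadditive)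
      finally have "?H (A \<inter> F) + ?H (A - F) \<le> (?H (A \<inter> F) + ?H (E n)) + (\<Sum>i. ?H (D (i + n)))"
        by (metis add.assoc add_left_mono)
      also have "\<dots> \<le> ?H A + (\<Sum>i. ?H (D (i + n)))" by (intro add_right_mono sepF)
      finally show ?thesis .
    qed
    have "(\<lambda>n. ?H A + (\<Sum>i. ?H (D (i + n)))) \<longlonglongrightarrow> ?H A + 0"
      by (intro tendsto_intros tail)
    then have "?H (A \<inter> F) + ?H (A - F) \<le> ?H A + 0"
      by (rule LIMSEQ_le_const) (use bound in auto)
    then show ?thesis by simp
  qed
qed

lemma measure_space_hausdorff:
  "measure_space UNIV (sets (borel :: 'a::metric_space measure)) (hausdorff_outer k)"
proof -
  interpret P: sigma_algebra UNIV "Pow UNIV :: 'a set set" by (rule sigma_algebra_Pow)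
  have oms: "outer_measure_space (Pow UNIV :: 'a set set) (hausdorff_outer k)"
    unfolding outer_measure_space_def positive_def increasing_def countably_subadditive_def
    by (auto simp: hausdorff_outer_empty hausdorff_outer_mono intro: hausdorff_outer_subadditive)
  define L where "L = lambda_system UNIV (Pow UNIV :: 'a set set) (hausdorff_outer k)"
  have ms: "measure_space UNIV L (hausdorff_outer k)"
    unfolding L_def by (rule P.caratheodory_lemma[OF oms])
  then have sa: "sigma_algebra UNIV L" by (simp add: measure_space_def)
  have "F \<in> L" if "closed F" for F
    using hausdorff_outer_closed[OF that, of k] P.lambda_system_eq[of "hausdorff_outer k"]
    by (simp add: L_def)
  then have "sigma_sets UNIV (Collect closed) \<subseteq> L"
    by (intro sigma_algebra.sigma_sets_subset[OF sa]) auto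
  then have "sets borel \<subseteq> L" by (simp add: borel_eq_closed)
  then show ?thesis
    using measure_down[OF ms] sets.sigma_algebra_axioms[of "borel :: 'a measure"] by simp
qed

lemma emeasure_hausdorff_measure:
  "A \<in> sets borel \<Longrightarrow> emeasure (hausdorff_measure k) A = hausdorff_outer k A"
  using measure_space_hausdorff[of k] unfolding hausdorff_measure_def
  by (intro emeasure_measure_of_sigma) (auto simp: measure_space_def)

lemma sets_hausdorff_measure: "sets (hausdorff_measure k) = sets borel"
  unfolding hausdorff_measure_def by (metis sets.sigma_sets_eq sets_measure_of space_borel top_greatest Pow_UNIV)

definition surface_measure :: "'a::euclidean_space set \<Rightarrow> 'a measure" where
  "surface_measure \<Omega> = restrict_space (hausdorff_measure (DIM('a) - 1)) (frontier \<Omega>)"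


section \<open>Square-integrable functions\<close>

definition L2 :: "'a measure \<Rightarrow> ('a \<Rightarrow> real) set" where
  "L2 M = {f. f \<in> borel_measurable M \<and> integrable M (\<lambda>x. (f x)\<^sup>2)}"

definition L2_norm :: "'a measure \<Rightarrow> ('a \<Rightarrow> real) \<Rightarrow> real" where
  "L2_norm M f = sqrt (LINT x|M. (f x)\<^sup>2)"


section \<open>Continuously differentiable functions and domains\<close>

text \<open>Meant for open \<open>U\<close>; partial derivatives are directional derivatives along \<open>Basis\<close>.\<close>

primrec Ck_on :: "nat \<Rightarrow> 'a::euclidean_space set \<Rightarrow> ('a \<Rightarrow> real) \<Rightarrow> bool" where
  "Ck_on 0 U f \<longleftrightarrow> continuous_on U f"
| "Ck_on (Suc k) U f \<longleftrightarrow>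
     f differentiable_on U \<and> (\<forall>b\<in>Basis. Ck_on k U (\<lambda>x. frechet_derivative f (at x) b))"

text \<open>
  Near each boundary point, after choosing a coordinate axis \<open>b\<close> and an orientation \<open>s\<close>, the
  set is the part lying above the graph of a \<open>C\<^sup>k\<close> function \<open>\<gamma>\<close> of the remaining coordinates.  A
  function of the remaining coordinates is encoded as a function on the whole space that is
  constant in the direction \<open>b\<close>.
\<close>

definition Ck_boundary :: "nat \<Rightarrow> 'a::euclidean_space set \<Rightarrow> bool" where
  "Ck_boundary k \<Omega> \<longleftrightarrow>
     (\<forall>p\<in>frontier \<Omega>. \<exists>r>0. \<exists>b\<in>Basis. \<exists>s\<in>{-1, 1::real}. \<exists>\<gamma>.
        Ck_on k UNIV \<gamma> \<and> (\<forall>x t. \<gamma> (x + t *\<^sub>R b) = \<gamma> x) \<and>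
        \<Omega> \<inter> ball p r = {x \<in> ball p r. \<gamma> x < s * (x \<bullet> b)})"


section \<open>The Sobolev space of order one\<close>

definition test_functions :: "'a::euclidean_space set \<Rightarrow> ('a \<Rightarrow> real) set" where
  "test_functions \<Omega> =
     {\<phi>. (\<forall>k. Ck_on k UNIV \<phi>) \<and> compact (closure {x. \<phi> x \<noteq> 0}) \<and> closure {x. \<phi> x \<noteq> 0} \<subseteq> \<Omega>}"

definition is_weak_partial ::
    "'a::euclidean_space set \<Rightarrow> 'a \<Rightarrow> ('a \<Rightarrow> real) \<Rightarrow> ('a \<Rightarrow> real) \<Rightarrow> bool" where
  "is_weak_partial \<Omega> b u v \<longleftrightarrow>
     (\<forall>\<phi>\<in>test_functions \<Omega>.
        (LINT x|lebesgue_on \<Omega>. u x * frechet_derivative \<phi> (at x) b)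
          = - (LINT x|lebesgue_on \<Omega>. v x * \<phi> x))"

definition H1 :: "'a::euclidean_space set \<Rightarrow> ('a \<Rightarrow> real) set" where
  "H1 \<Omega> = {u \<in> L2 (lebesgue_on \<Omega>). \<forall>b\<in>Basis. \<exists>v\<in>L2 (lebesgue_on \<Omega>). is_weak_partial \<Omega> b u v}"

text \<open>Weak partial derivatives are unique up to null sets, so the choice does not affect norms.\<close>

definition weak_partial :: "'a::euclidean_space set \<Rightarrow> 'a \<Rightarrow> ('a \<Rightarrow> real) \<Rightarrow> 'a \<Rightarrow> real" where
  "weak_partial \<Omega> b u = (SOME v. v \<in> L2 (lebesgue_on \<Omega>) \<and> is_weak_partial \<Omega> b u v)"

definition H1_norm :: "'a::euclidean_space set \<Rightarrow> ('a \<Rightarrow> real) \<Rightarrow> real" where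
  "H1_norm \<Omega> u =
     sqrt ((L2_norm (lebesgue_on \<Omega>) u)\<^sup>2
           + (\<Sum>b\<in>Basis. (L2_norm (lebesgue_on \<Omega>) (weak_partial \<Omega> b u))\<^sup>2))"


section \<open>Kernels and the integral equation\<close>

text \<open>
  The profile \<open>R\<close> lives on the half line; only its values at nonnegative arguments matter, and at
  0 its derivative is one-sided.
\<close>

definition C1_halfline :: "(real \<Rightarrow> real) \<Rightarrow> bool" where
  "C1_halfline R \<longleftrightarrow>
     (\<exists>R'. continuous_on {0..} R' \<and>
           (\<forall>r\<ge>0. (R has_real_derivative R' r) (at r within {0..})))"

definition Rbar :: "(real \<Rightarrow> real) \<Rightarrow> real \<Rightarrow> real" where
  "Rbar R r = (LINT s:{r..}|lborel. R s)"

definition scaled_kernel ::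
    "real \<Rightarrow> (real \<Rightarrow> real) \<Rightarrow> real \<Rightarrow> 'a::euclidean_space \<Rightarrow> 'a \<Rightarrow> real" where
  "scaled_kernel \<alpha> K \<delta> x y = \<alpha> / \<delta> ^ DIM('a) * K ((norm (x - y))\<^sup>2 / (4 * \<delta>\<^sup>2))"

text \<open>
  Elements of \<open>L\<^sup>2(\<Omega>)\<close> are equivalence classes, so the equation is required for almost every
  \<open>x \<in> \<Omega>\<close>.
\<close>

definition is_solution ::
    "'a::euclidean_space set \<Rightarrow> (real \<Rightarrow> real) \<Rightarrow> real \<Rightarrow> real
      \<Rightarrow> ('a \<Rightarrow> real) \<Rightarrow> ('a \<Rightarrow> real) \<Rightarrow> ('a \<Rightarrow> real) \<Rightarrow> bool" where
  "is_solution \<Omega> R \<alpha> \<delta> f g u \<longleftrightarrow>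
     u \<in> L2 (lebesgue_on \<Omega>) \<and>
     (AE x in lebesgue_on \<Omega>.
        1 / \<delta>\<^sup>2 * (LINT y|lebesgue_on \<Omega>. scaled_kernel \<alpha> R \<delta> x y * (u x - u y))
        + 2 / \<delta> * (LINT y|surface_measure \<Omega>. scaled_kernel \<alpha> (Rbar R) \<delta> x y * (u x - g y))
        = (LINT y|lebesgue_on \<Omega>. scaled_kernel \<alpha> (Rbar R) \<delta> x y * f y))"

end

theory Submission
  imports Defs
begin

text \<open>
  Multiplied by \<open>\<delta>\<^sup>2\<close>, the equation reads \<open>(w + \<sigma>) u - K u = F\<close>, where \<open>K\<close> is integration against the
  symmetric nonnegative kernel \<open>R\<^sub>\<delta>\<close>, \<open>w\<close> is its mass, \<open>\<sigma>\<close> is \<open>2\<delta>\<close> times the boundary integral of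
  the kernel \<open>Rbar\<close>, and \<open>F\<close> collects the data.  Its quadratic form is
  \<open>1/2 \<integral>\<integral> R\<^sub>\<delta>(x,y) (u x - u y)\<^sup>2 + \<integral> \<sigma> u\<^sup>2\<close>.  Everything rests on the coercivity
  \<open>\<parallel>u\<parallel>\<^sup>2 \<le> P\<^sub>0 / \<delta>\<^sup>2 * form u\<close> with \<open>P\<^sub>0\<close> independent of \<open>\<delta>\<close>, a nonlocal Poincare inequality with a
  boundary term (\<open>nonlocal_Poincare_boundary\<close>).

  That inequality is built from translations.  Points at distance at most \<open>\<delta>/2\<close> are compared through
  their common neighbours, a shift by \<open>H\<close> inside the domain is a chain of about \<open>|H|/\<delta>\<close> such steps,
  and Cauchy--Schwarz along the chain costs a factor \<open>1/\<delta>\<^sup>2\<close> (\<open>nl_energy_shift\<close>).  A \<open>C\<^sup>1\<close> boundary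
  gives the interior cone condition, along whose axes points are carried into balls inside the
  domain; compactness and connectedness then yield the inequality for \<open>u x - u y\<close> on all pairs of
  points (\<open>nonlocal_Poincare_Wirtinger\<close>).  To bound \<open>u\<close> itself, it is bounded in a strip above a piece
  of the boundary, which is cut into layers of thickness comparable to \<open>\<delta>\<close>: in the lowest layer
  \<open>\<sigma>\<close> is bounded below by the lower regularity of the surface measure, and the other layers are its
  translates.  The surface measure is a Hausdorff measure, so its regularity is proved from
  coverings of a graph.

  Existence follows from coercivity by a monotone iteration: for \<open>F \<ge> 0\<close> the iterates of
  \<open>u = (K u + F) / (w + \<sigma>)\<close> increase, and being subsolutions they stay bounded.  Uniqueness is
  coercivity of the difference.  Testing the equation with \<open>u\<close> gives the energy estimate
  \<open>form u \<le> 4 (\<delta> \<parallel>g\<parallel>\<^sup>2 + \<delta>\<^sup>2 P\<^sub>0 \<parallel>f\<parallel>\<^sup>2)\<close> (\<open>energy_estimate\<close>); dividing by \<open>\<delta>\<^sup>2\<close>,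
  as coercivity requires, leaves the factor \<open>1 / \<delta>\<close> on \<open>\<parallel>g\<parallel>\<^sup>2\<close>.

  For the gradient the equation is read as the formula \<open>u = (K u + F) / (w + \<sigma>)\<close>, whose right-hand side
  depends on \<open>x\<close> only through the kernels and is therefore differentiable.  Its derivative involves
  \<open>\<integral> \<partial>R\<^sub>\<delta>(x,y) (u y - u x) dy\<close>, which is of the size \<open>1/\<delta>\<close> times the square root of the form, but at the
  interaction radius \<open>2\<delta>\<close>, where \<open>R\<close> may be small although its derivative is not; the doubling
  inequality \<open>nl_energy_doubling\<close> brings the radius back to \<open>\<delta>\<close>.  The boundary contribution
  \<open>u x * \<integral> \<partial>Rbar\<^sub>\<delta>(x,y) dS y\<close> is controlled by \<open>\<sigma> u\<^sup>2\<close>, because \<open>R\<^sup>2\<close> is at most a constant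
  times \<open>Rbar\<close> (\<open>R_square_le\<close>).  Finally the pointwise derivative is a weak derivative, by
  translation invariance, and weak derivatives are unique.

  The scaled problem is a locale whose parameters are the geometric constants; none of them depends
  on \<open>\<delta>\<close>, as long as \<open>\<delta>\<close> stays below a given bound, and so neither does the final constant.
\<close>

section \<open>Local geometry of a domain with C1 boundary\<close>

text \<open>
  A boundary chart.  The height function \<open>\<phi>\<close> replaces the graph function of the definition of a
  \<open>C\<^sup>k\<close> boundary: it grows with unit speed in the direction \<open>e\<close>, it is Lipschitz near \<open>p\<close>, and its
  sign tells the domain from its complement.
\<close>

definition graph_chart ::
    "'a::euclidean_space set \<Rightarrow> 'a \<Rightarrow> real \<Rightarrow> real \<Rightarrow> 'a \<Rightarrow> ('a \<Rightarrow> real) \<Rightarrow> bool" where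
  "graph_chart \<Omega> p r K e \<phi> \<longleftrightarrow>
     r > 0 \<and> K \<ge> 1 \<and> (e \<in> Basis \<or> - e \<in> Basis) \<and> continuous_on UNIV \<phi> \<and>
     (\<forall>x t. \<phi> (x + t *\<^sub>R e) = \<phi> x + t) \<and>
     (\<forall>x\<in>ball p r. \<forall>y\<in>ball p r. \<bar>\<phi> x - \<phi> y\<bar> \<le> K * norm (x - y)) \<and>
     \<phi> p = 0 \<and>
     \<Omega> \<inter> ball p r = {x \<in> ball p r. \<phi> x > 0} \<and>
     frontier \<Omega> \<inter> ball p r = {x \<in> ball p r. \<phi> x = 0}"

lemma C1_Lipschitz_on_ball:
  fixes \<gamma> :: "'a::euclidean_space \<Rightarrow> real"
  assumes "Ck_on 1 UNIV \<gamma>"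
  obtains L where "L \<ge> 0" "\<And>x y. x \<in> ball p r \<Longrightarrow> y \<in> ball p r \<Longrightarrow> \<bar>\<gamma> x - \<gamma> y\<bar> \<le> L * norm (x - y)"
proof -
  have diff: "\<gamma> differentiable (at x)" for x
    using assms by (simp add: differentiable_on_def)
  have cont: "continuous_on UNIV (\<lambda>x. frechet_derivative \<gamma> (at x) b)" if "b \<in> Basis" for b
    using assms that by simp
  have "\<exists>M. \<forall>x\<in>cball p r. \<bar>frechet_derivative \<gamma> (at x) b\<bar> \<le> M" if "b \<in> Basis" for b
  proof -
    have "compact ((\<lambda>x. frechet_derivative \<gamma> (at x) b) ` cball p r)"
      by (intro compact_continuous_image continuous_on_subset[OF cont[OF that]]) auto
    then show ?thesis
      by (auto dest!: compact_imp_bounded simp: bounded_iff)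
  qed
  then obtain M where M: "\<And>b x. b \<in> Basis \<Longrightarrow> x \<in> cball p r \<Longrightarrow> \<bar>frechet_derivative \<gamma> (at x) b\<bar> \<le> M b"
    by metis
  define L where "L = (\<Sum>b\<in>(Basis::'a set). \<bar>M b\<bar>)"
  have "norm (\<gamma> x - \<gamma> y) \<le> L * norm (x - y)" if xy: "x \<in> ball p r" "y \<in> ball p r" for x y
  proof (rule differentiable_bound[OF convex_ball _ _ xy])
    fix z assume z: "z \<in> ball p r"
    let ?D = "frechet_derivative \<gamma> (at z)"
    have D: "(\<gamma> has_derivative ?D) (at z)"
      using diff frechet_derivative_works by blast
    then show "(\<gamma> has_derivative ?D) (at z within ball p r)"
      by (rule has_derivative_at_withinI)
    interpret linear ?D using D has_derivative_linear by blast
    show "onorm ?D \<le> L"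
    proof (rule onorm_le)
      fix h
      have "?D h = ?D (\<Sum>b\<in>Basis. (h \<bullet> b) *\<^sub>R b)" by (simp add: euclidean_representation)
      also have "\<dots> = (\<Sum>b\<in>Basis. (h \<bullet> b) * ?D b)" by (simp add: sum scaleR)
      finally have "norm (?D h) \<le> (\<Sum>b\<in>Basis. \<bar>h \<bullet> b\<bar> * \<bar>?D b\<bar>)"
        by (simp add: abs_mult[symmetric] sum_abs)
      also have "\<dots> \<le> (\<Sum>b\<in>Basis. norm h * \<bar>M b\<bar>)"
      proof (intro sum_mono mult_mono)
        show "\<bar>?D b\<bar> \<le> \<bar>M b\<bar>" if "b \<in> Basis" for b
          using M[OF that, of z] z by simp
      qed (simp_all add: Basis_le_norm)
      finally show "norm (?D h) \<le> L * norm h"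
        by (simp add: L_def sum_distrib_left[symmetric] mult.commute)
    qed
  qed
  moreover have "L \<ge> 0" by (simp add: L_def sum_nonneg)
  ultimately show ?thesis using that by simp
qed

text \<open>
  Taking \<open>\<phi> x = s (x \<bullet> b) - \<gamma> x\<close> turns the graph into a level set.  The zero level is the
  frontier: moving up along the axis from it leads into the domain, and where \<open>\<phi> < 0\<close> a whole
  neighbourhood misses the domain.
\<close>

lemma boundary_chart:
  assumes \<Omega>: "open \<Omega>" and Ck: "Ck_boundary 1 \<Omega>" and p: "p \<in> frontier \<Omega>"
  obtains r K e \<phi> where "graph_chart \<Omega> p r K e \<phi>"
proof -
  obtain r b s \<gamma> where r: "r > 0" and b: "b \<in> Basis" and s': "s \<in> {-1, 1::real}"
    and C1: "Ck_on 1 UNIV \<gamma>" and inv: "\<And>x t. \<gamma> (x + t *\<^sub>R b) = \<gamma> x"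
    and eq: "\<Omega> \<inter> ball p r = {x \<in> ball p r. \<gamma> x < s * (x \<bullet> b)}"
    using bspec[OF Ck[unfolded Ck_boundary_def] p] by (elim exE bexE conjE) (rule that, blast+)
  have s: "s = -1 \<or> s = 1" using s' by simp
  define e where "e = s *\<^sub>R b"
  define \<phi> where "\<phi> = (\<lambda>x. s * (x \<bullet> b) - \<gamma> x)"
  obtain L where L: "L \<ge> 0" "\<And>x y. x \<in> ball p r \<Longrightarrow> y \<in> ball p r \<Longrightarrow> \<bar>\<gamma> x - \<gamma> y\<bar> \<le> L * norm (x - y)"
    using C1_Lipschitz_on_ball[OF C1] by blast
  have "\<gamma> differentiable_on UNIV" using C1 by simp
  then have "continuous_on UNIV \<gamma>" by (rule differentiable_imp_continuous_on)
  then have cont: "continuous_on UNIV \<phi>" unfolding \<phi>_def by (intro continuous_intros)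
  have shift: "\<phi> (x + t *\<^sub>R e) = \<phi> x + t" for x t
    using s b inv[of x "t * s"] by (auto simp: \<phi>_def e_def inner_simps)
  have lip: "\<bar>\<phi> x - \<phi> y\<bar> \<le> (L + 1) * norm (x - y)" if "x \<in> ball p r" "y \<in> ball p r" for x y
  proof -
    have "\<bar>s * (x \<bullet> b) - s * (y \<bullet> b)\<bar> = \<bar>(x - y) \<bullet> b\<bar>" using s by (auto simp: inner_simps)
    also have "\<dots> \<le> norm (x - y)" using b by (rule Basis_le_norm)
    finally show ?thesis using L(2)[OF that] by (simp add: \<phi>_def algebra_simps)
  qed
  have ins: "\<Omega> \<inter> ball p r = {x \<in> ball p r. \<phi> x > 0}" using eq by (auto simp: \<phi>_def)
  have fr: "q \<in> frontier \<Omega> \<longleftrightarrow> \<phi> q = 0" if q: "q \<in> ball p r" for q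
  proof
    assume q1: "q \<in> frontier \<Omega>"
    then have "q \<notin> \<Omega>" using \<Omega> by (simp add: frontier_def interior_open)
    then have "\<phi> q \<le> 0" using ins q by force
    moreover have "\<not> \<phi> q < 0"
    proof
      assume "\<phi> q < 0"
      then have "q \<in> {x \<in> ball p r. \<phi> x < 0}" using q by auto
      moreover have "open {x \<in> ball p r. \<phi> x < 0}"
        using open_Int[OF open_ball open_Collect_less[OF cont continuous_on_const]]
        by (simp add: Int_def)
      ultimately have "{x \<in> ball p r. \<phi> x < 0} \<inter> \<Omega> \<noteq> {}"
        using q1 by (metis Diff_iff frontier_def open_Int_closure_eq_empty disjoint_iff)
      then show False using ins by force
    qed
    ultimately show "\<phi> q = 0" by simp
  next
    assume q0: "\<phi> q = 0"
    have "q \<in> closure \<Omega>"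
      unfolding closure_approachable
    proof (intro allI impI)
      fix \<epsilon> :: real assume \<epsilon>: "\<epsilon> > 0"
      define t where "t = min (\<epsilon> / 2) ((r - dist p q) / 2)"
      have t: "t > 0" "t < \<epsilon>" "t < r - dist p q" using \<epsilon> q by (auto simp: t_def min_less_iff_disj)
      have ne: "norm e = 1" using s b by (auto simp: e_def)
      have d: "dist (q + t *\<^sub>R e) q = t" using t ne by (simp add: dist_norm)
      have "dist p (q + t *\<^sub>R e) < r"
        using d t dist_triangle[of p "q + t *\<^sub>R e" q] by (simp add: dist_commute)
      then have "q + t *\<^sub>R e \<in> \<Omega>" using ins shift[of q t] q0 t by force
      then show "\<exists>y\<in>\<Omega>. dist y q < \<epsilon>" using d t by force
    qed
    moreover have "q \<notin> \<Omega>" using ins q q0 by force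
    ultimately show "q \<in> frontier \<Omega>" using \<Omega> by (simp add: frontier_def interior_open)
  qed
  have "graph_chart \<Omega> p r (L + 1) e \<phi>"
    unfolding graph_chart_def
    using r L(1) s b cont shift lip ins fr p by (auto simp: e_def)
  then show ?thesis by (rule that)
qed

text \<open>
  The interior cone condition: near every point of the closure, all points of the domain carry a
  cone of the same shape and direction inside the domain.  The estimates inside the domain use no
  other property of the boundary; at interior points the axis may be \<open>v = 0\<close>.
\<close>

definition cone_condition :: "'a::euclidean_space set \<Rightarrow> bool" where
  "cone_condition \<Omega> \<longleftrightarrow>
     (\<forall>p\<in>closure \<Omega>. \<exists>r>0. \<exists>\<kappa>>0. \<exists>\<eta>>0. \<exists>v. \<kappa> \<le> 1 \<and> norm v \<le> 1 \<and>
        (\<forall>x\<in>\<Omega> \<inter> ball p r. \<forall>\<delta>. 0 < \<delta> \<and> \<delta> \<le> \<eta> \<longrightarrow> ball (x + \<delta> *\<^sub>R v) (\<kappa> * \<delta>) \<subseteq> \<Omega>))"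

text \<open>
  Moving along the axis of a chart by \<open>\<delta>\<close> raises the height by \<open>\<delta>\<close>, and the Lipschitz bound \<open>K\<close> keeps
  it positive in the ball of radius \<open>\<delta> / K\<close>.
\<close>

lemma C1_boundary_imp_cone_condition:
  assumes \<Omega>: "open \<Omega>" and Ck: "Ck_boundary 1 \<Omega>"
  shows "cone_condition \<Omega>"
  unfolding cone_condition_def
proof
  fix p assume p: "p \<in> closure \<Omega>"
  show "\<exists>r>0. \<exists>\<kappa>>0. \<exists>\<eta>>0. \<exists>v. \<kappa> \<le> 1 \<and> norm v \<le> 1 \<and>
        (\<forall>x\<in>\<Omega> \<inter> ball p r. \<forall>\<delta>. 0 < \<delta> \<and> \<delta> \<le> \<eta> \<longrightarrow> ball (x + \<delta> *\<^sub>R v) (\<kappa> * \<delta>) \<subseteq> \<Omega>)"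
  proof (cases "p \<in> \<Omega>")
    case True
    then obtain r where r: "r > 0" "ball p r \<subseteq> \<Omega>" using \<Omega> openE by blast
    have "ball (x + \<delta> *\<^sub>R 0) (1 * \<delta>) \<subseteq> \<Omega>" if "x \<in> ball p (r/2)" "\<delta> \<le> r/2" for x \<delta>
    proof
      fix y assume "y \<in> ball (x + \<delta> *\<^sub>R 0) (1 * \<delta>)"
      then have "dist p y < r" using that dist_triangle[of p y x] by auto
      then show "y \<in> \<Omega>" using r by auto
    qed
    then show ?thesis
      using r(1) by (intro exI[of _ "r/2"] exI[of _ "1::real"] exI[of _ "0::'a"] conjI) auto
  next
    case False
    then have "p \<in> frontier \<Omega>" using p \<Omega> by (simp add: frontier_def interior_open)
    then obtain r K e \<phi> where ch: "graph_chart \<Omega> p r K e \<phi>" using boundary_chart[OF \<Omega> Ck] by blast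
    then have r: "r > 0" and K: "K \<ge> 1" and e: "e \<in> Basis \<or> - e \<in> Basis"
      and shift: "\<And>x t. \<phi> (x + t *\<^sub>R e) = \<phi> x + t"
      and lip: "\<And>x y. x \<in> ball p r \<Longrightarrow> y \<in> ball p r \<Longrightarrow> \<bar>\<phi> x - \<phi> y\<bar> \<le> K * norm (x - y)"
      and ins: "\<Omega> \<inter> ball p r = {x \<in> ball p r. \<phi> x > 0}"
      by (auto simp: graph_chart_def)
    have ne: "norm e = 1" using e norm_Basis[of e] norm_Basis[of "- e"] by auto
    have "ball (x + \<delta> *\<^sub>R e) (1 / K * \<delta>) \<subseteq> \<Omega>"
      if x: "x \<in> \<Omega> \<inter> ball p (r/2)" and \<delta>: "0 < \<delta>" "\<delta> \<le> r/4" for x \<delta>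
    proof
      fix y assume y: "y \<in> ball (x + \<delta> *\<^sub>R e) (1 / K * \<delta>)"
      have px: "dist p x < r / 2" "x \<in> ball p r" using x r by auto
      have xe: "dist x (x + \<delta> *\<^sub>R e) = \<delta>" using ne \<delta> by (simp add: dist_norm)
      have "1 / K * \<delta> \<le> \<delta>" using K \<delta> by (simp add: field_simps)
      then have yd: "dist (x + \<delta> *\<^sub>R e) y < \<delta>" using y by auto
      have pe: "dist p (x + \<delta> *\<^sub>R e) < r"
        using px xe \<delta> dist_triangle[of p "x + \<delta> *\<^sub>R e" x] by linarith
      have py: "dist p y < r"
        using px xe yd \<delta> dist_triangle[of p "x + \<delta> *\<^sub>R e" x] dist_triangle[of p y "x + \<delta> *\<^sub>R e"]
        by linarith
      have "x \<in> \<Omega> \<inter> ball p r" using x px by blast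
      then have "\<phi> x > 0" unfolding ins by simp
      have "\<bar>\<phi> (x + \<delta> *\<^sub>R e) - \<phi> y\<bar> \<le> K * norm (x + \<delta> *\<^sub>R e - y)"
        using pe py by (intro lip) auto
      also have "\<dots> < \<delta>" using y K by (simp add: dist_norm field_simps)
      finally have "\<phi> y > 0" using \<open>\<phi> x > 0\<close> shift[of x \<delta>] by auto
      then have "y \<in> \<Omega> \<inter> ball p r" unfolding ins using py by simp
      then show "y \<in> \<Omega>" by simp
    qed
    then show ?thesis
      using r K ne
      by (intro exI[of _ "r/2"] exI[of _ "1/K"] exI[of _ "r/4"] exI[of _ e] conjI) auto
  qed
qed

section \<open>Nonlocal energies\<close>

text \<open>
  All energies are \<open>ennreal\<close> valued, so that no integrability has to be known before an estimate is
  applied.  The power of \<open>\<delta>\<close> in the nonlocal energy is that of \<open>R\<^sub>\<delta>\<close>; for estimates from below, the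
  kernel may be replaced by the indicator of a ball of radius \<open>\<delta>\<close>.
\<close>

definition diff_energy :: "('a \<times> 'a) set \<Rightarrow> ('a::euclidean_space \<Rightarrow> real) \<Rightarrow> ennreal" where
  "diff_energy W u =
     (\<integral>\<^sup>+x. \<integral>\<^sup>+y. indicator W (x, y) * ennreal ((u x - u y)\<^sup>2) \<partial>lborel \<partial>lborel)"

definition near_pairs :: "'a::euclidean_space set \<Rightarrow> real \<Rightarrow> ('a \<times> 'a) set" where
  "near_pairs \<Omega> \<delta> = {(x, y). x \<in> \<Omega> \<and> y \<in> \<Omega> \<and> dist x y \<le> \<delta>}"

definition nl_energy :: "'a::euclidean_space set \<Rightarrow> real \<Rightarrow> ('a \<Rightarrow> real) \<Rightarrow> ennreal" where
  "nl_energy \<Omega> \<delta> u = ennreal (1 / \<delta> ^ DIM('a)) * diff_energy (near_pairs \<Omega> \<delta>) u"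

lemma near_pairs_measurable [measurable]:
  assumes [measurable]: "\<Omega> \<in> sets borel"
  shows "near_pairs \<Omega> \<delta> \<in> sets (borel \<Otimes>\<^sub>M borel)"
proof -
  have "{z \<in> space (borel \<Otimes>\<^sub>M borel). fst z \<in> \<Omega> \<and> snd z \<in> \<Omega> \<and> dist (fst z) (snd z) \<le> \<delta>}
      \<in> sets (borel \<Otimes>\<^sub>M borel)"
    by measurable
  moreover have "{z \<in> space (borel \<Otimes>\<^sub>M borel). fst z \<in> \<Omega> \<and> snd z \<in> \<Omega> \<and> dist (fst z) (snd z) \<le> \<delta>}
      = near_pairs \<Omega> \<delta>"
    by (auto simp: near_pairs_def space_pair_measure)
  ultimately show ?thesis by simp
qed

lemma diff_energy_integrand_measurable [measurable]:
  fixes u :: "'a::euclidean_space \<Rightarrow> real"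
  assumes [measurable]: "W \<in> sets (borel \<Otimes>\<^sub>M borel)" "u \<in> borel_measurable borel"
  shows "(\<lambda>z. indicator W z * ennreal ((u (fst z) - u (snd z))\<^sup>2)) \<in> borel_measurable (borel \<Otimes>\<^sub>M borel)"
  by measurable

lemma diff_energy_inner_measurable [measurable]:
  fixes u :: "'a::euclidean_space \<Rightarrow> real"
  assumes [measurable]: "W \<in> sets (borel \<Otimes>\<^sub>M borel)" "u \<in> borel_measurable borel"
  shows "(\<lambda>x. \<integral>\<^sup>+y. indicator W (x, y) * ennreal ((u x - u y)\<^sup>2) \<partial>lborel) \<in> borel_measurable borel"
  by measurable

lemma diff_energy_mono: "W \<subseteq> V \<Longrightarrow> diff_energy W u \<le> diff_energy V u"
  unfolding diff_energy_def
  by (intro nn_integral_mono mult_right_mono) (auto simp: indicator_def)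

lemma diff_energy_Un:
  assumes [measurable]: "W \<in> sets (borel \<Otimes>\<^sub>M borel)" "V \<in> sets (borel \<Otimes>\<^sub>M borel)" "u \<in> borel_measurable borel"
  shows "diff_energy (W \<union> V) u \<le> diff_energy W u + diff_energy V u"
proof -
  have "diff_energy (W \<union> V) u
      \<le> (\<integral>\<^sup>+x. \<integral>\<^sup>+y. indicator W (x, y) * ennreal ((u x - u y)\<^sup>2)
            + indicator V (x, y) * ennreal ((u x - u y)\<^sup>2) \<partial>lborel \<partial>lborel)"
    unfolding diff_energy_def by (intro nn_integral_mono) (auto simp: indicator_def)
  also have "\<dots> = diff_energy W u + diff_energy V u"
    unfolding diff_energy_def by (simp add: nn_integral_add)
  finally show ?thesis .
qed

lemma diff_energy_swap:
  assumes [measurable]: "W \<in> sets (borel \<Otimes>\<^sub>M borel)" "u \<in> borel_measurable borel"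
  shows "diff_energy W u = (\<integral>\<^sup>+y. \<integral>\<^sup>+x. indicator W (x, y) * ennreal ((u x - u y)\<^sup>2) \<partial>lborel \<partial>lborel)"
  unfolding diff_energy_def by (rule lborel_pair.Fubini'[symmetric]) simp

lemma nn_integral_translate:
  fixes F :: "'a::euclidean_space \<Rightarrow> ennreal"
  assumes "F \<in> borel_measurable borel"
  shows "(\<integral>\<^sup>+x. F (x + h) \<partial>lborel) = (\<integral>\<^sup>+x. F x \<partial>lborel)"
proof -
  have "(\<integral>\<^sup>+x. F x \<partial>lborel) = (\<integral>\<^sup>+x. F x \<partial>distr lborel borel ((+) h))"
    by (simp add: lborel_distr_plus)
  also have "\<dots> = (\<integral>\<^sup>+x. F (x + h) \<partial>lborel)"
    using assms by (subst nn_integral_distr) (auto simp: add.commute)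
  finally show ?thesis by simp
qed

lemma ennreal_le_divideI:
  assumes "a > 0" "b \<ge> 0" "ennreal a * X \<le> ennreal b * Y"
  shows "X \<le> ennreal (b / a) * Y"
proof -
  have "X = ennreal (1/a) * (ennreal a * X)"
    using assms(1) by (simp add: mult.assoc[symmetric] ennreal_mult[symmetric])
  also have "\<dots> \<le> ennreal (1/a) * (ennreal b * Y)" by (intro mult_left_mono assms) auto
  also have "\<dots> = ennreal (b / a) * Y"
    using assms by (simp add: mult.assoc[symmetric] ennreal_mult[symmetric])
  finally show ?thesis .
qed

lemma square_diff_le: "(a - c)\<^sup>2 \<le> 2 * (a - b)\<^sup>2 + 2 * (b - c)\<^sup>2" for a b c :: real
proof -
  have "0 \<le> ((a - b) - (b - c))\<^sup>2" by simp
  then show ?thesis by (simp add: power2_eq_square algebra_simps)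
qed

lemma ennreal_square_diff_le:
  "ennreal ((a - c)\<^sup>2) \<le> 2 * ennreal ((a - b)\<^sup>2) + 2 * ennreal ((b - c)\<^sup>2)" for a b c :: real
proof -
  have "ennreal ((a - c)\<^sup>2) \<le> ennreal (2 * (a - b)\<^sup>2 + 2 * (b - c)\<^sup>2)"
    by (intro ennreal_leI square_diff_le)
  also have "\<dots> = 2 * ennreal ((a - b)\<^sup>2) + 2 * ennreal ((b - c)\<^sup>2)"
    by (simp add: ennreal_plus ennreal_mult)
  finally show ?thesis .
qed

lemma diff_energy_near_pairs:
  fixes u :: "'a::euclidean_space \<Rightarrow> real"
  assumes "\<delta> > 0"
  shows "diff_energy (near_pairs \<Omega> \<delta>) u = ennreal (\<delta> ^ DIM('a)) * nl_energy \<Omega> \<delta> u"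
  using assms by (simp add: nl_energy_def mult.assoc[symmetric] ennreal_mult[symmetric])


section \<open>Uniform consequences of the cone condition\<close>

text \<open>
  The cone condition after a compactness argument.  The axis \<open>v p\<close> chosen for \<open>x\<close> also serves all
  points \<open>y\<close> of the domain near \<open>x\<close>, so neighbouring points can be moved in parallel.
\<close>

definition uniform_cone ::
    "'a::euclidean_space set \<Rightarrow> 'a set \<Rightarrow> ('a \<Rightarrow> real) \<Rightarrow> ('a \<Rightarrow> 'a) \<Rightarrow> real \<Rightarrow> real \<Rightarrow> real \<Rightarrow> bool" where
  "uniform_cone \<Omega> I r v \<rho> \<kappa> \<eta> \<longleftrightarrow>
     finite I \<and> closure \<Omega> \<subseteq> (\<Union>p\<in>I. ball p (r p)) \<and> \<rho> > 0 \<and> \<kappa> > 0 \<and> \<kappa> \<le> 1 \<and> \<eta> > 0 \<and>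
     (\<forall>p\<in>I. norm (v p) \<le> 1) \<and>
     (\<forall>p\<in>I. \<forall>x\<in>\<Omega> \<inter> ball p (r p). \<forall>y\<in>\<Omega>. \<forall>\<delta>. dist x y < \<rho> \<longrightarrow> 0 < \<delta> \<longrightarrow> \<delta> \<le> \<eta>
        \<longrightarrow> ball (y + \<delta> *\<^sub>R v p) (\<kappa> * \<delta>) \<subseteq> \<Omega>)"

lemma uniform_coneD:
  assumes "uniform_cone \<Omega> I r v \<rho> \<kappa> \<eta>"
  shows "finite I" "closure \<Omega> \<subseteq> (\<Union>p\<in>I. ball p (r p))" "\<rho> > 0" "\<kappa> > 0" "\<kappa> \<le> 1" "\<eta> > 0"
    "\<And>p. p \<in> I \<Longrightarrow> norm (v p) \<le> 1"
    "\<And>p x y \<delta>. p \<in> I \<Longrightarrow> x \<in> \<Omega> \<Longrightarrow> x \<in> ball p (r p) \<Longrightarrow> y \<in> \<Omega> \<Longrightarrow> dist x y < \<rho> \<Longrightarrow> 0 < \<delta> \<Longrightarrow> \<delta> \<le> \<eta>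
       \<Longrightarrow> ball (y + \<delta> *\<^sub>R v p) (\<kappa> * \<delta>) \<subseteq> \<Omega>"
  using assms unfolding uniform_cone_def by blast+

lemma cone_condition_uniform:
  fixes \<Omega> :: "'a::euclidean_space set"
  assumes cone: "cone_condition \<Omega>" and bd: "bounded \<Omega>"
  obtains I r v \<rho> \<kappa> \<eta> where "uniform_cone \<Omega> I r v \<rho> \<kappa> \<eta>"
proof -
  define G where "G = (\<lambda>p r \<kappa> \<eta> v. r > 0 \<and> \<kappa> > 0 \<and> \<eta> > 0 \<and> \<kappa> \<le> 1 \<and> norm v \<le> 1 \<and>
        (\<forall>x\<in>\<Omega> \<inter> ball p r. \<forall>\<delta>. 0 < \<delta> \<and> \<delta> \<le> \<eta> \<longrightarrow> ball (x + \<delta> *\<^sub>R v) (\<kappa> * \<delta>) \<subseteq> \<Omega>))"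
  have "\<forall>p\<in>closure \<Omega>. \<exists>r \<kappa> \<eta> v. G p r \<kappa> \<eta> v"
    using cone unfolding cone_condition_def G_def by blast
  then obtain s k h v where G: "\<And>p. p \<in> closure \<Omega> \<Longrightarrow> G p (s p) (k p) (h p) (v p)"
    by metis
  have s: "s p > 0" and k: "k p > 0 \<and> k p \<le> 1" and h: "h p > 0" and v: "norm (v p) \<le> 1"
    if "p \<in> closure \<Omega>" for p
    using G[OF that] by (auto simp: G_def)
  have C: "ball (x + \<delta> *\<^sub>R v p) (k p * \<delta>) \<subseteq> \<Omega>"
    if "p \<in> closure \<Omega>" "x \<in> \<Omega> \<inter> ball p (s p)" "0 < \<delta>" "\<delta> \<le> h p" for p x \<delta>
    using G[OF that(1)] that(2-) unfolding G_def by blast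
  have "compact (closure \<Omega>)" using bd by simp
  then obtain I where I: "I \<subseteq> closure \<Omega>" "finite I" "closure \<Omega> \<subseteq> (\<Union>p\<in>I. ball p (s p / 2))"
  proof (rule compactE_image[where C = "closure \<Omega>" and f = "\<lambda>p. ball p (s p / 2)"])
    show "closure \<Omega> \<subseteq> (\<Union>p\<in>closure \<Omega>. ball p (s p / 2))" using s by force
  qed auto
  define m where "m = (\<lambda>f :: 'a \<Rightarrow> real. Min (insert 1 (f ` I)))"
  have m_pos: "m f > 0" if "\<And>p. p \<in> I \<Longrightarrow> f p > 0" for f
    using that I(2) by (auto simp: m_def)
  have m_le: "m f \<le> f p" if "p \<in> I" for f p
    using that I(2) by (auto simp: m_def)
  have IC: "p \<in> closure \<Omega>" if "p \<in> I" for p using I(1) that by blast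
  have "uniform_cone \<Omega> I (\<lambda>p. s p / 2) v (m (\<lambda>p. s p / 2)) (m k) (m h)"
    unfolding uniform_cone_def
  proof (intro conjI ballI allI impI)
    show "m (\<lambda>p. s p / 2) > 0" "m k > 0" "m h > 0"
      by (rule m_pos; use IC s k h in force)+
    show "m k \<le> 1" using I(2) by (auto simp: m_def)
    show "norm (v p) \<le> 1" if "p \<in> I" for p using v IC that by blast
    fix p x y \<delta>
    assume A': "p \<in> I" "x \<in> \<Omega> \<inter> ball p (s p / 2)" "y \<in> \<Omega>" "dist x y < m (\<lambda>p. s p / 2)"
      "0 < \<delta>" "\<delta> \<le> m h"
    then have A: "p \<in> I" "x \<in> \<Omega>" "x \<in> ball p (s p / 2)" "y \<in> \<Omega>" "dist x y < m (\<lambda>p. s p / 2)"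
      "0 < \<delta>" "\<delta> \<le> m h" by auto
    have "dist p y < s p"
      using A m_le[OF A(1), of "\<lambda>p. s p / 2"] dist_triangle[of p y x] by auto
    then have "ball (y + \<delta> *\<^sub>R v p) (k p * \<delta>) \<subseteq> \<Omega>"
      using C[of p y \<delta>] IC[OF A(1)] A m_le[OF A(1), of h] by auto
    moreover have "m k * \<delta> \<le> k p * \<delta>" using A m_le[OF A(1), of k] by (intro mult_right_mono) auto
    ultimately show "ball (y + \<delta> *\<^sub>R v p) (m k * \<delta>) \<subseteq> \<Omega>"
      by (meson order_trans subset_ball)
  qed (use I in auto)
  then show ?thesis by (rule that)
qed

text \<open>
  The radius \<open>\<delta> / 2\<close>, rather than \<open>\<delta>\<close>, leaves room for a shift by \<open>\<delta> / 2\<close>.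
\<close>

definition measure_density :: "'a::euclidean_space set \<Rightarrow> real \<Rightarrow> real \<Rightarrow> bool" where
  "measure_density \<Omega> \<delta>\<^sub>0 c \<longleftrightarrow> c > 0 \<and>
     (\<forall>\<delta> x. 0 < \<delta> \<longrightarrow> \<delta> \<le> \<delta>\<^sub>0 \<longrightarrow> x \<in> \<Omega> \<longrightarrow> ennreal (c * \<delta> ^ DIM('a)) \<le> emeasure lborel (\<Omega> \<inter> cball x (\<delta> / 2)))"

lemma cone_condition_measure_density:
  fixes \<Omega> :: "'a::euclidean_space set"
  assumes cone: "cone_condition \<Omega>" and bd: "bounded \<Omega>" and op: "open \<Omega>" and \<delta>\<^sub>0: "\<delta>\<^sub>0 > 0"
  obtains c where "measure_density \<Omega> \<delta>\<^sub>0 c"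
proof -
  obtain I r v \<rho> \<kappa> \<eta> where "uniform_cone \<Omega> I r v \<rho> \<kappa> \<eta>"
    using cone_condition_uniform[OF cone bd] .
  note I = uniform_coneD[OF this]
  \<comment> \<open>The ball of radius \<open>\<kappa> m \<delta>\<close> at \<open>x + m \<delta> v\<close> lies in \<open>cball x (\<delta> / 2)\<close> because \<open>m \<le> 1/4\<close>;
    the second bound keeps \<open>m \<delta>\<close> in the range of the cone condition.\<close>
  define m where "m = min (1/4) (\<eta> / \<delta>\<^sub>0)"
  have m: "m > 0" "m \<le> 1/4" "m * \<delta>\<^sub>0 \<le> \<eta>"
    using I \<delta>\<^sub>0 by (auto simp: m_def min_def field_simps)
  define c where "c = unit_ball_vol (real DIM('a)) * (\<kappa> * m) ^ DIM('a)"
  have "measure_density \<Omega> \<delta>\<^sub>0 c"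
    unfolding measure_density_def
  proof (intro conjI allI impI)
    show "c > 0" using I m by (simp add: c_def)
    fix \<delta> x assume \<delta>: "0 < \<delta>" "\<delta> \<le> \<delta>\<^sub>0" and x: "x \<in> \<Omega>"
    obtain p where p: "p \<in> I" "x \<in> ball p (r p)" using I(2) x closure_subset by blast
    let ?B = "ball (x + (m * \<delta>) *\<^sub>R v p) (\<kappa> * (m * \<delta>))"
    have "m * \<delta> \<le> m * \<delta>\<^sub>0" using \<delta> m by simp
    then have md: "m * \<delta> \<le> \<eta>" "0 < m * \<delta>" using m(3) by linarith (use m \<delta> in simp)
    have B: "?B \<subseteq> \<Omega>" by (rule I(8)[OF p(1) x p(2) x _ md(2,1)]) (use I(3) in simp)
    have "?B \<subseteq> cball x (\<delta> / 2)"
    proof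
      fix y assume y: "y \<in> ?B"
      have "dist x (x + (m * \<delta>) *\<^sub>R v p) \<le> m * \<delta> * 1"
        using m \<delta> I(7)[OF p(1)] by (simp add: dist_norm mult_left_le)
      moreover have "\<kappa> * (m * \<delta>) \<le> m * \<delta>" using I m \<delta> by (simp add: mult_left_le_one_le)
      moreover have "m * \<delta> \<le> \<delta> / 4" using m \<delta> by simp
      ultimately show "y \<in> cball x (\<delta> / 2)"
        using y dist_triangle[of x y "x + (m * \<delta>) *\<^sub>R v p"] by auto
    qed
    then have "emeasure lborel ?B \<le> emeasure lborel (\<Omega> \<inter> cball x (\<delta> / 2))"
      using B op by (intro emeasure_mono) auto
    moreover have "emeasure lborel ?B = ennreal (c * \<delta> ^ DIM('a))"
      using I m \<delta> by (simp add: emeasure_ball c_def power_mult_distrib mult_ac)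
    ultimately show "ennreal (c * \<delta> ^ DIM('a)) \<le> emeasure lborel (\<Omega> \<inter> cball x (\<delta> / 2))" by simp
  qed
  then show ?thesis by (rule that)
qed

text \<open>
  The values \<open>u (x + h)\<close> and \<open>u x\<close> are both compared with \<open>u z\<close>, and the result is averaged over all
  points \<open>z\<close> of the domain near \<open>x\<close>: the pairs \<open>(x, z)\<close> and \<open>(x + h, z)\<close> are pairs that the nonlocal
  energy sees, and by density there are enough points \<open>z\<close>.
\<close>

lemma nl_energy_short_shift:
  fixes u :: "'a::euclidean_space \<Rightarrow> real"
  assumes dens: "measure_density \<Omega> \<delta>\<^sub>0 c" and \<delta>: "0 < \<delta>" "\<delta> \<le> \<delta>\<^sub>0"
    and [measurable]: "\<Omega> \<in> sets borel" "u \<in> borel_measurable borel" "A \<in> sets borel"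
    and h: "norm h \<le> \<delta> / 2" and A: "\<And>x. x \<in> A \<Longrightarrow> x \<in> \<Omega>" "\<And>x. x \<in> A \<Longrightarrow> x + h \<in> \<Omega>"
  shows "(\<integral>\<^sup>+x. indicator A x * ennreal ((u (x + h) - u x)\<^sup>2) \<partial>lborel) \<le> ennreal (4 / c) * nl_energy \<Omega> \<delta> u"
proof -
  have c: "c > 0" using dens by (simp add: measure_density_def)
  let ?W = "near_pairs \<Omega> \<delta>"
  define F where "F = (\<lambda>x. \<integral>\<^sup>+z. indicator ?W (x, z) * ennreal ((u x - u z)\<^sup>2) \<partial>lborel)"
  have [measurable]: "F \<in> borel_measurable borel" unfolding F_def by measurable
  have pt: "ennreal (c * \<delta> ^ DIM('a)) * (indicator A x * ennreal ((u (x + h) - u x)\<^sup>2)) \<le> 2 * F (x + h) + 2 * F x" for x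
  proof (cases "x \<in> A")
    case True
    have "ennreal (c * \<delta> ^ DIM('a)) * ennreal ((u (x + h) - u x)\<^sup>2)
        \<le> ennreal ((u (x + h) - u x)\<^sup>2) * emeasure lborel (\<Omega> \<inter> cball x (\<delta> / 2))"
      using dens \<delta> A True by (subst mult.commute) (auto simp: measure_density_def intro: mult_left_mono)
    also have "\<dots> = (\<integral>\<^sup>+z. ennreal ((u (x + h) - u x)\<^sup>2) * indicator (\<Omega> \<inter> cball x (\<delta> / 2)) z \<partial>lborel)"
      by (rule nn_integral_cmult_indicator[symmetric]) simp
    also have "\<dots> \<le> (\<integral>\<^sup>+z. 2 * (indicator ?W (x + h, z) * ennreal ((u (x + h) - u z)\<^sup>2))
                       + 2 * (indicator ?W (x, z) * ennreal ((u x - u z)\<^sup>2)) \<partial>lborel)"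
    proof (rule nn_integral_mono)
      fix z
      show "ennreal ((u (x + h) - u x)\<^sup>2) * indicator (\<Omega> \<inter> cball x (\<delta> / 2)) z
          \<le> 2 * (indicator ?W (x + h, z) * ennreal ((u (x + h) - u z)\<^sup>2))
                       + 2 * (indicator ?W (x, z) * ennreal ((u x - u z)\<^sup>2))"
      proof (cases "z \<in> \<Omega> \<inter> cball x (\<delta> / 2)")
        case z: True
        have "dist (x + h) z \<le> norm h + dist x z"
          using norm_triangle_ineq[of h "x - z"] by (simp add: dist_norm algebra_simps)
        then have "(x + h, z) \<in> ?W" "(x, z) \<in> ?W"
          using z A True h \<delta> by (auto simp: near_pairs_def)
        then show ?thesis
          using z ennreal_square_diff_le[of "u (x + h)" "u x" "u z"]
          by (simp add: power2_commute[of "u z" "u x"])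
      qed auto
    qed
    also have "\<dots> = 2 * F (x + h) + 2 * F x"
      unfolding F_def by (simp add: nn_integral_add nn_integral_cmult)
    finally show ?thesis using True by simp
  qed auto
  have "ennreal (c * \<delta> ^ DIM('a)) * (\<integral>\<^sup>+x. indicator A x * ennreal ((u (x + h) - u x)\<^sup>2) \<partial>lborel)
      = (\<integral>\<^sup>+x. ennreal (c * \<delta> ^ DIM('a)) * (indicator A x * ennreal ((u (x + h) - u x)\<^sup>2)) \<partial>lborel)"
    by (rule nn_integral_cmult[symmetric]) measurable
  also have "\<dots> \<le> (\<integral>\<^sup>+x. 2 * F (x + h) + 2 * F x \<partial>lborel)"
    by (intro nn_integral_mono pt)
  also have "\<dots> = 2 * (\<integral>\<^sup>+x. F x \<partial>lborel) + 2 * (\<integral>\<^sup>+x. F x \<partial>lborel)"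
    by (simp add: nn_integral_add nn_integral_cmult nn_integral_translate)
  also have "(\<integral>\<^sup>+x. F x \<partial>lborel) = ennreal (\<delta> ^ DIM('a)) * nl_energy \<Omega> \<delta> u"
    using \<delta> by (simp add: diff_energy_near_pairs[symmetric] F_def diff_energy_def)
  also have "2 * (ennreal (\<delta> ^ DIM('a)) * nl_energy \<Omega> \<delta> u) + 2 * (ennreal (\<delta> ^ DIM('a)) * nl_energy \<Omega> \<delta> u)
      = ennreal (4 * \<delta> ^ DIM('a)) * nl_energy \<Omega> \<delta> u"
    using \<delta> by (simp add: ennreal_mult mult.assoc[symmetric] distrib_right[symmetric])
  finally show ?thesis
    using ennreal_le_divideI[of "c * \<delta> ^ DIM('a)" "4 * \<delta> ^ DIM('a)"] c \<delta> by simp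
qed

text \<open>
  A long shift is a chain of \<open>N\<close> short ones.  The square of \<open>N\<close> appears: one factor comes from
  Cauchy--Schwarz along the chain, the other from adding up the costs of the steps.
\<close>

lemma nl_energy_shift:
  fixes u :: "'a::euclidean_space \<Rightarrow> real"
  assumes dens: "measure_density \<Omega> \<delta>\<^sub>0 c" and \<delta>: "0 < \<delta>" "\<delta> \<le> \<delta>\<^sub>0"
    and [measurable]: "\<Omega> \<in> sets borel" "u \<in> borel_measurable borel" "A \<in> sets borel"
    and A: "\<And>x t. x \<in> A \<Longrightarrow> 0 \<le> t \<Longrightarrow> t \<le> 1 \<Longrightarrow> x + t *\<^sub>R H \<in> \<Omega>"
  shows "(\<integral>\<^sup>+x. indicator A x * ennreal ((u (x + H) - u x)\<^sup>2) \<partial>lborel)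
    \<le> ennreal (16 / c * (1 + norm H / \<delta>)\<^sup>2) * nl_energy \<Omega> \<delta> u"
proof -
  have c: "c > 0" using dens by (simp add: measure_density_def)
  define N where "N = nat \<lceil>2 * norm H / \<delta>\<rceil> + 1"
  have N: "N \<ge> 1" "2 * norm H / \<delta> \<le> real N" "real N \<le> 2 * (1 + norm H / \<delta>)"
  proof -
    have "0 \<le> 2 * norm H / \<delta>" using \<delta> by simp
    then show "N \<ge> 1" "2 * norm H / \<delta> \<le> real N" "real N \<le> 2 * (1 + norm H / \<delta>)"
      unfolding N_def distrib_left times_divide_eq_right by linarith+
  qed
  define h where "h = (1 / real N) *\<^sub>R H"
  have h: "norm h \<le> \<delta> / 2"
    using N \<delta> by (simp add: h_def field_simps)
  have jh: "real j *\<^sub>R h = (real j / real N) *\<^sub>R H" for j by (simp add: h_def)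
  have step: "(\<integral>\<^sup>+x. indicator A x * ennreal ((u (x + real (Suc j) *\<^sub>R h) - u (x + real j *\<^sub>R h))\<^sup>2) \<partial>lborel)
      \<le> ennreal (4 / c) * nl_energy \<Omega> \<delta> u" if j: "j < N" for j
  proof -
    define B where "B = {y. y - real j *\<^sub>R h \<in> A}"
    have "(\<lambda>y. y - real j *\<^sub>R h) -` A \<inter> space borel \<in> sets borel"
      by (rule measurable_sets[of _ borel borel]) auto
    then have [measurable]: "B \<in> sets borel" by (simp add: B_def vimage_def)
    have "(\<integral>\<^sup>+x. indicator A x * ennreal ((u (x + real (Suc j) *\<^sub>R h) - u (x + real j *\<^sub>R h))\<^sup>2) \<partial>lborel)
       = (\<integral>\<^sup>+x. indicator B (x + real j *\<^sub>R h) * ennreal ((u (x + real j *\<^sub>R h + h) - u (x + real j *\<^sub>R h))\<^sup>2) \<partial>lborel)"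
      by (intro nn_integral_cong) (auto simp: B_def indicator_def algebra_simps)
    also have "\<dots> = (\<integral>\<^sup>+y. indicator B y * ennreal ((u (y + h) - u y)\<^sup>2) \<partial>lborel)"
      by (rule nn_integral_translate[where F = "\<lambda>y. indicator B y * ennreal ((u (y + h) - u y)\<^sup>2)"]) measurable
    also have "\<dots> \<le> ennreal (4 / c) * nl_energy \<Omega> \<delta> u"
    proof (rule nl_energy_short_shift[OF dens \<delta> _ _ _ h])
      fix y assume "y \<in> B"
      then have y: "y - real j *\<^sub>R h \<in> A" by (simp add: B_def)
      show "y \<in> \<Omega>" using A[OF y, of "real j / real N"] j by (simp add: jh)
      have "y - real j *\<^sub>R h + real (Suc j) *\<^sub>R h \<in> \<Omega>" using A[OF y, of "real (Suc j) / real N"] j by (simp add: jh del: of_nat_Suc)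
      then show "y + h \<in> \<Omega>" by (simp add: algebra_simps)
    qed measurable
    finally show ?thesis .
  qed
  have pt: "ennreal ((u (x + H) - u x)\<^sup>2)
      \<le> of_nat N * (\<Sum>j<N. ennreal ((u (x + real (Suc j) *\<^sub>R h) - u (x + real j *\<^sub>R h))\<^sup>2))" for x
  proof -
    have "u (x + H) - u x = (\<Sum>j<N. u (x + real (Suc j) *\<^sub>R h) - u (x + real j *\<^sub>R h))"
      using N by (subst sum_lessThan_telescope[of "\<lambda>j. u (x + real j *\<^sub>R h)"]) (simp add: h_def)
    then have "(u (x + H) - u x)\<^sup>2 \<le> (\<Sum>j<N. (u (x + real (Suc j) *\<^sub>R h) - u (x + real j *\<^sub>R h))\<^sup>2) * real N"
      using sum_squared_le_sum_of_squares[of "\<lambda>j. u (x + real (Suc j) *\<^sub>R h) - u (x + real j *\<^sub>R h)" "{..<N}"] by simp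
    then have "ennreal ((u (x + H) - u x)\<^sup>2)
       \<le> ennreal (real N * (\<Sum>j<N. (u (x + real (Suc j) *\<^sub>R h) - u (x + real j *\<^sub>R h))\<^sup>2))"
      by (intro ennreal_leI) (simp add: mult.commute)
    also have "\<dots> = of_nat N * (\<Sum>j<N. ennreal ((u (x + real (Suc j) *\<^sub>R h) - u (x + real j *\<^sub>R h))\<^sup>2))"
      by (simp add: ennreal_mult sum_nonneg sum_ennreal ennreal_of_nat_eq_real_of_nat)
    finally show ?thesis .
  qed
  have "(\<integral>\<^sup>+x. indicator A x * ennreal ((u (x + H) - u x)\<^sup>2) \<partial>lborel)
     \<le> (\<integral>\<^sup>+x. of_nat N * (\<Sum>j<N. indicator A x * ennreal ((u (x + real (Suc j) *\<^sub>R h) - u (x + real j *\<^sub>R h))\<^sup>2)) \<partial>lborel)"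
    using pt by (intro nn_integral_mono) (auto simp: indicator_def)
  also have "\<dots> = of_nat N * (\<Sum>j<N. \<integral>\<^sup>+x. indicator A x * ennreal ((u (x + real (Suc j) *\<^sub>R h) - u (x + real j *\<^sub>R h))\<^sup>2) \<partial>lborel)"
    by (subst nn_integral_cmult, measurable, subst nn_integral_sum, measurable)
  also have "\<dots> \<le> of_nat N * (\<Sum>j<N. ennreal (4 / c) * nl_energy \<Omega> \<delta> u)"
    by (intro mult_left_mono sum_mono step) auto
  also have "\<dots> = ennreal (real N * real N * (4 / c)) * nl_energy \<Omega> \<delta> u"
    using c by (simp add: ennreal_mult ennreal_of_nat_eq_real_of_nat mult.assoc
        del: times_divide_eq_right times_divide_eq_left)
  also have "\<dots> \<le> ennreal (16 / c * (1 + norm H / \<delta>)\<^sup>2) * nl_energy \<Omega> \<delta> u"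
  proof (intro mult_right_mono ennreal_leI)
    have "real N * real N \<le> (2 * (1 + norm H / \<delta>)) * (2 * (1 + norm H / \<delta>))"
      using N \<delta> by (intro mult_mono) auto
    then have "real N * real N * (4 / c) \<le> (2 * (1 + norm H / \<delta>)) * (2 * (1 + norm H / \<delta>)) * (4 / c)"
      using c by (intro mult_right_mono) auto
    then show "real N * real N * (4 / c) \<le> 16 / c * (1 + norm H / \<delta>)\<^sup>2"
      by (simp add: power2_eq_square algebra_simps)
  qed auto
  finally show ?thesis .
qed

lemma nl_energy_shift_from:
  fixes u :: "'a::euclidean_space \<Rightarrow> real"
  assumes dens: "measure_density \<Omega> \<delta>\<^sub>0 c" and \<delta>: "0 < \<delta>" "\<delta> \<le> \<delta>\<^sub>0"
    and [measurable]: "\<Omega> \<in> sets borel" "u \<in> borel_measurable borel" "A \<in> sets borel"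
    and A: "\<And>x t. x \<in> A \<Longrightarrow> 0 \<le> t \<Longrightarrow> t \<le> 1 \<Longrightarrow> x + a + t *\<^sub>R H \<in> \<Omega>"
    and L: "norm H \<le> L * \<delta>"
  shows "(\<integral>\<^sup>+x. indicator A x * ennreal ((u (x + a + H) - u (x + a))\<^sup>2) \<partial>lborel)
    \<le> ennreal (16 / c * (1 + L)\<^sup>2) * nl_energy \<Omega> \<delta> u"
proof -
  have c: "c > 0" using dens by (simp add: measure_density_def)
  define B where "B = {y. y - a \<in> A}"
  have "(\<lambda>y. y - a) -` A \<inter> space borel \<in> sets borel"
    by (rule measurable_sets[of _ borel borel]) auto
  then have [measurable]: "B \<in> sets borel" by (simp add: B_def vimage_def)
  have "(\<integral>\<^sup>+x. indicator A x * ennreal ((u (x + a + H) - u (x + a))\<^sup>2) \<partial>lborel)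
      = (\<integral>\<^sup>+x. indicator B (x + a) * ennreal ((u ((x + a) + H) - u (x + a))\<^sup>2) \<partial>lborel)"
    by (intro nn_integral_cong) (auto simp: B_def indicator_def)
  also have "\<dots> = (\<integral>\<^sup>+y. indicator B y * ennreal ((u (y + H) - u y)\<^sup>2) \<partial>lborel)"
    by (rule nn_integral_translate[where F = "\<lambda>y. indicator B y * ennreal ((u (y + H) - u y)\<^sup>2)"]) measurable
  also have "\<dots> \<le> ennreal (16 / c * (1 + norm H / \<delta>)\<^sup>2) * nl_energy \<Omega> \<delta> u"
  proof (rule nl_energy_shift[OF dens \<delta>])
    fix y t :: _ assume "y \<in> B" "0 \<le> t" "t \<le> (1::real)"
    then show "y + t *\<^sub>R H \<in> \<Omega>" using A[of "y - a" t] by (simp add: B_def)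
  qed measurable
  also have "\<dots> \<le> ennreal (16 / c * (1 + L)\<^sup>2) * nl_energy \<Omega> \<delta> u"
  proof (intro mult_right_mono ennreal_leI mult_left_mono power_mono add_left_mono)
    show "norm H / \<delta> \<le> L" using L \<delta> by (simp add: field_simps)
  qed (use c \<delta> in auto)
  finally show ?thesis .
qed

section \<open>A nonlocal Poincare--Wirtinger inequality\<close>

text \<open>
  The pairs on which the difference energy is bounded by the nonlocal energy with the scaling
  \<open>1 / \<delta>\<^sup>2\<close>, uniformly in \<open>\<delta>\<close> and \<open>u\<close>.  Products of sets with this property can be chained like a
  transitive relation, so the inequality on the whole domain follows from connectedness.
\<close>

definition controlled :: "'a::euclidean_space set \<Rightarrow> real \<Rightarrow> ('a \<times> 'a) set \<Rightarrow> bool" where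
  "controlled \<Omega> \<delta>\<^sub>0 W \<longleftrightarrow>
     (\<exists>C\<ge>0. \<forall>\<delta> u. 0 < \<delta> \<longrightarrow> \<delta> \<le> \<delta>\<^sub>0 \<longrightarrow> u \<in> borel_measurable borel \<longrightarrow>
        diff_energy W u \<le> ennreal (C / \<delta>\<^sup>2) * nl_energy \<Omega> \<delta> u)"

lemma emeasure_bounded_eq_measure:
  "bounded S \<Longrightarrow> emeasure lborel S = ennreal (measure lborel S)" for S :: "'a::euclidean_space set"
  using emeasure_bounded_finite[of S] by (intro emeasure_eq_ennreal_measure) (auto simp: less_top)

lemma controlledI:
  assumes "C \<ge> 0" "\<And>\<delta> u. 0 < \<delta> \<Longrightarrow> \<delta> \<le> \<delta>\<^sub>0 \<Longrightarrow> u \<in> borel_measurable borel \<Longrightarrow>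
        diff_energy W u \<le> ennreal (C / \<delta>\<^sup>2) * nl_energy \<Omega> \<delta> u"
  shows "controlled \<Omega> \<delta>\<^sub>0 W"
  using assms unfolding controlled_def by blast

lemma controlledE:
  assumes "controlled \<Omega> \<delta>\<^sub>0 W"
  obtains C where "C \<ge> 0" "\<And>\<delta> u. 0 < \<delta> \<Longrightarrow> \<delta> \<le> \<delta>\<^sub>0 \<Longrightarrow> u \<in> borel_measurable borel \<Longrightarrow>
        diff_energy W u \<le> ennreal (C / \<delta>\<^sup>2) * nl_energy \<Omega> \<delta> u"
  using assms unfolding controlled_def by blast

lemma controlled_subset: "controlled \<Omega> \<delta>\<^sub>0 V \<Longrightarrow> W \<subseteq> V \<Longrightarrow> controlled \<Omega> \<delta>\<^sub>0 W"
  unfolding controlled_def by (meson diff_energy_mono order_trans)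

lemma controlled_Un:
  assumes W: "controlled \<Omega> \<delta>\<^sub>0 W" and V: "controlled \<Omega> \<delta>\<^sub>0 V"
    and [measurable]: "W \<in> sets (borel \<Otimes>\<^sub>M borel)" "V \<in> sets (borel \<Otimes>\<^sub>M borel)"
  shows "controlled \<Omega> \<delta>\<^sub>0 (W \<union> V)"
proof -
  obtain C D where CD: "C \<ge> 0" "D \<ge> 0"
    and C: "\<And>\<delta> u. 0 < \<delta> \<Longrightarrow> \<delta> \<le> \<delta>\<^sub>0 \<Longrightarrow> u \<in> borel_measurable borel \<Longrightarrow>
        diff_energy W u \<le> ennreal (C / \<delta>\<^sup>2) * nl_energy \<Omega> \<delta> u"
    and D: "\<And>\<delta> u. 0 < \<delta> \<Longrightarrow> \<delta> \<le> \<delta>\<^sub>0 \<Longrightarrow> u \<in> borel_measurable borel \<Longrightarrow>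
        diff_energy V u \<le> ennreal (D / \<delta>\<^sup>2) * nl_energy \<Omega> \<delta> u"
    using W V by (elim controlledE) blast
  show ?thesis
  proof (rule controlledI)
    fix \<delta> and u :: "'a \<Rightarrow> real" assume *: "0 < \<delta>" "\<delta> \<le> \<delta>\<^sub>0" and [measurable]: "u \<in> borel_measurable borel"
    have "diff_energy (W \<union> V) u \<le> diff_energy W u + diff_energy V u"
      by (rule diff_energy_Un) measurable
    also have "\<dots> \<le> ennreal (C / \<delta>\<^sup>2) * nl_energy \<Omega> \<delta> u + ennreal (D / \<delta>\<^sup>2) * nl_energy \<Omega> \<delta> u"
      using C D * by (intro add_mono) auto
    also have "\<dots> = ennreal ((C + D) / \<delta>\<^sup>2) * nl_energy \<Omega> \<delta> u"
      using CD by (simp add: distrib_right[symmetric] ennreal_plus[symmetric] add_divide_distrib del: ennreal_plus)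
    finally show "diff_energy (W \<union> V) u \<le> ennreal ((C + D) / \<delta>\<^sup>2) * nl_energy \<Omega> \<delta> u" .
  qed (use CD in simp)
qed

lemma controlled_UN:
  assumes "finite I" "\<And>i. i \<in> I \<Longrightarrow> controlled \<Omega> \<delta>\<^sub>0 (W i)"
    "\<And>i. i \<in> I \<Longrightarrow> W i \<in> sets (borel \<Otimes>\<^sub>M borel)"
  shows "controlled \<Omega> \<delta>\<^sub>0 (\<Union>i\<in>I. W i)"
  using assms
proof (induction I)
  case empty
  show ?case by (rule controlledI[of 0]) (auto simp: diff_energy_def)
next
  case (insert i I)
  then have "controlled \<Omega> \<delta>\<^sub>0 (W i \<union> (\<Union>i\<in>I. W i))"
    by (intro controlled_Un sets.finite_UN) auto
  then show ?case by simp
qed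

lemma Times_borel [measurable]: "A \<in> sets borel \<Longrightarrow> B \<in> sets borel \<Longrightarrow> A \<times> B \<in> sets (borel \<Otimes>\<^sub>M borel)"
  by simp

lemma diff_energy_Times_swap:
  fixes A B :: "'a::euclidean_space set"
  assumes [measurable]: "A \<in> sets borel" "B \<in> sets borel" "u \<in> borel_measurable borel"
  shows "diff_energy (A \<times> B) u = diff_energy (B \<times> A) u"
  by (subst diff_energy_swap, measurable)
     (auto simp: diff_energy_def indicator_def power2_commute intro!: nn_integral_cong)

lemma controlled_sym:
  fixes A B :: "'a::euclidean_space set"
  assumes "controlled \<Omega> \<delta>\<^sub>0 (A \<times> B)" "A \<in> sets borel" "B \<in> sets borel"
  shows "controlled \<Omega> \<delta>\<^sub>0 (B \<times> A)"
  using assms by (auto simp: controlled_def diff_energy_Times_swap[of A B])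

text \<open>
  The values at \<open>x\<close> and \<open>y\<close> are compared through the average over the middle set, which therefore needs
  positive measure.
\<close>

lemma controlled_trans:
  fixes A B D :: "'a::euclidean_space set"
  assumes AB: "controlled \<Omega> \<delta>\<^sub>0 (A \<times> B)" and BD: "controlled \<Omega> \<delta>\<^sub>0 (B \<times> D)"
    and [measurable]: "A \<in> sets borel" "B \<in> sets borel" "D \<in> sets borel"
    and bd: "bounded A" "bounded B" "bounded D" and pos: "emeasure lborel B > 0"
  shows "controlled \<Omega> \<delta>\<^sub>0 (A \<times> D)"
proof -
  define a where "a = measure lborel A"
  define b where "b = measure lborel B"
  define d where "d = measure lborel D"
  have a: "emeasure lborel A = ennreal a" and b: "emeasure lborel B = ennreal b" and d: "emeasure lborel D = ennreal d"
    using bd by (simp_all add: a_def b_def d_def emeasure_bounded_eq_measure)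
  have ge: "a \<ge> 0" "d \<ge> 0" and b0: "b > 0" using pos b by (simp_all add: a_def d_def)
  obtain C\<^sub>1 C\<^sub>2 where C: "C\<^sub>1 \<ge> 0" "C\<^sub>2 \<ge> 0"
    and C1: "\<And>\<delta> u. 0 < \<delta> \<Longrightarrow> \<delta> \<le> \<delta>\<^sub>0 \<Longrightarrow> u \<in> borel_measurable borel \<Longrightarrow>
        diff_energy (A \<times> B) u \<le> ennreal (C\<^sub>1 / \<delta>\<^sup>2) * nl_energy \<Omega> \<delta> u"
    and C2: "\<And>\<delta> u. 0 < \<delta> \<Longrightarrow> \<delta> \<le> \<delta>\<^sub>0 \<Longrightarrow> u \<in> borel_measurable borel \<Longrightarrow>
        diff_energy (B \<times> D) u \<le> ennreal (C\<^sub>2 / \<delta>\<^sup>2) * nl_energy \<Omega> \<delta> u"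
    using AB BD by (elim controlledE) blast
  show ?thesis
  proof (rule controlledI[of "(2 * d * C\<^sub>1 + 2 * a * C\<^sub>2) / b"])
    fix \<delta> and u :: "'a \<Rightarrow> real" assume \<delta>: "0 < \<delta>" "\<delta> \<le> \<delta>\<^sub>0" and [measurable]: "u \<in> borel_measurable borel"
    define f where "f = (\<lambda>x. \<integral>\<^sup>+z. indicator (A \<times> B) (x, z) * ennreal ((u x - u z)\<^sup>2) \<partial>lborel)"
    define g where "g = (\<lambda>y. \<integral>\<^sup>+z. indicator (B \<times> D) (z, y) * ennreal ((u z - u y)\<^sup>2) \<partial>lborel)"
    have [measurable]: "f \<in> borel_measurable borel" "g \<in> borel_measurable borel"
      unfolding f_def g_def by measurable
    have pt: "ennreal b * (indicator (A \<times> D) (x, y) * ennreal ((u x - u y)\<^sup>2))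
        \<le> 2 * f x * indicator D y + 2 * g y * indicator A x" for x y
    proof (cases "x \<in> A \<and> y \<in> D")
      case True
      have "ennreal b * ennreal ((u x - u y)\<^sup>2) = (\<integral>\<^sup>+z. ennreal ((u x - u y)\<^sup>2) * indicator B z \<partial>lborel)"
        by (subst nn_integral_cmult_indicator) (auto simp: b mult.commute)
      also have "\<dots> \<le> (\<integral>\<^sup>+z. 2 * (indicator (A \<times> B) (x, z) * ennreal ((u x - u z)\<^sup>2))
           + 2 * (indicator (B \<times> D) (z, y) * ennreal ((u z - u y)\<^sup>2)) \<partial>lborel)"
        using True ennreal_square_diff_le[of "u x" "u y"]
        by (intro nn_integral_mono) (auto simp: indicator_def)
      also have "\<dots> = 2 * f x + 2 * g y"
        unfolding f_def g_def by (simp add: nn_integral_add nn_integral_cmult)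
      finally show ?thesis using True by simp
    qed auto
    have "ennreal b * diff_energy (A \<times> D) u
        = (\<integral>\<^sup>+x. \<integral>\<^sup>+y. ennreal b * (indicator (A \<times> D) (x, y) * ennreal ((u x - u y)\<^sup>2)) \<partial>lborel \<partial>lborel)"
    proof -
      have "ennreal b * diff_energy (A \<times> D) u
         = (\<integral>\<^sup>+x. ennreal b * (\<integral>\<^sup>+y. indicator (A \<times> D) (x, y) * ennreal ((u x - u y)\<^sup>2) \<partial>lborel) \<partial>lborel)"
        unfolding diff_energy_def by (rule nn_integral_cmult[symmetric]) measurable
      also have "\<dots> = (\<integral>\<^sup>+x. \<integral>\<^sup>+y. ennreal b * (indicator (A \<times> D) (x, y) * ennreal ((u x - u y)\<^sup>2)) \<partial>lborel \<partial>lborel)"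
        by (rule nn_integral_cong, rule nn_integral_cmult[symmetric]) measurable
      finally show ?thesis .
    qed
    also have "\<dots> \<le> (\<integral>\<^sup>+x. \<integral>\<^sup>+y. 2 * f x * indicator D y + 2 * g y * indicator A x \<partial>lborel \<partial>lborel)"
      by (intro nn_integral_mono pt)
    also have "\<dots> = (\<integral>\<^sup>+x. 2 * ennreal d * f x + (2 * (\<integral>\<^sup>+y. g y \<partial>lborel)) * indicator A x \<partial>lborel)"
      by (intro nn_integral_cong, subst nn_integral_add)
         (auto simp: nn_integral_cmult nn_integral_multc d mult_ac)
    also have "\<dots> = 2 * ennreal d * (\<integral>\<^sup>+x. f x \<partial>lborel) + 2 * ennreal a * (\<integral>\<^sup>+y. g y \<partial>lborel)"
      by (subst nn_integral_add, measurable, subst nn_integral_cmult, measurable,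
          subst nn_integral_cmult_indicator, measurable) (simp add: a mult_ac)
    also have "(\<integral>\<^sup>+x. f x \<partial>lborel) = diff_energy (A \<times> B) u" by (simp add: f_def diff_energy_def)
    also have "(\<integral>\<^sup>+y. g y \<partial>lborel) = diff_energy (B \<times> D) u" unfolding g_def by (rule diff_energy_swap[symmetric]) measurable
    also have "2 * ennreal d * diff_energy (A \<times> B) u + 2 * ennreal a * diff_energy (B \<times> D) u
       \<le> 2 * ennreal d * (ennreal (C\<^sub>1 / \<delta>\<^sup>2) * nl_energy \<Omega> \<delta> u) + 2 * ennreal a * (ennreal (C\<^sub>2 / \<delta>\<^sup>2) * nl_energy \<Omega> \<delta> u)"
      using \<delta> by (intro add_mono mult_left_mono C1 C2) auto
    also have "\<dots> = ennreal (2 * d * (C\<^sub>1 / \<delta>\<^sup>2) + 2 * a * (C\<^sub>2 / \<delta>\<^sup>2)) * nl_energy \<Omega> \<delta> u"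
      using C ge by (simp add: ennreal_mult distrib_right mult.assoc del: times_divide_eq_right times_divide_eq_left)
    finally have "diff_energy (A \<times> D) u \<le> ennreal ((2 * d * (C\<^sub>1 / \<delta>\<^sup>2) + 2 * a * (C\<^sub>2 / \<delta>\<^sup>2)) / b) * nl_energy \<Omega> \<delta> u"
      using C ge by (intro ennreal_le_divideI b0) auto
    then show "diff_energy (A \<times> D) u \<le> ennreal ((2 * d * C\<^sub>1 + 2 * a * C\<^sub>2) / b / \<delta>\<^sup>2) * nl_energy \<Omega> \<delta> u"
      by (simp add: add_divide_distrib mult.commute)
  qed (use C ge b0 in auto)
qed

text \<open>
  Pairs are sorted by their difference \<open>H\<close>; for each \<open>H\<close> the segments from \<open>x\<close> to \<open>x + H\<close> stay in the
  convex set, so the estimate for shifts applies, and the admissible \<open>H\<close> fill a ball.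
\<close>

lemma controlled_convex:
  fixes B :: "'a::euclidean_space set"
  assumes dens: "measure_density \<Omega> \<delta>\<^sub>0 c" and [measurable]: "\<Omega> \<in> sets borel" "B \<in> sets borel"
    and B: "convex B" "bounded B" "B \<subseteq> \<Omega>" and \<delta>\<^sub>0: "\<delta>\<^sub>0 > 0"
  shows "controlled \<Omega> \<delta>\<^sub>0 (B \<times> B)"
proof -
  have c: "c > 0" using dens by (simp add: measure_density_def)
  define d where "d = diameter B"
  have d: "d \<ge> 0" "\<And>x y. x \<in> B \<Longrightarrow> y \<in> B \<Longrightarrow> dist x y \<le> d"
    using B by (simp_all add: d_def diameter_ge_0 diameter_bounded_bound)
  define m where "m = measure lborel (cball (0::'a) d)"
  have m: "emeasure lborel (cball (0::'a) d) = ennreal m" "m \<ge> 0"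
    by (simp_all add: m_def emeasure_bounded_eq_measure)
  show ?thesis
  proof (rule controlledI[of "16 / c * (\<delta>\<^sub>0 + d)\<^sup>2 * m"])
    fix \<delta> and u :: "'a \<Rightarrow> real" assume \<delta>: "0 < \<delta>" "\<delta> \<le> \<delta>\<^sub>0" and [measurable]: "u \<in> borel_measurable borel"
    define G where "G = (\<lambda>x y. indicator (B \<times> B) (x, y) * ennreal ((u x - u y)\<^sup>2))"
    have [measurable (raw)]: "(\<lambda>z. G (f z) (g z)) \<in> borel_measurable N"
      if [measurable]: "f \<in> N \<rightarrow>\<^sub>M borel" "g \<in> N \<rightarrow>\<^sub>M borel" for f g and N :: "'b measure"
      unfolding G_def by measurable
    have [measurable]: "G x \<in> borel_measurable borel" for x unfolding G_def by measurable
    define M where "M = ennreal (16 / c * (1 + d / \<delta>)\<^sup>2) * nl_energy \<Omega> \<delta> u"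
    have in_H: "(\<integral>\<^sup>+x. G x (H + x) \<partial>lborel) \<le> M * indicator (cball 0 d) H" for H
    proof (cases "H \<in> cball 0 d")
      case True
      define A where "A = B \<inter> {y. y + H \<in> B}"
      have "(\<lambda>y. y + H) -` B \<inter> space borel \<in> sets borel"
        by (rule measurable_sets[of _ borel borel]) auto
      then have [measurable]: "A \<in> sets borel" by (simp add: A_def vimage_def)
      have "(\<integral>\<^sup>+x. G x (H + x) \<partial>lborel) = (\<integral>\<^sup>+x. indicator A x * ennreal ((u (x + 0 + H) - u (x + 0))\<^sup>2) \<partial>lborel)"
        by (intro nn_integral_cong) (auto simp: G_def A_def indicator_def add.commute power2_commute)
      also have "\<dots> \<le> ennreal (16 / c * (1 + d / \<delta>)\<^sup>2) * nl_energy \<Omega> \<delta> u"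
      proof (rule nl_energy_shift_from[OF dens \<delta>])
        fix x t assume x: "x \<in> A" and t: "0 \<le> t" "t \<le> (1::real)"
        have "(1 - t) *\<^sub>R x + t *\<^sub>R (x + H) \<in> B"
          using x t B by (intro convexD) (auto simp: A_def)
        then show "x + 0 + t *\<^sub>R H \<in> \<Omega>" using B(3) by (auto simp: algebra_simps)
      qed (use True \<delta> in auto)
      finally show ?thesis using True by (simp add: M_def)
    next
      case False
      have "G x (H + x) = 0" for x
        using False d(2)[of x "H + x"] by (auto simp: G_def indicator_def dist_norm)
      then show ?thesis by simp
    qed
    have "diff_energy (B \<times> B) u = (\<integral>\<^sup>+x. \<integral>\<^sup>+y. G x y \<partial>lborel \<partial>lborel)"
      by (simp add: diff_energy_def G_def)
    also have "\<dots> = (\<integral>\<^sup>+x. \<integral>\<^sup>+H. G x (H + x) \<partial>lborel \<partial>lborel)"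
      by (rule nn_integral_cong, rule nn_integral_translate[symmetric]) measurable
    also have "\<dots> = (\<integral>\<^sup>+H. \<integral>\<^sup>+x. G x (H + x) \<partial>lborel \<partial>lborel)"
      by (rule lborel_pair.Fubini') measurable
    also have "\<dots> \<le> (\<integral>\<^sup>+H. M * indicator (cball (0::'a) d) H \<partial>lborel)"
      by (rule nn_integral_mono) (rule in_H)
    also have "\<dots> = M * ennreal m" by (subst nn_integral_cmult_indicator) (auto simp: m)
    also have "\<dots> = ennreal (16 / c * (1 + d / \<delta>)\<^sup>2 * m) * nl_energy \<Omega> \<delta> u"
      using m c by (simp add: M_def ennreal_mult mult_ac del: times_divide_eq_right times_divide_eq_left)
    also have "\<dots> \<le> ennreal (16 / c * (\<delta>\<^sub>0 + d)\<^sup>2 * m / \<delta>\<^sup>2) * nl_energy \<Omega> \<delta> u"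
    proof (intro mult_right_mono ennreal_leI)
      have "1 + d / \<delta> = (\<delta> + d) / \<delta>" using \<delta> by (simp add: field_simps)
      also have "\<dots> \<le> (\<delta>\<^sub>0 + d) / \<delta>" using \<delta> by (intro divide_right_mono) auto
      finally have "(1 + d / \<delta>)\<^sup>2 \<le> ((\<delta>\<^sub>0 + d) / \<delta>)\<^sup>2" using \<delta> d by (intro power_mono) auto
      then have "16 / c * m * (1 + d / \<delta>)\<^sup>2 \<le> 16 / c * m * ((\<delta>\<^sub>0 + d) / \<delta>)\<^sup>2"
        using c m by (intro mult_left_mono) auto
      then show "16 / c * (1 + d / \<delta>)\<^sup>2 * m \<le> 16 / c * (\<delta>\<^sub>0 + d)\<^sup>2 * m / \<delta>\<^sup>2"
        by (simp add: power_divide mult_ac)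
    qed auto
    finally show "diff_energy (B \<times> B) u \<le> ennreal (16 / c * (\<delta>\<^sub>0 + d)\<^sup>2 * m / \<delta>\<^sup>2) * nl_energy \<Omega> \<delta> u" .
  qed (use c m in auto)
qed

text \<open>
  If a translation carries \<open>A\<close> into \<open>A'\<close> through the domain, then control is inherited from \<open>A'\<close>.
\<close>

lemma controlled_shift:
  fixes A A' D :: "'a::euclidean_space set"
  assumes dens: "measure_density \<Omega> \<delta>\<^sub>0 c" and ctrl: "controlled \<Omega> \<delta>\<^sub>0 (A' \<times> D)" and \<delta>\<^sub>0: "\<delta>\<^sub>0 > 0"
    and [measurable]: "\<Omega> \<in> sets borel" "A \<in> sets borel" "A' \<in> sets borel" "D \<in> sets borel"
    and bd: "bounded D"
    and A: "\<And>x t. x \<in> A \<Longrightarrow> 0 \<le> t \<Longrightarrow> t \<le> 1 \<Longrightarrow> x + t *\<^sub>R H \<in> \<Omega>" "\<And>x. x \<in> A \<Longrightarrow> x + H \<in> A'"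
  shows "controlled \<Omega> \<delta>\<^sub>0 (A \<times> D)"
proof -
  have c: "c > 0" using dens by (simp add: measure_density_def)
  define d where "d = measure lborel D"
  have d: "emeasure lborel D = ennreal d" "d \<ge> 0"
    using bd by (simp_all add: d_def emeasure_bounded_eq_measure)
  obtain C where C: "C \<ge> 0"
    "\<And>\<delta> u. 0 < \<delta> \<Longrightarrow> \<delta> \<le> \<delta>\<^sub>0 \<Longrightarrow> u \<in> borel_measurable borel \<Longrightarrow>
        diff_energy (A' \<times> D) u \<le> ennreal (C / \<delta>\<^sup>2) * nl_energy \<Omega> \<delta> u"
    using ctrl by (elim controlledE) blast
  define K where "K = 16 / c * (\<delta>\<^sub>0 + norm H)\<^sup>2"
  have K: "K \<ge> 0" using c by (simp add: K_def)
  show ?thesis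
  proof (rule controlledI[of "2 * d * K + 2 * C"])
    fix \<delta> and u :: "'a \<Rightarrow> real" assume \<delta>: "0 < \<delta>" "\<delta> \<le> \<delta>\<^sub>0" and [measurable]: "u \<in> borel_measurable borel"
    define F where "F = (\<lambda>x. \<integral>\<^sup>+y. indicator (A' \<times> D) (x, y) * ennreal ((u x - u y)\<^sup>2) \<partial>lborel)"
    have [measurable]: "F \<in> borel_measurable borel" unfolding F_def by measurable
    have pt: "(\<integral>\<^sup>+y. indicator (A \<times> D) (x, y) * ennreal ((u x - u y)\<^sup>2) \<partial>lborel)
        \<le> 2 * ennreal d * (indicator A x * ennreal ((u (x + 0 + H) - u (x + 0))\<^sup>2)) + 2 * F (x + H)" for x
    proof (cases "x \<in> A")
      case True
      have "(\<integral>\<^sup>+y. indicator (A \<times> D) (x, y) * ennreal ((u x - u y)\<^sup>2) \<partial>lborel)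
        \<le> (\<integral>\<^sup>+y. 2 * ennreal ((u (x + 0 + H) - u (x + 0))\<^sup>2) * indicator D y
              + 2 * (indicator (A' \<times> D) (x + H, y) * ennreal ((u (x + H) - u y)\<^sup>2)) \<partial>lborel)"
        using True A(2)[OF True] ennreal_square_diff_le[of "u x" _ "u (x + H)"]
        by (intro nn_integral_mono) (auto simp: indicator_def power2_commute[of "u x" "u (x + H)"])
      also have "\<dots> = 2 * ennreal d * ennreal ((u (x + 0 + H) - u (x + 0))\<^sup>2) + 2 * F (x + H)"
        unfolding F_def
        by (subst nn_integral_add, measurable, subst nn_integral_cmult_indicator, measurable,
            subst nn_integral_cmult, measurable) (simp add: d mult_ac)
      finally show ?thesis using True by simp
    qed auto
    have "diff_energy (A \<times> D) u
      \<le> (\<integral>\<^sup>+x. 2 * ennreal d * (indicator A x * ennreal ((u (x + 0 + H) - u (x + 0))\<^sup>2)) + 2 * F (x + H) \<partial>lborel)"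
      unfolding diff_energy_def by (intro nn_integral_mono pt)
    also have "\<dots> = 2 * ennreal d * (\<integral>\<^sup>+x. indicator A x * ennreal ((u (x + 0 + H) - u (x + 0))\<^sup>2) \<partial>lborel)
        + 2 * diff_energy (A' \<times> D) u"
      by (subst nn_integral_add, measurable)
         (simp add: nn_integral_cmult nn_integral_translate, simp add: F_def diff_energy_def)
    also have "\<dots> \<le> 2 * ennreal d * (ennreal (16 / c * (1 + norm H / \<delta>)\<^sup>2) * nl_energy \<Omega> \<delta> u)
        + 2 * (ennreal (C / \<delta>\<^sup>2) * nl_energy \<Omega> \<delta> u)"
      using A(1) \<delta> by (intro add_mono mult_left_mono C nl_energy_shift_from[OF dens \<delta>]) auto
    also have "\<dots> = ennreal (2 * d * (16 / c * (1 + norm H / \<delta>)\<^sup>2) + 2 * (C / \<delta>\<^sup>2)) * nl_energy \<Omega> \<delta> u"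
      using C d c by (simp add: ennreal_mult distrib_right mult.assoc del: times_divide_eq_right times_divide_eq_left)
    also have "\<dots> \<le> ennreal (2 * d * (K / \<delta>\<^sup>2) + 2 * (C / \<delta>\<^sup>2)) * nl_energy \<Omega> \<delta> u"
    proof (intro mult_right_mono ennreal_leI add_right_mono mult_left_mono)
      have "1 + norm H / \<delta> = (\<delta> + norm H) / \<delta>" using \<delta> by (simp add: field_simps)
      also have "\<dots> \<le> (\<delta>\<^sub>0 + norm H) / \<delta>" using \<delta> by (intro divide_right_mono) auto
      finally have "(1 + norm H / \<delta>)\<^sup>2 \<le> ((\<delta>\<^sub>0 + norm H) / \<delta>)\<^sup>2" using \<delta> by (intro power_mono) auto
      then have "16 / c * (1 + norm H / \<delta>)\<^sup>2 \<le> 16 / c * ((\<delta>\<^sub>0 + norm H) / \<delta>)\<^sup>2"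
        using c by (intro mult_left_mono) auto
      then show "16 / c * (1 + norm H / \<delta>)\<^sup>2 \<le> K / \<delta>\<^sup>2"
        by (simp add: K_def power_divide)
    qed (use d in auto)
    finally show "diff_energy (A \<times> D) u \<le> ennreal ((2 * d * K + 2 * C) / \<delta>\<^sup>2) * nl_energy \<Omega> \<delta> u"
      by (simp add: add_divide_distrib)
  qed (use C d K in auto)
qed

lemma emeasure_lborel_open_pos:
  fixes S :: "'a::euclidean_space set"
  assumes "open S" "S \<noteq> {}"
  shows "emeasure lborel S > 0"
proof -
  obtain x r where r: "r > 0" "ball x r \<subseteq> S" using assms by (meson all_not_in_conv openE)
  have "0 < emeasure lborel (ball x r)" using r(1) by (simp add: emeasure_ball ennreal_zero_less_mult_iff)
  also have "\<dots> \<le> emeasure lborel S" using r assms by (intro emeasure_mono) auto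
  finally show ?thesis .
qed

text \<open>
  The cone condition moves a neighbourhood of \<open>x\<close>, relative to the domain, along one axis into a ball
  inside the domain, where convexity applies.
\<close>

lemma controlled_local:
  fixes \<Omega> :: "'a::euclidean_space set"
  assumes dens: "measure_density \<Omega> \<delta>\<^sub>0 c" and uc: "uniform_cone \<Omega> I r v \<rho> \<kappa> \<eta>"
    and op: "open \<Omega>" and bd: "bounded \<Omega>" and \<delta>\<^sub>0: "\<delta>\<^sub>0 > 0" and x: "x \<in> \<Omega>"
  defines "N \<equiv> \<Omega> \<inter> ball x (min \<rho> (\<kappa> * \<eta>))"
  shows "controlled \<Omega> \<delta>\<^sub>0 (N \<times> N)"
proof -
  note I = uniform_coneD[OF uc]
  have [measurable]: "\<Omega> \<in> sets borel" "N \<in> sets borel" using op by (auto simp: N_def)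
  obtain p where p: "p \<in> I" "x \<in> ball p (r p)" using I(2) x closure_subset by blast
  define B where "B = ball (x + \<eta> *\<^sub>R v p) (\<kappa> * \<eta>)"
  have BO: "B \<subseteq> \<Omega>" unfolding B_def by (rule I(8)[OF p(1) x p(2) x]) (use I in auto)
  have seg: "y + t *\<^sub>R (\<eta> *\<^sub>R v p) \<in> \<Omega>" if y: "y \<in> N" and t: "0 \<le> t" "t \<le> 1" for y t
  proof (cases "t = 0")
    case True
    then show ?thesis using y by (simp add: N_def)
  next
    case False
    have "t * \<eta> \<le> 1 * \<eta>" using t I(6) by (intro mult_right_mono) auto
    then have "ball (y + (t * \<eta>) *\<^sub>R v p) (\<kappa> * (t * \<eta>)) \<subseteq> \<Omega>"
      using y t False I(6) by (intro I(8)[OF p(1) x p(2)]) (auto simp: N_def)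
    moreover have "y + (t * \<eta>) *\<^sub>R v p \<in> ball (y + (t * \<eta>) *\<^sub>R v p) (\<kappa> * (t * \<eta>))"
      using t False I(4,6) by simp
    ultimately show ?thesis by auto
  qed
  have NB: "y + \<eta> *\<^sub>R v p \<in> B" if "y \<in> N" for y
    using that by (simp add: B_def N_def dist_norm)
  have bN: "bounded N" using bd by (auto simp: N_def intro: bounded_subset)
  have [measurable]: "B \<in> sets borel" by (simp add: B_def)
  have "controlled \<Omega> \<delta>\<^sub>0 (B \<times> B)"
    by (rule controlled_convex[OF dens _ _ _ _ BO \<delta>\<^sub>0]) (auto simp: B_def op)
  then have "controlled \<Omega> \<delta>\<^sub>0 (N \<times> B)"
    by (rule controlled_shift[OF dens _ \<delta>\<^sub>0, where H = "\<eta> *\<^sub>R v p"]) (use seg NB in \<open>auto simp: B_def\<close>)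
  then have "controlled \<Omega> \<delta>\<^sub>0 (B \<times> N)"
    by (rule controlled_sym) measurable
  then show ?thesis
    by (rule controlled_shift[OF dens _ \<delta>\<^sub>0, where H = "\<eta> *\<^sub>R v p"]) (use seg NB bN in auto)
qed

text \<open>
  Neighbourhoods of a fixed radius are controlled, and two of them with close centres overlap in a
  set of positive measure; so the relation "the product of the two neighbourhoods is controlled" is
  locally constant on the connected domain.
\<close>

theorem nonlocal_Poincare_Wirtinger:
  fixes \<Omega> :: "'a::euclidean_space set"
  assumes cone: "cone_condition \<Omega>" and op: "open \<Omega>" and bd: "bounded \<Omega>" and conn: "connected \<Omega>"
    and \<delta>\<^sub>0: "\<delta>\<^sub>0 > 0"
  shows "controlled \<Omega> \<delta>\<^sub>0 (\<Omega> \<times> \<Omega>)"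
proof -
  obtain c where dens: "measure_density \<Omega> \<delta>\<^sub>0 c"
    using cone_condition_measure_density[OF cone bd op \<delta>\<^sub>0] .
  obtain I r v \<rho> \<kappa> \<eta> where uc: "uniform_cone \<Omega> I r v \<rho> \<kappa> \<eta>"
    using cone_condition_uniform[OF cone bd] .
  define \<tau> where "\<tau> = min \<rho> (\<kappa> * \<eta>)"
  have \<tau>: "\<tau> > 0" using uniform_coneD[OF uc] by (simp add: \<tau>_def)
  define N where "N = (\<lambda>x. \<Omega> \<inter> ball x \<tau>)"
  have NN: "controlled \<Omega> \<delta>\<^sub>0 (N x \<times> N x)" if "x \<in> \<Omega>" for x
    unfolding N_def \<tau>_def by (rule controlled_local[OF dens uc op bd \<delta>\<^sub>0 that])
  have [measurable]: "N x \<in> sets borel" for x using op by (simp add: N_def)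
  have bN: "bounded (N x)" for x using bd by (auto simp: N_def intro: bounded_subset)
  have step: "controlled \<Omega> \<delta>\<^sub>0 (N x \<times> N y)" if xy: "x \<in> \<Omega>" "y \<in> \<Omega>" "dist x y < \<tau>" for x y
  proof -
    define Z where "Z = N x \<inter> N y"
    have Z: "open Z" "x \<in> Z" using op \<tau> xy by (auto simp: Z_def N_def dist_commute)
    have [measurable]: "Z \<in> sets borel" by (simp add: Z_def)
    have "controlled \<Omega> \<delta>\<^sub>0 (N x \<times> Z)" "controlled \<Omega> \<delta>\<^sub>0 (Z \<times> N y)"
      using NN xy by (auto intro: controlled_subset simp: Z_def)
    then show ?thesis
      by (rule controlled_trans) (use bN Z emeasure_lborel_open_pos[of Z] in \<open>auto simp: Z_def\<close>)
  qed
  have nonempty: "emeasure lborel (N x) > 0" if "x \<in> \<Omega>" for x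
    using op \<tau> that by (intro emeasure_lborel_open_pos) (auto simp: N_def)
  have all: "controlled \<Omega> \<delta>\<^sub>0 (N x \<times> N y)" if xy: "x \<in> \<Omega>" "y \<in> \<Omega>" for x y
  proof (rule connected_equivalence_relation[OF conn xy])
    show "controlled \<Omega> \<delta>\<^sub>0 (N b \<times> N a)" if "controlled \<Omega> \<delta>\<^sub>0 (N a \<times> N b)" for a b
      using that by (rule controlled_sym) measurable
    show "controlled \<Omega> \<delta>\<^sub>0 (N a \<times> N d)"
      if "controlled \<Omega> \<delta>\<^sub>0 (N a \<times> N b)" "controlled \<Omega> \<delta>\<^sub>0 (N b \<times> N d)" "b \<in> \<Omega>" for a b d
      using that(1,2) by (rule controlled_trans) (use bN nonempty that(3) in auto)
    show "\<exists>T. openin (top_of_set \<Omega>) T \<and> a \<in> T \<and> (\<forall>x\<in>T. controlled \<Omega> \<delta>\<^sub>0 (N a \<times> N x))"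
      if a: "a \<in> \<Omega>" for a
      using a \<tau> op step[OF a]
      by (intro exI[of _ "\<Omega> \<inter> ball a \<tau>"]) (auto intro: openin_open_Int)
  qed
  have "compact (closure \<Omega>)" using bd by simp
  then obtain J where J: "J \<subseteq> \<Omega>" "finite J" "closure \<Omega> \<subseteq> (\<Union>x\<in>J. ball x \<tau>)"
  proof (rule compactE_image[where C = \<Omega> and f = "\<lambda>x. ball x \<tau>"])
    show "closure \<Omega> \<subseteq> (\<Union>x\<in>\<Omega>. ball x \<tau>)"
      using \<tau> by (force simp: closure_approachable)
  qed auto
  have "controlled \<Omega> \<delta>\<^sub>0 (\<Union>(x, y)\<in>J \<times> J. N x \<times> N y)"
    using J(2) by (intro controlled_UN) (auto intro!: all subsetD[OF J(1)])
  moreover have "\<Omega> \<times> \<Omega> \<subseteq> (\<Union>(x, y)\<in>J \<times> J. N x \<times> N y)"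
    using J(3) closure_subset[of \<Omega>] by (fastforce simp: N_def)
  ultimately show ?thesis by (rule controlled_subset)
qed

text \<open>
  Doubling the interaction radius costs only a constant.  For small \<open>\<delta>\<close> the points \<open>x\<close> and \<open>x + H\<close>
  are joined by a detour into the cone: \<open>x\<close>, \<open>x + w\<close>, \<open>x + w + H\<close>, \<open>x + H\<close>, where \<open>w\<close> is so long
  that the middle segment stays in the ball that the cone condition provides.  For the other \<open>\<delta>\<close> the
  Poincare--Wirtinger inequality is enough.
\<close>

theorem nl_energy_doubling:
  fixes \<Omega> :: "'a::euclidean_space set"
  assumes cone: "cone_condition \<Omega>" and op: "open \<Omega>" and bd: "bounded \<Omega>" and conn: "connected \<Omega>"
    and \<delta>\<^sub>0: "\<delta>\<^sub>0 > 0"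
  obtains C where "C \<ge> 0" "\<And>\<delta> u. 0 < \<delta> \<Longrightarrow> \<delta> \<le> \<delta>\<^sub>0 \<Longrightarrow> u \<in> borel_measurable borel \<Longrightarrow>
      diff_energy (near_pairs \<Omega> (2 * \<delta>)) u \<le> ennreal (C * \<delta> ^ DIM('a)) * nl_energy \<Omega> \<delta> u"
proof -
  obtain c where dens: "measure_density \<Omega> \<delta>\<^sub>0 c"
    using cone_condition_measure_density[OF cone bd op \<delta>\<^sub>0] .
  obtain I r v \<rho> \<kappa> \<eta> where uc: "uniform_cone \<Omega> I r v \<rho> \<kappa> \<eta>"
    using cone_condition_uniform[OF cone bd] .
  note I = uniform_coneD[OF uc]
  have c: "c > 0" using dens by (simp add: measure_density_def)
  have [measurable]: "\<Omega> \<in> sets borel" using op by simp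
  obtain P where P: "P \<ge> 0" "\<And>\<delta> u. 0 < \<delta> \<Longrightarrow> \<delta> \<le> \<delta>\<^sub>0 \<Longrightarrow> u \<in> borel_measurable borel \<Longrightarrow>
        diff_energy (\<Omega> \<times> \<Omega>) u \<le> ennreal (P / \<delta>\<^sup>2) * nl_energy \<Omega> \<delta> u"
    using nonlocal_Poincare_Wirtinger[OF cone op bd conn \<delta>\<^sub>0] by (elim controlledE) blast
  \<comment> \<open>Below this threshold the detour stays in the range of the cone condition.\<close>
  define \<delta>\<^sub>1 where "\<delta>\<^sub>1 = min (\<rho> / 3) (\<kappa> * \<eta> / 3)"
  have \<delta>\<^sub>1: "\<delta>\<^sub>1 > 0" "\<delta>\<^sub>1 \<le> \<rho> / 3" "\<delta>\<^sub>1 \<le> \<kappa> * \<eta> / 3" using I by (auto simp: \<delta>\<^sub>1_def)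
  define K where "K = 16 / c * (1 + 3 / \<kappa>)\<^sup>2"
  have K: "K \<ge> 0" using c by (simp add: K_def)
  define \<omega> where "\<omega> = unit_ball_vol (real DIM('a)) * 2 ^ DIM('a)"
  have \<omega>: "\<omega> \<ge> 0" by (simp add: \<omega>_def)
  have small: "diff_energy (near_pairs \<Omega> (2 * \<delta>)) u
      \<le> ennreal (real (card I) * (10 * K * \<omega>) * \<delta> ^ DIM('a)) * nl_energy \<Omega> \<delta> u"
    if \<delta>: "0 < \<delta>" "\<delta> \<le> \<delta>\<^sub>0" "\<delta> \<le> \<delta>\<^sub>1" and [measurable]: "u \<in> borel_measurable borel"
    for \<delta> and u :: "'a \<Rightarrow> real"
  proof -
    \<comment> \<open>The detour has length \<open>\<delta>'\<close>, so that the cone has width \<open>3 \<delta>\<close> there, more than \<open>|H| \<le> 2 \<delta>\<close>.\<close>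
    define \<delta>' where "\<delta>' = 3 * \<delta> / \<kappa>"
    have \<delta>': "\<delta>' > 0" "\<delta>' \<le> \<eta>" "2 * \<delta> < \<kappa> * \<delta>'" "2 * \<delta> < \<rho>"
      using \<delta> \<delta>\<^sub>1 I by (auto simp: \<delta>'_def field_simps)
    define E where "E = ennreal K * nl_energy \<Omega> \<delta> u"
    define G where "G = (\<lambda>p x y. indicator (near_pairs \<Omega> (2 * \<delta>) \<inter> ball p (r p) \<times> UNIV) (x, y) * ennreal ((u x - u y)\<^sup>2))"
    have [measurable (raw)]: "(\<lambda>z. G p (f z) (g z)) \<in> borel_measurable N"
      if [measurable]: "f \<in> N \<rightarrow>\<^sub>M borel" "g \<in> N \<rightarrow>\<^sub>M borel" for p f g and N :: "'b measure"
      unfolding G_def by measurable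
    have [measurable]: "G p x \<in> borel_measurable borel" for p x unfolding G_def by measurable
    have in_H: "(\<integral>\<^sup>+x. G p x (H + x) \<partial>lborel) \<le> 10 * E * indicator (cball 0 (2 * \<delta>)) H" if p: "p \<in> I" for p H
    proof (cases "norm H \<le> 2 * \<delta>")
      case True
      define A where "A = \<Omega> \<inter> ball p (r p) \<inter> {x. x + H \<in> \<Omega>}"
      have "(\<lambda>y. y + H) -` \<Omega> \<inter> space borel \<in> sets borel"
        by (rule measurable_sets[of _ borel borel]) auto
      then have [measurable]: "A \<in> sets borel" by (simp add: A_def vimage_def)
      define w where "w = \<delta>' *\<^sub>R v p"
      have nw: "norm w \<le> (3 / \<kappa>) * \<delta>" 
      proof -
        have "norm w \<le> \<delta>' * 1" using \<delta>' I(7)[OF p] by (simp add: w_def mult_left_le)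
        then show ?thesis by (simp add: \<delta>'_def)
      qed
      have "3 \<le> 3 / \<kappa>" using I by (simp add: field_simps)
      then have nH: "norm H \<le> (3 / \<kappa>) * \<delta>" using True \<delta> mult_right_mono[of 3 "3 / \<kappa>" \<delta>] by linarith
      have dH: "dist x (x + H) < \<rho>" for x :: 'a using True \<delta>' by (simp add: dist_norm)
      have up: "y + t *\<^sub>R w \<in> \<Omega>" if x: "x \<in> A" and y: "y \<in> \<Omega>" "dist x y < \<rho>" and t: "0 \<le> t" "t \<le> 1" for x y t
      proof (cases "t = 0")
        case False
        have "t * \<delta>' \<le> 1 * \<eta>" using t \<delta>' by (intro mult_mono) auto
        then have "ball (y + (t * \<delta>') *\<^sub>R v p) (\<kappa> * (t * \<delta>')) \<subseteq> \<Omega>"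
          using x y t False \<delta>' by (intro I(8)[OF p, of x]) (auto simp: A_def)
        moreover have "y + (t * \<delta>') *\<^sub>R v p \<in> ball (y + (t * \<delta>') *\<^sub>R v p) (\<kappa> * (t * \<delta>'))"
          using t False I(4) \<delta>' by simp
        ultimately show ?thesis by (auto simp: w_def)
      qed (use y in simp)
      have mid: "x + w + t *\<^sub>R H \<in> \<Omega>" if x: "x \<in> A" and t: "0 \<le> t" "t \<le> 1" for x t
      proof -
        have "ball (x + w) (\<kappa> * \<delta>') \<subseteq> \<Omega>"
          unfolding w_def using x \<delta>' I(3) by (intro I(8)[OF p, of x]) (auto simp: A_def)
        moreover have "t * norm H \<le> 1 * (2 * \<delta>)" using t True by (intro mult_mono) auto
        then have "x + w + t *\<^sub>R H \<in> ball (x + w) (\<kappa> * \<delta>')"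
          using \<delta>' t by (simp add: dist_norm)
        ultimately show ?thesis by blast
      qed
      define a1 where "a1 = (\<lambda>x. indicator A x * ennreal ((u (x + H + w) - u (x + H))\<^sup>2))"
      define a2 where "a2 = (\<lambda>x. indicator A x * ennreal ((u (x + w + H) - u (x + w))\<^sup>2))"
      define a3 where "a3 = (\<lambda>x. indicator A x * ennreal ((u (x + 0 + w) - u (x + 0))\<^sup>2))"
      have [measurable]: "a1 \<in> borel_measurable borel" "a2 \<in> borel_measurable borel" "a3 \<in> borel_measurable borel"
        unfolding a1_def a2_def a3_def by measurable
      have i1: "(\<integral>\<^sup>+x. a1 x \<partial>lborel) \<le> E"
        unfolding a1_def E_def K_def using \<delta> up dH nw
        by (intro nl_energy_shift_from[OF dens]) (auto simp: A_def)
      have i2: "(\<integral>\<^sup>+x. a2 x \<partial>lborel) \<le> E"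
        unfolding a2_def E_def K_def using \<delta> mid nH by (intro nl_energy_shift_from[OF dens]) auto
      have i3: "(\<integral>\<^sup>+x. a3 x \<partial>lborel) \<le> E"
        unfolding a3_def E_def K_def using \<delta> up nw I(3)
        by (intro nl_energy_shift_from[OF dens]) (auto simp: A_def)
      have "(\<integral>\<^sup>+x. G p x (H + x) \<partial>lborel) \<le> (\<integral>\<^sup>+x. 2 * a1 x + (4 * a2 x + 4 * a3 x) \<partial>lborel)"
      proof (rule nn_integral_mono)
        fix x
        show "G p x (H + x) \<le> 2 * a1 x + (4 * a2 x + 4 * a3 x)"
        proof (cases "x \<in> A")
          case True
          have "ennreal ((u (x + H) - u x)\<^sup>2)
              \<le> 2 * ennreal ((u (x + H) - u (x + H + w))\<^sup>2) + 2 * ennreal ((u (x + H + w) - u x)\<^sup>2)"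
            by (rule ennreal_square_diff_le)
          also have "\<dots> \<le> 2 * ennreal ((u (x + H) - u (x + H + w))\<^sup>2)
              + 2 * (2 * ennreal ((u (x + H + w) - u (x + w))\<^sup>2) + 2 * ennreal ((u (x + w) - u x)\<^sup>2))"
            by (intro add_left_mono mult_left_mono ennreal_square_diff_le) auto
          also have "\<dots> = 2 * a1 x + (4 * a2 x + 4 * a3 x)"
            using True by (simp add: a1_def a2_def a3_def power2_commute[of "u (H + x)" "u (H + (w + x))"] distrib_left
                add_ac mult.assoc[symmetric])
          finally show ?thesis
            by (auto simp: G_def indicator_def power2_commute[of "u x"] add.commute[of H])
        next
          case False
          then have "G p x (H + x) = 0"
            by (auto simp: G_def A_def near_pairs_def indicator_def add.commute)
          then show ?thesis by simp
        qed
      qed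
      also have "(\<integral>\<^sup>+x. 2 * a1 x + (4 * a2 x + 4 * a3 x) \<partial>lborel)
          = 2 * (\<integral>\<^sup>+x. a1 x \<partial>lborel) + (4 * (\<integral>\<^sup>+x. a2 x \<partial>lborel) + 4 * (\<integral>\<^sup>+x. a3 x \<partial>lborel))"
        by (simp add: nn_integral_add nn_integral_cmult)
      also have "\<dots> \<le> 2 * E + (4 * E + 4 * E)"
        by (intro add_mono mult_left_mono i1 i2 i3) auto
      also have "\<dots> = 10 * E" by (simp add: distrib_right[symmetric])
      finally show ?thesis using True by simp
    next
      case False
      then have "G p x (H + x) = 0" for x
        by (auto simp: G_def near_pairs_def indicator_def dist_norm)
      then show ?thesis by simp
    qed
    have Gp: "(\<integral>\<^sup>+x. \<integral>\<^sup>+y. G p x y \<partial>lborel \<partial>lborel) \<le> ennreal (10 * K * \<omega> * \<delta> ^ DIM('a)) * nl_energy \<Omega> \<delta> u"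
      if p: "p \<in> I" for p
    proof -
      have "(\<integral>\<^sup>+x. \<integral>\<^sup>+y. G p x y \<partial>lborel \<partial>lborel) = (\<integral>\<^sup>+x. \<integral>\<^sup>+H. G p x (H + x) \<partial>lborel \<partial>lborel)"
        by (rule nn_integral_cong, rule nn_integral_translate[symmetric]) measurable
      also have "\<dots> = (\<integral>\<^sup>+H. \<integral>\<^sup>+x. G p x (H + x) \<partial>lborel \<partial>lborel)"
        by (rule lborel_pair.Fubini') measurable
      also have "\<dots> \<le> (\<integral>\<^sup>+H. 10 * E * indicator (cball (0::'a) (2 * \<delta>)) H \<partial>lborel)"
        by (rule nn_integral_mono) (rule in_H[OF p])
      also have "\<dots> = 10 * E * ennreal (\<omega> * \<delta> ^ DIM('a))"
        using \<delta> by (subst nn_integral_cmult_indicator)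
          (auto simp: emeasure_cball \<omega>_def power_mult_distrib mult_ac)
      also have "\<dots> = ennreal (10 * K * \<omega> * \<delta> ^ DIM('a)) * nl_energy \<Omega> \<delta> u"
        using K \<omega> \<delta> by (simp add: E_def ennreal_mult mult_ac)
      finally show ?thesis .
    qed
    have "diff_energy (near_pairs \<Omega> (2 * \<delta>)) u \<le> (\<integral>\<^sup>+x. \<integral>\<^sup>+y. (\<Sum>p\<in>I. G p x y) \<partial>lborel \<partial>lborel)"
      unfolding diff_energy_def
    proof (intro nn_integral_mono)
      fix x y
      show "indicator (near_pairs \<Omega> (2 * \<delta>)) (x, y) * ennreal ((u x - u y)\<^sup>2) \<le> (\<Sum>p\<in>I. G p x y)"
      proof (cases "(x, y) \<in> near_pairs \<Omega> (2 * \<delta>)")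
        case True
        then obtain p where p: "p \<in> I" "x \<in> ball p (r p)"
          using I(2) closure_subset[of \<Omega>] by (auto simp: near_pairs_def)
        have "indicator (near_pairs \<Omega> (2 * \<delta>)) (x, y) * ennreal ((u x - u y)\<^sup>2) = G p x y"
          using True p by (simp add: G_def)
        also have "\<dots> \<le> (\<Sum>p\<in>I. G p x y)" using p I(1) by (intro member_le_sum) auto
        finally show ?thesis .
      qed auto
    qed
    also have "\<dots> = (\<Sum>p\<in>I. \<integral>\<^sup>+x. \<integral>\<^sup>+y. G p x y \<partial>lborel \<partial>lborel)"
      by (simp add: nn_integral_sum)
    also have "\<dots> \<le> (\<Sum>p\<in>I. ennreal (10 * K * \<omega> * \<delta> ^ DIM('a)) * nl_energy \<Omega> \<delta> u)"
      by (intro sum_mono Gp)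
    also have "\<dots> = ennreal (real (card I) * (10 * K * \<omega>) * \<delta> ^ DIM('a)) * nl_energy \<Omega> \<delta> u"
      using K \<omega> \<delta> by (simp add: ennreal_mult ennreal_of_nat_eq_real_of_nat mult.assoc)
    finally show ?thesis .
  qed
  have large: "diff_energy (near_pairs \<Omega> (2 * \<delta>)) u
      \<le> ennreal (P / (\<delta>\<^sub>1\<^sup>2 * \<delta>\<^sub>1 ^ DIM('a)) * \<delta> ^ DIM('a)) * nl_energy \<Omega> \<delta> u"
    if \<delta>: "0 < \<delta>" "\<delta> \<le> \<delta>\<^sub>0" "\<delta>\<^sub>1 \<le> \<delta>" and [measurable]: "u \<in> borel_measurable borel"
    for \<delta> and u :: "'a \<Rightarrow> real"
  proof -
    have "diff_energy (near_pairs \<Omega> (2 * \<delta>)) u \<le> diff_energy (\<Omega> \<times> \<Omega>) u"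
      by (intro diff_energy_mono) (auto simp: near_pairs_def)
    also have "\<dots> \<le> ennreal (P / \<delta>\<^sup>2) * nl_energy \<Omega> \<delta> u" using \<delta> by (intro P) auto
    also have "\<dots> \<le> ennreal (P / (\<delta>\<^sub>1\<^sup>2 * \<delta>\<^sub>1 ^ DIM('a)) * \<delta> ^ DIM('a)) * nl_energy \<Omega> \<delta> u"
    proof (intro mult_right_mono ennreal_leI)
      have "P / \<delta>\<^sup>2 \<le> P / \<delta>\<^sub>1\<^sup>2" using \<delta> \<delta>\<^sub>1 P by (intro divide_left_mono power_mono) auto
      also have "\<dots> \<le> P / \<delta>\<^sub>1\<^sup>2 * (\<delta> / \<delta>\<^sub>1) ^ DIM('a)"
        using \<delta> \<delta>\<^sub>1 P mult_left_mono[of 1 "(\<delta> / \<delta>\<^sub>1) ^ DIM('a)" "P / \<delta>\<^sub>1\<^sup>2"]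
        by (simp add: one_le_power)
      finally show "P / \<delta>\<^sup>2 \<le> P / (\<delta>\<^sub>1\<^sup>2 * \<delta>\<^sub>1 ^ DIM('a)) * \<delta> ^ DIM('a)"
        by (simp add: power_divide)
    qed auto
    finally show ?thesis .
  qed
  define C where "C = real (card I) * (10 * K * \<omega>) + P / (\<delta>\<^sub>1\<^sup>2 * \<delta>\<^sub>1 ^ DIM('a))"
  show ?thesis
  proof (rule that[of C])
    show "C \<ge> 0" using K \<omega> P \<delta>\<^sub>1 by (simp add: C_def)
    fix \<delta> and u :: "'a \<Rightarrow> real" assume \<delta>: "0 < \<delta>" "\<delta> \<le> \<delta>\<^sub>0" and u: "u \<in> borel_measurable borel"
    have le: "real (card I) * (10 * K * \<omega>) \<le> C" "P / (\<delta>\<^sub>1\<^sup>2 * \<delta>\<^sub>1 ^ DIM('a)) \<le> C"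
      using K \<omega> P \<delta>\<^sub>1 by (simp_all add: C_def)
    show "diff_energy (near_pairs \<Omega> (2 * \<delta>)) u \<le> ennreal (C * \<delta> ^ DIM('a)) * nl_energy \<Omega> \<delta> u"
    proof (cases "\<delta> \<le> \<delta>\<^sub>1")
      case True
      show ?thesis
        by (rule order_trans[OF small[OF \<delta> True u]])
           (intro mult_right_mono ennreal_leI le(1), use \<delta> in auto)
    next
      case False
      then have "\<delta>\<^sub>1 \<le> \<delta>" by simp
      then show ?thesis
        by (intro order_trans[OF large[OF \<delta> _ u]] mult_right_mono ennreal_leI le(2)) (use \<delta> in auto)
    qed
  qed
qed

section \<open>Regularity of the surface measure\<close>

lemma hausdorff_pre_finite_cover:
  fixes U :: "'i \<Rightarrow> 'a::metric_space set"
  assumes I: "finite I" and S: "S \<subseteq> (\<Union>i\<in>I. U i)" and \<eta>: "\<eta> \<ge> 0"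
    and U: "\<And>i. i \<in> I \<Longrightarrow> bounded (U i)" "\<And>i. i \<in> I \<Longrightarrow> diameter (U i) \<le> \<eta>"
  shows "hausdorff_pre k \<eta> S \<le> (\<Sum>i\<in>I. hausdorff_gauge k (U i))"
proof -
  obtain g where g: "bij_betw g {..<card I} I"
    using ex_bij_betw_nat_finite[OF I] by (auto simp: atLeast0LessThan)
  define V where "V = (\<lambda>n. if n < card I then U (g n) else {})"
  have gI: "g n \<in> I" if "n < card I" for n using g that by (auto simp: bij_betw_def)
  have "S \<subseteq> (\<Union>n. V n)"
  proof
    fix x assume "x \<in> S"
    then obtain i where i: "i \<in> I" "x \<in> U i" using S by blast
    then have "i \<in> g ` {..<card I}" using g by (simp add: bij_betw_def)
    then obtain n where "n < card I" "g n = i" by blast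
    then have "x \<in> V n" using i by (simp add: V_def)
    then show "x \<in> (\<Union>n. V n)" by blast
  qed
  then have "V \<in> hausdorff_covers \<eta> S"
    using U gI \<eta> by (auto simp: hausdorff_covers_def V_def)
  then have "hausdorff_pre k \<eta> S \<le> (\<Sum>n. hausdorff_gauge k (V n))"
    unfolding hausdorff_pre_def by (rule INF_lower)
  also have "\<dots> = (\<Sum>n<card I. hausdorff_gauge k (V n))"
    by (rule suminf_finite) (auto simp: V_def hausdorff_gauge_def)
  also have "\<dots> = (\<Sum>n<card I. hausdorff_gauge k (U (g n)))"
    by (rule sum.cong) (auto simp: V_def)
  also have "\<dots> = (\<Sum>i\<in>I. hausdorff_gauge k (U i))"
    by (rule sum.reindex_bij_betw[OF g])
  finally show ?thesis .
qed

lemma hausdorff_outer_finite_UN: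
  assumes "finite I"
  shows "hausdorff_outer k (\<Union>i\<in>I. A i) \<le> (\<Sum>i\<in>I. hausdorff_outer k (A i))"
  using assms
proof (induction I)
  case empty
  then show ?case by (simp add: hausdorff_outer_empty)
next
  case (insert i I)
  have "hausdorff_outer k (A i \<union> (\<Union>i\<in>I. A i)) \<le> hausdorff_outer k (A i) + hausdorff_outer k (\<Union>i\<in>I. A i)"
    by (rule hausdorff_outer_subadditive2)
  also have "\<dots> \<le> hausdorff_outer k (A i) + (\<Sum>i\<in>I. hausdorff_outer k (A i))"
    by (rule add_left_mono) (rule insert.IH)
  finally show ?case using insert.hyps by simp
qed

lemma hausdorff_gauge_le:
  assumes "diameter U \<le> d" "bounded U"
  shows "hausdorff_gauge k U \<le> ennreal (unit_ball_vol (real k) * (d / 2) ^ k)"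
  using assms diameter_ge_0[of U]
  by (auto simp: hausdorff_gauge_def intro!: ennreal_leI mult_left_mono power_mono)

lemma graph_chartD:
  assumes "graph_chart \<Omega> p r K e \<phi>"
  shows "norm e = 1" "r > 0" "K \<ge> 1" "continuous_on UNIV \<phi>" "\<phi> p = 0"
    "\<And>x t. \<phi> (x + t *\<^sub>R e) = \<phi> x + t"
    "\<And>x y. x \<in> ball p r \<Longrightarrow> y \<in> ball p r \<Longrightarrow> \<bar>\<phi> x - \<phi> y\<bar> \<le> K * norm (x - y)"
    "\<And>x. x \<in> ball p r \<Longrightarrow> x \<in> \<Omega> \<longleftrightarrow> \<phi> x > 0"
    "\<And>x. x \<in> ball p r \<Longrightarrow> x \<in> frontier \<Omega> \<longleftrightarrow> \<phi> x = 0"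
proof -
  note A = assms[unfolded graph_chart_def]
  show "norm e = 1" using A norm_Basis[of e] norm_Basis[of "- e"] by auto
  show "x \<in> \<Omega> \<longleftrightarrow> \<phi> x > 0" if "x \<in> ball p r" for x
  proof -
    have "\<Omega> \<inter> ball p r = {x \<in> ball p r. \<phi> x > 0}" using A by (elim conjE)
    then show ?thesis using that by blast
  qed
  show "x \<in> frontier \<Omega> \<longleftrightarrow> \<phi> x = 0" if "x \<in> ball p r" for x
  proof -
    have "frontier \<Omega> \<inter> ball p r = {x \<in> ball p r. \<phi> x = 0}" using A by (elim conjE)
    then show ?thesis using that by blast
  qed
qed (use assms in \<open>auto simp: graph_chart_def\<close>)

lemma graph_chart_axis:
  assumes "graph_chart \<Omega> p r K e \<phi>"
  obtains b where "b \<in> Basis" "e = b \<or> e = - b"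
  using assms that[of e] that[of "- e"] by (auto simp: graph_chart_def)

lemma norm_le_sum_other_coordinates:
  fixes x :: "'a::euclidean_space"
  assumes b: "b \<in> Basis" and x: "x \<bullet> b = 0" and h: "\<And>i. i \<in> Basis - {b} \<Longrightarrow> \<bar>x \<bullet> i\<bar> \<le> h"
  shows "norm x \<le> real (DIM('a) - 1) * h"
proof -
  have "norm x \<le> (\<Sum>i\<in>Basis. \<bar>x \<bullet> i\<bar>)" by (rule norm_le_l1)
  also have "\<dots> = (\<Sum>i\<in>Basis - {b}. \<bar>x \<bullet> i\<bar>)"
    using b x by (subst sum.remove[OF _ b]) auto
  also have "\<dots> \<le> (\<Sum>i\<in>Basis - {b}. h)" by (intro sum_mono h)
  also have "\<dots> = real (DIM('a) - 1) * h" using b by (simp add: card_Diff_singleton)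
  finally show ?thesis .
qed

text \<open>
  Upper regularity: a grid of mesh \<open>2\<rho>/N\<close> in the coordinates orthogonal to the axis cuts the graph
  into \<open>N\<^sup>n\<^sup>-\<^sup>1\<close> pieces whose diameter is at most a constant times \<open>\<rho>/N\<close>, by the Lipschitz property.
\<close>

lemma graph_chart_surface_upper:
  fixes \<Omega> :: "'a::euclidean_space set"
  assumes ch: "graph_chart \<Omega> p r K e \<phi>"
  obtains C where "C \<ge> 0" "\<And>x \<rho>. \<rho> > 0 \<Longrightarrow>
    hausdorff_outer (DIM('a) - 1) (frontier \<Omega> \<inter> ball p (r / 3) \<inter> cball x \<rho>) \<le> ennreal (C * \<rho> ^ (DIM('a) - 1))"
proof -
  note cD = graph_chartD[OF ch]
  note r = cD(2) and K = cD(3) and shift = cD(6) and lip = cD(7) and fr = cD(9)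
  obtain b where b: "b \<in> Basis" "e = b \<or> e = - b" "norm e = 1"
    using graph_chart_axis[OF ch] cD(1) by metis
  define m where "m = DIM('a) - 1"
  have card: "card (Basis - {b} :: 'a set) = m" using b by (simp add: m_def card_Diff_singleton)
  define C where "C = unit_ball_vol (real m) * ((1 + K) * real m) ^ m"
  have C: "C \<ge> 0" using K by (simp add: C_def)
  show ?thesis
  proof (rule that[OF C])
    fix x :: 'a and \<rho> :: real assume \<rho>: "\<rho> > 0"
    define S where "S = frontier \<Omega> \<inter> ball p (r / 3) \<inter> cball x \<rho>"
    have main: "hausdorff_pre m \<eta> S \<le> ennreal (C * \<rho> ^ m)" if \<eta>: "\<eta> > 0" for \<eta>
    proof -
      define N where "N = nat \<lceil>(1 + K) * (real m * (2 * \<rho>)) / \<eta>\<rceil> + 1"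
      have N: "real N \<ge> 1" "(1 + K) * (real m * (2 * \<rho>)) / \<eta> \<le> real N" unfolding N_def by linarith+
      define h where "h = 2 * \<rho> / real N"
      have h: "h > 0" "real N * h = 2 * \<rho>" using N \<rho> by (auto simp: h_def)
      define d where "d = (1 + K) * (real m * h)"
      have d: "0 \<le> d" "d \<le> \<eta>" using N K \<rho> \<eta> by (auto simp: d_def h_def field_simps)
      define U where "U = (\<lambda>\<sigma> :: 'a \<Rightarrow> nat. {y \<in> S. \<forall>i\<in>Basis - {b}.
          x \<bullet> i - \<rho> + real (\<sigma> i) * h \<le> y \<bullet> i \<and>
          y \<bullet> i \<le> x \<bullet> i - \<rho> + (real (\<sigma> i) + 1) * h})"
      define I where "I = (Basis - {b}) \<rightarrow>\<^sub>E {..<N}"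
      have dist: "dist y z \<le> d" if y: "y \<in> U \<sigma>" and z: "z \<in> U \<sigma>" for y z \<sigma>
      proof -
        define t where "t = (z - y) \<bullet> e"
        \<comment> \<open>The point \<open>y'\<close> is \<open>y\<close> moved along the axis to the level of \<open>z\<close>.  It differs from \<open>z\<close> only in
          the other coordinates, by at most the mesh size, and \<open>\<phi> y' = t\<close> because \<open>\<phi> y = 0\<close>.\<close>
        define y' where "y' = y + t *\<^sub>R e"
        have perp: "(y' - z) \<bullet> b = 0" using b by (auto simp: y'_def t_def inner_simps)
        have co: "\<bar>(y' - z) \<bullet> i\<bar> \<le> h" if i: "i \<in> Basis - {b}" for i
        proof -
          have "e \<bullet> i = 0" using b i by (auto simp: inner_not_same_Basis)
          then have eq: "(y' - z) \<bullet> i = y \<bullet> i - z \<bullet> i" by (simp add: y'_def inner_simps)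
          have cell: "x \<bullet> i - \<rho> + real (\<sigma> i) * h \<le> w \<bullet> i" "w \<bullet> i \<le> x \<bullet> i - \<rho> + real (\<sigma> i) * h + h"
            if "w \<in> U \<sigma>" for w
          proof -
            have "x \<bullet> i - \<rho> + real (\<sigma> i) * h \<le> w \<bullet> i \<and> w \<bullet> i \<le> x \<bullet> i - \<rho> + (real (\<sigma> i) + 1) * h"
              using that i unfolding U_def by blast
            then show "x \<bullet> i - \<rho> + real (\<sigma> i) * h \<le> w \<bullet> i" "w \<bullet> i \<le> x \<bullet> i - \<rho> + real (\<sigma> i) * h + h"
              by (simp_all add: distrib_right)
          qed
          show ?thesis unfolding eq using cell[OF y] cell[OF z] by linarith
        qed
        have n1: "norm (y' - z) \<le> real m * h"
          using norm_le_sum_other_coordinates[OF b(1) perp co] by (simp add: m_def)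
        have n2: "norm (y' - z) \<le> norm (y - z)"
        proof -
          define a where "a = y' - z"
          have ae: "a \<bullet> e = 0" "e \<bullet> e = 1" using perp b(1,2) by (auto simp: a_def)
          have "(norm (y - z))\<^sup>2 = (norm (a - t *\<^sub>R e))\<^sup>2" by (simp add: y'_def a_def)
          also have "\<dots> = (norm a)\<^sup>2 + t\<^sup>2"
            unfolding power2_norm_eq_inner using ae
            by (simp add: inner_diff_left inner_diff_right inner_commute[of e a] power2_eq_square)
          finally have "(norm (y' - z))\<^sup>2 \<le> (norm (y - z))\<^sup>2" by (simp add: a_def)
          then show ?thesis by (rule power2_le_imp_le) simp
        qed
        have yz: "dist p y < r / 3" "dist p z < r / 3" "y \<in> frontier \<Omega>" "z \<in> frontier \<Omega>"
          using y z by (auto simp: U_def S_def)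
        have "dist y z < 2 * r / 3" using yz dist_triangle[of y z p] by (simp add: dist_commute)
        then have "dist p y' < r"
          using yz n2 dist_triangle[of p y' z] by (simp add: dist_norm norm_minus_commute)
        then have "\<bar>\<phi> y' - \<phi> z\<bar> \<le> K * norm (y' - z)" using yz r by (intro lip) auto
        moreover have "\<phi> y = 0" "\<phi> z = 0" using fr[of y] fr[of z] yz r by auto
        ultimately have "\<bar>t\<bar> \<le> K * norm (y' - z)" by (simp add: y'_def shift)
        moreover have "norm (y - z) \<le> norm (y' - z) + \<bar>t\<bar>"
          using norm_triangle_ineq4[of "y' - z" "t *\<^sub>R e"] b by (simp add: y'_def)
        ultimately have "norm (y - z) \<le> (1 + K) * norm (y' - z)" by (simp add: algebra_simps)
        also have "\<dots> \<le> d" unfolding d_def using n1 K by (intro mult_left_mono) auto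
        finally show ?thesis by (simp add: dist_norm)
      qed
      have bU: "bounded (U \<sigma>)" for \<sigma>
        by (rule bounded_subset[of "cball x \<rho>"]) (auto simp: U_def S_def)
      have dU: "diameter (U \<sigma>) \<le> d" for \<sigma>
        by (rule diameter_le) (use d dist in \<open>auto simp: dist_norm\<close>)
      have "S \<subseteq> (\<Union>\<sigma>\<in>I. U \<sigma>)"
      proof
        fix y assume y: "y \<in> S"
        define t where "t = (\<lambda>i. (y \<bullet> i - x \<bullet> i + \<rho>) / h)"
        define \<sigma> where "\<sigma> = restrict (\<lambda>i. min (N - 1) (nat \<lfloor>t i\<rfloor>)) (Basis - {b})"
        have "y \<in> U \<sigma>"
          unfolding U_def
        proof (intro CollectI conjI y ballI)
          fix i assume i: "i \<in> Basis - {b}"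
          have "\<bar>(y - x) \<bullet> i\<bar> \<le> norm (y - x)" using i Basis_le_norm by blast
          also have "\<dots> \<le> \<rho>" using y by (simp add: S_def dist_norm norm_minus_commute)
          finally have "0 \<le> y \<bullet> i - x \<bullet> i + \<rho>" "y \<bullet> i - x \<bullet> i + \<rho> \<le> 2 * \<rho>"
            by (auto simp: inner_simps)
          then have t: "0 \<le> t i" "t i \<le> real N"
            using h by (auto simp: t_def pos_divide_le_eq)
          have "real (\<sigma> i) \<le> t i" "t i \<le> real (\<sigma> i) + 1"
            using t N i by (auto simp: \<sigma>_def min_def) linarith+
          then have "real (\<sigma> i) * h \<le> t i * h"
            "t i * h \<le> (real (\<sigma> i) + 1) * h"
            using h by (intro mult_right_mono; simp)+
          moreover have "t i * h = y \<bullet> i - x \<bullet> i + \<rho>" using h by (simp add: t_def)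
          ultimately show "x \<bullet> i - \<rho> + real (\<sigma> i) * h \<le> y \<bullet> i"
            "y \<bullet> i \<le> x \<bullet> i - \<rho> + (real (\<sigma> i) + 1) * h" by linarith+
        qed
        moreover have "\<sigma> \<in> I" using N by (auto simp: I_def \<sigma>_def)
        ultimately show "y \<in> (\<Union>\<sigma>\<in>I. U \<sigma>)" by blast
      qed
      moreover have "finite I" by (auto simp: I_def intro: finite_PiE)
      ultimately have "hausdorff_pre m \<eta> S \<le> (\<Sum>\<sigma>\<in>I. hausdorff_gauge m (U \<sigma>))"
        using \<eta> bU dU d by (intro hausdorff_pre_finite_cover) (auto intro: order_trans)
      also have "\<dots> \<le> (\<Sum>\<sigma>\<in>I. ennreal (unit_ball_vol (real m) * (d / 2) ^ m))"
        by (intro sum_mono hausdorff_gauge_le dU bU)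
      also have "\<dots> = ennreal (real (card I) * (unit_ball_vol (real m) * (d / 2) ^ m))"
        using d by (simp add: ennreal_mult ennreal_of_nat_eq_real_of_nat)
      also have "real (card I) * (unit_ball_vol (real m) * (d / 2) ^ m) = C * \<rho> ^ m"
      proof -
        have "real N * (d / 2) = (1 + K) * real m * (real N * h / 2)" by (simp add: d_def)
        then have "real N * (d / 2) = (1 + K) * real m * \<rho>" by (simp add: h(2))
        then have "real N ^ m * (d / 2) ^ m = ((1 + K) * real m) ^ m * \<rho> ^ m"
          by (simp add: power_mult_distrib[symmetric])
        then show ?thesis by (simp add: I_def card_PiE card C_def)
      qed
      finally show ?thesis .
    qed
    show "hausdorff_outer (DIM('a) - 1) (frontier \<Omega> \<inter> ball p (r / 3) \<inter> cball x \<rho>) \<le> ennreal (C * \<rho> ^ (DIM('a) - 1))"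
      unfolding hausdorff_outer_def S_def[symmetric] m_def[symmetric] by (rule SUP_least) (use main in auto)
  qed
qed

text \<open>
  The frontier is compact, so finitely many of the estimates for charts add up.
\<close>

lemma surface_upper_regular:
  fixes \<Omega> :: "'a::euclidean_space set"
  assumes \<Omega>: "open \<Omega>" "bounded \<Omega>" and Ck: "Ck_boundary 1 \<Omega>"
  obtains C where "C \<ge> 0" "\<And>x \<rho>. \<rho> > 0 \<Longrightarrow>
    hausdorff_outer (DIM('a) - 1) (frontier \<Omega> \<inter> cball x \<rho>) \<le> ennreal (C * \<rho> ^ (DIM('a) - 1))"
proof -
  have "\<exists>s C. s > 0 \<and> C \<ge> 0 \<and> (\<forall>x \<rho>. \<rho> > 0 \<longrightarrow>
    hausdorff_outer (DIM('a) - 1) (frontier \<Omega> \<inter> ball p s \<inter> cball x \<rho>) \<le> ennreal (C * \<rho> ^ (DIM('a) - 1)))"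
    if p: "p \<in> frontier \<Omega>" for p
  proof -
    obtain r K e \<phi> where ch: "graph_chart \<Omega> p r K e \<phi>" using boundary_chart[OF \<Omega>(1) Ck p] .
    obtain C where C: "C \<ge> 0" "\<And>x \<rho>. \<rho> > 0 \<Longrightarrow>
      hausdorff_outer (DIM('a) - 1) (frontier \<Omega> \<inter> ball p (r / 3) \<inter> cball x \<rho>) \<le> ennreal (C * \<rho> ^ (DIM('a) - 1))"
      using graph_chart_surface_upper[OF ch] by blast
    have "r / 3 > 0" using ch by (simp add: graph_chart_def)
    then show ?thesis using C by (intro exI[of _ "r / 3"] exI[of _ C]) auto
  qed
  then obtain s C where sC: "\<And>p. p \<in> frontier \<Omega> \<Longrightarrow> s p > 0 \<and> C p \<ge> 0 \<and> (\<forall>x \<rho>. \<rho> > 0 \<longrightarrow>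
    hausdorff_outer (DIM('a) - 1) (frontier \<Omega> \<inter> ball p (s p) \<inter> cball x \<rho>) \<le> ennreal (C p * \<rho> ^ (DIM('a) - 1)))"
    by metis
  have "compact (frontier \<Omega>)" using \<Omega> by (simp add: compact_frontier_bounded)
  then obtain I where I: "I \<subseteq> frontier \<Omega>" "finite I" "frontier \<Omega> \<subseteq> (\<Union>p\<in>I. ball p (s p))"
  proof (rule compactE_image[where C = "frontier \<Omega>" and f = "\<lambda>p. ball p (s p)"])
    show "frontier \<Omega> \<subseteq> (\<Union>p\<in>frontier \<Omega>. ball p (s p))" using sC by force
  qed auto
  have C0: "C p \<ge> 0" if "p \<in> I" for p using sC I(1) that by blast
  show ?thesis
  proof (rule that[of "\<Sum>p\<in>I. C p"])
    show "(\<Sum>p\<in>I. C p) \<ge> 0" using C0 by (rule sum_nonneg)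
    fix x :: 'a and \<rho> :: real assume \<rho>: "\<rho> > 0"
    have "hausdorff_outer (DIM('a) - 1) (frontier \<Omega> \<inter> cball x \<rho>)
        \<le> hausdorff_outer (DIM('a) - 1) (\<Union>p\<in>I. frontier \<Omega> \<inter> ball p (s p) \<inter> cball x \<rho>)"
      using I(3) by (intro hausdorff_outer_mono) auto
    also have "\<dots> \<le> (\<Sum>p\<in>I. hausdorff_outer (DIM('a) - 1) (frontier \<Omega> \<inter> ball p (s p) \<inter> cball x \<rho>))"
      by (rule hausdorff_outer_finite_UN[OF I(2)])
    also have "\<dots> \<le> (\<Sum>p\<in>I. ennreal (C p * \<rho> ^ (DIM('a) - 1)))"
      using sC I(1) \<rho> by (intro sum_mono) blast
    also have "\<dots> = ennreal ((\<Sum>p\<in>I. C p) * \<rho> ^ (DIM('a) - 1))"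
      using C0 \<rho> by (simp add: sum_ennreal sum_distrib_right)
    finally show "hausdorff_outer (DIM('a) - 1) (frontier \<Omega> \<inter> cball x \<rho>)
        \<le> ennreal ((\<Sum>p\<in>I. C p) * \<rho> ^ (DIM('a) - 1))" .
  qed
qed

text \<open>
  Lower regularity: the graph projects onto a box of side comparable to \<open>\<rho>\<close> in the hyperplane
  orthogonal to the axis.  Covers of the graph are compared with Lebesgue measure by thickening this
  box, and the projections of the covering sets, by a unit interval in the direction of the axis.
\<close>

lemma graph_chart_surface_lower:
  fixes \<Omega> :: "'a::euclidean_space set"
  assumes ch: "graph_chart \<Omega> p r K e \<phi>"
  obtains c where "c > 0" "\<And>q \<rho>. q \<in> frontier \<Omega> \<Longrightarrow> q \<in> ball p (r / 2) \<Longrightarrow> 0 < \<rho> \<Longrightarrow> \<rho> \<le> r / 2 \<Longrightarrow>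
    ennreal (c * \<rho> ^ (DIM('a) - 1)) \<le> hausdorff_outer (DIM('a) - 1) (frontier \<Omega> \<inter> cball q \<rho>)"
proof -
  note cD = graph_chartD[OF ch]
  note r = cD(2) and K = cD(3) and shift = cD(6) and lip = cD(7) and fr = cD(9)
  obtain b where b: "b \<in> Basis" "e = b \<or> e = - b" "norm e = 1"
    using graph_chart_axis[OF ch] cD(1) by metis
  define m where "m = DIM('a) - 1"
  have card: "card (Basis - {b} :: 'a set) = m" using b by (simp add: m_def card_Diff_singleton)
  define n where "n = real DIM('a)"
  have n: "n \<ge> 1" "real m \<le> n" using DIM_positive[where 'a='a] by (simp_all add: n_def m_def)
  have eb: "e \<bullet> i = 0" if "i \<in> Basis - {b}" for i using b that by (auto simp: inner_not_same_Basis)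
  define W where "W = (\<lambda>(a::'a) (d::real) (s::real).
     cbox (\<Sum>i\<in>Basis. (if i = b then s else a \<bullet> i - d) *\<^sub>R i) (\<Sum>i\<in>Basis. (if i = b then s + 1 else a \<bullet> i + d) *\<^sub>R i))"
  have memW: "y \<in> W a d s \<longleftrightarrow> s \<le> y \<bullet> b \<and> y \<bullet> b \<le> s + 1 \<and> (\<forall>i\<in>Basis - {b}. \<bar>y \<bullet> i - a \<bullet> i\<bar> \<le> d)" for y a d s
    using b by (auto simp: W_def mem_box abs_le_iff algebra_simps split: if_splits)
  have measW: "emeasure lborel (W a d s) = ennreal ((2 * d) ^ m)" if d: "d \<ge> 0" for a d s
  proof -
    have "emeasure lborel (W a d s) = ennreal (\<Prod>i\<in>Basis. if i = b then 1 else 2 * d)"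
      unfolding W_def by (subst emeasure_lborel_cbox) (use d in \<open>auto simp: inner_diff_left intro!: arg_cong[where f = ennreal] prod.cong\<close>)
    also have "(\<Prod>i\<in>Basis. if i = b then 1 else 2 * d) = (\<Prod>i\<in>Basis - {b}. 2 * d)"
      using b by (subst prod.remove[OF _ b(1)]) (auto intro!: prod.cong)
    finally show ?thesis by (simp add: card)
  qed
  define c where "c = unit_ball_vol (real m) / 4 ^ m * (2 / ((1 + K) * n)) ^ m"
  have c: "c > 0" using K n by (simp add: c_def)
  show ?thesis
  proof (rule that[OF c])
    fix q \<rho> assume q: "q \<in> frontier \<Omega>" "q \<in> ball p (r / 2)" and \<rho>: "0 < \<rho>" "\<rho> \<le> r / 2"
    define G where "G = frontier \<Omega> \<inter> cball q \<rho>"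
    define \<rho>' where "\<rho>' = \<rho> / ((1 + K) * n)"
    have \<rho>': "\<rho>' > 0" "(1 + K) * (n * \<rho>') = \<rho>" using \<rho> K n by (auto simp: \<rho>'_def)
    have "\<phi> q = 0" using fr[of q] q r by auto
    \<comment> \<open>Every point of the box lies over or under a point of the graph.\<close>
    have foot: "\<exists>z. z \<in> G \<and> (\<forall>i\<in>Basis - {b}. z \<bullet> i = y \<bullet> i)" if y: "y \<in> W q \<rho>' (q \<bullet> b)" for y
    proof -
      define y' where "y' = y - (y \<bullet> b - q \<bullet> b) *\<^sub>R b"
      have y'i: "y' \<bullet> i = y \<bullet> i" if "i \<in> Basis - {b}" for i
        using that b by (auto simp: y'_def inner_simps inner_not_same_Basis)
      have "(y' - q) \<bullet> b = 0" using b by (simp add: y'_def inner_simps)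
      moreover have "\<bar>(y' - q) \<bullet> i\<bar> \<le> \<rho>'" if "i \<in> Basis - {b}" for i
        using y that y'i[OF that] by (auto simp: memW inner_simps)
      ultimately have "norm (y' - q) \<le> real m * \<rho>'"
        unfolding m_def by (rule norm_le_sum_other_coordinates[OF b(1)])
      also have "\<dots> \<le> n * \<rho>'" using n \<rho>' by (intro mult_right_mono) auto
      finally have ny: "norm (y' - q) \<le> n * \<rho>'" .
      have "n * \<rho>' \<le> (1 + K) * (n * \<rho>')" using mult_right_mono[of 1 "1 + K" "n * \<rho>'"] K n \<rho>'(1) by simp
      then have "dist p y' < r" using ny \<rho> \<rho>' q dist_triangle[of p y' q] by (auto simp: dist_norm norm_minus_commute)
      then have "\<bar>\<phi> y' - \<phi> q\<bar> \<le> K * norm (y' - q)" using q r by (intro lip) auto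
      then have ph: "\<bar>\<phi> y'\<bar> \<le> K * norm (y' - q)" using \<open>\<phi> q = 0\<close> by simp
      define z where "z = y' + (- \<phi> y') *\<^sub>R e"
      have "norm (z - q) \<le> norm (y' - q) + \<bar>\<phi> y'\<bar>"
        using norm_triangle_ineq[of "y' - q" "(- \<phi> y') *\<^sub>R e"] b by (simp add: z_def algebra_simps)
      also have "\<dots> \<le> (1 + K) * norm (y' - q)" using ph by (simp add: algebra_simps)
      also have "\<dots> \<le> (1 + K) * (n * \<rho>')" using ny K by (intro mult_left_mono) auto
      finally have zq: "norm (z - q) \<le> \<rho>" using \<rho>' by simp
      have "dist p z < r" using zq \<rho> q dist_triangle[of p z q] by (auto simp: dist_norm norm_minus_commute)
      moreover have "\<phi> z = 0" unfolding z_def shift by simp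
      ultimately have "z \<in> frontier \<Omega>" using fr[of z] by auto
      then have "z \<in> G" using zq by (simp add: G_def dist_norm norm_minus_commute)
      moreover have "z \<bullet> i = y \<bullet> i" if "i \<in> Basis - {b}" for i
        using y'i[OF that] eb[OF that] by (simp add: z_def inner_simps)
      ultimately show ?thesis by blast
    qed
    have main: "ennreal (c * \<rho> ^ m) \<le> hausdorff_pre m \<eta> G" for \<eta>
      unfolding hausdorff_pre_def
    proof (rule INF_greatest)
      fix U assume U: "U \<in> hausdorff_covers \<eta> G"
      \<comment> \<open>A covering set with diameter \<open>d\<close> projects into a cube of side \<open>2 d\<close> around any of its points.\<close>
      define a where "a = (\<lambda>j. SOME a. a \<in> U j)"
      define V where "V = (\<lambda>j. if U j = {} then {} else W (a j) (diameter (U j)) (q \<bullet> b))"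
      have bU: "bounded (U j)" for j using U by (auto simp: hausdorff_covers_def)
      have "W q \<rho>' (q \<bullet> b) \<subseteq> (\<Union>j. V j)"
      proof
        fix y assume y: "y \<in> W q \<rho>' (q \<bullet> b)"
        obtain z where z: "z \<in> G" "\<forall>i\<in>Basis - {b}. z \<bullet> i = y \<bullet> i" using foot[OF y] by blast
        obtain j where j: "z \<in> U j" using U z by (auto simp: hausdorff_covers_def)
        then have aj: "a j \<in> U j" by (auto simp: a_def intro: someI)
        have "\<bar>y \<bullet> i - a j \<bullet> i\<bar> \<le> diameter (U j)" if i: "i \<in> Basis - {b}" for i
        proof -
          have "\<bar>y \<bullet> i - a j \<bullet> i\<bar> = \<bar>(z - a j) \<bullet> i\<bar>" using z i by (simp add: inner_simps)
          also have "\<dots> \<le> norm (z - a j)" using i Basis_le_norm by blast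
          also have "\<dots> \<le> diameter (U j)" using diameter_bounded_bound[OF bU j aj] by (simp add: dist_norm)
          finally show ?thesis .
        qed
        then have "y \<in> V j" using j y by (auto simp: V_def memW)
        then show "y \<in> (\<Union>j. V j)" by blast
      qed
      moreover have Vs: "V j \<in> sets lborel" for j by (simp add: V_def W_def)
      ultimately have "emeasure lborel (W q \<rho>' (q \<bullet> b)) \<le> (\<Sum>j. emeasure lborel (V j))"
        by (intro order_trans[OF emeasure_mono emeasure_subadditive_countably]) auto
      then have "ennreal ((2 * \<rho>') ^ m) \<le> (\<Sum>j. emeasure lborel (V j))"
        using \<rho>' by (simp add: measW)
      moreover have "ennreal (unit_ball_vol (real m) / 4 ^ m) * emeasure lborel (V j) \<le> hausdorff_gauge m (U j)" for j
      proof (cases "U j = {}")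
        case False
        have d: "diameter (U j) \<ge> 0" by (rule diameter_ge_0[OF bU])
        have "unit_ball_vol (real m) / 4 ^ m * (2 * diameter (U j)) ^ m = unit_ball_vol (real m) * (diameter (U j) / 2) ^ m"
        proof -
          have "(2 * diameter (U j)) ^ m = (4 * (diameter (U j) / 2)) ^ m" by simp
          then show ?thesis unfolding power_mult_distrib by simp
        qed
        then show ?thesis
          using False d by (simp add: V_def measW hausdorff_gauge_def ennreal_mult[symmetric])
      qed (simp add: V_def)
      then have "(\<Sum>j. ennreal (unit_ball_vol (real m) / 4 ^ m) * emeasure lborel (V j)) \<le> (\<Sum>j. hausdorff_gauge m (U j))"
        by (intro suminf_le) auto
      ultimately have "ennreal (unit_ball_vol (real m) / 4 ^ m) * ennreal ((2 * \<rho>') ^ m) \<le> (\<Sum>j. hausdorff_gauge m (U j))"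
        by (simp add: ennreal_suminf_cmult) (meson mult_left_mono order_trans zero_le)
      moreover have "unit_ball_vol (real m) / 4 ^ m * (2 * \<rho>') ^ m = c * \<rho> ^ m"
      proof -
        have "2 * \<rho>' = 2 / ((1 + K) * n) * \<rho>" by (simp add: \<rho>'_def)
        then show ?thesis unfolding c_def by (simp only: power_mult_distrib mult.assoc)
      qed
      ultimately show "ennreal (c * \<rho> ^ m) \<le> (\<Sum>j. hausdorff_gauge m (U j))"
        using \<rho>' by (simp add: ennreal_mult[symmetric])
    qed
    have "ennreal (c * \<rho> ^ m) \<le> hausdorff_outer m G"
      by (rule order_trans[OF main[of 1] hausdorff_pre_le_outer]) simp
    then show "ennreal (c * \<rho> ^ (DIM('a) - 1)) \<le> hausdorff_outer (DIM('a) - 1) (frontier \<Omega> \<inter> cball q \<rho>)"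
      by (simp add: G_def m_def)
  qed
qed

section \<open>A nonlocal Poincare inequality with boundary term\<close>

text \<open>
  Near a boundary point, the domain is sliced into \<open>J\<close> layers of thickness \<open>\<rho> / J\<close>, comparable to
  \<open>\<delta>\<close>, that are translates of each other.  The lowest layer \<open>L\<^sub>0\<close> is where the boundary term
  is effective; the others are reached from it by short shifts, whose costs add up to the nonlocal
  energy.
\<close>

lemma boundary_layer_estimate:
  fixes \<Omega> :: "'a::euclidean_space set" and u :: "'a \<Rightarrow> real"
  assumes ch: "graph_chart \<Omega> p r K e \<phi>" and dens: "measure_density \<Omega> \<delta>\<^sub>0 c"
    and \<delta>: "0 < \<delta>" "\<delta> \<le> \<delta>\<^sub>0"
    and J: "J \<ge> 1" and \<rho>: "\<rho> = r / 2" and \<eta>: "\<eta> = \<rho> / real J" "\<eta> \<le> \<delta> / 2"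
    and [measurable]: "\<Omega> \<in> sets borel" "u \<in> borel_measurable borel"
  defines "S \<equiv> (\<lambda>k::nat. {x. x - \<phi> x *\<^sub>R e \<in> ball p \<rho> \<and> 0 < \<phi> x \<and> \<phi> x \<le> real k * \<eta>})"
  shows "(\<integral>\<^sup>+x. indicator (S J) x * ennreal ((u x)\<^sup>2) \<partial>lborel)
     \<le> ennreal (2 * real J) * (\<integral>\<^sup>+x. indicator (S 1) x * ennreal ((u x)\<^sup>2) \<partial>lborel)
       + ennreal ((real J)\<^sup>2 * (72 / c)) * nl_energy \<Omega> \<delta> u"
proof -
  note cD = graph_chartD[OF ch]
  have c: "c > 0" using dens by (simp add: measure_density_def)
  have [measurable]: "\<phi> \<in> borel_measurable borel"
    by (rule borel_measurable_continuous_onI) (rule cD(4))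
  have \<eta>0: "\<eta> > 0" using \<eta>(1) \<rho> cD(2) J by simp
  have J\<eta>: "real J * \<eta> = \<rho>" using \<eta>(1) J by simp
  define h where "h = \<eta> *\<^sub>R e"
  have nh: "norm h \<le> 1 / 2 * \<delta>" using \<eta>0 \<eta>(2) cD(1) by (simp add: h_def)
  have jh: "real j *\<^sub>R h = (real j * \<eta>) *\<^sub>R e" for j by (simp add: h_def)
  define L where "L = (\<lambda>j::nat. {x. x - \<phi> x *\<^sub>R e \<in> ball p \<rho> \<and> real j * \<eta> < \<phi> x \<and> \<phi> x \<le> real j * \<eta> + \<eta>})"
  have [measurable]: "L j \<in> sets borel" for j unfolding L_def mem_ball by measurable
  have [measurable]: "S j \<in> sets borel" for j unfolding S_def mem_ball by measurable
  have L0: "L 0 = S 1" by (auto simp: L_def S_def)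
  have Lshift: "indicator (L j) (x + real j *\<^sub>R h) = (indicator (L 0) x :: ennreal)" for j x
    by (simp add: L_def indicator_def jh cD(6) algebra_simps)
  have Lsum: "(\<Sum>j<k. indicator (L j) x) = (indicator (S k) x :: ennreal)" for k x
  proof (induction k)
    case (Suc k)
    have "0 \<le> real k * \<eta>" using \<eta>0 by simp
    then have "0 < \<phi> x" if "real k * \<eta> < \<phi> x" using that by linarith
    moreover have "real (Suc k) * \<eta> = real k * \<eta> + \<eta>"
      by (simp add: algebra_simps)
    ultimately have "real (Suc k) * \<eta> = real k * \<eta> + \<eta>" "real k * \<eta> < \<phi> x \<Longrightarrow> 0 < \<phi> x" by auto
    then show ?case
      unfolding sum.lessThan_Suc Suc using \<eta>0 by (auto simp: L_def S_def indicator_def simp del: of_nat_Suc)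
  qed (auto simp: S_def)
  have layers: "(\<integral>\<^sup>+x. indicator (S k) x * F x \<partial>lborel) = (\<Sum>j<k. \<integral>\<^sup>+x. indicator (S 1) x * F (x + real j *\<^sub>R h) \<partial>lborel)"
    if [measurable]: "F \<in> borel_measurable borel" for F :: "'a \<Rightarrow> ennreal" and k
  proof -
    have "(\<integral>\<^sup>+x. indicator (S k) x * F x \<partial>lborel) = (\<Sum>j<k. \<integral>\<^sup>+x. indicator (L j) x * F x \<partial>lborel)"
      unfolding Lsum[symmetric] sum_distrib_right by (rule nn_integral_sum) measurable
    also have "\<dots> = (\<Sum>j<k. \<integral>\<^sup>+x. indicator (L j) (x + real j *\<^sub>R h) * F (x + real j *\<^sub>R h) \<partial>lborel)"
      by (intro sum.cong refl nn_integral_translate[where F = "\<lambda>x. indicator (L _) x * F x", symmetric]) measurable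
    finally show ?thesis by (simp add: Lshift L0)
  qed
  define d where "d = (\<lambda>i x. ennreal ((u (x + real (Suc i) *\<^sub>R h) - u (x + real i *\<^sub>R h))\<^sup>2))"
  have [measurable]: "d i \<in> borel_measurable borel" for i unfolding d_def by measurable
  have pt: "ennreal ((u (x + real j *\<^sub>R h))\<^sup>2) \<le> 2 * ennreal ((u x)\<^sup>2) + 2 * ennreal (real J) * (\<Sum>i<J - 1. d i x)"
    if j: "j < J" for j x
  proof -
    have "(u (x + real j *\<^sub>R h) - u x)\<^sup>2 = (\<Sum>i<j. u (x + real (Suc i) *\<^sub>R h) - u (x + real i *\<^sub>R h))\<^sup>2"
      by (subst sum_lessThan_telescope[of "\<lambda>j. u (x + real j *\<^sub>R h)"]) simp
    also have "\<dots> \<le> (\<Sum>i<j. (u (x + real (Suc i) *\<^sub>R h) - u (x + real i *\<^sub>R h))\<^sup>2) * real j"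
      using sum_squared_le_sum_of_squares[of "\<lambda>i. u (x + real (Suc i) *\<^sub>R h) - u (x + real i *\<^sub>R h)" "{..<j}"] by simp
    also have "\<dots> \<le> (\<Sum>i<J-1. (u (x + real (Suc i) *\<^sub>R h) - u (x + real i *\<^sub>R h))\<^sup>2) * real J"
      using j by (intro mult_mono sum_mono2) (auto intro: sum_nonneg)
    finally have D: "ennreal ((u (x + real j *\<^sub>R h) - u x)\<^sup>2) \<le> ennreal (real J) * (\<Sum>i<J - 1. d i x)"
      unfolding d_def by (simp add: ennreal_mult[symmetric] sum_nonneg mult.commute ennreal_leI)
    have "ennreal ((u (x + real j *\<^sub>R h) - 0)\<^sup>2) \<le> 2 * ennreal ((u (x + real j *\<^sub>R h) - u x)\<^sup>2) + 2 * ennreal ((u x - 0)\<^sup>2)"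
      by (rule ennreal_square_diff_le)
    also have "\<dots> \<le> 2 * (ennreal (real J) * (\<Sum>i<J - 1. d i x)) + 2 * ennreal ((u x - 0)\<^sup>2)"
      by (intro add_right_mono mult_left_mono D) auto
    finally show ?thesis by (simp add: mult.assoc add.commute)
  qed
  have shiftE: "(\<Sum>i<J - 1. \<integral>\<^sup>+x. indicator (S 1) x * d i x \<partial>lborel) \<le> ennreal (36 / c) * nl_energy \<Omega> \<delta> u"
  proof -
    have "(\<Sum>i<J - 1. \<integral>\<^sup>+x. indicator (S 1) x * d i x \<partial>lborel)
        = (\<integral>\<^sup>+x. indicator (S (J - 1)) x * ennreal ((u (x + 0 + h) - u (x + 0))\<^sup>2) \<partial>lborel)"
      by (subst layers) (auto simp: d_def algebra_simps)
    also have "\<dots> \<le> ennreal (16 / c * (1 + 1 / 2)\<^sup>2) * nl_energy \<Omega> \<delta> u"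
    proof (rule nl_energy_shift_from[OF dens \<delta> _ _ _ _ nh])
      fix x t assume x: "x \<in> S (J - 1)" and t: "0 \<le> t" "t \<le> (1::real)"
      define y where "y = x + 0 + t *\<^sub>R h"
      have \<phi>y: "\<phi> y = \<phi> x + t * \<eta>" by (simp add: y_def h_def cD(6))
      have "t * \<eta> \<le> 1 * \<eta>" "0 \<le> t * \<eta>" using t \<eta>0 by (auto intro: mult_right_mono)
      moreover have "real (J - 1) * \<eta> = \<rho> - \<eta>" using J J\<eta> by (simp add: of_nat_diff algebra_simps)
      ultimately have y: "0 < \<phi> y" "\<phi> y \<le> \<rho>" using x by (auto simp: S_def \<phi>y)
      have "y - \<phi> y *\<^sub>R e = x - \<phi> x *\<^sub>R e" unfolding \<phi>y by (simp add: y_def h_def algebra_simps)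
      then have "dist p (y - \<phi> y *\<^sub>R e) < \<rho>" using x by (simp add: S_def)
      moreover have "dist (y - \<phi> y *\<^sub>R e) y = \<phi> y" using y cD(1) by (simp add: dist_norm)
      ultimately have "dist p y < r" using y \<rho> dist_triangle[of p y "y - \<phi> y *\<^sub>R e"] by simp
      then show "x + 0 + t *\<^sub>R h \<in> \<Omega>" using cD(8)[of y] y by (simp add: y_def)
    qed measurable
    finally show ?thesis by (simp add: power2_eq_square)
  qed
  have "(\<integral>\<^sup>+x. indicator (S J) x * ennreal ((u x)\<^sup>2) \<partial>lborel)
      = (\<Sum>j<J. \<integral>\<^sup>+x. indicator (S 1) x * ennreal ((u (x + real j *\<^sub>R h))\<^sup>2) \<partial>lborel)"
    by (rule layers) measurable
  also have "\<dots> \<le> (\<Sum>j<J. \<integral>\<^sup>+x. 2 * (indicator (S 1) x * ennreal ((u x)\<^sup>2))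
       + 2 * ennreal (real J) * (\<Sum>i<J - 1. indicator (S 1) x * d i x) \<partial>lborel)"
    using pt by (intro sum_mono nn_integral_mono) (auto simp: indicator_def)
  also have "\<dots> = (\<Sum>j<J. 2 * (\<integral>\<^sup>+x. indicator (S 1) x * ennreal ((u x)\<^sup>2) \<partial>lborel)
       + 2 * ennreal (real J) * (\<Sum>i<J - 1. \<integral>\<^sup>+x. indicator (S 1) x * d i x \<partial>lborel))"
    by (intro sum.cong refl, subst nn_integral_add, measurable, subst nn_integral_cmult, measurable,
        subst nn_integral_cmult, measurable, subst nn_integral_sum, measurable)
  also have "\<dots> \<le> (\<Sum>j<J. 2 * (\<integral>\<^sup>+x. indicator (S 1) x * ennreal ((u x)\<^sup>2) \<partial>lborel)
       + 2 * ennreal (real J) * (ennreal (36 / c) * nl_energy \<Omega> \<delta> u))"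
    by (intro sum_mono add_left_mono mult_left_mono shiftE) auto
  also have "\<dots> = ennreal (real J) * (2 * (\<integral>\<^sup>+x. indicator (S 1) x * ennreal ((u x)\<^sup>2) \<partial>lborel))
       + ennreal (real J) * (2 * ennreal (real J) * (ennreal (36 / c) * nl_energy \<Omega> \<delta> u))"
    by (simp add: ennreal_of_nat_eq_real_of_nat distrib_left)
  also have "ennreal (real J) * (2 * ennreal (real J) * (ennreal (36 / c) * nl_energy \<Omega> \<delta> u))
      = ennreal ((real J)\<^sup>2 * (72 / c)) * nl_energy \<Omega> \<delta> u"
  proof -
    have "(real J)\<^sup>2 * (72 / c) = real J * (2 * real J * (36 / c))" by (simp add: power2_eq_square)
    then show ?thesis using c by (simp add: ennreal_mult mult.assoc del: times_divide_eq_right times_divide_eq_left)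
  qed
  finally show ?thesis by (simp add: ennreal_mult mult_ac)
qed

text \<open>
  The boundary enters through any upper bound \<open>\<sigma>\<close> of the surface measure seen from \<open>x\<close> within
  distance \<open>\<delta>\<close>; this keeps the statement free of measurability questions about that measure as a
  function of \<open>x\<close>.
\<close>

theorem nonlocal_Poincare_boundary:
  fixes \<Omega> :: "'a::euclidean_space set"
  assumes op: "open \<Omega>" and bd: "bounded \<Omega>" and conn: "connected \<Omega>" and ne: "\<Omega> \<noteq> {}"
    and Ck: "Ck_boundary 1 \<Omega>" and \<delta>\<^sub>0: "\<delta>\<^sub>0 > 0"
  obtains C where "C \<ge> 0" "\<And>\<delta> u \<sigma>. 0 < \<delta> \<Longrightarrow> \<delta> \<le> \<delta>\<^sub>0 \<Longrightarrow> u \<in> borel_measurable borel \<Longrightarrow> \<sigma> \<in> borel_measurable borel \<Longrightarrow>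
      (\<And>x. x \<in> \<Omega> \<Longrightarrow> hausdorff_outer (DIM('a) - 1) (frontier \<Omega> \<inter> cball x \<delta>) \<le> \<sigma> x) \<Longrightarrow>
      (\<integral>\<^sup>+x. indicator \<Omega> x * ennreal ((u x)\<^sup>2) \<partial>lborel)
      \<le> ennreal (C / \<delta>\<^sup>2) * (nl_energy \<Omega> \<delta> u
            + ennreal (1 / \<delta> ^ (DIM('a) - 1)) * (\<integral>\<^sup>+x. indicator \<Omega> x * (\<sigma> x * ennreal ((u x)\<^sup>2)) \<partial>lborel))"
proof -
  have cone: "cone_condition \<Omega>" by (rule C1_boundary_imp_cone_condition[OF op Ck])
  obtain c where dens: "measure_density \<Omega> \<delta>\<^sub>0 c"
    using cone_condition_measure_density[OF cone bd op \<delta>\<^sub>0] .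
  have c: "c > 0" using dens by (simp add: measure_density_def)
  have [measurable]: "\<Omega> \<in> sets borel" using op by simp
  obtain P where P: "P \<ge> 0" "\<And>\<delta> u. 0 < \<delta> \<Longrightarrow> \<delta> \<le> \<delta>\<^sub>0 \<Longrightarrow> u \<in> borel_measurable borel \<Longrightarrow>
        diff_energy (\<Omega> \<times> \<Omega>) u \<le> ennreal (P / \<delta>\<^sup>2) * nl_energy \<Omega> \<delta> u"
    using nonlocal_Poincare_Wirtinger[OF cone op bd conn \<delta>\<^sub>0] by (elim controlledE) blast
  have "frontier \<Omega> \<noteq> {}" using ne bd by (metis frontier_eq_empty not_bounded_UNIV)
  then obtain p where p: "p \<in> frontier \<Omega>" by blast
  obtain r K e \<phi> where ch: "graph_chart \<Omega> p r K e \<phi>" using boundary_chart[OF op Ck p] .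
  note cD = graph_chartD[OF ch]
  have [measurable]: "\<phi> \<in> borel_measurable borel"
    by (rule borel_measurable_continuous_onI) (rule cD(4))
  obtain c\<^sub>1 where c1: "c\<^sub>1 > 0" "\<And>q \<rho>. q \<in> frontier \<Omega> \<Longrightarrow> q \<in> ball p (r / 2) \<Longrightarrow> 0 < \<rho> \<Longrightarrow> \<rho> \<le> r / 2 \<Longrightarrow>
    ennreal (c\<^sub>1 * \<rho> ^ (DIM('a) - 1)) \<le> hausdorff_outer (DIM('a) - 1) (frontier \<Omega> \<inter> cball q \<rho>)"
    using graph_chart_surface_lower[OF ch] by blast
  define m where "m = DIM('a) - 1"
  define \<mu> where "\<mu> = min (1 / 2) (r / (2 * \<delta>\<^sub>0))"
  have \<mu>: "\<mu> > 0" "\<mu> \<le> 1 / 2" "\<mu> * \<delta>\<^sub>0 \<le> r / 2"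
    using cD(2) \<delta>\<^sub>0 by (auto simp: \<mu>_def min_def field_simps)
  define \<rho> where "\<rho> = r / 2"
  have \<rho>: "\<rho> > 0" using cD(2) by (simp add: \<rho>_def)
  define T where "T = {x. x - \<phi> x *\<^sub>R e \<in> ball p \<rho> \<and> 0 < \<phi> x \<and> \<phi> x \<le> \<rho>}"
  have [measurable]: "T \<in> sets borel" unfolding T_def mem_ball by measurable
  have foot: "dist (x - \<phi> x *\<^sub>R e) x = \<phi> x" if "x \<in> T" for x
    using that cD(1) by (simp add: T_def dist_norm)
  have Tball: "x \<in> ball p r" if "x \<in> T" for x
    using foot[OF that] that dist_triangle[of p x "x - \<phi> x *\<^sub>R e"] by (auto simp: T_def \<rho>_def)
  have TO: "T \<subseteq> \<Omega>" using Tball cD(8) by (auto simp: T_def)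
  have bT: "bounded T" using TO bd bounded_subset by blast
  define t where "t = measure lborel T"
  define w where "w = measure lborel \<Omega>"
  have t: "emeasure lborel T = ennreal t" and w: "emeasure lborel \<Omega> = ennreal w" "w \<ge> 0"
    using bT bd by (simp_all add: t_def w_def emeasure_bounded_eq_measure)
  have "open {x. x - \<phi> x *\<^sub>R e \<in> ball p \<rho> \<and> 0 < \<phi> x \<and> \<phi> x < \<rho>}"
    unfolding mem_ball by (intro open_Collect_conj open_Collect_less continuous_intros cD(4))
  moreover have "p + (\<rho> / 2) *\<^sub>R e \<in> {x. x - \<phi> x *\<^sub>R e \<in> ball p \<rho> \<and> 0 < \<phi> x \<and> \<phi> x < \<rho>}"
    using \<rho> cD(5) by (simp add: cD(6))
  ultimately have "emeasure lborel {x. x - \<phi> x *\<^sub>R e \<in> ball p \<rho> \<and> 0 < \<phi> x \<and> \<phi> x < \<rho>} > 0"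
    by (intro emeasure_lborel_open_pos) auto
  also have "emeasure lborel {x. x - \<phi> x *\<^sub>R e \<in> ball p \<rho> \<and> 0 < \<phi> x \<and> \<phi> x < \<rho>} \<le> emeasure lborel T"
    by (intro emeasure_mono) (auto simp: T_def)
  finally have t0: "t > 0" using t by simp
  \<comment> \<open>The number \<open>J\<close> of layers is at most \<open>M / \<delta>\<close>.\<close>
  define M where "M = 2 * \<rho> + \<delta>\<^sub>0"
  have M: "M > 0" using \<rho> \<delta>\<^sub>0 by (simp add: M_def)
  define C\<^sub>S where "C\<^sub>S = 2 * M * \<delta>\<^sub>0 / (c\<^sub>1 * \<mu> ^ m) + M\<^sup>2 * (72 / c)"
  have CS: "C\<^sub>S \<ge> 0" using M \<delta>\<^sub>0 c1(1) c \<mu> by (simp add: C\<^sub>S_def)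
  show ?thesis
  proof (rule that[of "(2 * P + 2 * w * C\<^sub>S) / t"])
    show "(2 * P + 2 * w * C\<^sub>S) / t \<ge> 0" using P CS w t0 by simp
    fix \<delta> and u :: "'a \<Rightarrow> real" and \<sigma> :: "'a \<Rightarrow> ennreal"
    assume \<delta>: "0 < \<delta>" "\<delta> \<le> \<delta>\<^sub>0" and [measurable]: "u \<in> borel_measurable borel" "\<sigma> \<in> borel_measurable borel"
      and \<sigma>: "\<And>x. x \<in> \<Omega> \<Longrightarrow> hausdorff_outer (DIM('a) - 1) (frontier \<Omega> \<inter> cball x \<delta>) \<le> \<sigma> x"
    define E where "E = nl_energy \<Omega> \<delta> u"
    define D where "D = ennreal (1 / \<delta> ^ m) * (\<integral>\<^sup>+x. indicator \<Omega> x * (\<sigma> x * ennreal ((u x)\<^sup>2)) \<partial>lborel)"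
    define J where "J = nat \<lceil>2 * \<rho> / \<delta>\<rceil>"
    have "2 * \<rho> / \<delta> > 0" using \<rho> \<delta> by simp
    then have J: "J \<ge> 1" "2 * \<rho> / \<delta> \<le> real J" "real J \<le> 2 * \<rho> / \<delta> + 1" unfolding J_def by linarith+
    have JM: "real J \<le> M / \<delta>" using J(3) \<delta> by (simp add: M_def field_simps)
    define \<eta> where "\<eta> = \<rho> / real J"
    have \<eta>: "\<eta> \<le> \<delta> / 2" "0 < \<eta>" using J \<delta> \<rho> by (auto simp: \<eta>_def field_simps)
    have J\<eta>: "real J * \<eta> = \<rho>" using J by (simp add: \<eta>_def)
    define S where "S = (\<lambda>k::nat. {x. x - \<phi> x *\<^sub>R e \<in> ball p \<rho> \<and> 0 < \<phi> x \<and> \<phi> x \<le> real k * \<eta>})"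
    have [measurable]: "S k \<in> sets borel" for k unfolding S_def mem_ball by measurable
    have SJ: "S J = T" by (simp add: S_def T_def J\<eta>)
    have "\<eta> \<le> \<rho>" using J \<rho> by (simp add: \<eta>_def field_simps)
    then have S1: "S 1 \<subseteq> T" by (auto simp: S_def T_def)
    \<comment> \<open>A point \<open>x\<close> of the lowest layer has its foot \<open>q\<close> on the frontier within \<open>\<delta> / 2\<close>, so it sees the
      surface near \<open>q\<close> at scale \<open>\<mu> \<delta>\<close>.\<close>
    have low: "ennreal (c\<^sub>1 * \<mu> ^ m * \<delta> ^ m) \<le> \<sigma> x" if x: "x \<in> S 1" for x
    proof -
      define q where "q = x - \<phi> x *\<^sub>R e"
      have xT: "x \<in> T" using x S1 by blast
      have dq: "dist q x \<le> \<delta> / 2" using foot[OF xT] x \<eta> by (auto simp: q_def S_def)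
      have q1: "q \<in> ball p (r / 2)" using x by (simp add: q_def S_def \<rho>_def)
      have "\<phi> q = 0" using cD(6)[of x "- \<phi> x"] by (simp add: q_def)
      then have q2: "q \<in> frontier \<Omega>" using cD(9)[of q] q1 cD(2) by auto
      have "\<mu> * \<delta> \<le> \<mu> * \<delta>\<^sub>0" using \<mu> \<delta> by (intro mult_left_mono) auto
      then have \<mu>\<delta>: "\<mu> * \<delta> \<le> r / 2" "0 < \<mu> * \<delta>" using \<mu>(1,3) \<delta> by (linarith, simp)
      then have "ennreal (c\<^sub>1 * (\<mu> * \<delta>) ^ (DIM('a) - 1)) \<le> hausdorff_outer (DIM('a) - 1) (frontier \<Omega> \<inter> cball q (\<mu> * \<delta>))"
        by (intro c1(2)[OF q2 q1])
      also have "\<dots> \<le> hausdorff_outer (DIM('a) - 1) (frontier \<Omega> \<inter> cball x \<delta>)"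
      proof (rule hausdorff_outer_mono)
        have "\<mu> * \<delta> \<le> \<delta> / 2" using \<mu> \<delta> by simp
        moreover have "dist x z \<le> dist q x + dist q z" for z
          using dist_triangle[of x z q] by (simp add: dist_commute)
        ultimately have "dist x z \<le> \<delta>" if "dist q z \<le> \<mu> * \<delta>" for z
          using dq that by (smt (verit, ccfv_SIG) field_sum_of_halves)
        then show "frontier \<Omega> \<inter> cball q (\<mu> * \<delta>) \<subseteq> frontier \<Omega> \<inter> cball x \<delta>"
          by auto
      qed
      also have "\<dots> \<le> \<sigma> x" using \<sigma> xT TO by blast
      finally show ?thesis by (simp add: m_def power_mult_distrib mult.assoc)
    qed
    have US1: "(\<integral>\<^sup>+x. indicator (S 1) x * ennreal ((u x)\<^sup>2) \<partial>lborel) \<le> ennreal (1 / (c\<^sub>1 * \<mu> ^ m)) * D"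
    proof -
      have "ennreal (c\<^sub>1 * \<mu> ^ m * \<delta> ^ m) * (\<integral>\<^sup>+x. indicator (S 1) x * ennreal ((u x)\<^sup>2) \<partial>lborel)
        = (\<integral>\<^sup>+x. ennreal (c\<^sub>1 * \<mu> ^ m * \<delta> ^ m) * (indicator (S 1) x * ennreal ((u x)\<^sup>2)) \<partial>lborel)"
        by (rule nn_integral_cmult[symmetric]) measurable
      also have "\<dots> \<le> (\<integral>\<^sup>+x. indicator \<Omega> x * (\<sigma> x * ennreal ((u x)\<^sup>2)) \<partial>lborel)"
        using low S1 TO by (intro nn_integral_mono) (auto simp: indicator_def intro!: mult_right_mono)
      also have "\<dots> = ennreal (\<delta> ^ m) * D"
        using \<delta> by (simp add: D_def mult.assoc[symmetric] ennreal_mult[symmetric])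
      finally have "(\<integral>\<^sup>+x. indicator (S 1) x * ennreal ((u x)\<^sup>2) \<partial>lborel) \<le> ennreal (\<delta> ^ m / (c\<^sub>1 * \<mu> ^ m * \<delta> ^ m)) * D"
        using c1(1) \<mu> \<delta> by (intro ennreal_le_divideI) auto
      then show ?thesis using \<delta> by simp
    qed
    have UT: "(\<integral>\<^sup>+x. indicator T x * ennreal ((u x)\<^sup>2) \<partial>lborel) \<le> ennreal (C\<^sub>S / \<delta>\<^sup>2) * (E + D)"
    proof -
      have "(\<integral>\<^sup>+x. indicator T x * ennreal ((u x)\<^sup>2) \<partial>lborel)
        \<le> ennreal (2 * real J) * (\<integral>\<^sup>+x. indicator (S 1) x * ennreal ((u x)\<^sup>2) \<partial>lborel)
          + ennreal ((real J)\<^sup>2 * (72 / c)) * E"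
        unfolding SJ[symmetric] E_def S_def
        by (rule boundary_layer_estimate[OF ch dens \<delta> J(1) \<rho>_def \<eta>_def \<eta>(1)]) measurable
      also have "\<dots> \<le> ennreal (2 * real J) * (ennreal (1 / (c\<^sub>1 * \<mu> ^ m)) * D) + ennreal ((real J)\<^sup>2 * (72 / c)) * E"
        by (intro add_right_mono mult_left_mono US1) auto
      also have "\<dots> = ennreal (2 * real J * (1 / (c\<^sub>1 * \<mu> ^ m))) * D + ennreal ((real J)\<^sup>2 * (72 / c)) * E"
        using c1(1) \<mu> by (simp add: ennreal_mult mult.assoc del: times_divide_eq_right times_divide_eq_left)
      also have "\<dots> \<le> ennreal (C\<^sub>S / \<delta>\<^sup>2) * D + ennreal (C\<^sub>S / \<delta>\<^sup>2) * E"
      proof (intro add_mono mult_right_mono ennreal_leI)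
        have "(real J)\<^sup>2 \<le> (M / \<delta>)\<^sup>2" using JM by (intro power_mono) auto
        then have "(real J)\<^sup>2 * (72 / c) \<le> M\<^sup>2 / \<delta>\<^sup>2 * (72 / c)"
          using c by (intro mult_right_mono) (auto simp: power_divide)
        also have "\<dots> = M\<^sup>2 * (72 / c) / \<delta>\<^sup>2" by simp
        also have "\<dots> \<le> C\<^sub>S / \<delta>\<^sup>2"
          using M \<delta>\<^sub>0 c1(1) \<mu> by (intro divide_right_mono) (auto simp: C\<^sub>S_def)
        finally show "(real J)\<^sup>2 * (72 / c) \<le> C\<^sub>S / \<delta>\<^sup>2" .
        have "M * \<delta> \<le> M * \<delta>\<^sub>0" using M \<delta> by simp
        then have "M / \<delta> \<le> M * \<delta>\<^sub>0 / \<delta>\<^sup>2" using \<delta> by (simp add: field_simps power2_eq_square)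
        then have "real J \<le> M * \<delta>\<^sub>0 / \<delta>\<^sup>2" using JM by linarith
        then have "2 * real J * (1 / (c\<^sub>1 * \<mu> ^ m)) \<le> 2 * (M * \<delta>\<^sub>0 / \<delta>\<^sup>2) * (1 / (c\<^sub>1 * \<mu> ^ m))"
          using c1(1) \<mu> by (intro mult_right_mono mult_left_mono) auto
        also have "\<dots> = 2 * M * \<delta>\<^sub>0 / (c\<^sub>1 * \<mu> ^ m) / \<delta>\<^sup>2" by (simp add: mult_ac)
        also have "\<dots> \<le> C\<^sub>S / \<delta>\<^sup>2" using c by (intro divide_right_mono) (auto simp: C\<^sub>S_def)
        finally show "2 * real J * (1 / (c\<^sub>1 * \<mu> ^ m)) \<le> C\<^sub>S / \<delta>\<^sup>2" .
      qed auto
      finally show ?thesis by (simp add: distrib_left add.commute)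
    qed
    \<comment> \<open>The bound for \<open>u\<close> on \<open>T\<close> spreads to \<open>\<Omega>\<close> by comparing \<open>u x\<close> with the values of \<open>u\<close> on \<open>T\<close>.\<close>
    define f where "f = (\<lambda>x. \<integral>\<^sup>+y. indicator (\<Omega> \<times> T) (x, y) * ennreal ((u x - u y)\<^sup>2) \<partial>lborel)"
    have [measurable]: "f \<in> borel_measurable borel" unfolding f_def by measurable
    define B where "B = (\<integral>\<^sup>+y. indicator T y * ennreal ((u y)\<^sup>2) \<partial>lborel)"
    have pt: "ennreal t * (indicator \<Omega> x * ennreal ((u x)\<^sup>2)) \<le> 2 * f x + 2 * B * indicator \<Omega> x" for x
    proof (cases "x \<in> \<Omega>")
      case True
      have "ennreal t * ennreal ((u x)\<^sup>2) = (\<integral>\<^sup>+y. ennreal ((u x)\<^sup>2) * indicator T y \<partial>lborel)"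
        by (subst nn_integral_cmult_indicator) (auto simp: t mult.commute)
      also have "\<dots> \<le> (\<integral>\<^sup>+y. 2 * (indicator (\<Omega> \<times> T) (x, y) * ennreal ((u x - u y)\<^sup>2))
          + 2 * (indicator T y * ennreal ((u y)\<^sup>2)) \<partial>lborel)"
        using True ennreal_square_diff_le[of "u x" 0] by (intro nn_integral_mono) (auto simp: indicator_def)
      also have "\<dots> = 2 * f x + 2 * B"
        unfolding f_def B_def by (subst nn_integral_add, measurable, subst nn_integral_cmult, measurable, subst nn_integral_cmult, measurable)
      finally show ?thesis using True by simp
    qed auto
    have "ennreal t * (\<integral>\<^sup>+x. indicator \<Omega> x * ennreal ((u x)\<^sup>2) \<partial>lborel)
        = (\<integral>\<^sup>+x. ennreal t * (indicator \<Omega> x * ennreal ((u x)\<^sup>2)) \<partial>lborel)"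
      by (rule nn_integral_cmult[symmetric]) measurable
    also have "\<dots> \<le> (\<integral>\<^sup>+x. 2 * f x + 2 * B * indicator \<Omega> x \<partial>lborel)"
      by (intro nn_integral_mono pt)
    also have "\<dots> = 2 * diff_energy (\<Omega> \<times> T) u + 2 * B * ennreal w"
      by (subst nn_integral_add, measurable, subst nn_integral_cmult, measurable,
          subst nn_integral_cmult_indicator, measurable) (simp add: w f_def diff_energy_def)
    also have "\<dots> \<le> 2 * (ennreal (P / \<delta>\<^sup>2) * E) + 2 * (ennreal (C\<^sub>S / \<delta>\<^sup>2) * (E + D)) * ennreal w"
    proof (intro add_mono mult_left_mono mult_right_mono)
      have "diff_energy (\<Omega> \<times> T) u \<le> diff_energy (\<Omega> \<times> \<Omega>) u" using TO by (intro diff_energy_mono) auto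
      also have "\<dots> \<le> ennreal (P / \<delta>\<^sup>2) * E" unfolding E_def using \<delta> by (intro P) auto
      finally show "diff_energy (\<Omega> \<times> T) u \<le> ennreal (P / \<delta>\<^sup>2) * E" .
      show "B \<le> ennreal (C\<^sub>S / \<delta>\<^sup>2) * (E + D)" unfolding B_def by (rule UT)
    qed auto
    also have "\<dots> \<le> 2 * (ennreal (P / \<delta>\<^sup>2) * (E + D)) + 2 * (ennreal (C\<^sub>S / \<delta>\<^sup>2) * (E + D)) * ennreal w"
      by (intro add_right_mono mult_left_mono) auto
    also have "\<dots> = ennreal (2 * (P / \<delta>\<^sup>2) + 2 * (C\<^sub>S / \<delta>\<^sup>2) * w) * (E + D)"
      using P(1) CS w by (simp add: ennreal_mult distrib_right distrib_left add_ac mult_ac del: times_divide_eq_right times_divide_eq_left)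
    finally have "(\<integral>\<^sup>+x. indicator \<Omega> x * ennreal ((u x)\<^sup>2) \<partial>lborel)
        \<le> ennreal ((2 * (P / \<delta>\<^sup>2) + 2 * (C\<^sub>S / \<delta>\<^sup>2) * w) / t) * (E + D)"
      using P(1) CS w by (intro ennreal_le_divideI t0) auto
    also have "(2 * (P / \<delta>\<^sup>2) + 2 * (C\<^sub>S / \<delta>\<^sup>2) * w) / t = (2 * P + 2 * w * C\<^sub>S) / t / \<delta>\<^sup>2"
      by (simp add: add_divide_distrib mult.commute)
    finally show "(\<integral>\<^sup>+x. indicator \<Omega> x * ennreal ((u x)\<^sup>2) \<partial>lborel)
      \<le> ennreal ((2 * P + 2 * w * C\<^sub>S) / t / \<delta>\<^sup>2) * (nl_energy \<Omega> \<delta> u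
            + ennreal (1 / \<delta> ^ (DIM('a) - 1)) * (\<integral>\<^sup>+x. indicator \<Omega> x * (\<sigma> x * ennreal ((u x)\<^sup>2)) \<partial>lborel))"
      by (simp add: E_def D_def m_def)
  qed
qed

section \<open>Smooth test functions\<close>

text \<open>
  The powers of \<open>1 / t\<close> are included because they appear in the derivatives of \<open>exp (- 1 / t)\<close>.
\<close>

definition exp_bump :: "nat \<Rightarrow> real \<Rightarrow> real" where
  "exp_bump k t = (if t > 0 then exp (- (1 / t)) / t ^ k else 0)"

lemma exp_bump_nonneg: "exp_bump k t \<ge> 0"
  by (simp add: exp_bump_def)

lemma exp_bump_0_pos_iff: "exp_bump 0 t > 0 \<longleftrightarrow> t > 0"
  by (simp add: exp_bump_def)

lemma exp_bump_tendsto_0: "(exp_bump k \<longlongrightarrow> 0) (at 0)"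
proof -
  have "((\<lambda>t. (inverse t) ^ k / exp (inverse t)) \<longlongrightarrow> (0::real)) (at_right 0)"
    by (rule filterlim_compose[OF tendsto_power_div_exp_0 filterlim_inverse_at_top_right])
  then have r: "(exp_bump k \<longlongrightarrow> 0) (at_right 0)"
    by (rule Lim_transform_eventually)
       (auto simp: eventually_at_filter exp_bump_def exp_minus field_simps inverse_eq_divide)
  have l: "(exp_bump k \<longlongrightarrow> 0) (at_left 0)"
    by (rule Lim_transform_eventually[OF tendsto_const])
       (auto simp: eventually_at_filter exp_bump_def)
  show ?thesis using l r by (simp add: filterlim_split_at)
qed

lemma DERIV_exp_bump: "(exp_bump k has_real_derivative exp_bump (k + 2) t - real k * exp_bump (k + 1) t) (at t)"
proof -
  consider "t > 0" | "t < 0" | "t = 0" by linarith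
  then show ?thesis
  proof cases
    case 1
    have d: "((\<lambda>s. exp (- (1 / s)) / s ^ k) has_real_derivative
        exp_bump (k + 2) t - real k * exp_bump (k + 1) t) (at t)"
    proof (cases k)
      case 0
      show ?thesis unfolding 0 using 1
        by (auto intro!: derivative_eq_intros simp: exp_bump_def power2_eq_square)
    next
      case (Suc l)
      show ?thesis unfolding Suc using 1
        by (auto intro!: derivative_eq_intros simp: exp_bump_def field_simps power2_eq_square) (cases l; simp)
    qed
    show ?thesis
      by (rule has_field_derivative_transform_within_open[OF d, of "{0<..}"]) (use 1 in \<open>auto simp: exp_bump_def\<close>)
  next
    case 2
    have "((\<lambda>s::real. 0) has_real_derivative exp_bump (k + 2) t - real k * exp_bump (k + 1) t) (at t)"
      using 2 by (auto simp: exp_bump_def)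
    then show ?thesis
      by (rule has_field_derivative_transform_within_open[of _ _ _ "{..<0}"]) (use 2 in \<open>auto simp: exp_bump_def\<close>)
  next
    case 3
    have "((\<lambda>h. (exp_bump k (0 + h) - exp_bump k 0) / h) \<longlongrightarrow> 0) (at 0)"
      by (rule Lim_transform_eventually[OF exp_bump_tendsto_0[of "k + 1"]])
         (auto simp: eventually_at_filter exp_bump_def)
    then show ?thesis unfolding 3 DERIV_def by (simp add: exp_bump_def)
  qed
qed

text \<open>
  A class of functions that contains enough cut-off functions and is closed under partial
  derivatives; its members are therefore smooth without any computation of higher derivatives.
\<close>

inductive_set bump_algebra :: "('a::euclidean_space \<Rightarrow> real) set" where
  const: "(\<lambda>x. c) \<in> bump_algebra"
| bump: "(\<lambda>x. exp_bump k (x \<bullet> v + c)) \<in> bump_algebra"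
| add: "f \<in> bump_algebra \<Longrightarrow> g \<in> bump_algebra \<Longrightarrow> (\<lambda>x. f x + g x) \<in> bump_algebra"
| mult: "f \<in> bump_algebra \<Longrightarrow> g \<in> bump_algebra \<Longrightarrow> (\<lambda>x. f x * g x) \<in> bump_algebra"
| inverse: "f \<in> bump_algebra \<Longrightarrow> (\<And>x. f x \<noteq> 0) \<Longrightarrow> (\<lambda>x. inverse (f x)) \<in> bump_algebra"

lemma bump_algebra_derivative:
  assumes "f \<in> bump_algebra"
  shows "\<exists>f'. (\<forall>x. (f has_derivative f' x) (at x)) \<and> (\<forall>b. (\<lambda>x. f' x b) \<in> bump_algebra)"
  using assms
proof induction
  case (const c)
  have "(\<lambda>x. 0::real) \<in> bump_algebra" by (rule bump_algebra.const)
  then show ?case by (intro exI[of _ "\<lambda>x h. 0"]) auto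
next
  case (bump k v c)
  have d: "((\<lambda>x. exp_bump k (x \<bullet> v + c)) has_derivative
      (\<lambda>h. (exp_bump (k + 2) (x \<bullet> v + c) + - real k * exp_bump (k + 1) (x \<bullet> v + c)) * (h \<bullet> v))) (at x)" for x
    by (rule has_derivative_compose[of "\<lambda>x. x \<bullet> v + c" _ _ _ "exp_bump k"])
       (auto intro!: derivative_eq_intros DERIV_exp_bump[THEN has_field_derivative_imp_has_derivative, THEN has_derivative_eq_rhs])
  have m: "(\<lambda>x. (exp_bump (k + 2) (x \<bullet> v + c) + - real k * exp_bump (k + 1) (x \<bullet> v + c)) * (h \<bullet> v)) \<in> bump_algebra" for h
    by (intro bump_algebra.intros)
  show ?case using d m by (intro exI[of _ "\<lambda>x h. (exp_bump (k + 2) (x \<bullet> v + c) + - real k * exp_bump (k + 1) (x \<bullet> v + c)) * (h \<bullet> v)"]) auto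
next
  case (add f g)
  then obtain f' g' where
    "\<And>x. (f has_derivative f' x) (at x)" "\<And>b. (\<lambda>x. f' x b) \<in> bump_algebra"
    "\<And>x. (g has_derivative g' x) (at x)" "\<And>b. (\<lambda>x. g' x b) \<in> bump_algebra" by metis
  then show ?case
    by (intro exI[of _ "\<lambda>x h. f' x h + g' x h"]) (auto intro: has_derivative_add bump_algebra.add)
next
  case (mult f g)
  then obtain f' g' where
    "\<And>x. (f has_derivative f' x) (at x)" "\<And>b. (\<lambda>x. f' x b) \<in> bump_algebra"
    "\<And>x. (g has_derivative g' x) (at x)" "\<And>b. (\<lambda>x. g' x b) \<in> bump_algebra" by metis
  with mult show ?case
    by (intro exI[of _ "\<lambda>x h. f x * g' x h + f' x h * g x"])
       (auto intro!: has_derivative_mult bump_algebra.add bump_algebra.mult)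
next
  case (inverse f)
  then obtain f' where f':
    "\<And>x. (f has_derivative f' x) (at x)" "\<And>b. (\<lambda>x. f' x b) \<in> bump_algebra" by metis
  have d: "((\<lambda>x. inverse (f x)) has_derivative (\<lambda>h. - (inverse (f x) * f' x h * inverse (f x)))) (at x)" for x
    by (rule Deriv.has_derivative_inverse[OF inverse.hyps(2) f'(1)])
  have "(\<lambda>x. (-1) * (inverse (f x) * f' x b * inverse (f x))) \<in> bump_algebra" for b
    by (intro bump_algebra.const bump_algebra.mult bump_algebra.inverse inverse f'(2))
  with d show ?case by (intro exI[of _ "\<lambda>x h. - (inverse (f x) * f' x h * inverse (f x))"]) auto
qed

lemma bump_algebra_Ck: "f \<in> bump_algebra \<Longrightarrow> Ck_on k UNIV f"
proof (induction k arbitrary: f)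
  case 0
  then obtain f' where "\<And>x. (f has_derivative f' x) (at x)" using bump_algebra_derivative by blast
  then show ?case by (auto intro!: continuous_at_imp_continuous_on has_derivative_continuous)
next
  case (Suc k)
  then obtain f' where f': "\<And>x. (f has_derivative f' x) (at x)" "\<And>b. (\<lambda>x. f' x b) \<in> bump_algebra"
    using bump_algebra_derivative by blast
  have "frechet_derivative f (at x) = f' x" for x using frechet_derivative_at[OF f'(1)] by simp
  then show ?case using f' Suc.IH by (auto simp: differentiable_on_def differentiable_def)
qed

lemma bump_algebra_prod:
  assumes "finite I" "\<And>i. i \<in> I \<Longrightarrow> f i \<in> bump_algebra"
  shows "(\<lambda>x. \<Prod>i\<in>I. f i x) \<in> bump_algebra"
  using assms by (induction I) (auto intro: bump_algebra.intros)

definition box_bump :: "'a::euclidean_space \<Rightarrow> 'a \<Rightarrow> 'a \<Rightarrow> real" where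
  "box_bump a b x = (\<Prod>i\<in>Basis. exp_bump 0 (x \<bullet> i + - (a \<bullet> i)) * exp_bump 0 (x \<bullet> (- i) + b \<bullet> i))"

lemma box_bump_nonneg: "box_bump a b x \<ge> 0"
  by (auto simp: box_bump_def intro!: prod_nonneg mult_nonneg_nonneg exp_bump_nonneg)

lemma box_bump_pos: "x \<in> box a b \<Longrightarrow> box_bump a b x > 0"
  by (auto simp: box_bump_def mem_box exp_bump_0_pos_iff intro!: prod_pos)

lemma box_bump_eq_0: "x \<notin> box a b \<Longrightarrow> box_bump a b x = 0"
  by (force simp: box_bump_def mem_box exp_bump_def)

lemma box_bump_bump_algebra: "box_bump a b \<in> bump_algebra"
proof -
  have "(\<lambda>x. \<Prod>i\<in>Basis. exp_bump 0 (x \<bullet> i + - (a \<bullet> i)) * exp_bump 0 (x \<bullet> (- i) + b \<bullet> i)) \<in> bump_algebra"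
    by (intro bump_algebra_prod bump_algebra.mult bump_algebra.bump) auto
  then show ?thesis by (simp add: box_bump_def[abs_def])
qed

text \<open>
  As \<open>n\<close> grows, these functions tend to the indicator of the open box.
\<close>

definition box_cutoff :: "'a::euclidean_space \<Rightarrow> 'a \<Rightarrow> nat \<Rightarrow> 'a \<Rightarrow> real" where
  "box_cutoff a b n x = box_bump a b x * inverse (box_bump a b x + 1 / real (Suc n))"

lemma box_cutoff_test_function:
  assumes "cbox a b \<subseteq> \<Omega>"
  shows "box_cutoff a b n \<in> test_functions \<Omega>"
proof -
  have ne: "box_bump a b x + 1 / real (Suc n) \<noteq> 0" for x
    using box_bump_nonneg[of a b x] by (smt (verit) divide_pos_pos of_nat_0_less_iff zero_less_Suc)
  have "(\<lambda>x. box_bump a b x * inverse (box_bump a b x + 1 / real (Suc n))) \<in> bump_algebra"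
    by (intro bump_algebra.mult bump_algebra.inverse bump_algebra.add bump_algebra.const box_bump_bump_algebra ne)
  then have m: "box_cutoff a b n \<in> bump_algebra" by (simp add: box_cutoff_def[abs_def])
  have sub: "{x. box_cutoff a b n x \<noteq> 0} \<subseteq> cbox a b"
    using box_bump_eq_0 box_subset_cbox by (force simp: box_cutoff_def)
  then have "bounded {x. box_cutoff a b n x \<noteq> 0}" by (rule bounded_subset[OF bounded_cbox])
  then have "compact (closure {x. box_cutoff a b n x \<noteq> 0})" by simp
  moreover have "closure {x. box_cutoff a b n x \<noteq> 0} \<subseteq> cbox a b"
    by (rule closure_minimal[OF sub closed_cbox])
  ultimately show ?thesis
    using bump_algebra_Ck[OF m] assms
    by (auto simp: test_functions_def)
qed

lemma box_cutoff_bounds: "0 \<le> box_cutoff a b n x" "box_cutoff a b n x \<le> indicator (box a b) x"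
proof -
  let ?F = "box_bump a b x" and ?e = "1 / real (Suc n)"
  have F: "?F \<ge> 0" "?e > 0" by (simp_all add: box_bump_nonneg)
  show "0 \<le> box_cutoff a b n x" using F by (simp add: box_cutoff_def)
  have "s / (s + t) \<le> 1" if "s \<ge> 0" "t > 0" for s t :: real using that by simp
  from this[OF F] have "?F / (?F + ?e) \<le> 1" .
  then show "box_cutoff a b n x \<le> indicator (box a b) x"
    using box_bump_eq_0[of x a b] by (auto simp: box_cutoff_def indicator_def divide_inverse)
qed

lemma box_cutoff_tendsto: "(\<lambda>n. box_cutoff a b n x) \<longlonglongrightarrow> indicator (box a b) x"
proof (cases "x \<in> box a b")
  case True
  have "(\<lambda>n. box_bump a b x * inverse (box_bump a b x + 1 / real (Suc n)))
      \<longlonglongrightarrow> box_bump a b x * inverse (box_bump a b x + 0)"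
    using box_bump_pos[OF True]
    by (intro tendsto_intros LIMSEQ_Suc[OF lim_1_over_n]) auto
  then show ?thesis using True box_bump_pos[OF True] by (simp add: box_cutoff_def[abs_def])
qed (simp add: box_cutoff_def box_bump_eq_0)

section \<open>Weak derivatives\<close>

lemma integral_lebesgue_on_borel:
  fixes h :: "'a::euclidean_space \<Rightarrow> real"
  assumes [measurable]: "\<Omega> \<in> sets borel" "h \<in> borel_measurable borel"
  shows "(LINT x|lebesgue_on \<Omega>. h x) = (LINT x|lborel. indicator \<Omega> x * h x)"
    "integrable (lebesgue_on \<Omega>) h \<longleftrightarrow> integrable lborel (\<lambda>x. indicator \<Omega> x * h x)"
proof -
  have [measurable]: "(\<lambda>x. indicator \<Omega> x *\<^sub>R h x) \<in> borel_measurable lborel" by measurable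
  show "(LINT x|lebesgue_on \<Omega>. h x) = (LINT x|lborel. indicator \<Omega> x * h x)"
    by (subst integral_restrict_space) (simp_all add: integral_completion)
  show "integrable (lebesgue_on \<Omega>) h \<longleftrightarrow> integrable lborel (\<lambda>x. indicator \<Omega> x * h x)"
    by (subst integrable_restrict_space) (simp_all add: integrable_completion)
qed

lemma nn_integral_lebesgue_on_borel:
  fixes h :: "'a::euclidean_space \<Rightarrow> ennreal"
  assumes [measurable]: "\<Omega> \<in> sets borel"
  shows "(\<integral>\<^sup>+x. h x \<partial>lebesgue_on \<Omega>) = (\<integral>\<^sup>+x. indicator \<Omega> x * h x \<partial>lborel)"
  by (subst nn_integral_restrict_space) (simp_all add: nn_integral_completion mult.commute)

lemma borel_measurable_lebesgue_on_borel:
  "h \<in> borel \<rightarrow>\<^sub>M N \<Longrightarrow> h \<in> lebesgue_on \<Omega> \<rightarrow>\<^sub>M N" for h :: "'a::euclidean_space \<Rightarrow> 'b"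
  by (intro measurable_restrict_space1 measurable_completion) simp

text \<open>
  Elements of \<open>L\<^sup>2\<close> are only Lebesgue measurable, whereas double integrals need functions of two variables
  that are measurable for the product of the Borel algebras.
\<close>

lemma borel_representative:
  fixes v :: "'a::euclidean_space \<Rightarrow> real"
  assumes \<Omega>: "\<Omega> \<in> sets borel" and v: "v \<in> borel_measurable (lebesgue_on \<Omega>)"
  obtains v' where "v' \<in> borel_measurable borel" "AE x in lebesgue_on \<Omega>. v x = v' x"
proof -
  have "(\<lambda>x. indicator \<Omega> x *\<^sub>R v x) \<in> borel_measurable lebesgue"
    using v \<Omega> by (subst (asm) borel_measurable_restrict_space_iff) auto
  then obtain v' where v': "v' \<in> borel_measurable lborel" "AE x in lborel. indicator \<Omega> x *\<^sub>R v x = v' x"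
    using completion_ex_borel_measurable_real by blast
  have "AE x in lebesgue. indicator \<Omega> x *\<^sub>R v x = v' x" by (rule AE_completion[OF v'(2)])
  then have "AE x in lebesgue_on \<Omega>. v x = v' x"
    using \<Omega> by (subst AE_restrict_space_iff) (auto elim!: eventually_mono)
  then show ?thesis using v' that by simp
qed

lemma finite_measure_lebesgue_on_bounded:
  "open \<Omega> \<Longrightarrow> bounded \<Omega> \<Longrightarrow> finite_measure (lebesgue_on \<Omega>)" for \<Omega> :: "'a::euclidean_space set"
  by (intro finite_measure_lebesgue_on lmeasurable_open)

lemma box_integrals_eq_0_imp_AE_eq_0:
  fixes W :: "'a::euclidean_space \<Rightarrow> real"
  assumes W: "integrable lborel W" and box0: "\<And>a b. (LINT x|lborel. indicator (box a b) x * W x) = 0"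
  shows "AE x in lborel. W x = 0"
proof -
  have [measurable]: "W \<in> borel_measurable borel" using W by auto
  let ?M = "density lborel (\<lambda>x. ennreal (W x))" and ?N = "density lborel (\<lambda>x. ennreal (- W x))"
  let ?E = "range (\<lambda>(a, b). box a b :: 'a set)"
  have eq: "emeasure ?M (box a b) = emeasure ?N (box a b)" and fin: "emeasure ?M (box a b) \<noteq> \<infinity>" for a b
  proof -
    define V where "V = (\<lambda>x. indicator (box a b) x * W x)"
    have V: "integrable lborel V" unfolding V_def
      using integrable_mult_indicator[OF _ W, of "box a b"] by simp
    have M: "emeasure ?M (box a b) = (\<integral>\<^sup>+x. ennreal (V x) \<partial>lborel)"
      by (subst emeasure_density) (auto simp: V_def indicator_def intro!: nn_integral_cong)
    have N: "emeasure ?N (box a b) = (\<integral>\<^sup>+x. ennreal (- V x) \<partial>lborel)"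
      by (subst emeasure_density) (auto simp: V_def indicator_def intro!: nn_integral_cong)
    have f: "(\<integral>\<^sup>+x. ennreal (V x) \<partial>lborel) \<noteq> \<infinity>" "(\<integral>\<^sup>+x. ennreal (- V x) \<partial>lborel) \<noteq> \<infinity>"
      using V by (auto simp: real_integrable_def)
    have "enn2real (\<integral>\<^sup>+x. ennreal (V x) \<partial>lborel) - enn2real (\<integral>\<^sup>+x. ennreal (- V x) \<partial>lborel) = 0"
      using real_lebesgue_integral_def[OF V] box0[of a b] by (simp add: V_def)
    then have "(\<integral>\<^sup>+x. ennreal (V x) \<partial>lborel) = (\<integral>\<^sup>+x. ennreal (- V x) \<partial>lborel)"
    proof -
      assume *: "enn2real (\<integral>\<^sup>+x. ennreal (V x) \<partial>lborel) - enn2real (\<integral>\<^sup>+x. ennreal (- V x) \<partial>lborel) = 0"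
      have "(\<integral>\<^sup>+x. ennreal (V x) \<partial>lborel) = ennreal (enn2real (\<integral>\<^sup>+x. ennreal (V x) \<partial>lborel))"
        using f(1) by (simp add: less_top)
      also have "\<dots> = ennreal (enn2real (\<integral>\<^sup>+x. ennreal (- V x) \<partial>lborel))" using * by simp
      also have "\<dots> = (\<integral>\<^sup>+x. ennreal (- V x) \<partial>lborel)" using f(2) by (simp add: less_top)
      finally show ?thesis .
    qed
    then show "emeasure ?M (box a b) = emeasure ?N (box a b)" "emeasure ?M (box a b) \<noteq> \<infinity>"
      using M N f by simp_all
  qed
  have "?M = ?N"
  proof (rule measure_eqI_generator_eq[where E = ?E and \<Omega> = UNIV and A = "\<lambda>i::nat. box (- (real i *\<^sub>R One)) (real i *\<^sub>R One)"])
    show "Int_stable ?E" by (auto simp: Int_stable_def box_Int_box)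
    show "sets ?M = sigma_sets UNIV ?E" "sets ?N = sigma_sets UNIV ?E"
      by (simp_all add: borel_eq_box)
    show "range (\<lambda>i::nat. box (- (real i *\<^sub>R One)) (real i *\<^sub>R One)) \<subseteq> ?E" by auto
    show "(\<Union>i::nat. box (- (real i *\<^sub>R One)) (real i *\<^sub>R One)) = (UNIV :: 'a set)" by (rule UN_box_eq_UNIV)
  qed (use eq fin in auto)
  then have "AE x in lborel. ennreal (W x) = ennreal (- W x)"
    by (subst (asm) sigma_finite_measure.density_unique_iff[OF sigma_finite_lborel]) auto
  then show ?thesis
  proof eventually_elim
    case (elim x)
    then show ?case by (cases "W x \<ge> 0") (auto simp: ennreal_eq_0_iff ennreal_neg)
  qed
qed

lemma box_cutoff_abs_le_1: "\<bar>box_cutoff a b n x\<bar> \<le> 1"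
  using box_cutoff_bounds[of a b n x] 
  by (cases "x \<in> box a b") (simp_all add: box_bump_eq_0 box_cutoff_def)

lemma test_function_differentiable:
  assumes "\<phi> \<in> test_functions \<Omega>"
  shows "(\<phi> has_derivative frechet_derivative \<phi> (at x)) (at x)" "continuous_on UNIV \<phi>"
    "b \<in> Basis \<Longrightarrow> continuous_on UNIV (\<lambda>x. frechet_derivative \<phi> (at x) b)"
proof -
  have 1: "Ck_on 1 UNIV \<phi>" and 0: "Ck_on 0 UNIV \<phi>" using assms by (auto simp: test_functions_def)
  show "(\<phi> has_derivative frechet_derivative \<phi> (at x)) (at x)"
    using 1 frechet_derivative_works by (auto simp: differentiable_on_def)
  show "continuous_on UNIV \<phi>" using 0 by simp
  show "b \<in> Basis \<Longrightarrow> continuous_on UNIV (\<lambda>x. frechet_derivative \<phi> (at x) b)" using 1 by simp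
qed

text \<open>
  The difference of two weak derivatives has integral 0 against the cut-offs of every closed box in
  the domain, so in the limit over the open box.  Open boxes generate the Borel sets and countably
  many of these boxes cover the domain.
\<close>

theorem weak_partial_unique:
  fixes \<Omega> :: "'a::euclidean_space set"
  assumes op: "open \<Omega>" and bd: "bounded \<Omega>"
    and v: "v\<^sub>1 \<in> L2 (lebesgue_on \<Omega>)" "v\<^sub>2 \<in> L2 (lebesgue_on \<Omega>)"
    and wp: "is_weak_partial \<Omega> b u v\<^sub>1" "is_weak_partial \<Omega> b u v\<^sub>2"
  shows "AE x in lebesgue_on \<Omega>. v\<^sub>1 x = v\<^sub>2 x"
proof -
  interpret F: finite_measure "lebesgue_on \<Omega>" by (rule finite_measure_lebesgue_on_bounded[OF op bd])
  have [measurable]: "\<Omega> \<in> sets borel" using op by simp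
  have int: "integrable (lebesgue_on \<Omega>) v\<^sub>1" "integrable (lebesgue_on \<Omega>) v\<^sub>2"
    using v by (auto simp: L2_def intro: F.square_integrable_imp_integrable)
  obtain w\<^sub>1 where w1[measurable]: "w\<^sub>1 \<in> borel_measurable borel" and a1: "AE x in lebesgue_on \<Omega>. v\<^sub>1 x = w\<^sub>1 x"
    by (rule borel_representative[of \<Omega> v\<^sub>1]) (use int in auto)
  obtain w\<^sub>2 where w2[measurable]: "w\<^sub>2 \<in> borel_measurable borel" and a2: "AE x in lebesgue_on \<Omega>. v\<^sub>2 x = w\<^sub>2 x"
    by (rule borel_representative[of \<Omega> v\<^sub>2]) (use int in auto)
  note mw = borel_measurable_lebesgue_on_borel[OF w1] borel_measurable_lebesgue_on_borel[OF w2]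
  have intw: "integrable (lebesgue_on \<Omega>) w\<^sub>1" "integrable (lebesgue_on \<Omega>) w\<^sub>2"
    by (rule integrable_cong_AE_imp[OF int(1) mw(1) a1], rule integrable_cong_AE_imp[OF int(2) mw(2) a2])
  define W where "W = (\<lambda>x. indicator \<Omega> x * (w\<^sub>1 x - w\<^sub>2 x))"
  have W: "integrable lborel W"
    using integral_lebesgue_on_borel(2)[of \<Omega> "\<lambda>x. w\<^sub>1 x - w\<^sub>2 x"] intw by (simp add: W_def)
  have [measurable]: "W \<in> borel_measurable borel" using W by auto
  have cut: "(LINT x|lborel. W x * box_cutoff c d n x) = 0" if cd: "cbox c d \<subseteq> \<Omega>" for c d n
  proof -
    let ?\<phi> = "box_cutoff c d n"
    have t: "?\<phi> \<in> test_functions \<Omega>" by (rule box_cutoff_test_function[OF cd])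
    have \<phi>m[measurable]: "?\<phi> \<in> borel_measurable borel"
      by (rule borel_measurable_continuous_onI) (rule test_function_differentiable(2)[OF t])
    note \<phi>m' = borel_measurable_lebesgue_on_borel[OF \<phi>m]
    have b: "norm (f x * ?\<phi> x) \<le> norm (f x)" for f :: "'a \<Rightarrow> real" and x
    proof -
      have "\<bar>?\<phi> x\<bar> \<le> 1" by (rule box_cutoff_abs_le_1)
      then show ?thesis by (simp add: abs_mult mult_left_le)
    qed
    have i0: "integrable (lebesgue_on \<Omega>) (\<lambda>x. w x * ?\<phi> x)"
      if w: "integrable (lebesgue_on \<Omega>) w" for w :: "'a \<Rightarrow> real"
      using borel_measurable_integrable[OF w] \<phi>m' b
      by (intro Bochner_Integration.integrable_bound[OF w]) auto
    note i1 = i0[OF intw(1)] i0[OF intw(2)]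
    have e1: "(LINT x|lebesgue_on \<Omega>. v\<^sub>1 x * ?\<phi> x) = (LINT x|lebesgue_on \<Omega>. w\<^sub>1 x * ?\<phi> x)"
      using a1 mw \<phi>m' int by (intro integral_cong_AE) auto
    have e2: "(LINT x|lebesgue_on \<Omega>. v\<^sub>2 x * ?\<phi> x) = (LINT x|lebesgue_on \<Omega>. w\<^sub>2 x * ?\<phi> x)"
      using a2 mw \<phi>m' int by (intro integral_cong_AE) auto
    have "(LINT x|lebesgue_on \<Omega>. v\<^sub>1 x * ?\<phi> x) = (LINT x|lebesgue_on \<Omega>. v\<^sub>2 x * ?\<phi> x)"
      using wp t by (auto simp: is_weak_partial_def)
    then have "(LINT x|lebesgue_on \<Omega>. w\<^sub>1 x * ?\<phi> x - w\<^sub>2 x * ?\<phi> x) = 0"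
      using e1 e2 i1 by (simp add: Bochner_Integration.integral_diff)
    then have "(LINT x|lebesgue_on \<Omega>. (w\<^sub>1 x - w\<^sub>2 x) * ?\<phi> x) = 0" by (simp add: left_diff_distrib)
    then show ?thesis
      by (subst (asm) integral_lebesgue_on_borel) (auto simp: W_def mult.assoc)
  qed
  have box0: "(LINT x|lborel. indicator (box c d) x * W x) = 0" if cd: "cbox c d \<subseteq> \<Omega>" for c d
  proof -
    have "(\<lambda>n. LINT x|lborel. W x * box_cutoff c d n x) \<longlonglongrightarrow> (LINT x|lborel. W x * indicator (box c d) x)"
    proof (rule integral_dominated_convergence[where w = "\<lambda>x. norm (W x)"])
      show "(\<lambda>x. W x * box_cutoff c d n x) \<in> borel_measurable lborel" for n
      proof -
        have [measurable]: "box_cutoff c d n \<in> borel_measurable borel"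
          by (rule borel_measurable_continuous_onI) (rule test_function_differentiable(2)[OF box_cutoff_test_function[OF cd]])
        show ?thesis by measurable
      qed
      show "AE x in lborel. norm (W x * box_cutoff c d n x) \<le> norm (W x)" for n
      proof (intro AE_I2)
        fix x
        have "\<bar>box_cutoff c d n x\<bar> \<le> 1" by (rule box_cutoff_abs_le_1)
        then show "norm (W x * box_cutoff c d n x) \<le> norm (W x)" by (simp add: abs_mult mult_left_le)
      qed
      show "AE x in lborel. (\<lambda>n. W x * box_cutoff c d n x) \<longlonglongrightarrow> W x * indicator (box c d) x"
        by (intro AE_I2 tendsto_intros box_cutoff_tendsto)
    qed (use W in auto)
    then have "(\<lambda>n. 0) \<longlonglongrightarrow> (LINT x|lborel. W x * indicator (box c d) x)" using cut[OF cd] by simp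
    then have "(LINT x|lborel. W x * indicator (box c d) x) = 0" by (rule LIMSEQ_unique[OF _ tendsto_const])
    then show ?thesis by (simp only: mult.commute)
  qed
  have loc: "AE x in lborel. x \<in> box c d \<longrightarrow> W x = 0" if cd: "cbox c d \<subseteq> \<Omega>" for c d
  proof -
    have "AE x in lborel. indicator (box c d) x * W x = 0"
    proof (rule box_integrals_eq_0_imp_AE_eq_0)
      show "integrable lborel (\<lambda>x. indicator (box c d) x * W x)"
        using integrable_mult_indicator[OF _ W, of "box c d"] by simp
      fix s t :: 'a
      define l where "l = (\<Sum>i\<in>Basis. max (c \<bullet> i) (s \<bullet> i) *\<^sub>R i)"
      define h where "h = (\<Sum>i\<in>Basis. min (d \<bullet> i) (t \<bullet> i) *\<^sub>R i)"
      have "box s t \<inter> box c d = box l h" by (auto simp: mem_box l_def h_def)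
      then have "(LINT x|lborel. indicator (box s t) x * (indicator (box c d) x * W x)) = (LINT x|lborel. indicator (box l h) x * W x)"
        by (intro Bochner_Integration.integral_cong) (auto simp: indicator_def)
      also have "\<dots> = 0"
        by (rule box0, rule order_trans[OF _ cd]) (auto simp: mem_box l_def h_def)
      finally show "(LINT x|lborel. indicator (box s t) x * (indicator (box c d) x * W x)) = 0" .
    qed
    then show ?thesis by eventually_elim auto
  qed
  define \<F> where "\<F> = {box c d | c d. cbox c d \<subseteq> \<Omega>}"
  obtain \<G> where \<G>: "\<G> \<subseteq> \<F>" "countable \<G>" "\<Union>\<G> = \<Union>\<F>"
    by (rule Lindelof[of \<F>]) (auto simp: \<F>_def)
  have cover: "\<Omega> \<subseteq> \<Union>\<F>"
  proof
    fix x assume "x \<in> \<Omega>"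
    then obtain e where e: "e > 0" "ball x e \<subseteq> \<Omega>" using op openE by blast
    obtain c d where cd: "x \<in> box c d" "box c d \<subseteq> ball x (e / 2)"
      using rational_boxes[of "e / 2" x] e by auto
    have "cbox c d = closure (box c d)" using cd(1) by (metis closure_box empty_iff)
    also have "\<dots> \<subseteq> closure (ball x (e / 2))" using cd by (intro closure_mono)
    also have "\<dots> \<subseteq> ball x e" using e by (auto simp: closure_ball)
    finally have "box c d \<in> \<F>" using e by (auto simp: \<F>_def)
    then show "x \<in> \<Union>\<F>" using cd by blast
  qed
  have "AE x in lborel. \<forall>X\<in>\<G>. x \<in> X \<longrightarrow> W x = 0"
    using \<G>(1,2) loc by (subst AE_ball_countable) (auto simp: \<F>_def)
  then have "AE x in lborel. x \<in> \<Omega> \<longrightarrow> w\<^sub>1 x = w\<^sub>2 x"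
    by eventually_elim (use \<G>(3) cover in \<open>auto simp: W_def indicator_def\<close>)
  then have "AE x in lebesgue. x \<in> \<Omega> \<longrightarrow> w\<^sub>1 x = w\<^sub>2 x" by (rule AE_completion)
  then have "AE x in lebesgue_on \<Omega>. w\<^sub>1 x = w\<^sub>2 x"
    by (subst AE_restrict_space_iff) auto
  then show ?thesis using a1 a2 by eventually_elim auto
qed

text \<open>
  Integration by parts for a function that is differentiable along one coordinate direction: the
  difference quotients of the product with a test function have integral 0 by translation
  invariance, and they converge dominatedly.
\<close>

theorem weak_partial_of_directional_derivative:
  fixes \<Omega> :: "'a::euclidean_space set" and u D :: "'a \<Rightarrow> real"
  assumes op: "open \<Omega>" and bd: "bounded \<Omega>" and b: "b \<in> Basis"
    and [measurable]: "u \<in> borel_measurable borel" "D \<in> borel_measurable borel"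
    and der: "\<And>x. x \<in> \<Omega> \<Longrightarrow> ((\<lambda>t. u (x + t *\<^sub>R b)) has_real_derivative D x) (at 0)"
    and bnd: "\<And>x. x \<in> \<Omega> \<Longrightarrow> \<bar>u x\<bar> \<le> M" "\<And>x. x \<in> \<Omega> \<Longrightarrow> \<bar>D x\<bar> \<le> M"
  shows "is_weak_partial \<Omega> b u D"
  unfolding is_weak_partial_def
proof
  fix \<phi> assume \<phi>: "\<phi> \<in> test_functions \<Omega>"
  note t = test_function_differentiable[OF \<phi>]
  define \<phi>' where "\<phi>' = (\<lambda>x. frechet_derivative \<phi> (at x) b)"
  have [measurable]: "\<Omega> \<in> sets borel" using op by simp
  have [measurable]: "\<phi> \<in> borel_measurable borel" "\<phi>' \<in> borel_measurable borel"
    unfolding \<phi>'_def by (intro borel_measurable_continuous_onI t b)+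
  have cl: "compact (closure \<Omega>)" using bd by simp
  have "bounded (\<phi> ` closure \<Omega>)" "bounded (\<phi>' ` closure \<Omega>)"
    unfolding \<phi>'_def
    by (intro compact_imp_bounded compact_continuous_image cl continuous_on_subset[OF t(2)] continuous_on_subset[OF t(3)[OF b]]; simp)+
  then obtain B\<^sub>1 B\<^sub>2 where "\<forall>x\<in>closure \<Omega>. \<bar>\<phi> x\<bar> \<le> B\<^sub>1" "\<forall>x\<in>closure \<Omega>. \<bar>\<phi>' x\<bar> \<le> B\<^sub>2"
    by (auto simp: bounded_iff)
  then obtain B where B: "\<And>x. x \<in> \<Omega> \<Longrightarrow> \<bar>\<phi> x\<bar> \<le> B" "\<And>x. x \<in> \<Omega> \<Longrightarrow> \<bar>\<phi>' x\<bar> \<le> B"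
    using closure_subset[of \<Omega>] by (metis max.bounded_iff max.cobounded1 max.cobounded2 order_trans subsetD)
  define K where "K = closure {x. \<phi> x \<noteq> 0}"
  have K: "closed K" "K \<subseteq> \<Omega>" "\<And>x. x \<notin> K \<Longrightarrow> \<phi> x = 0"
    using \<phi> closure_subset[of "{x. \<phi> x \<noteq> 0}"] by (auto simp: K_def test_functions_def)
  have der\<phi>: "((\<lambda>t. \<phi> (x + t *\<^sub>R b)) has_real_derivative \<phi>' x) (at 0)" for x
  proof -
    have "((\<lambda>t. \<phi> (x + t *\<^sub>R b)) has_derivative (\<lambda>t. frechet_derivative \<phi> (at x) (t *\<^sub>R b))) (at 0)"
      by (rule has_derivative_compose[of "\<lambda>t. x + t *\<^sub>R b" "\<lambda>t. t *\<^sub>R b" _ _ \<phi>])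
         (use t(1) in \<open>auto intro!: derivative_eq_intros\<close>)
    moreover have "frechet_derivative \<phi> (at x) (s *\<^sub>R b) = \<phi>' x * s" for s
      using has_derivative_linear[OF t(1)[of x]] by (simp add: \<phi>'_def linear_scale)
    ultimately show ?thesis by (simp add: has_field_derivative_def)
  qed
  define \<psi> where "\<psi> = (\<lambda>x. indicator \<Omega> x * (u x * \<phi> x))"
  define \<psi>' where "\<psi>' = (\<lambda>x. indicator \<Omega> x * (D x * \<phi> x + u x * \<phi>' x))"
  have [measurable]: "\<psi> \<in> borel_measurable borel" "\<psi>' \<in> borel_measurable borel"
    unfolding \<psi>_def \<psi>'_def by measurable
  have ev: "eventually (\<lambda>t. x + t *\<^sub>R b \<in> S) (nhds 0)" if "open S" "x \<in> S" for x and S :: "'a set"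
  proof -
    have "((\<lambda>t. x + t *\<^sub>R b) \<longlongrightarrow> x + 0 *\<^sub>R b) (nhds 0)"
      by (intro tendsto_intros) (simp add: filterlim_ident)
    then show ?thesis using that by (intro topological_tendstoD[of _ x]) auto
  qed
  have der\<psi>: "((\<lambda>t. \<psi> (x + t *\<^sub>R b)) has_real_derivative \<psi>' x) (at 0)" for x
  proof (cases "x \<in> \<Omega>")
    case True
    have "((\<lambda>t. u (x + t *\<^sub>R b) * \<phi> (x + t *\<^sub>R b)) has_real_derivative D x * \<phi> x + u x * \<phi>' x) (at 0)"
      using DERIV_mult[OF der[OF True] der\<phi>[of x]] by (simp add: mult.commute)
    moreover have "eventually (\<lambda>t. u (x + t *\<^sub>R b) * \<phi> (x + t *\<^sub>R b) = \<psi> (x + t *\<^sub>R b)) (nhds 0)"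
      using ev[OF op True] by eventually_elim (simp add: \<psi>_def)
    ultimately show ?thesis using True by (subst (asm) DERIV_cong_ev) (auto simp: \<psi>'_def)
  next
    case False
    then have "x \<in> - K" using K(2) by blast
    then have "eventually (\<lambda>t. x + t *\<^sub>R b \<in> - K) (nhds 0)" using K(1) by (intro ev) auto
    then have "eventually (\<lambda>t. 0 = \<psi> (x + t *\<^sub>R b)) (nhds 0)"
      by (rule eventually_mono) (auto simp: \<psi>_def K(3))
    moreover have "((\<lambda>t. 0) has_real_derivative \<psi>' x) (at 0)" using False by (simp add: \<psi>'_def)
    ultimately show ?thesis by (subst (asm) DERIV_cong_ev) auto
  qed
  have der\<psi>t: "((\<lambda>s. \<psi> (x + s *\<^sub>R b)) has_real_derivative \<psi>' (x + t *\<^sub>R b)) (at t)" for x t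
  proof -
    have "((\<lambda>s. \<psi> ((x + t *\<^sub>R b) + s *\<^sub>R b)) has_real_derivative \<psi>' (x + t *\<^sub>R b)) (at (t - t))"
      using der\<psi>[of "x + t *\<^sub>R b"] by simp
    then have "((\<lambda>s. \<psi> ((x + t *\<^sub>R b) + (s - t) *\<^sub>R b)) has_real_derivative \<psi>' (x + t *\<^sub>R b)) (at t)"
      using DERIV_shift[of "\<lambda>s. \<psi> ((x + t *\<^sub>R b) + s *\<^sub>R b)" _ t "- t"] by simp
    then show ?thesis by (simp add: algebra_simps)
  qed
  define C where "C = \<bar>M\<bar> * \<bar>B\<bar> + \<bar>M\<bar> * \<bar>B\<bar>"
  have C: "\<bar>\<psi>' x\<bar> \<le> C" for x
  proof (cases "x \<in> \<Omega>")
    case True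
    have "\<bar>D x * \<phi> x + u x * \<phi>' x\<bar> \<le> \<bar>D x\<bar> * \<bar>\<phi> x\<bar> + \<bar>u x\<bar> * \<bar>\<phi>' x\<bar>"
      by (metis abs_mult abs_triangle_ineq)
    also have "\<dots> \<le> C" unfolding C_def
      using bnd[OF True] B[OF True] by (intro add_mono mult_mono) auto
    finally show ?thesis using True by (simp add: \<psi>'_def)
  qed (simp add: \<psi>'_def C_def)
  have Lip: "\<bar>\<psi> (x + t *\<^sub>R b) - \<psi> x\<bar> \<le> C * t" if t: "t > 0" for x t
  proof -
    obtain z where "\<psi> (x + t *\<^sub>R b) - \<psi> (x + 0 *\<^sub>R b) = (t - 0) * \<psi>' (x + z *\<^sub>R b)"
      using MVT2[of 0 t "\<lambda>s. \<psi> (x + s *\<^sub>R b)" "\<lambda>s. \<psi>' (x + s *\<^sub>R b)"] der\<psi>t t by blast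
    then show ?thesis using C t by (simp add: abs_mult)
  qed
  obtain r where r: "\<And>x. x \<in> \<Omega> \<Longrightarrow> norm x \<le> r" using bd by (auto simp: bounded_iff)
  have bs: "integrable lborel (\<lambda>x. K' * indicator (cball (0::'a) s) x)" for K' s :: real
    by (intro integrable_mult_right integrable_real_indicator) (auto intro: emeasure_bounded_finite[unfolded infinity_ennreal_def])
  have int\<psi>: "integrable lborel \<psi>"
  proof (rule Bochner_Integration.integrable_bound[OF bs[of "\<bar>M\<bar> * \<bar>B\<bar>" r]])
    show "AE x in lborel. norm (\<psi> x) \<le> norm (\<bar>M\<bar> * \<bar>B\<bar> * indicator (cball 0 r) x)"
    proof (intro AE_I2)
      fix x
      have "\<bar>u x\<bar> * \<bar>\<phi> x\<bar> \<le> \<bar>M\<bar> * \<bar>B\<bar>" if "x \<in> \<Omega>"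
        using bnd(1)[OF that] B(1)[OF that] by (intro mult_mono) auto
      then show "norm (\<psi> x) \<le> norm (\<bar>M\<bar> * \<bar>B\<bar> * indicator (cball 0 r) x)"
        using r by (auto simp: \<psi>_def indicator_def abs_mult)
    qed
  qed simp
  define h where "h = (\<lambda>n. 1 / real (Suc n))"
  have h: "0 < h n" "h n \<le> 1" for n by (simp_all add: h_def)
  have h0: "h \<longlonglongrightarrow> 0" unfolding h_def by (rule LIMSEQ_Suc[OF lim_1_over_n])
  define q where "q = (\<lambda>n x. (\<psi> (x + h n *\<^sub>R b) - \<psi> x) / h n)"
  have [measurable]: "q n \<in> borel_measurable borel" for n unfolding q_def by measurable
  have q0: "(LINT x|lborel. q n x) = 0" for n
  proof -
    have "(LINT x|lborel. \<psi> x) = (LINT x|distr lborel borel ((+) (h n *\<^sub>R b)). \<psi> x)"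
      by (simp add: lborel_distr_plus)
    also have "\<dots> = (LINT x|lborel. \<psi> (h n *\<^sub>R b + x))" by (rule integral_distr) auto
    finally have e: "(LINT x|lborel. \<psi> (x + h n *\<^sub>R b)) = (LINT x|lborel. \<psi> x)" by (simp add: add.commute)
    have "integrable (distr lborel borel ((+) (h n *\<^sub>R b))) \<psi>" using int\<psi> by (simp add: lborel_distr_plus)
    then have "integrable lborel (\<lambda>x. \<psi> (h n *\<^sub>R b + x))" by (subst (asm) integrable_distr_eq) auto
    then have "integrable lborel (\<lambda>x. \<psi> (x + h n *\<^sub>R b))" by (simp add: add.commute)
    then show ?thesis unfolding q_def using int\<psi> e by simp
  qed
  have "(\<lambda>n. LINT x|lborel. q n x) \<longlonglongrightarrow> (LINT x|lborel. \<psi>' x)"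
  proof (rule integral_dominated_convergence[OF _ _ bs[of C "r + 1"]])
    show "AE x in lborel. (\<lambda>n. q n x) \<longlonglongrightarrow> \<psi>' x"
    proof (intro AE_I2)
      fix x
      have "((\<lambda>t. (\<psi> (x + t *\<^sub>R b) - \<psi> x) / t) \<longlongrightarrow> \<psi>' x) (at 0)"
        using der\<psi>[of x] by (simp add: DERIV_def)
      moreover have "filterlim h (at 0) sequentially"
        using h0 h by (auto simp: filterlim_at intro!: always_eventually less_imp_neq[symmetric])
      ultimately show "(\<lambda>n. q n x) \<longlonglongrightarrow> \<psi>' x"
        unfolding q_def by (rule filterlim_compose)
    qed
    fix n
    show "AE x in lborel. norm (q n x) \<le> C * indicator (cball 0 (r + 1)) x"
    proof (intro AE_I2)
      fix x :: 'a
      show "norm (q n x) \<le> C * indicator (cball 0 (r + 1)) x"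
      proof (cases "norm x \<le> r + 1")
        case True
        then show ?thesis using Lip[OF h(1), of x n] h[of n] by (simp add: q_def divide_le_eq)
      next
        case False
        have "norm x \<le> norm (x + h n *\<^sub>R b) + h n"
          using norm_triangle_ineq4[of "x + h n *\<^sub>R b" "h n *\<^sub>R b"] b h[of n] by simp
        then have "x \<notin> \<Omega>" "x + h n *\<^sub>R b \<notin> \<Omega>" using False r[of x] r[of "x + h n *\<^sub>R b"] h[of n] by auto
        then show ?thesis using False by (simp add: q_def \<psi>_def)
      qed
    qed
  qed measurable
  then have "(LINT x|lborel. \<psi>' x) = 0" using q0 by (simp add: LIMSEQ_const_iff)
  then have "(LINT x|lebesgue_on \<Omega>. D x * \<phi> x + u x * \<phi>' x) = 0"
    by (subst integral_lebesgue_on_borel) (auto simp: \<psi>'_def)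
  moreover have i: "integrable (lebesgue_on \<Omega>) (\<lambda>x. f x * g x)"
    if "\<And>x. x \<in> \<Omega> \<Longrightarrow> \<bar>f x\<bar> \<le> M" "\<And>x. x \<in> \<Omega> \<Longrightarrow> \<bar>g x\<bar> \<le> B"
      and [measurable]: "f \<in> borel_measurable borel" "g \<in> borel_measurable borel" for f g :: "'a \<Rightarrow> real"
  proof -
    have "\<bar>f x\<bar> * \<bar>g x\<bar> \<le> \<bar>M\<bar> * \<bar>B\<bar>" if "x \<in> \<Omega>" for x
      using \<open>\<And>x. x \<in> \<Omega> \<Longrightarrow> \<bar>f x\<bar> \<le> M\<close>[OF that] \<open>\<And>x. x \<in> \<Omega> \<Longrightarrow> \<bar>g x\<bar> \<le> B\<close>[OF that] by (intro mult_mono) auto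
    then have "norm (indicator \<Omega> x * (f x * g x)) \<le> norm (\<bar>M\<bar> * \<bar>B\<bar> * indicator (cball 0 r) x)" for x
      using r by (auto simp: indicator_def abs_mult)
    then have "integrable lborel (\<lambda>x. indicator \<Omega> x * (f x * g x))"
      by (intro Bochner_Integration.integrable_bound[OF bs[of "\<bar>M\<bar> * \<bar>B\<bar>" r]]) auto
    then show ?thesis by (subst integral_lebesgue_on_borel) auto
  qed
  ultimately have "(LINT x|lebesgue_on \<Omega>. D x * \<phi> x) + (LINT x|lebesgue_on \<Omega>. u x * \<phi>' x) = 0"
    using bnd B by (subst Bochner_Integration.integral_add[symmetric]) auto
  then show "(LINT x|lebesgue_on \<Omega>. u x * frechet_derivative \<phi> (at x) b) = - (LINT x|lebesgue_on \<Omega>. D x * \<phi> x)"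
    by (simp add: \<phi>'_def)
qed

section \<open>Coercive nonlocal operators on a finite measure space\<close>

lemma abs_mult_le_squares: "\<bar>a * b\<bar> \<le> a\<^sup>2 + b\<^sup>2" for a b :: real
proof -
  have "2 * \<bar>a * b\<bar> \<le> a\<^sup>2 + b\<^sup>2"
    using sum_squares_bound[of "\<bar>a\<bar>" "\<bar>b\<bar>"] by (simp add: abs_mult mult.assoc)
  then show ?thesis using abs_ge_zero[of "a * b"] by linarith
qed

text \<open>
  The integral equation without its geometry.  The lower bound \<open>c\<close> for the mass of the kernel makes the
  diagonal part of the operator invertible; the upper bound \<open>B\<close> makes the averages bounded functions.
\<close>

locale nonlocal_kernel = finite_measure M for M :: "'a measure" +
  fixes k :: "'a \<Rightarrow> 'a \<Rightarrow> real" and \<sigma> :: "'a \<Rightarrow> real" and B c :: real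
  assumes k_measurable [measurable]: "(\<lambda>z. k (fst z) (snd z)) \<in> borel_measurable (M \<Otimes>\<^sub>M M)"
    and k_measurable_snd [measurable]: "\<And>x. k x \<in> borel_measurable M"
    and k_nonneg: "\<And>x y. 0 \<le> k x y" and k_le: "\<And>x y. k x y \<le> B" and k_sym: "\<And>x y. k x y = k y x"
    and \<sigma>_measurable [measurable]: "\<sigma> \<in> borel_measurable M"
    and \<sigma>_nonneg: "\<And>x. 0 \<le> \<sigma> x" and \<sigma>_le: "\<And>x. \<sigma> x \<le> B"
    and c_pos: "c > 0" and weight_ge: "\<And>x. x \<in> space M \<Longrightarrow> c \<le> (LINT y|M. k x y)"
begin

definition weight :: "'a \<Rightarrow> real" where
  "weight x = (LINT y|M. k x y)"

definition avg :: "('a \<Rightarrow> real) \<Rightarrow> 'a \<Rightarrow> real" where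
  "avg v x = (LINT y|M. k x y * v y)"

definition nl_op :: "('a \<Rightarrow> real) \<Rightarrow> 'a \<Rightarrow> real" where
  "nl_op v x = (weight x + \<sigma> x) * v x - avg v x"

definition form :: "('a \<Rightarrow> real) \<Rightarrow> real" where
  "form v = (LINT x|M. LINT y|M. k x y * (v x - v y)\<^sup>2) / 2 + (LINT x|M. \<sigma> x * (v x)\<^sup>2)"

lemma B_nonneg: "B \<ge> 0"
  using k_nonneg k_le order_trans by blast

lemma L2_measurable [dest]: "v \<in> L2 M \<Longrightarrow> v \<in> borel_measurable M"
  by (simp add: L2_def)

lemma L2_square_integrable: "v \<in> L2 M \<Longrightarrow> integrable M (\<lambda>x. (v x)\<^sup>2)"
  by (simp add: L2_def)

lemma L2_integrable: "v \<in> L2 M \<Longrightarrow> integrable M v"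
  by (auto simp: L2_def intro: square_integrable_imp_integrable)

lemma L2_affine_bound:
  assumes f: "f \<in> L2 M" and [measurable]: "h \<in> borel_measurable M"
    and h: "\<And>x. x \<in> space M \<Longrightarrow> \<bar>h x\<bar> \<le> a + b * \<bar>f x\<bar>"
  shows "h \<in> L2 M"
proof -
  have int: "integrable M (\<lambda>x. 2 * a\<^sup>2 + 2 * b\<^sup>2 * (f x)\<^sup>2)"
    using L2_square_integrable[OF f] by (intro Bochner_Integration.integrable_add integrable_mult_right) auto
  have bnd: "(h x)\<^sup>2 \<le> 2 * a\<^sup>2 + 2 * b\<^sup>2 * (f x)\<^sup>2" if x: "x \<in> space M" for x
  proof -
    have "(h x)\<^sup>2 \<le> (a + b * \<bar>f x\<bar>)\<^sup>2" using h[OF x] by (metis abs_ge_zero order_trans power2_abs power_mono)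
    also have "\<dots> \<le> 2 * a\<^sup>2 + 2 * (b * \<bar>f x\<bar>)\<^sup>2"
      using square_diff_le[of a "- (b * \<bar>f x\<bar>)" 0] by simp
    finally show ?thesis by (simp add: power_mult_distrib)
  qed
  have "integrable M (\<lambda>x. (h x)\<^sup>2)"
  proof (rule Bochner_Integration.integrable_bound[OF int])
    show "AE x in M. norm ((h x)\<^sup>2) \<le> norm (2 * a\<^sup>2 + 2 * b\<^sup>2 * (f x)\<^sup>2)"
    proof (intro AE_I2)
      fix x assume "x \<in> space M"
      from bnd[OF this] show "norm ((h x)\<^sup>2) \<le> norm (2 * a\<^sup>2 + 2 * b\<^sup>2 * (f x)\<^sup>2)" by simp
    qed
  qed simp
  then show ?thesis by (simp add: L2_def)
qed

lemma L2_diff: "v \<in> L2 M \<Longrightarrow> w \<in> L2 M \<Longrightarrow> (\<lambda>x. v x - w x) \<in> L2 M"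
proof -
  assume v: "v \<in> L2 M" and w: "w \<in> L2 M"
  have [measurable]: "v \<in> borel_measurable M" "w \<in> borel_measurable M" using v w by auto
  have "integrable M (\<lambda>x. 2 * (v x)\<^sup>2 + 2 * (w x)\<^sup>2)"
    using v w by (auto dest!: L2_square_integrable)
  moreover have "(v x - w x)\<^sup>2 \<le> 2 * (v x)\<^sup>2 + 2 * (w x)\<^sup>2" for x
    using square_diff_le[of "v x" "w x" 0] by simp
  ultimately have "integrable M (\<lambda>x. (v x - w x)\<^sup>2)"
    by (elim Bochner_Integration.integrable_bound) auto
  then show "(\<lambda>x. v x - w x) \<in> L2 M" by (simp add: L2_def)
qed

lemma L2_mult_integrable:
  assumes v: "v \<in> L2 M" and w: "w \<in> L2 M"
  shows "integrable M (\<lambda>x. v x * w x)"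
proof -
  have [measurable]: "v \<in> borel_measurable M" "w \<in> borel_measurable M" using v w by auto
  have "integrable M (\<lambda>x. (v x)\<^sup>2 + (w x)\<^sup>2)" using v w by (auto dest!: L2_square_integrable)
  then show ?thesis
    by (rule Bochner_Integration.integrable_bound) (auto simp: abs_mult_le_squares)
qed

lemma kernel_mult_integrable:
  assumes "integrable M v"
  shows "integrable M (\<lambda>y. k x y * v y)"
proof (rule Bochner_Integration.integrable_bound[of _ "\<lambda>y. B * \<bar>v y\<bar>"])
  show "(\<lambda>y. k x y * v y) \<in> borel_measurable M" using assms by measurable
  show "AE y in M. norm (k x y * v y) \<le> norm (B * \<bar>v y\<bar>)"
    using k_nonneg k_le B_nonneg by (intro AE_I2) (auto simp: abs_mult intro!: mult_right_mono)
qed (use assms in auto)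

lemma kernel_integrable: "integrable M (k x)"
  using kernel_mult_integrable[of "\<lambda>_. 1" x] by simp

lemma weight_measurable [measurable]: "weight \<in> borel_measurable M"
  unfolding weight_def by measurable

lemma avg_measurable [measurable]:
  assumes [measurable]: "v \<in> borel_measurable M"
  shows "avg v \<in> borel_measurable M"
  unfolding avg_def by measurable

lemma weight_bounds: "0 \<le> weight x" "weight x \<le> B * measure M (space M)"
proof -
  show "0 \<le> weight x" unfolding weight_def by (intro Bochner_Integration.integral_nonneg k_nonneg)
  have "weight x \<le> (LINT y|M. B)"
    unfolding weight_def by (intro integral_mono kernel_integrable) (auto intro: k_le)
  then show "weight x \<le> B * measure M (space M)" by (simp add: mult.commute)
qed

lemma avg_mono:
  assumes "integrable M v" "integrable M w" "\<And>y. y \<in> space M \<Longrightarrow> v y \<le> w y"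
  shows "avg v x \<le> avg w x"
  unfolding avg_def using assms
  by (intro integral_mono kernel_mult_integrable mult_left_mono k_nonneg)

lemma avg_abs_le:
  assumes v: "integrable M v"
  shows "\<bar>avg v x\<bar> \<le> B * (LINT y|M. \<bar>v y\<bar>)"
proof -
  have "\<bar>avg v x\<bar> \<le> (LINT y|M. \<bar>k x y * v y\<bar>)"
    unfolding avg_def using integral_norm_bound[of M "\<lambda>y. k x y * v y"] by simp
  also have "\<dots> \<le> (LINT y|M. B * \<bar>v y\<bar>)"
    using v k_nonneg k_le
    by (intro integral_mono integrable_mult_right integrable_abs kernel_mult_integrable)
       (auto simp: abs_mult intro!: mult_right_mono)
  finally show ?thesis by simp
qed

lemma product_integrable:
  assumes v: "v \<in> L2 M"
  shows "integrable (M \<Otimes>\<^sub>M M) (\<lambda>(x, y). k x y * (v x)\<^sup>2)"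
    "integrable (M \<Otimes>\<^sub>M M) (\<lambda>(x, y). k x y * (v y)\<^sup>2)"
    "integrable (M \<Otimes>\<^sub>M M) (\<lambda>(x, y). k x y * (v x * v y))"
    "integrable (M \<Otimes>\<^sub>M M) (\<lambda>(x, y). k x y * (v x - v y)\<^sup>2)"
proof -
  interpret PP: pair_sigma_finite M M ..
  have [measurable]: "v \<in> borel_measurable M" using v by auto
  note v2 = L2_square_integrable[OF v]
  have i1: "integrable (M \<Otimes>\<^sub>M M) (\<lambda>(x, y). k x y * (v x)\<^sup>2)"
  proof (rule PP.Fubini_integrable)
    have "(\<lambda>z. k (fst z) (snd z) * (v (fst z))\<^sup>2) \<in> borel_measurable (M \<Otimes>\<^sub>M M)" by measurable
    then show "(\<lambda>(x, y). k x y * (v x)\<^sup>2) \<in> borel_measurable (M \<Otimes>\<^sub>M M)" by (simp add: case_prod_beta')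
    have "(\<lambda>x. LINT y|M. norm (case (x, y) of (x, y) \<Rightarrow> k x y * (v x)\<^sup>2)) = (\<lambda>x. weight x * (v x)\<^sup>2)"
      by (auto simp: weight_def abs_mult k_nonneg)
    moreover have "integrable M (\<lambda>x. weight x * (v x)\<^sup>2)"
      by (rule Bochner_Integration.integrable_bound[OF integrable_mult_right[OF v2, of "B * measure M (space M)"]])
         (auto simp: abs_mult weight_bounds B_nonneg intro!: mult_right_mono)
    ultimately show "integrable M (\<lambda>x. LINT y|M. norm (case (x, y) of (x, y) \<Rightarrow> k x y * (v x)\<^sup>2))" by simp
    show "AE x in M. integrable M (\<lambda>y. case (x, y) of (x, y) \<Rightarrow> k x y * (v x)\<^sup>2)"
      by (auto intro: kernel_integrable)
  qed
  have i2: "integrable (M \<Otimes>\<^sub>M M) (\<lambda>(x, y). k x y * (v y)\<^sup>2)"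
    using PP.integrable_product_swap[OF i1] by (simp add: k_sym[of "snd _"] case_prod_beta' k_sym)
  have i3: "integrable (M \<Otimes>\<^sub>M M) (\<lambda>(x, y). k x y * (v x * v y))"
  proof (rule Bochner_Integration.integrable_bound[OF Bochner_Integration.integrable_add[OF i1 i2]])
    have "(\<lambda>z. k (fst z) (snd z) * (v (fst z) * v (snd z))) \<in> borel_measurable (M \<Otimes>\<^sub>M M)" by measurable
    then show "(\<lambda>(x, y). k x y * (v x * v y)) \<in> borel_measurable (M \<Otimes>\<^sub>M M)" by (simp add: case_prod_beta')
    show "AE z in M \<Otimes>\<^sub>M M. norm (case z of (x, y) \<Rightarrow> k x y * (v x * v y))
        \<le> norm ((case z of (x, y) \<Rightarrow> k x y * (v x)\<^sup>2) + (case z of (x, y) \<Rightarrow> k x y * (v y)\<^sup>2))"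
      by (intro AE_I2) (auto simp: abs_mult[of "k _ _"] k_nonneg distrib_left[symmetric] intro!: mult_left_mono abs_mult_le_squares)
  qed
  show "integrable (M \<Otimes>\<^sub>M M) (\<lambda>(x, y). k x y * (v x)\<^sup>2)"
    "integrable (M \<Otimes>\<^sub>M M) (\<lambda>(x, y). k x y * (v y)\<^sup>2)"
    "integrable (M \<Otimes>\<^sub>M M) (\<lambda>(x, y). k x y * (v x * v y))" by (fact i1 i2 i3)+
  have "integrable (M \<Otimes>\<^sub>M M) (\<lambda>(x, y). k x y * (v x)\<^sup>2 + k x y * (v y)\<^sup>2 - 2 * (k x y * (v x * v y)))"
    using i1 i2 i3 by (auto simp: case_prod_beta')
  then show "integrable (M \<Otimes>\<^sub>M M) (\<lambda>(x, y). k x y * (v x - v y)\<^sup>2)"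
    by (simp add: power2_eq_square algebra_simps)
qed

lemma sigma_square_integrable:
  assumes v: "v \<in> L2 M"
  shows "integrable M (\<lambda>x. \<sigma> x * (v x)\<^sup>2)"
proof -
  have [measurable]: "v \<in> borel_measurable M" using v by auto
  show ?thesis
    by (rule Bochner_Integration.integrable_bound[OF integrable_mult_right[OF L2_square_integrable[OF v], of B]])
       (auto simp: abs_mult \<sigma>_nonneg \<sigma>_le B_nonneg intro!: mult_right_mono)
qed

lemma nn_integral_form:
  assumes v: "v \<in> L2 M"
  shows "(\<integral>\<^sup>+x. \<integral>\<^sup>+y. ennreal (k x y * (v x - v y)\<^sup>2) \<partial>M \<partial>M)
      = ennreal (LINT x|M. LINT y|M. k x y * (v x - v y)\<^sup>2)"
    "(\<integral>\<^sup>+x. ennreal (\<sigma> x * (v x)\<^sup>2) \<partial>M) = ennreal (LINT x|M. \<sigma> x * (v x)\<^sup>2)"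
proof -
  interpret PP: pair_sigma_finite M M ..
  have [measurable]: "v \<in> borel_measurable M" using v by auto
  note i = product_integrable(4)[OF v]
  have "(\<lambda>z. ennreal (k (fst z) (snd z) * (v (fst z) - v (snd z))\<^sup>2)) \<in> borel_measurable (M \<Otimes>\<^sub>M M)" by measurable
  then have "(\<integral>\<^sup>+x. \<integral>\<^sup>+y. ennreal (k x y * (v x - v y)\<^sup>2) \<partial>M \<partial>M)
      = (\<integral>\<^sup>+z. ennreal (case z of (x, y) \<Rightarrow> k x y * (v x - v y)\<^sup>2) \<partial>(M \<Otimes>\<^sub>M M))"
    by (subst nn_integral_fst[symmetric]) (simp_all add: case_prod_beta')
  also have "\<dots> = ennreal (integral\<^sup>L (M \<Otimes>\<^sub>M M) (\<lambda>(x, y). k x y * (v x - v y)\<^sup>2))"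
    by (rule nn_integral_eq_integral[OF i]) (auto simp: k_nonneg)
  also have "\<dots> = ennreal (LINT x|M. LINT y|M. k x y * (v x - v y)\<^sup>2)"
    using PP.integral_fst'[OF i] by simp
  finally show "(\<integral>\<^sup>+x. \<integral>\<^sup>+y. ennreal (k x y * (v x - v y)\<^sup>2) \<partial>M \<partial>M)
      = ennreal (LINT x|M. LINT y|M. k x y * (v x - v y)\<^sup>2)" .
  show "(\<integral>\<^sup>+x. ennreal (\<sigma> x * (v x)\<^sup>2) \<partial>M) = ennreal (LINT x|M. \<sigma> x * (v x)\<^sup>2)"
    by (rule nn_integral_eq_integral[OF sigma_square_integrable[OF v]]) (auto simp: \<sigma>_nonneg)
qed

text \<open>
  Expanding the square in the form gives two diagonal terms, which agree since the kernel is symmetric.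
\<close>

lemma energy_identity:
  assumes v: "v \<in> L2 M"
  shows "(LINT x|M. v x * nl_op v x) = form v"
proof -
  interpret PP: pair_sigma_finite M M ..
  note i1 = product_integrable(1)[OF v] and i2 = product_integrable(2)[OF v] and i3 = product_integrable(3)[OF v]
  note i\<sigma> = sigma_square_integrable[OF v]
  define A where "A = integral\<^sup>L (M \<Otimes>\<^sub>M M) (\<lambda>(x, y). k x y * (v x)\<^sup>2)"
  define X where "X = integral\<^sup>L (M \<Otimes>\<^sub>M M) (\<lambda>(x, y). k x y * (v x * v y))"
  have A2: "integral\<^sup>L (M \<Otimes>\<^sub>M M) (\<lambda>(x, y). k x y * (v y)\<^sup>2) = A"
    using PP.integral_product_swap[of "\<lambda>(x, y). k x y * (v x)\<^sup>2"] i1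
    by (simp add: A_def k_sym case_prod_beta')
  have fst1: "(LINT x|M. weight x * (v x)\<^sup>2) = A" "integrable M (\<lambda>x. weight x * (v x)\<^sup>2)"
    using PP.integral_fst'[OF i1] PP.integrable_fst'[OF i1] by (simp_all add: A_def weight_def)
  have fst3: "(LINT x|M. v x * avg v x) = X" "integrable M (\<lambda>x. v x * avg v x)"
  proof -
    have "(LINT y|M. k x y * (v x * v y)) = v x * avg v x" for x
      unfolding avg_def by (subst Bochner_Integration.integral_mult_right_zero[symmetric]) (simp add: mult_ac)
    then show "(LINT x|M. v x * avg v x) = X" "integrable M (\<lambda>x. v x * avg v x)"
      using PP.integral_fst'[OF i3] PP.integrable_fst'[OF i3] by (simp_all add: X_def)
  qed
  have "(LINT x|M. LINT y|M. k x y * (v x - v y)\<^sup>2)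
      = integral\<^sup>L (M \<Otimes>\<^sub>M M) (\<lambda>(x, y). k x y * (v x)\<^sup>2 + k x y * (v y)\<^sup>2 - 2 * (k x y * (v x * v y)))"
  proof -
    have "integrable (M \<Otimes>\<^sub>M M) (\<lambda>(x, y). k x y * (v x)\<^sup>2 + k x y * (v y)\<^sup>2 - 2 * (k x y * (v x * v y)))"
      using i1 i2 i3 by (auto simp: case_prod_beta')
    from PP.integral_fst'[OF this] show ?thesis by (simp add: power2_eq_square algebra_simps)
  qed
  also have "\<dots> = A + A - 2 * X"
    using i1 i2 i3 A2 by (simp add: case_prod_beta' A_def X_def)
  finally have "form v = A - X + (LINT x|M. \<sigma> x * (v x)\<^sup>2)" by (simp add: form_def)
  also have "\<dots> = (LINT x|M. weight x * (v x)\<^sup>2 - v x * avg v x + \<sigma> x * (v x)\<^sup>2)"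
    using fst1 fst3 i\<sigma> by simp
  also have "\<dots> = (LINT x|M. v x * nl_op v x)"
    by (intro Bochner_Integration.integral_cong) (auto simp: nl_op_def power2_eq_square algebra_simps)
  finally show ?thesis by simp
qed

lemma nl_op_L2:
  assumes v: "v \<in> L2 M"
  shows "nl_op v \<in> L2 M"
proof (rule L2_affine_bound[OF v])
  have [measurable]: "v \<in> borel_measurable M" using v by auto
  show "nl_op v \<in> borel_measurable M" unfolding nl_op_def by measurable
  fix x
  have "\<bar>nl_op v x\<bar> \<le> \<bar>weight x + \<sigma> x\<bar> * \<bar>v x\<bar> + \<bar>avg v x\<bar>"
    unfolding nl_op_def by (metis abs_mult abs_triangle_ineq4)
  also have "\<dots> \<le> (B * measure M (space M) + B) * \<bar>v x\<bar> + B * (LINT y|M. \<bar>v y\<bar>)"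
  proof (intro add_mono mult_right_mono)
    show "\<bar>weight x + \<sigma> x\<bar> \<le> B * measure M (space M) + B"
      using weight_bounds[of x] \<sigma>_nonneg[of x] \<sigma>_le[of x] by linarith
  qed (use avg_abs_le[OF L2_integrable[OF v]] in auto)
  finally show "\<bar>nl_op v x\<bar> \<le> B * (LINT y|M. \<bar>v y\<bar>) + (B * measure M (space M) + B) * \<bar>v x\<bar>" by simp
qed

lemma nl_op_diff:
  assumes "v \<in> L2 M" "w \<in> L2 M"
  shows "nl_op (\<lambda>x. v x - w x) x = nl_op v x - nl_op w x"
proof -
  have "avg (\<lambda>x. v x - w x) x = avg v x - avg w x"
    unfolding avg_def right_diff_distrib
    by (intro Bochner_Integration.integral_diff kernel_mult_integrable L2_integrable assms)
  then show ?thesis by (simp add: nl_op_def algebra_simps)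
qed

end

locale nonlocal_operator = nonlocal_kernel +
  fixes P :: real
  assumes P_nonneg: "P \<ge> 0"
    and coercive: "\<And>v. v \<in> L2 M \<Longrightarrow> (LINT x|M. (v x)\<^sup>2) \<le> P * form v"
begin

text \<open>
  Coercivity and the energy identity give \<open>\<parallel>v\<parallel>\<^sup>2 \<le> P \<integral> v F\<close>; only an upper bound of the operator is needed
  because \<open>v\<close> is nonnegative.
\<close>

lemma subsolution_estimate:
  assumes v: "v \<in> L2 M" and F: "F \<in> L2 M"
    and nn: "\<And>x. x \<in> space M \<Longrightarrow> 0 \<le> v x" and sub: "\<And>x. x \<in> space M \<Longrightarrow> nl_op v x \<le> F x"
  shows "(LINT x|M. (v x)\<^sup>2) \<le> P\<^sup>2 * (LINT x|M. (F x)\<^sup>2)"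
proof -
  have "(LINT x|M. (v x)\<^sup>2) \<le> P * form v" by (rule coercive[OF v])
  also have "form v = (LINT x|M. v x * nl_op v x)" by (rule energy_identity[OF v, symmetric])
  also have "P * \<dots> \<le> P * (LINT x|M. v x * F x)"
    using nn sub P_nonneg
    by (intro mult_left_mono integral_mono L2_mult_integrable nl_op_L2 v F) auto
  also have "\<dots> = (LINT x|M. v x * (P * F x))"
    by (subst Bochner_Integration.integral_mult_right_zero[symmetric]) (simp add: mult_ac)
  also have "\<dots> \<le> (LINT x|M. (v x)\<^sup>2 / 2 + P\<^sup>2 * (F x)\<^sup>2 / 2)"
  proof (rule integral_mono)
    show "integrable M (\<lambda>x. v x * (P * F x))"
      using integrable_mult_right[OF L2_mult_integrable[OF v F], of P] by (simp add: mult_ac)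
    show "integrable M (\<lambda>x. (v x)\<^sup>2 / 2 + P\<^sup>2 * (F x)\<^sup>2 / 2)"
      using L2_square_integrable[OF v] L2_square_integrable[OF F] by auto
    fix x
    show "v x * (P * F x) \<le> (v x)\<^sup>2 / 2 + P\<^sup>2 * (F x)\<^sup>2 / 2"
      using sum_squares_bound[of "v x" "P * F x"] by (simp add: power_mult_distrib)
  qed
  also have "\<dots> = (LINT x|M. (v x)\<^sup>2) / 2 + P\<^sup>2 * (LINT x|M. (F x)\<^sup>2) / 2"
    using L2_square_integrable[OF v] L2_square_integrable[OF F] by simp
  finally show ?thesis by simp
qed

text \<open>
  For a nonnegative right-hand side the fixed point iteration starting from 0 increases, because the
  kernel is nonnegative.  Its members are subsolutions, so coercivity bounds them in \<open>L\<^sup>2\<close>, and then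
  the iteration formula bounds them pointwise.  Monotone limits thus replace completeness of \<open>L\<^sup>2\<close>.
\<close>

lemma exists_solution_nonneg:
  assumes F: "F \<in> L2 M" and F0: "\<And>x. x \<in> space M \<Longrightarrow> 0 \<le> F x"
  obtains u where "u \<in> L2 M" "\<And>x. x \<in> space M \<Longrightarrow> nl_op u x = F x"
proof -
  have [measurable]: "F \<in> borel_measurable M" using F by auto
  define m where "m = (\<lambda>x. weight x + \<sigma> x)"
  have [measurable]: "m \<in> borel_measurable M" unfolding m_def by measurable
  have m: "m x \<ge> c" if "x \<in> space M" for x
    using weight_ge[OF that] \<sigma>_nonneg[of x] by (simp add: m_def weight_def)
  have m0: "m x > 0" if "x \<in> space M" for x using m[OF that] c_pos by linarith
  have nl: "nl_op v x = m x * v x - avg v x" for v x by (simp add: nl_op_def m_def)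
  define U where "U = rec_nat (\<lambda>x. 0) (\<lambda>_ v x. (avg v x + F x) / m x)"
  have U0: "U 0 = (\<lambda>x. 0)" and US: "U (Suc n) x = (avg (U n) x + F x) / m x" for n x
    by (simp_all add: U_def)
  have UL: "U n \<in> L2 M" for n
  proof (induction n)
    case 0
    then show ?case by (simp add: U0 L2_def)
  next
    case (Suc n)
    have [measurable]: "U n \<in> borel_measurable M" using Suc by auto
    show ?case
    proof (rule L2_affine_bound[OF F])
      show "U (Suc n) \<in> borel_measurable M"
        unfolding US[abs_def] by measurable
      fix x assume x: "x \<in> space M"
      have "\<bar>U (Suc n) x\<bar> = \<bar>avg (U n) x + F x\<bar> / m x" using m0[OF x] by (simp add: US)
      also have "\<dots> \<le> \<bar>avg (U n) x + F x\<bar> / c"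
        using m[OF x] c_pos by (intro divide_left_mono) auto
      also have "\<dots> \<le> (B * (LINT y|M. \<bar>U n y\<bar>) + \<bar>F x\<bar>) / c"
        using avg_abs_le[OF L2_integrable[OF Suc], of x] c_pos by (intro divide_right_mono) auto
      finally show "\<bar>U (Suc n) x\<bar> \<le> B * (LINT y|M. \<bar>U n y\<bar>) / c + 1 / c * \<bar>F x\<bar>"
        by (simp add: add_divide_distrib)
    qed
  qed
  have Uint: "integrable M (U n)" for n by (rule L2_integrable[OF UL])
  have mono: "0 \<le> U n x \<and> U n x \<le> U (Suc n) x" if "x \<in> space M" for n x
    using that
  proof (induction n arbitrary: x)
    case 0
    then show ?case using m0[OF 0] F0[OF 0] by (simp add: US U0 avg_def)
  next
    case (Suc n)
    have "avg (U n) x \<le> avg (U (Suc n)) x" using Suc.IH by (intro avg_mono Uint) auto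
    then show ?case
      using Suc.IH[OF Suc.prems] m0[OF Suc.prems] by (subst (2) US, subst US) (auto simp: US divide_right_mono)
  qed
  have sub: "nl_op (U n) x \<le> F x" if x: "x \<in> space M" for n x
  proof (cases n)
    case 0
    then show ?thesis using F0[OF x] by (simp add: nl_op_def U0 avg_def)
  next
    case (Suc l)
    have "avg (U l) x \<le> avg (U (Suc l)) x" using mono by (intro avg_mono Uint) auto
    moreover have "m x * U (Suc l) x = avg (U l) x + F x" using m0[OF x] by (simp add: US)
    ultimately show ?thesis by (simp add: nl Suc)
  qed
  define S where "S = P\<^sup>2 * (LINT x|M. (F x)\<^sup>2)"
  define T where "T = (S + measure M (space M)) / 2"
  \<comment> \<open>On a finite measure space the bound in \<open>L\<^sup>2\<close> gives one in \<open>L\<^sup>1\<close>, which bounds the averages.\<close>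
  have "(LINT y|M. \<bar>U n y\<bar>) \<le> T" for n
  proof -
    have "(LINT y|M. \<bar>U n y\<bar>) \<le> (LINT y|M. (U n y)\<^sup>2 / 2 + 1 / 2)"
    proof (rule integral_mono)
      show "\<bar>U n y\<bar> \<le> (U n y)\<^sup>2 / 2 + 1 / 2" for y
        using sum_squares_bound[of "\<bar>U n y\<bar>" 1] by (simp add: field_simps)
    qed (use Uint L2_square_integrable[OF UL] in auto)
    also have "\<dots> = ((LINT y|M. (U n y)\<^sup>2) + measure M (space M)) / 2"
      using L2_square_integrable[OF UL] by (simp add: add_divide_distrib)
    also have "\<dots> \<le> T"
      unfolding T_def S_def using subsolution_estimate[OF UL F, of n] mono sub by (simp add: divide_right_mono)
    finally show ?thesis .
  qed
  then have avgU: "avg (U n) x \<le> B * T" for n x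
    using avg_abs_le[OF Uint, of n x] mult_left_mono[OF _ B_nonneg, of "LINT y|M. \<bar>U n y\<bar>" T] by fastforce
  define W where "W = (\<lambda>x. (B * T + F x) / c)"
  have BT: "0 \<le> B * T" using avgU[of 0] by (simp add: U0 avg_def)
  have UW: "U n x \<le> W x" if x: "x \<in> space M" for n x
  proof -
    have "U n x \<le> U (Suc n) x" using mono[OF x] by simp
    also have "\<dots> = (avg (U n) x + F x) / m x" by (rule US)
    also have "\<dots> \<le> (B * T + F x) / m x" using avgU[of n x] m0[OF x] by (intro divide_right_mono) auto
    also have "\<dots> \<le> W x" unfolding W_def using m[OF x] c_pos m0[OF x] BT F0[OF x] by (intro divide_left_mono) auto
    finally show ?thesis .
  qed
  define u where "u = (\<lambda>x. lim (\<lambda>n. U n x))"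
  have lim: "(\<lambda>n. U n x) \<longlonglongrightarrow> u x" if x: "x \<in> space M" for x
  proof -
    have "incseq (\<lambda>n. U n x)" using mono[OF x] by (intro incseq_SucI) auto
    then have "convergent (\<lambda>n. U n x)"
      using UW[OF x] mono[OF x] by (intro Bseq_mono_convergent BseqI'[of _ "W x"]) (auto simp: incseq_def)
    then show ?thesis by (simp add: u_def convergent_LIMSEQ_iff)
  qed
  have [measurable]: "U n \<in> borel_measurable M" for n using UL by auto
  have [measurable]: "u \<in> borel_measurable M"
    by (rule borel_measurable_LIMSEQ_real[OF lim]) measurable
  have u: "0 \<le> u x" "u x \<le> W x" if x: "x \<in> space M" for x
    using lim[OF x] mono[OF x] UW[OF x] by (auto intro: LIMSEQ_le_const LIMSEQ_le_const2)
  have uL: "u \<in> L2 M"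
  proof (rule L2_affine_bound[OF F])
    fix x assume x: "x \<in> space M"
    show "\<bar>u x\<bar> \<le> B * T / c + 1 / c * \<bar>F x\<bar>"
      using u[OF x] F0[OF x] by (simp add: W_def add_divide_distrib)
  qed measurable
  show ?thesis
  proof (rule that[OF uL])
    fix x assume x: "x \<in> space M"
    have "(\<lambda>n. avg (U n) x) \<longlonglongrightarrow> avg u x"
      unfolding avg_def
    proof (rule integral_dominated_convergence[where w = "\<lambda>y. B * W y"])
      have "integrable M W" unfolding W_def using L2_integrable[OF F] by auto
      then show "integrable M (\<lambda>y. B * W y)" by auto
      show "AE y in M. (\<lambda>n. k x y * U n y) \<longlonglongrightarrow> k x y * u y"
        by (intro AE_I2 tendsto_intros lim)
      show "AE y in M. norm (k x y * U n y) \<le> B * W y" for n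
      proof (intro AE_I2)
        fix y assume y: "y \<in> space M"
        show "norm (k x y * U n y) \<le> B * W y"
          using k_nonneg k_le B_nonneg mono[OF y] UW[OF y] by (auto simp: abs_mult intro!: mult_mono)
      qed
    qed measurable
    then have "(\<lambda>n. (avg (U n) x + F x) / m x) \<longlonglongrightarrow> (avg u x + F x) / m x"
      using m0[OF x] by (intro tendsto_intros) auto
    then have "(\<lambda>n. U (Suc n) x) \<longlonglongrightarrow> (avg u x + F x) / m x" by (simp add: US)
    then have "u x = (avg u x + F x) / m x"
      using LIMSEQ_Suc[OF lim[OF x]] LIMSEQ_unique by blast
    then show "nl_op u x = F x" using m0[OF x] by (simp add: nl field_simps)
  qed
qed

text \<open>
  The operator is linear, so the positive and the negative part of the data are treated separately.
\<close>

theorem exists_solution: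
  assumes F: "F \<in> L2 M"
  obtains u where "u \<in> L2 M" "\<And>x. x \<in> space M \<Longrightarrow> nl_op u x = F x"
proof -
  have [measurable]: "F \<in> borel_measurable M" using F by auto
  have "(\<lambda>x. max (F x) 0) \<in> L2 M" "(\<lambda>x. max (- F x) 0) \<in> L2 M"
    by (rule L2_affine_bound[OF F, where a = 0 and b = 1]; simp)+
  then have F\<^sub>1: "(\<lambda>x. max (F x) 0) \<in> L2 M" and F\<^sub>2: "(\<lambda>x. max (- F x) 0) \<in> L2 M" by auto
  obtain u\<^sub>1 where u1: "u\<^sub>1 \<in> L2 M" "\<And>x. x \<in> space M \<Longrightarrow> nl_op u\<^sub>1 x = max (F x) 0"
    by (rule exists_solution_nonneg[OF F\<^sub>1]) auto
  obtain u\<^sub>2 where u2: "u\<^sub>2 \<in> L2 M" "\<And>x. x \<in> space M \<Longrightarrow> nl_op u\<^sub>2 x = max (- F x) 0"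
    by (rule exists_solution_nonneg[OF F\<^sub>2]) auto
  note u = u1 u2
  show ?thesis
    by (rule that[OF L2_diff[OF u(1,3)]]) (auto simp: nl_op_diff[OF u(1,3)] u(2,4))
qed

theorem solution_unique:
  assumes u: "u \<in> L2 M" and v: "v \<in> L2 M" and eq: "AE x in M. nl_op u x = nl_op v x"
  shows "AE x in M. u x = v x"
proof -
  define w where "w = (\<lambda>x. u x - v x)"
  have w: "w \<in> L2 M" unfolding w_def by (rule L2_diff[OF u v])
  have "AE x in M. w x * nl_op w x = 0"
    using eq by eventually_elim (simp add: w_def nl_op_diff[OF u v])
  then have "form w = 0"
    unfolding energy_identity[OF w, symmetric] by (rule integral_eq_zero_AE)
  then have "(LINT x|M. (w x)\<^sup>2) \<le> 0" using coercive[OF w] by simp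
  then have "(LINT x|M. (w x)\<^sup>2) = 0"
    by (intro antisym) (auto intro: Bochner_Integration.integral_nonneg)
  then have "AE x in M. (w x)\<^sup>2 = 0"
    using L2_square_integrable[OF w] by (subst (asm) integral_nonneg_eq_0_iff_AE) auto
  then show ?thesis by eventually_elim (simp add: w_def)
qed

end

section \<open>Integral estimates\<close>

text \<open>
  With a bound in \<open>ennreal\<close> the integrals on the right may be infinite; if \<open>f\<close> is not integrable, its
  integral is 0 by convention.
\<close>

lemma nn_Cauchy_Schwarz_weighted:
  fixes f p h :: "'a \<Rightarrow> real"
  assumes [measurable]: "f \<in> borel_measurable N" "p \<in> borel_measurable N" "h \<in> borel_measurable N"
    and p: "\<And>y. 0 \<le> p y" and f: "\<And>y. y \<in> space N \<Longrightarrow> \<bar>f y\<bar> \<le> p y * \<bar>h y\<bar>"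
  shows "ennreal ((LINT y|N. f y)\<^sup>2) \<le> (\<integral>\<^sup>+y. ennreal (p y) \<partial>N) * (\<integral>\<^sup>+y. ennreal (p y * (h y)\<^sup>2) \<partial>N)"
proof (cases "integrable N f")
  case True
  define s where "s = (\<lambda>y. ennreal (sqrt (p y)))"
  define t where "t = (\<lambda>y. ennreal (sqrt (p y) * \<bar>h y\<bar>))"
  have [measurable]: "s \<in> borel_measurable N" "t \<in> borel_measurable N" unfolding s_def t_def by measurable
  have "ennreal (norm (LINT y|N. f y)) \<le> (\<integral>\<^sup>+y. ennreal (norm (f y)) \<partial>N)"
    by (rule integral_norm_bound_ennreal[OF True])
  also have "\<dots> \<le> (\<integral>\<^sup>+y. s y * t y \<partial>N)"
  proof (rule nn_integral_mono)
    fix y assume "y \<in> space N"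
    have "s y * t y = ennreal (p y * \<bar>h y\<bar>)"
      using p by (simp add: s_def t_def ennreal_mult[symmetric] mult.assoc[symmetric])
    then show "ennreal (norm (f y)) \<le> s y * t y" using f[OF \<open>y \<in> space N\<close>] by (simp add: ennreal_leI)
  qed
  finally have "(ennreal (norm (LINT y|N. f y)))\<^sup>2 \<le> (\<integral>\<^sup>+y. s y * t y \<partial>N)\<^sup>2"
    by (rule power_mono) simp
  also have "\<dots> \<le> (\<integral>\<^sup>+y. (s y)\<^sup>2 \<partial>N) * (\<integral>\<^sup>+y. (t y)\<^sup>2 \<partial>N)"
    by (rule Cauchy_Schwarz_nn_integral) measurable
  finally show ?thesis
    using p by (simp add: s_def t_def ennreal_power power_mult_distrib)
qed (simp add: not_integrable_integral_eq)

text \<open>Differentiation under the integral sign along a line, by dominated convergence.\<close>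

lemma DERIV_under_integral:
  fixes \<kappa> \<kappa>' :: "real \<Rightarrow> 'b \<Rightarrow> real"
  assumes h: "integrable N h" and [measurable]: "\<And>t. \<kappa> t \<in> borel_measurable N" "\<kappa>' 0 \<in> borel_measurable N"
    and bnd: "\<And>t y. \<bar>\<kappa> t y\<bar> \<le> C" and bnd': "\<And>t y. \<bar>\<kappa>' t y\<bar> \<le> C"
    and der: "\<And>t y. ((\<lambda>s. \<kappa> s y) has_real_derivative \<kappa>' t y) (at t)"
  shows "((\<lambda>t. LINT y|N. \<kappa> t y * h y) has_real_derivative (LINT y|N. \<kappa>' 0 y * h y)) (at 0)"
  unfolding DERIV_def tendsto_at_iff_sequentially
proof (intro allI impI)
  fix X :: "nat \<Rightarrow> real" assume X0: "\<forall>i. X i \<in> UNIV - {0}" and X: "X \<longlonglongrightarrow> 0"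
  have [measurable]: "h \<in> borel_measurable N" using h by auto
  have abs_C: "\<bar>\<kappa> t y\<bar> \<le> \<bar>C\<bar>" for t y by (rule order_trans[OF bnd abs_ge_self])
  have int: "integrable N (\<lambda>y. \<kappa> t y * h y)" for t
    by (rule Bochner_Integration.integrable_bound[OF integrable_mult_right[OF integrable_abs[OF h], of "\<bar>C\<bar>"]])
       (auto simp: abs_mult intro!: mult_right_mono AE_I2 abs_C)
  have eq: "((LINT y|N. \<kappa> (0 + X i) y * h y) - (LINT y|N. \<kappa> 0 y * h y)) / X i
      = (LINT y|N. (\<kappa> (X i) y - \<kappa> 0 y) / X i * h y)" for i
  proof -
    have "(LINT y|N. (\<kappa> (X i) y - \<kappa> 0 y) / X i * h y) = (LINT y|N. (\<kappa> (X i) y * h y - \<kappa> 0 y * h y) / X i)"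
      by (intro Bochner_Integration.integral_cong) (auto simp: left_diff_distrib)
    also have "\<dots> = (LINT y|N. \<kappa> (X i) y * h y - \<kappa> 0 y * h y) / X i" by simp
    also have "\<dots> = ((LINT y|N. \<kappa> (X i) y * h y) - (LINT y|N. \<kappa> 0 y * h y)) / X i" using int by simp
    finally show ?thesis unfolding add_0 by (rule sym)
  qed
  have Lip: "\<bar>(\<kappa> (X i) y - \<kappa> 0 y) / X i\<bar> \<le> C" for i y
  proof -
    have "\<bar>\<kappa> (X i) y - \<kappa> 0 y\<bar> \<le> C * \<bar>X i - 0\<bar>"
      using field_differentiable_bound[of UNIV "\<lambda>s. \<kappa> s y" "\<lambda>t. \<kappa>' t y" C "X i" 0] der bnd' by simp
    then show ?thesis using X0 by (simp add: divide_le_eq)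
  qed
  have "(\<lambda>i. LINT y|N. (\<kappa> (X i) y - \<kappa> 0 y) / X i * h y) \<longlonglongrightarrow> (LINT y|N. \<kappa>' 0 y * h y)"
  proof (rule integral_dominated_convergence[where w = "\<lambda>y. C * \<bar>h y\<bar>"])
    show "AE y in N. (\<lambda>i. (\<kappa> (X i) y - \<kappa> 0 y) / X i * h y) \<longlonglongrightarrow> \<kappa>' 0 y * h y"
    proof (intro AE_I2 tendsto_mult tendsto_const)
      fix y
      have "((\<lambda>t. (\<kappa> (0 + t) y - \<kappa> 0 y) / t) \<longlongrightarrow> \<kappa>' 0 y) (at 0)"
        using der[of y 0] by (simp add: DERIV_def)
      then show "(\<lambda>i. (\<kappa> (X i) y - \<kappa> 0 y) / X i) \<longlonglongrightarrow> \<kappa>' 0 y"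
        unfolding tendsto_at_iff_sequentially using X0 X by (auto simp: o_def)
    qed
    show "AE y in N. norm ((\<kappa> (X i) y - \<kappa> 0 y) / X i * h y) \<le> C * \<bar>h y\<bar>" for i
      using Lip by (intro AE_I2) (simp only: real_norm_def abs_mult, intro mult_right_mono, auto)
  qed (use h in auto)
  then show "((\<lambda>h'. ((LINT y|N. \<kappa> (0 + h') y * h y) - (LINT y|N. \<kappa> 0 y * h y)) / h') \<circ> X)
      \<longlonglongrightarrow> (LINT y|N. \<kappa>' 0 y * h y)"
    unfolding o_def eq .
qed


section \<open>Kernel profiles\<close>

text \<open>
  The bounds \<open>M\<^sub>0\<close> and \<open>M\<^sub>1\<close> exist because \<open>R\<close> is continuously differentiable and vanishes beyond 1.
  Since \<open>R\<close> is an arbitrary function on negative arguments, all conditions are restricted to \<open>r \<ge> 0\<close>.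
\<close>

locale kernel_profile =
  fixes R R' :: "real \<Rightarrow> real" and M\<^sub>0 M\<^sub>1 \<gamma> :: real
  assumes R'_cont: "continuous_on {0..} R'"
    and R_deriv: "\<And>r. r \<ge> 0 \<Longrightarrow> (R has_real_derivative R' r) (at r within {0..})"
    and R_nonneg: "\<And>r. r \<ge> 0 \<Longrightarrow> 0 \<le> R r" and R_le: "\<And>r. r \<ge> 0 \<Longrightarrow> R r \<le> M\<^sub>0"
    and R'_le: "\<And>r. r \<ge> 0 \<Longrightarrow> \<bar>R' r\<bar> \<le> M\<^sub>1"
    and R_zero: "\<And>r. r > 1 \<Longrightarrow> R r = 0" and R'_zero: "\<And>r. r > 1 \<Longrightarrow> R' r = 0"
    and \<gamma>_pos: "\<gamma> > 0" and R_ge: "\<And>r. 0 \<le> r \<Longrightarrow> r \<le> 1 / 2 \<Longrightarrow> \<gamma> \<le> R r"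

lemma kernel_profile_exists:
  assumes C1: "C1_halfline R" and nn: "\<forall>r\<ge>0. R r \<ge> 0" and zero: "\<forall>r>1. R r = 0"
    and pos: "\<exists>\<gamma>\<^sub>0>0. \<forall>r. 0 \<le> r \<and> r \<le> 1 / 2 \<longrightarrow> R r \<ge> \<gamma>\<^sub>0"
  obtains R' M\<^sub>0 M\<^sub>1 \<gamma> where "kernel_profile R R' M\<^sub>0 M\<^sub>1 \<gamma>"
proof -
  obtain R' where R': "continuous_on {0..} R'" "\<forall>r\<ge>0. (R has_real_derivative R' r) (at r within {0..})"
    using C1 by (auto simp: C1_halfline_def)
  obtain \<gamma> where \<gamma>: "\<gamma> > 0" "\<forall>r. 0 \<le> r \<and> r \<le> 1 / 2 \<longrightarrow> R r \<ge> \<gamma>" using pos by auto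
  have cR: "continuous_on {0..} R" by (rule DERIV_continuous_on) (use R' in auto)
  have z': "R' r = 0" if r: "r > 1" for r
  proof -
    have "(R has_real_derivative R' r) (at r within {0..})" using R' r by auto
    then have "(R has_real_derivative R' r) (at r)"
      using r by (subst (asm) at_within_interior) auto
    moreover have "(R has_real_derivative 0) (at r)"
      by (rule has_field_derivative_transform_within_open[of "\<lambda>_. 0" 0 r "{1<..}"]) (use r zero in auto)
    ultimately show ?thesis by (rule DERIV_unique)
  qed
  have "compact (R ` {0..1})" "compact (R' ` {0..1})"
    by (intro compact_continuous_image continuous_on_subset[OF cR] continuous_on_subset[OF R'(1)]; auto)+
  then obtain A\<^sub>0 A\<^sub>1 where A: "\<forall>r\<in>{0..1}. \<bar>R r\<bar> \<le> A\<^sub>0" "\<forall>r\<in>{0..1}. \<bar>R' r\<bar> \<le> A\<^sub>1"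
    by (auto dest!: compact_imp_bounded simp: bounded_iff)
  have "kernel_profile R R' A\<^sub>0 A\<^sub>1 \<gamma>"
  proof
    fix r :: real assume r: "r \<ge> 0"
    have A0: "0 \<le> A\<^sub>0" "0 \<le> A\<^sub>1" using A by (force intro: order_trans[OF abs_ge_zero])+
    show "R r \<le> A\<^sub>0" using A(1) r zero A0 by (cases "r \<le> 1") (auto simp: abs_le_iff)
    show "\<bar>R' r\<bar> \<le> A\<^sub>1" using A(2) r z' A0 by (cases "r \<le> 1") auto
  qed (use R' nn zero \<gamma> z' in auto)
  then show ?thesis by (rule that)
qed

context kernel_profile
begin

lemma R_cont: "continuous_on {0..} R"
  by (rule DERIV_continuous_on) (use R_deriv in auto)

lemma M_nonneg: "0 \<le> M\<^sub>0" "0 \<le> M\<^sub>1"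
  using R_nonneg[of 0] R_le[of 0] R'_le[of 0] by linarith+

lemma Rbar_eq_integral:
  assumes "0 \<le> r" "r \<le> b" "1 \<le> b"
  shows "Rbar R r = integral {r..b} R"
proof -
  have "continuous_on {r..b} R" by (rule continuous_on_subset[OF R_cont]) (use assms in auto)
  then have si: "set_integrable lborel {r..b} R" by (rule borel_integrable_atLeastAtMost')
  have "Rbar R r = (LINT s:{r..b}|lborel. R s)"
    unfolding Rbar_def set_lebesgue_integral_def
    by (intro Bochner_Integration.integral_cong) (use assms R_zero in \<open>auto simp: indicator_def\<close>)
  also have "\<dots> = integral {r..b} R" by (rule set_borel_integral_eq_integral(2)[OF si])
  finally show ?thesis .
qed

lemma R_integrable_on: "0 \<le> a \<Longrightarrow> R integrable_on {a..b}"
  by (intro integrable_continuous_real continuous_on_subset[OF R_cont]) auto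

lemma Rbar_deriv:
  assumes r: "r \<ge> 0"
  shows "(Rbar R has_real_derivative - R r) (at r within {0..})"
proof -
  define b where "b = r + 2"
  have "((\<lambda>t. integral {0..b} R - integral {0..t} R) has_real_derivative 0 - R r) (at r within {0..b})"
    by (intro derivative_intros integral_has_real_derivative continuous_on_subset[OF R_cont])
       (use r in \<open>auto simp: b_def\<close>)
  then have "(Rbar R has_real_derivative - R r) (at r within {0..b})"
  proof (subst has_field_derivative_cong_eventually[where g = "\<lambda>t. integral {0..b} R - integral {0..t} R"])
    have eq: "Rbar R t = integral {0..b} R - integral {0..t} R" if t: "t \<in> {0..b}" for t
    proof -
      have "integral {0..t} R + integral {t..b} R = integral {0..b} R"
        using t by (intro Henstock_Kurzweil_Integration.integral_combine R_integrable_on) auto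
      then show ?thesis using Rbar_eq_integral[of t b] t r by (simp add: b_def)
    qed
    then show "\<forall>\<^sub>F t in at r within {0..b}. Rbar R t = integral {0..b} R - integral {0..t} R"
      by (auto simp: eventually_at_filter)
    show "Rbar R r = integral {0..b} R - integral {0..r} R" using r by (intro eq) (auto simp: b_def)
  qed simp
  moreover have "at r within {0..b} = at r within {0..}"
    by (rule at_within_nhd[of r "{..<b}"]) (auto simp: b_def)
  ultimately show ?thesis by simp
qed

lemma Rbar_cont: "continuous_on {0..} (Rbar R)"
  by (rule DERIV_continuous_on) (use Rbar_deriv in auto)

lemma Rbar_zero: "r > 1 \<Longrightarrow> Rbar R r = 0"
  using Rbar_eq_integral[of r r] by simp

lemma Rbar_nonneg: "r \<ge> 0 \<Longrightarrow> 0 \<le> Rbar R r"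
  using Rbar_eq_integral[of r "r + 1"]
  by (auto intro!: Henstock_Kurzweil_Integration.integral_nonneg intro: R_integrable_on R_nonneg)

lemma Rbar_le: "r \<ge> 0 \<Longrightarrow> Rbar R r \<le> M\<^sub>0"
proof (cases "r > 1")
  case False
  assume r: "r \<ge> 0"
  have "Rbar R r = integral {r..1} R" using r False by (intro Rbar_eq_integral) auto
  also have "\<dots> \<le> integral {r..1} (\<lambda>_. M\<^sub>0)"
    using r by (intro integral_le R_integrable_on R_le) auto
  also have "\<dots> = (1 - r) * M\<^sub>0" using False by simp
  also have "\<dots> \<le> M\<^sub>0" using r M_nonneg by (simp add: mult_left_le_one_le left_diff_distrib)
  finally show ?thesis .
qed (use M_nonneg Rbar_zero in auto)

text \<open>
  The interval \<open>[1/4, 1/2]\<close> alone contributes \<open>\<gamma> / 4\<close>.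
\<close>

lemma Rbar_ge:
  assumes "0 \<le> r" "r \<le> 1 / 4"
  shows "\<gamma> / 4 \<le> Rbar R r"
proof -
  have "integral {1/4..1/2::real} (\<lambda>_. \<gamma>) \<le> integral {1/4..1/2} R"
    by (intro integral_le R_integrable_on) (auto intro: R_ge)
  also have "\<dots> \<le> integral {r..1} R"
    by (rule integral_subset_le) (use assms R_nonneg R_integrable_on in auto)
  also have "\<dots> = Rbar R r" using assms by (intro Rbar_eq_integral[symmetric]) auto
  finally show ?thesis by simp
qed

text \<open>
  The derivative of \<open>2 M\<^sub>1 Rbar - R\<^sup>2\<close> is \<open>- 2 R (M\<^sub>1 + R') \<le> 0\<close>, so this function decreases to 0.
  Through this inequality, the derivative \<open>- R\<close> of the boundary kernel is controlled by the kernel itself.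
\<close>

lemma R_square_le: "r \<ge> 0 \<Longrightarrow> (R r)\<^sup>2 \<le> 2 * M\<^sub>1 * Rbar R r"
proof -
  assume r: "r \<ge> 0"
  define b where "b = r + 2"
  let ?h = "\<lambda>t. 2 * M\<^sub>1 * Rbar R t - (R t)\<^sup>2"
  have "?h b \<le> ?h r"
  proof (rule DERIV_nonpos_imp_decreasing_open[where f = ?h])
    show "r \<le> b" by (simp add: b_def)
    show "continuous_on {r..b} ?h"
      using r by (intro continuous_intros continuous_on_subset[OF R_cont] continuous_on_subset[OF Rbar_cont]) auto
    fix t assume t: "r < t" "t < b"
    have "(R has_real_derivative R' t) (at t)" "(Rbar R has_real_derivative - R t) (at t)"
      using R_deriv[of t] Rbar_deriv[of t] t r at_within_interior[of t "{0..}"] by auto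
    then have "(?h has_real_derivative 2 * M\<^sub>1 * - R t - 2 * R t * R' t) (at t)"
      by (auto intro!: derivative_eq_intros)
    moreover have "2 * M\<^sub>1 * - R t - 2 * R t * R' t \<le> 0"
    proof -
      have "0 \<le> R t * (M\<^sub>1 + R' t)"
        using R_nonneg[of t] R'_le[of t] t r by (intro mult_nonneg_nonneg) auto
      then show ?thesis by (simp add: algebra_simps)
    qed
    ultimately show "\<exists>y. (?h has_real_derivative y) (at t) \<and> y \<le> 0" by blast
  qed
  moreover have "?h b = 0" using r Rbar_zero[of b] R_zero[of b] by (simp add: b_def)
  ultimately show ?thesis by simp
qed

end

lemma scaled_kernel_borel:
  fixes f g :: "'b \<Rightarrow> 'a::euclidean_space"
  assumes K: "continuous_on {0..} K" and [measurable]: "f \<in> N \<rightarrow>\<^sub>M borel" "g \<in> N \<rightarrow>\<^sub>M borel"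
  shows "(\<lambda>z. scaled_kernel \<alpha> K \<delta> (f z) (g z)) \<in> borel_measurable N"
proof -
  have "continuous_on UNIV (\<lambda>r. K (max r 0))"
    by (rule continuous_on_compose2[OF K]) (auto intro!: continuous_intros)
  then have [measurable]: "(\<lambda>r. K (max r 0)) \<in> borel_measurable borel"
    by (rule borel_measurable_continuous_onI)
  have eq: "scaled_kernel \<alpha> K \<delta> x y = \<alpha> / \<delta> ^ DIM('a) * (\<lambda>r. K (max r 0)) ((norm (x - y))\<^sup>2 / (4 * \<delta>\<^sup>2))" for x y :: 'a
    by (simp add: scaled_kernel_def)
  show ?thesis unfolding eq by measurable
qed

lemma scaled_kernel_commute: "scaled_kernel \<alpha> K \<delta> x y = scaled_kernel \<alpha> K \<delta> y x"
  by (simp add: scaled_kernel_def norm_minus_commute)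

lemma scaled_kernel_DERIV:
  fixes x y b :: "'a::euclidean_space"
  assumes K: "\<And>r. r \<ge> 0 \<Longrightarrow> (K has_real_derivative K' r) (at r within {0..})" and \<delta>: "\<delta> > 0"
  shows "((\<lambda>s. scaled_kernel \<alpha> K \<delta> (x + s *\<^sub>R b) y) has_real_derivative
           scaled_kernel \<alpha> K' \<delta> (x + t *\<^sub>R b) y * ((x + t *\<^sub>R b - y) \<bullet> b / (2 * \<delta>\<^sup>2))) (at t)"
proof -
  let ?g = "\<lambda>s. (norm (x + s *\<^sub>R b - y))\<^sup>2 / (4 * \<delta>\<^sup>2)"
  have g: "(?g has_real_derivative ((x + t *\<^sub>R b - y) \<bullet> b / (2 * \<delta>\<^sup>2))) (at t)"
  proof -
    have "((\<lambda>s. (x + s *\<^sub>R b - y) \<bullet> (x + s *\<^sub>R b - y)) has_real_derivative 2 * ((x + t *\<^sub>R b - y) \<bullet> b)) (at t)"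
      unfolding has_field_derivative_def
      by (auto intro!: derivative_eq_intros simp: inner_commute algebra_simps)
    from DERIV_cdivide[OF this, of "4 * \<delta>\<^sup>2"] show ?thesis
      by (simp add: power2_norm_eq_inner)
  qed
  have "((K \<circ> ?g) has_real_derivative K' (?g t) * ((x + t *\<^sub>R b - y) \<bullet> b / (2 * \<delta>\<^sup>2))) (at t)"
  proof (rule DERIV_image_chain[of K "K' (?g t)" ?g t UNIV, simplified])
    show "(K has_real_derivative K' (?g t)) (at (?g t) within range ?g)"
      by (rule DERIV_subset[OF K]) auto
  qed (rule g)
  then have "((\<lambda>s. \<alpha> / \<delta> ^ DIM('a) * K (?g s)) has_real_derivative
      \<alpha> / \<delta> ^ DIM('a) * (K' (?g t) * ((x + t *\<^sub>R b - y) \<bullet> b / (2 * \<delta>\<^sup>2)))) (at t)"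
    by (intro DERIV_cmult) (simp add: o_def)
  then show ?thesis by (simp add: scaled_kernel_def mult.assoc)
qed


section \<open>The surface measure of a bounded C1 domain\<close>

lemma emeasure_surface_measure:
  fixes \<Omega> :: "'a::euclidean_space set"
  assumes "A \<in> sets borel"
  shows "emeasure (surface_measure \<Omega>) (frontier \<Omega> \<inter> A) = hausdorff_outer (DIM('a) - 1) (frontier \<Omega> \<inter> A)"
  unfolding surface_measure_def
  using assms by (subst emeasure_restrict_space)
    (auto simp: sets_hausdorff_measure emeasure_hausdorff_measure borel_closed)

lemma space_surface_measure [simp]:
  fixes \<Omega> :: "'a::euclidean_space set"
  shows "space (surface_measure \<Omega>) = frontier \<Omega>"
proof -
  have "space (hausdorff_measure (DIM('a) - 1) :: 'a measure) = UNIV"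
    using sets_eq_imp_space_eq[OF sets_hausdorff_measure[of "DIM('a) - 1"]] by simp
  then show ?thesis by (simp only: surface_measure_def space_restrict_space Int_UNIV_right)
qed

lemma borel_measurable_surface:
  "h \<in> borel \<rightarrow>\<^sub>M N \<Longrightarrow> h \<in> surface_measure \<Omega> \<rightarrow>\<^sub>M N" for h :: "'a::euclidean_space \<Rightarrow> 'b"
  unfolding surface_measure_def
  by (rule measurable_restrict_space1) (simp add: measurable_cong_sets[OF sets_hausdorff_measure refl])

lemma finite_measure_surface:
  fixes \<Omega> :: "'a::euclidean_space set"
  assumes bd: "bounded \<Omega>" and C: "\<And>x \<rho>. \<rho> > 0 \<Longrightarrow>
    hausdorff_outer (DIM('a) - 1) (frontier \<Omega> \<inter> cball x \<rho>) \<le> ennreal (C * \<rho> ^ (DIM('a) - 1))"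
  shows "finite_measure (surface_measure \<Omega>)"
proof
  have "bounded (frontier \<Omega>)" using bd by (auto simp: frontier_def intro: bounded_subset[OF bounded_closure])
  then obtain \<rho> where \<rho>: "\<rho> > 0" "\<forall>x\<in>frontier \<Omega>. norm x \<le> \<rho>" using bounded_pos by blast
  then have eq: "frontier \<Omega> \<inter> cball 0 \<rho> = frontier \<Omega>" by auto
  have "emeasure (surface_measure \<Omega>) (frontier \<Omega> \<inter> cball 0 \<rho>) \<le> ennreal (C * \<rho> ^ (DIM('a) - 1))"
    by (subst emeasure_surface_measure) (use C \<rho> in auto)
  then show "emeasure (surface_measure \<Omega>) (space (surface_measure \<Omega>)) \<noteq> \<infinity>"
    using eq by (auto simp: top_unique)
qed

section \<open>The integral equation at a fixed scale\<close>

lemma diff_energy_slice_measurable: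
  fixes u :: "'a::euclidean_space \<Rightarrow> real"
  assumes [measurable]: "W \<in> sets (borel \<Otimes>\<^sub>M borel)" "u \<in> borel_measurable borel"
  shows "(\<lambda>y. indicator W (x, y) * ennreal ((u x - u y)\<^sup>2)) \<in> borel_measurable lborel"
  by measurable

text \<open>
  All geometric constants are parameters here, so that every bound proved below for one value of
  \<open>\<delta>\<close> displays how it depends on \<open>\<delta>\<close>.
\<close>

locale scaled_problem = kernel_profile R R' M\<^sub>0 M\<^sub>1 \<gamma>
  for R R' :: "real \<Rightarrow> real" and M\<^sub>0 M\<^sub>1 \<gamma> :: real +
  fixes \<Omega> :: "'a::euclidean_space set" and \<alpha> \<delta> C\<^sub>S C\<^sub>P C\<^sub>D c\<^sub>W :: real
  assumes op: "open \<Omega>" and bd: "bounded \<Omega>" and \<delta>_pos: "\<delta> > 0" and \<alpha>_pos: "\<alpha> > 0"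
    and normalized: "\<And>x::'a. (LINT y|lborel. scaled_kernel \<alpha> (Rbar R) \<delta> x y) = 1"
    and CS_nonneg: "C\<^sub>S \<ge> 0" and surface: "\<And>x \<rho>. \<rho> > 0 \<Longrightarrow>
      hausdorff_outer (DIM('a) - 1) (frontier \<Omega> \<inter> cball x \<rho>) \<le> ennreal (C\<^sub>S * \<rho> ^ (DIM('a) - 1))"
    and CP_pos: "C\<^sub>P > 0" and poincare: "\<And>u s. u \<in> borel_measurable borel \<Longrightarrow> s \<in> borel_measurable borel \<Longrightarrow>
      (\<And>x. x \<in> \<Omega> \<Longrightarrow> hausdorff_outer (DIM('a) - 1) (frontier \<Omega> \<inter> cball x \<delta>) \<le> s x) \<Longrightarrow>
      (\<integral>\<^sup>+x. indicator \<Omega> x * ennreal ((u x)\<^sup>2) \<partial>lborel)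
      \<le> ennreal (C\<^sub>P / \<delta>\<^sup>2) * (nl_energy \<Omega> \<delta> u
            + ennreal (1 / \<delta> ^ (DIM('a) - 1)) * (\<integral>\<^sup>+x. indicator \<Omega> x * (s x * ennreal ((u x)\<^sup>2)) \<partial>lborel))"
    and CD_nonneg: "C\<^sub>D \<ge> 0" and doubling: "\<And>u. u \<in> borel_measurable borel \<Longrightarrow>
      diff_energy (near_pairs \<Omega> (2 * \<delta>)) u \<le> ennreal (C\<^sub>D * \<delta> ^ DIM('a)) * nl_energy \<Omega> \<delta> u"
    and cW_pos: "c\<^sub>W > 0" and density: "\<And>x. x \<in> \<Omega> \<Longrightarrow>
      ennreal (c\<^sub>W * \<delta> ^ DIM('a)) \<le> emeasure lborel (\<Omega> \<inter> cball x (\<delta> / 2))"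
begin

abbreviation "M \<equiv> lebesgue_on \<Omega>"
abbreviation "S \<equiv> surface_measure \<Omega>"

text \<open>
  The kernel \<open>kb\<close> is that of the boundary and data terms; \<open>\<sigma>\<close> is the coefficient that the boundary
  integral gives to \<open>u x\<close> once the equation is multiplied by \<open>\<delta>\<^sup>2\<close>.
\<close>

definition a :: real where "a = \<alpha> / \<delta> ^ DIM('a)"
definition k :: "'a \<Rightarrow> 'a \<Rightarrow> real" where "k = scaled_kernel \<alpha> R \<delta>"
definition kb :: "'a \<Rightarrow> 'a \<Rightarrow> real" where "kb = scaled_kernel \<alpha> (Rbar R) \<delta>"
definition \<sigma> :: "'a \<Rightarrow> real" where "\<sigma> x = 2 * \<delta> * (LINT y|S. kb x y)"

lemma a_pos: "a > 0"
  using \<alpha>_pos \<delta>_pos by (simp add: a_def)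

lemma \<Omega>_borel [measurable]: "\<Omega> \<in> sets borel"
  using op by simp

sublocale M: finite_measure M
  by (rule finite_measure_lebesgue_on_bounded[OF op bd])

sublocale S: finite_measure S
  by (rule finite_measure_surface[OF bd surface])

lemma id_M: "(\<lambda>x. x) \<in> M \<rightarrow>\<^sub>M borel"
  by (rule borel_measurable_lebesgue_on_borel) simp

lemma id_S: "(\<lambda>x. x) \<in> S \<rightarrow>\<^sub>M borel"
  by (rule borel_measurable_surface) simp

lemma fst_M [measurable]: "fst \<in> M \<Otimes>\<^sub>M N \<rightarrow>\<^sub>M borel"
  by (rule measurable_compose[OF measurable_fst id_M])

lemma snd_M [measurable]: "snd \<in> N \<Otimes>\<^sub>M M \<rightarrow>\<^sub>M borel"
  by (rule measurable_compose[OF measurable_snd id_M])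

lemma snd_S [measurable]: "snd \<in> N \<Otimes>\<^sub>M S \<rightarrow>\<^sub>M borel"
  by (rule measurable_compose[OF measurable_snd id_S])

lemma k_measurable [measurable (raw)]:
  "f \<in> N \<rightarrow>\<^sub>M borel \<Longrightarrow> g \<in> N \<rightarrow>\<^sub>M borel \<Longrightarrow> (\<lambda>z. k (f z) (g z)) \<in> borel_measurable N"
  unfolding k_def by (rule scaled_kernel_borel[OF R_cont])

lemma kb_measurable [measurable (raw)]:
  "f \<in> N \<rightarrow>\<^sub>M borel \<Longrightarrow> g \<in> N \<rightarrow>\<^sub>M borel \<Longrightarrow> (\<lambda>z. kb (f z) (g z)) \<in> borel_measurable N"
  unfolding kb_def by (rule scaled_kernel_borel[OF Rbar_cont])

lemma kernel_section_measurable [measurable]: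
  "k x \<in> borel_measurable M" "k x \<in> borel_measurable S" "kb x \<in> borel_measurable M" "kb x \<in> borel_measurable S"
proof -
  have 1: "k x \<in> borel_measurable borel"
    by (rule k_measurable[of "\<lambda>_. x" borel "\<lambda>y. y"]) (rule measurable_const measurable_ident[unfolded id_def]; simp)+
  have 2: "kb x \<in> borel_measurable borel"
    by (rule kb_measurable[of "\<lambda>_. x" borel "\<lambda>y. y"]) (rule measurable_const measurable_ident[unfolded id_def]; simp)+
  show "k x \<in> borel_measurable M" by (rule borel_measurable_lebesgue_on_borel[OF 1])
  show "kb x \<in> borel_measurable M" by (rule borel_measurable_lebesgue_on_borel[OF 2])
  show "k x \<in> borel_measurable S" by (rule borel_measurable_surface[OF 1])
  show "kb x \<in> borel_measurable S" by (rule borel_measurable_surface[OF 2])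
qed

lemma kernel_argument:
  fixes x y :: 'a
  shows "0 \<le> (norm (x - y))\<^sup>2 / (4 * \<delta>\<^sup>2)"
    "dist x y > 2 * \<delta> \<Longrightarrow> (norm (x - y))\<^sup>2 / (4 * \<delta>\<^sup>2) > 1"
    "dist x y \<le> \<delta> \<Longrightarrow> (norm (x - y))\<^sup>2 / (4 * \<delta>\<^sup>2) \<le> 1 / 4"
proof -
  show "0 \<le> (norm (x - y))\<^sup>2 / (4 * \<delta>\<^sup>2)" by simp
  show "(norm (x - y))\<^sup>2 / (4 * \<delta>\<^sup>2) > 1" if "dist x y > 2 * \<delta>"
  proof -
    have "(2 * \<delta>)\<^sup>2 < (norm (x - y))\<^sup>2"
      using that \<delta>_pos by (intro power_strict_mono) (auto simp: dist_norm)
    then show ?thesis using \<delta>_pos by (simp add: power_mult_distrib)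
  qed
  show "(norm (x - y))\<^sup>2 / (4 * \<delta>\<^sup>2) \<le> 1 / 4" if "dist x y \<le> \<delta>"
  proof -
    have "(norm (x - y))\<^sup>2 \<le> \<delta>\<^sup>2" using that by (intro power_mono) (auto simp: dist_norm)
    then show ?thesis using \<delta>_pos by (simp add: divide_le_eq)
  qed
qed

lemma kernel_alt:
  "k x y = a * R ((norm (x - y))\<^sup>2 / (4 * \<delta>\<^sup>2))" "kb x y = a * Rbar R ((norm (x - y))\<^sup>2 / (4 * \<delta>\<^sup>2))"
  by (simp_all add: k_def kb_def a_def scaled_kernel_def)

lemma k_nonneg: "0 \<le> k x y" and k_le: "k x y \<le> a * M\<^sub>0"
  and kb_nonneg: "0 \<le> kb x y" and kb_le: "kb x y \<le> a * M\<^sub>0"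
  using a_pos by (auto simp: kernel_alt R_nonneg R_le Rbar_nonneg Rbar_le)

lemma k_sym: "k x y = k y x" and kb_sym: "kb x y = kb y x"
  by (simp_all add: k_def kb_def scaled_kernel_commute)

lemma k_zero: "dist x y > 2 * \<delta> \<Longrightarrow> k x y = 0"
  by (simp only: kernel_alt R_zero[OF kernel_argument(2)] mult_zero_right)

lemma k_ge: "dist x y \<le> \<delta> \<Longrightarrow> a * \<gamma> \<le> k x y"
  using a_pos kernel_argument(1,3)[of x y] by (auto simp: kernel_alt intro!: R_ge)

lemma kb_ge: "dist x y \<le> \<delta> \<Longrightarrow> a * \<gamma> / 4 \<le> kb x y"
  using a_pos Rbar_ge[OF kernel_argument(1,3)[of x y]] by (auto simp: kernel_alt)

lemma k_square_le: "(k x y)\<^sup>2 \<le> 2 * M\<^sub>1 * a * kb x y"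
proof -
  have "a\<^sup>2 * (R ((norm (x - y))\<^sup>2 / (4 * \<delta>\<^sup>2)))\<^sup>2 \<le> a\<^sup>2 * (2 * M\<^sub>1 * Rbar R ((norm (x - y))\<^sup>2 / (4 * \<delta>\<^sup>2)))"
    by (intro mult_left_mono R_square_le) auto
  then show ?thesis by (simp add: kernel_alt power_mult_distrib power2_eq_square mult_ac)
qed

lemma nn_integral_kb_le_1: "(\<integral>\<^sup>+y. ennreal (kb x y) \<partial>M) \<le> 1"
proof -
  have int: "integrable lborel (kb x)"
  proof (rule ccontr)
    assume "\<not> integrable lborel (kb x)"
    then have "(LINT y|lborel. kb x y) = 0" by (rule not_integrable_integral_eq)
    then show False using normalized[of x] by (simp add: kb_def)
  qed
  have "(\<integral>\<^sup>+y. ennreal (kb x y) \<partial>M) = (\<integral>\<^sup>+y. indicator \<Omega> y * ennreal (kb x y) \<partial>lborel)"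
    by (rule nn_integral_lebesgue_on_borel) simp
  also have "\<dots> \<le> (\<integral>\<^sup>+y. ennreal (kb x y) \<partial>lborel)"
    by (intro nn_integral_mono) (auto simp: indicator_def)
  also have "\<dots> = ennreal (LINT y|lborel. kb x y)"
    using int by (intro nn_integral_eq_integral) (auto simp: kb_nonneg)
  finally show ?thesis using normalized[of x] by (simp add: kb_def)
qed

lemma bounded_kernel_mult_integrable:
  assumes "integrable N h" "\<And>y. 0 \<le> \<kappa> y" "\<And>y. \<kappa> y \<le> b" "\<kappa> \<in> borel_measurable N"
  shows "integrable N (\<lambda>y. \<kappa> y * h y :: real)"
proof (rule Bochner_Integration.integrable_bound[of _ "\<lambda>y. b * \<bar>h y\<bar>"])
  show "AE y in N. norm (\<kappa> y * h y) \<le> norm (b * \<bar>h y\<bar>)"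
    using assms(2,3) order_trans[OF assms(2,3)] by (intro AE_I2) (auto simp: abs_mult intro!: mult_right_mono)
  show "(\<lambda>y. \<kappa> y * h y) \<in> borel_measurable N" using assms by measurable
qed (use assms in auto)

lemma kb_mult_integrable_M: "integrable M h \<Longrightarrow> integrable M (\<lambda>y. kb x y * h y)"
  and kb_mult_integrable_S: "integrable S g \<Longrightarrow> integrable S (\<lambda>y. kb x y * g y)"
  and kb_integrable_M: "integrable M (kb x)" and kb_integrable_S: "integrable S (kb x)"
proof -
  show "integrable M h \<Longrightarrow> integrable M (\<lambda>y. kb x y * h y)" for h
    by (rule bounded_kernel_mult_integrable[of _ _ _ "a * M\<^sub>0"]) (auto simp: kb_nonneg kb_le)
  show "integrable S g \<Longrightarrow> integrable S (\<lambda>y. kb x y * g y)" for g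
    by (rule bounded_kernel_mult_integrable[of _ _ _ "a * M\<^sub>0"]) (auto simp: kb_nonneg kb_le)
  from this[of "\<lambda>_. 1"] show "integrable S (kb x)" by simp
  have "integrable M (\<lambda>y. kb x y * 1)"
    by (rule bounded_kernel_mult_integrable[of _ _ _ "a * M\<^sub>0"]) (auto simp: kb_nonneg kb_le)
  then show "integrable M (kb x)" by simp
qed

lemma integral_kb_le_1: "(LINT y|M. kb x y) \<le> 1"
proof -
  have "ennreal (LINT y|M. kb x y) \<le> ennreal 1"
    using nn_integral_kb_le_1[of x] by (subst nn_integral_eq_integral[symmetric]) (auto simp: kb_integrable_M kb_nonneg)
  then show ?thesis by (subst (asm) ennreal_le_iff) auto
qed

lemma \<sigma>_borel [measurable]: "\<sigma> \<in> borel_measurable borel"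
  unfolding \<sigma>_def by measurable

lemma \<sigma>_bounds: "0 \<le> \<sigma> x" "\<sigma> x \<le> 2 * \<delta> * (a * M\<^sub>0 * measure S (space S))"
proof -
  show "0 \<le> \<sigma> x" unfolding \<sigma>_def using \<delta>_pos by (intro mult_nonneg_nonneg Bochner_Integration.integral_nonneg kb_nonneg) auto
  have "(LINT y|S. kb x y) \<le> (LINT y|S. a * M\<^sub>0)"
    by (intro integral_mono kb_integrable_S) (auto intro: kb_le)
  then show "\<sigma> x \<le> 2 * \<delta> * (a * M\<^sub>0 * measure S (space S))"
    unfolding \<sigma>_def using \<delta>_pos by (intro mult_left_mono) (auto simp: mult_ac)
qed

definition B :: real where "B = max (a * M\<^sub>0) (2 * \<delta> * (a * M\<^sub>0 * measure S (space S)))"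
definition c :: real where "c = \<alpha> * \<gamma> * c\<^sub>W"

lemma c_pos: "c > 0"
  using \<alpha>_pos \<gamma>_pos cW_pos by (simp add: c_def)

text \<open>
  The kernel is at least \<open>\<alpha> \<gamma> / \<delta>\<^sup>n\<close> within distance \<open>\<delta>\<close>, and by density the domain fills a fixed
  fraction of each ball; hence the bound does not depend on \<open>\<delta>\<close>.
\<close>

lemma weight_lower:
  assumes x: "x \<in> \<Omega>"
  shows "c \<le> (LINT y|M. k x y)"
proof -
  have int: "integrable M (\<lambda>y. k x y * 1)"
    by (rule bounded_kernel_mult_integrable[of _ _ _ "a * M\<^sub>0"]) (auto simp: k_nonneg k_le)
  have "c = a * \<gamma> * (c\<^sub>W * \<delta> ^ DIM('a))" using \<delta>_pos by (simp add: c_def a_def)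
  then have "ennreal c = ennreal (a * \<gamma>) * ennreal (c\<^sub>W * \<delta> ^ DIM('a))"
    using a_pos \<gamma>_pos cW_pos \<delta>_pos by (simp only: ennreal_mult mult_nonneg_nonneg less_imp_le zero_le_power)
  also have "\<dots> \<le> ennreal (a * \<gamma>) * emeasure lborel (\<Omega> \<inter> cball x (\<delta> / 2))"
    by (intro mult_left_mono density x) auto
  also have "\<dots> = (\<integral>\<^sup>+y. ennreal (a * \<gamma>) * indicator (\<Omega> \<inter> cball x (\<delta> / 2)) y \<partial>lborel)"
    by (rule nn_integral_cmult_indicator[symmetric]) simp
  also have "\<dots> \<le> (\<integral>\<^sup>+y. indicator \<Omega> y * ennreal (k x y) \<partial>lborel)"
    using \<delta>_pos by (intro nn_integral_mono) (auto simp: indicator_def intro!: ennreal_leI k_ge)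
  also have "\<dots> = (\<integral>\<^sup>+y. ennreal (k x y) \<partial>M)"
    by (rule nn_integral_lebesgue_on_borel[symmetric]) simp
  also have "\<dots> = ennreal (LINT y|M. k x y)"
    using int by (intro nn_integral_eq_integral) (auto simp: k_nonneg)
  finally show ?thesis
    by (subst (asm) ennreal_le_iff) (auto intro: Bochner_Integration.integral_nonneg k_nonneg)
qed

sublocale K: nonlocal_kernel M k \<sigma> B c
proof unfold_locales
  show "(\<lambda>z. k (fst z) (snd z)) \<in> borel_measurable (M \<Otimes>\<^sub>M M)" by measurable
  show "k x \<in> borel_measurable M" for x by measurable
  show "\<sigma> \<in> borel_measurable M" by (rule borel_measurable_lebesgue_on_borel) measurable
  show "k x y \<le> B" "\<sigma> x \<le> B" for x y
    using k_le[of x y] \<sigma>_bounds(2)[of x] by (auto simp: B_def)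
  show "x \<in> space M \<Longrightarrow> c \<le> (LINT y|M. k x y)" for x by (rule weight_lower) (simp add: space_restrict_space)
qed (rule k_nonneg k_sym \<sigma>_bounds c_pos)+

text \<open>
  Within distance \<open>\<delta>\<close> the argument of \<open>R\<close> is at most \<open>1/4\<close>, where \<open>R \<ge> \<gamma>\<close>.
\<close>

lemma nl_energy_le:
  assumes v: "v \<in> L2 M" and [measurable]: "v' \<in> borel_measurable borel" and eq: "AE x in M. v x = v' x"
  shows "nl_energy \<Omega> \<delta> v' \<le> ennreal (1 / (\<alpha> * \<gamma>)) * ennreal (LINT x|M. LINT y|M. k x y * (v x - v y)\<^sup>2)"
proof -
  have "ennreal (a * \<gamma>) * diff_energy (near_pairs \<Omega> \<delta>) v'
      = (\<integral>\<^sup>+x. ennreal (a * \<gamma>) * (\<integral>\<^sup>+y. indicator (near_pairs \<Omega> \<delta>) (x, y) * ennreal ((v' x - v' y)\<^sup>2) \<partial>lborel) \<partial>lborel)"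
    unfolding diff_energy_def by (rule nn_integral_cmult[symmetric]) measurable
  also have "\<dots> = (\<integral>\<^sup>+x. \<integral>\<^sup>+y. ennreal (a * \<gamma>) * (indicator (near_pairs \<Omega> \<delta>) (x, y) * ennreal ((v' x - v' y)\<^sup>2)) \<partial>lborel \<partial>lborel)"
    by (rule nn_integral_cong, rule nn_integral_cmult[symmetric], rule diff_energy_slice_measurable) measurable
  also have "\<dots> \<le> (\<integral>\<^sup>+x. indicator \<Omega> x * (\<integral>\<^sup>+y. indicator \<Omega> y * ennreal (k x y * (v' x - v' y)\<^sup>2) \<partial>lborel) \<partial>lborel)"
  proof (rule nn_integral_mono)
    fix x
    have "(\<integral>\<^sup>+y. ennreal (a * \<gamma>) * (indicator (near_pairs \<Omega> \<delta>) (x, y) * ennreal ((v' x - v' y)\<^sup>2)) \<partial>lborel)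
        \<le> (\<integral>\<^sup>+y. indicator \<Omega> x * (indicator \<Omega> y * ennreal (k x y * (v' x - v' y)\<^sup>2)) \<partial>lborel)"
    proof (rule nn_integral_mono)
      fix y
      show "ennreal (a * \<gamma>) * (indicator (near_pairs \<Omega> \<delta>) (x, y) * ennreal ((v' x - v' y)\<^sup>2))
          \<le> indicator \<Omega> x * (indicator \<Omega> y * ennreal (k x y * (v' x - v' y)\<^sup>2))"
      proof (cases "(x, y) \<in> near_pairs \<Omega> \<delta>")
        case True
        then have "dist x y \<le> \<delta>" "x \<in> \<Omega>" "y \<in> \<Omega>" by (auto simp: near_pairs_def)
        then show ?thesis
          using k_ge[of x y] a_pos \<gamma>_pos True
          by (auto simp: ennreal_mult[symmetric] k_nonneg intro!: ennreal_leI mult_right_mono)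
      qed auto
    qed
    also have "\<dots> = indicator \<Omega> x * (\<integral>\<^sup>+y. indicator \<Omega> y * ennreal (k x y * (v' x - v' y)\<^sup>2) \<partial>lborel)"
      by (rule nn_integral_cmult) measurable
    finally show "(\<integral>\<^sup>+y. ennreal (a * \<gamma>) * (indicator (near_pairs \<Omega> \<delta>) (x, y) * ennreal ((v' x - v' y)\<^sup>2)) \<partial>lborel)
        \<le> indicator \<Omega> x * (\<integral>\<^sup>+y. indicator \<Omega> y * ennreal (k x y * (v' x - v' y)\<^sup>2) \<partial>lborel)" .
  qed
  also have "\<dots> = (\<integral>\<^sup>+x. \<integral>\<^sup>+y. ennreal (k x y * (v' x - v' y)\<^sup>2) \<partial>M \<partial>M)"
    by (simp add: nn_integral_lebesgue_on_borel)
  also have "\<dots> = (\<integral>\<^sup>+x. \<integral>\<^sup>+y. ennreal (k x y * (v x - v y)\<^sup>2) \<partial>M \<partial>M)"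
  proof (rule nn_integral_cong_AE)
    show "AE x in M. (\<integral>\<^sup>+y. ennreal (k x y * (v' x - v' y)\<^sup>2) \<partial>M) = (\<integral>\<^sup>+y. ennreal (k x y * (v x - v y)\<^sup>2) \<partial>M)"
      using eq
    proof eventually_elim
      case x: (elim x)
      show ?case by (rule nn_integral_cong_AE) (use eq in eventually_elim, simp add: x)
    qed
  qed
  also have "\<dots> = 1 * ennreal (LINT x|M. LINT y|M. k x y * (v x - v y)\<^sup>2)"
    using K.nn_integral_form(1)[OF v] by simp
  finally have le: "diff_energy (near_pairs \<Omega> \<delta>) v' \<le> ennreal (1 / (a * \<gamma>)) * ennreal (LINT x|M. LINT y|M. k x y * (v x - v y)\<^sup>2)"
    using a_pos \<gamma>_pos by (intro ennreal_le_divideI) auto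
  have "nl_energy \<Omega> \<delta> v' \<le> ennreal (1 / \<delta> ^ DIM('a)) * (ennreal (1 / (a * \<gamma>)) * ennreal (LINT x|M. LINT y|M. k x y * (v x - v y)\<^sup>2))"
    unfolding nl_energy_def by (rule mult_left_mono[OF le]) simp
  also have "\<dots> = ennreal (1 / (\<alpha> * \<gamma>)) * ennreal (LINT x|M. LINT y|M. k x y * (v x - v y)\<^sup>2)"
  proof -
    have "1 / \<delta> ^ DIM('a) * (1 / (a * \<gamma>)) = 1 / (\<alpha> * \<gamma>)" using \<delta>_pos by (simp add: a_def)
    moreover have "ennreal (1 / \<delta> ^ DIM('a)) * ennreal (1 / (a * \<gamma>)) = ennreal (1 / \<delta> ^ DIM('a) * (1 / (a * \<gamma>)))"
      by (rule ennreal_mult[symmetric]) (use a_pos \<gamma>_pos \<delta>_pos in auto)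
    ultimately have "ennreal (1 / \<delta> ^ DIM('a)) * ennreal (1 / (a * \<gamma>)) = ennreal (1 / (\<alpha> * \<gamma>))"
      by (simp only:)
    then show ?thesis by (simp only: mult.assoc[symmetric])
  qed
  finally show ?thesis .
qed

text \<open>
  The bound \<open>\<gamma> / 4\<close> for \<open>Rbar\<close> within distance \<open>\<delta>\<close> makes \<open>\<sigma>\<close>, up to a constant, an upper bound for the
  surface measure seen from \<open>x\<close>, as required by the Poincare inequality.
\<close>

lemma surface_le_\<sigma>:
  "hausdorff_outer (DIM('a) - 1) (frontier \<Omega> \<inter> cball x \<delta>) \<le> ennreal (2 / (\<delta> * a * \<gamma>) * \<sigma> x)"
proof -
  have "ennreal (a * \<gamma> / 4) * hausdorff_outer (DIM('a) - 1) (frontier \<Omega> \<inter> cball x \<delta>)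
      = ennreal (a * \<gamma> / 4) * emeasure S (frontier \<Omega> \<inter> cball x \<delta>)"
    by (simp add: emeasure_surface_measure)
  also have "\<dots> = (\<integral>\<^sup>+y. ennreal (a * \<gamma> / 4) * indicator (frontier \<Omega> \<inter> cball x \<delta>) y \<partial>S)"
  proof (rule nn_integral_cmult_indicator[symmetric])
    have "(\<lambda>y. y) -` cball x \<delta> \<inter> space S \<in> sets S" by (rule measurable_sets[OF id_S]) simp
    then show "frontier \<Omega> \<inter> cball x \<delta> \<in> sets S" by (simp add: Int_commute)
  qed
  also have "\<dots> \<le> (\<integral>\<^sup>+y. ennreal (kb x y) \<partial>S)"
    by (intro nn_integral_mono) (auto simp: indicator_def intro!: ennreal_leI kb_ge)
  also have "\<dots> = ennreal (LINT y|S. kb x y)"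
    by (intro nn_integral_eq_integral kb_integrable_S) (auto simp: kb_nonneg)
  also have "\<dots> = ennreal (1 / (2 * \<delta>)) * ennreal (\<sigma> x)"
    using \<delta>_pos \<sigma>_bounds(1)[of x] by (simp add: ennreal_mult[symmetric]) (simp add: \<sigma>_def)
  finally have "ennreal (a * \<gamma> / 4) * hausdorff_outer (DIM('a) - 1) (frontier \<Omega> \<inter> cball x \<delta>)
      \<le> ennreal (1 / (2 * \<delta>)) * ennreal (\<sigma> x)" .
  then have "hausdorff_outer (DIM('a) - 1) (frontier \<Omega> \<inter> cball x \<delta>) \<le> ennreal (1 / (2 * \<delta>) / (a * \<gamma> / 4)) * ennreal (\<sigma> x)"
    by (rule ennreal_le_divideI[rotated 2]) (use a_pos \<gamma>_pos \<delta>_pos in simp_all)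
  also have "\<dots> = ennreal (2 / (\<delta> * a * \<gamma>) * \<sigma> x)"
  proof -
    have "1 / (2 * \<delta>) / (a * \<gamma> / 4) = 2 / (\<delta> * a * \<gamma>)" by simp
    then show ?thesis
      using a_pos \<gamma>_pos \<delta>_pos \<sigma>_bounds(1)[of x] by (simp only: ennreal_mult divide_nonneg_nonneg mult_nonneg_nonneg less_imp_le zero_le_numeral)
  qed
  finally show ?thesis .
qed

definition P\<^sub>0 :: real where "P\<^sub>0 = 2 * C\<^sub>P / (\<alpha> * \<gamma>)"

lemma P0_pos: "P\<^sub>0 > 0"
  using CP_pos \<alpha>_pos \<gamma>_pos by (simp add: P\<^sub>0_def)

lemma L2_representative:
  assumes v: "v \<in> L2 M"
  obtains v' where "v' \<in> borel_measurable borel" "AE x in M. v x = v' x"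
  by (rule borel_representative[OF \<Omega>_borel, of v]) (use v in \<open>auto simp: L2_def\<close>)

text \<open>
  Coercivity: the Poincare inequality for a Borel representative, with its two energies bounded by the
  two parts of the form.  The powers of \<open>\<delta>\<close> in the boundary term cancel against the normalisation of
  the kernel.
\<close>

sublocale K: nonlocal_operator M k \<sigma> B c "P\<^sub>0 / \<delta>\<^sup>2"
proof
  show "P\<^sub>0 / \<delta>\<^sup>2 \<ge> 0" using P0_pos by simp
  fix v assume v: "v \<in> L2 M"
  obtain v' where v': "v' \<in> borel_measurable borel" and eq: "AE x in M. v x = v' x"
    using L2_representative[OF v] .
  have [measurable]: "v \<in> borel_measurable M" using v by (simp add: L2_def)
  note [measurable] = v'
  define X where "X = (LINT x|M. LINT y|M. k x y * (v x - v y)\<^sup>2)"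
  define Y where "Y = (LINT x|M. \<sigma> x * (v x)\<^sup>2)"
  have XY: "X \<ge> 0" "Y \<ge> 0"
    unfolding X_def Y_def by (auto intro!: Bochner_Integration.integral_nonneg simp: k_nonneg \<sigma>_bounds(1))
  have "(\<integral>\<^sup>+x. indicator \<Omega> x * (ennreal (2 / (\<delta> * a * \<gamma>) * \<sigma> x) * ennreal ((v' x)\<^sup>2)) \<partial>lborel)
      = (\<integral>\<^sup>+x. ennreal (2 / (\<delta> * a * \<gamma>) * \<sigma> x) * ennreal ((v' x)\<^sup>2) \<partial>M)"
    by (rule nn_integral_lebesgue_on_borel[symmetric]) simp
  also have "\<dots> = (\<integral>\<^sup>+x. ennreal (2 / (\<delta> * a * \<gamma>)) * ennreal (\<sigma> x * (v x)\<^sup>2) \<partial>M)"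
    by (rule nn_integral_cong_AE, use eq in eventually_elim)
       (use a_pos \<gamma>_pos \<delta>_pos in \<open>simp add: ennreal_mult[symmetric] \<sigma>_bounds(1) mult.assoc\<close>)
  also have "\<dots> = ennreal (2 / (\<delta> * a * \<gamma>)) * (\<integral>\<^sup>+x. ennreal (\<sigma> x * (v x)\<^sup>2) \<partial>M)"
    by (rule nn_integral_cmult) measurable
  finally have bdry: "(\<integral>\<^sup>+x. indicator \<Omega> x * (ennreal (2 / (\<delta> * a * \<gamma>) * \<sigma> x) * ennreal ((v' x)\<^sup>2)) \<partial>lborel)
      = ennreal (2 / (\<delta> * a * \<gamma>)) * ennreal Y"
    by (simp only: K.nn_integral_form(2)[OF v] Y_def)
  have n: "\<delta> ^ DIM('a) = \<delta> * \<delta> ^ (DIM('a) - 1)"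
    using DIM_positive[where 'a='a] by (metis Suc_diff_1 power_Suc)
  have "ennreal (LINT x|M. (v x)\<^sup>2) = (\<integral>\<^sup>+x. ennreal ((v x)\<^sup>2) \<partial>M)"
    by (rule nn_integral_eq_integral[OF K.L2_square_integrable[OF v], symmetric]) simp
  also have "\<dots> = (\<integral>\<^sup>+x. ennreal ((v' x)\<^sup>2) \<partial>M)"
    by (rule nn_integral_cong_AE) (use eq in eventually_elim, simp)
  also have "\<dots> = (\<integral>\<^sup>+x. indicator \<Omega> x * ennreal ((v' x)\<^sup>2) \<partial>lborel)"
    by (rule nn_integral_lebesgue_on_borel) simp
  also have "\<dots> \<le> ennreal (C\<^sub>P / \<delta>\<^sup>2) * (nl_energy \<Omega> \<delta> v'
      + ennreal (1 / \<delta> ^ (DIM('a) - 1)) * (ennreal (2 / (\<delta> * a * \<gamma>)) * ennreal Y))"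
    unfolding bdry[symmetric] by (rule poincare, measurable, rule surface_le_\<sigma>)
  also have "\<dots> \<le> ennreal (C\<^sub>P / \<delta>\<^sup>2) * (ennreal (1 / (\<alpha> * \<gamma>)) * ennreal X
      + ennreal (1 / \<delta> ^ (DIM('a) - 1)) * (ennreal (2 / (\<delta> * a * \<gamma>)) * ennreal Y))"
    unfolding X_def by (intro mult_left_mono add_right_mono nl_energy_le v v' eq) auto
  also have "\<dots> = ennreal (C\<^sub>P / \<delta>\<^sup>2 * (1 / (\<alpha> * \<gamma>) * X + 1 / \<delta> ^ (DIM('a) - 1) * (2 / (\<delta> * a * \<gamma>) * Y)))"
    using XY CP_pos \<alpha>_pos \<gamma>_pos \<delta>_pos a_pos
    by (simp add: ennreal_mult[symmetric] ennreal_plus[symmetric] del: ennreal_plus times_divide_eq_left times_divide_eq_right)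
  also have "1 / \<delta> ^ (DIM('a) - 1) * (2 / (\<delta> * a * \<gamma>) * Y) = 2 / (\<alpha> * \<gamma>) * Y"
    using \<delta>_pos by (simp add: a_def n)
  also have "C\<^sub>P / \<delta>\<^sup>2 * (1 / (\<alpha> * \<gamma>) * X + 2 / (\<alpha> * \<gamma>) * Y) = P\<^sub>0 / \<delta>\<^sup>2 * K.form v"
    using \<alpha>_pos \<gamma>_pos \<delta>_pos by (simp add: P\<^sub>0_def K.form_def X_def Y_def field_simps)
  finally show "(LINT x|M. (v x)\<^sup>2) \<le> P\<^sub>0 / \<delta>\<^sup>2 * K.form v"
    using XY P0_pos by (subst (asm) ennreal_le_iff) (auto simp: K.form_def X_def Y_def)
qed

end

section \<open>Solvability and the energy estimate\<close>

context scaled_problem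
begin

definition rhs :: "('a \<Rightarrow> real) \<Rightarrow> ('a \<Rightarrow> real) \<Rightarrow> 'a \<Rightarrow> real" where
  "rhs f g x = 2 * \<delta> * (LINT y|S. kb x y * g y) + \<delta>\<^sup>2 * (LINT y|M. kb x y * f y)"

lemma S_L2:
  assumes "g \<in> L2 S"
  shows "g \<in> borel_measurable S" "integrable S g" "integrable S (\<lambda>y. (g y)\<^sup>2)"
  using assms by (auto simp: L2_def intro: S.square_integrable_imp_integrable)

lemma M_L2:
  assumes "f \<in> L2 M"
  shows "f \<in> borel_measurable M" "integrable M f" "integrable M (\<lambda>y. (f y)\<^sup>2)"
  using assms by (auto simp: L2_def intro: M.square_integrable_imp_integrable)

lemma is_solution_iff:
  assumes f: "f \<in> L2 M" and g: "g \<in> L2 S"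
  shows "is_solution \<Omega> R \<alpha> \<delta> f g u \<longleftrightarrow> u \<in> L2 M \<and> (AE x in M. K.nl_op u x = rhs f g x)"
proof -
  have "(1 / \<delta>\<^sup>2 * (LINT y|M. k x y * (u x - u y)) + 2 / \<delta> * (LINT y|S. kb x y * (u x - g y))
         = (LINT y|M. kb x y * f y)) \<longleftrightarrow> K.nl_op u x = rhs f g x" if u: "u \<in> L2 M" for x
  proof -
    have "(LINT y|M. k x y * (u x - u y)) = (LINT y|M. k x y * u x - k x y * u y)"
      by (simp add: right_diff_distrib)
    also have "\<dots> = (LINT y|M. k x y * u x) - (LINT y|M. k x y * u y)"
      by (rule Bochner_Integration.integral_diff[OF _ K.kernel_mult_integrable[OF M_L2(2)[OF u]]])
         (use K.kernel_integrable in auto)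
    finally have 1: "(LINT y|M. k x y * (u x - u y)) = K.weight x * u x - K.avg u x"
      by (simp add: K.weight_def K.avg_def)
    have "(LINT y|S. kb x y * (u x - g y)) = (LINT y|S. kb x y * u x - kb x y * g y)"
      by (simp add: right_diff_distrib)
    also have "\<dots> = (LINT y|S. kb x y * u x) - (LINT y|S. kb x y * g y)"
      by (rule Bochner_Integration.integral_diff[OF _ kb_mult_integrable_S[OF S_L2(2)[OF g]]])
         (use kb_integrable_S in auto)
    finally have 2: "(LINT y|S. kb x y * (u x - g y)) = (LINT y|S. kb x y) * u x - (LINT y|S. kb x y * g y)"
      by simp
    define s where "s = (LINT y|S. kb x y)"
    define G where "G = (LINT y|S. kb x y * g y)"
    define F where "F = (LINT y|M. kb x y * f y)"
    have "(1 / \<delta>\<^sup>2 * (K.weight x * u x - K.avg u x) + 2 / \<delta> * (s * u x - G) = F)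
        \<longleftrightarrow> \<delta>\<^sup>2 * (1 / \<delta>\<^sup>2 * (K.weight x * u x - K.avg u x) + 2 / \<delta> * (s * u x - G)) = \<delta>\<^sup>2 * F"
      using \<delta>_pos by simp
    also have "\<delta>\<^sup>2 * (1 / \<delta>\<^sup>2 * (K.weight x * u x - K.avg u x) + 2 / \<delta> * (s * u x - G))
        = K.nl_op u x - 2 * \<delta> * G"
      using \<delta>_pos by (simp add: K.nl_op_def \<sigma>_def s_def[symmetric] power2_eq_square distrib_left right_diff_distrib)
        (simp add: field_simps)
    also have "(K.nl_op u x - 2 * \<delta> * G = \<delta>\<^sup>2 * F) \<longleftrightarrow> K.nl_op u x = rhs f g x"
      by (auto simp: rhs_def G_def F_def)
    finally show ?thesis by (simp only: 1 2 s_def G_def F_def)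
  qed
  then show ?thesis unfolding is_solution_def k_def[symmetric] kb_def[symmetric] by auto
qed

lemma rhs_borel:
  assumes f: "f \<in> L2 M" and g: "g \<in> L2 S"
  shows "rhs f g \<in> borel_measurable borel"
proof -
  have [measurable]: "f \<in> borel_measurable M" "g \<in> borel_measurable S" using M_L2[OF f] S_L2[OF g] by auto
  show ?thesis unfolding rhs_def by measurable
qed

lemma integral_kb_abs_le:
  assumes h: "integrable N h" and m: "kb x \<in> borel_measurable N"
  shows "\<bar>LINT y|N. kb x y * h y\<bar> \<le> a * M\<^sub>0 * (LINT y|N. \<bar>h y\<bar>)"
proof -
  have "\<bar>LINT y|N. kb x y * h y\<bar> \<le> (LINT y|N. \<bar>kb x y * h y\<bar>)"
    using integral_norm_bound[of N "\<lambda>y. kb x y * h y"] by simp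
  also have "\<dots> \<le> (LINT y|N. a * M\<^sub>0 * \<bar>h y\<bar>)"
    by (intro integral_mono integrable_abs integrable_mult_right bounded_kernel_mult_integrable[of _ _ _ "a * M\<^sub>0"] h m)
       (auto simp: kb_nonneg kb_le abs_mult intro!: mult_right_mono)
  finally show ?thesis by simp
qed

lemma rhs_L2:
  assumes f: "f \<in> L2 M" and g: "g \<in> L2 S"
  shows "rhs f g \<in> L2 M"
proof (rule K.L2_affine_bound[OF f])
  show "rhs f g \<in> borel_measurable M" by (rule borel_measurable_lebesgue_on_borel[OF rhs_borel[OF f g]])
  fix x
  have "\<bar>rhs f g x\<bar> \<le> 2 * \<delta> * \<bar>LINT y|S. kb x y * g y\<bar> + \<delta>\<^sup>2 * \<bar>LINT y|M. kb x y * f y\<bar>"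
    unfolding rhs_def using \<delta>_pos by (intro order_trans[OF abs_triangle_ineq]) (simp add: abs_mult)
  also have "\<dots> \<le> 2 * \<delta> * (a * M\<^sub>0 * (LINT y|S. \<bar>g y\<bar>)) + \<delta>\<^sup>2 * (a * M\<^sub>0 * (LINT y|M. \<bar>f y\<bar>))"
    using \<delta>_pos by (intro add_mono mult_left_mono integral_kb_abs_le M_L2[OF f] S_L2[OF g] kernel_section_measurable) auto
  finally show "\<bar>rhs f g x\<bar> \<le> (2 * \<delta> * (a * M\<^sub>0 * (LINT y|S. \<bar>g y\<bar>)) + \<delta>\<^sup>2 * (a * M\<^sub>0 * (LINT y|M. \<bar>f y\<bar>))) + 0 * \<bar>f x\<bar>"
    by simp
qed

theorem solution_exists:
  assumes f: "f \<in> L2 M" and g: "g \<in> L2 S"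
  obtains u where "is_solution \<Omega> R \<alpha> \<delta> f g u"
proof -
  obtain u where "u \<in> L2 M" "\<And>x. x \<in> space M \<Longrightarrow> K.nl_op u x = rhs f g x"
    by (rule K.exists_solution[OF rhs_L2[OF f g]]) auto
  then have "is_solution \<Omega> R \<alpha> \<delta> f g u" by (subst is_solution_iff[OF f g]) (auto intro: AE_I2)
  then show ?thesis by (rule that)
qed

theorem solution_unique:
  assumes f: "f \<in> L2 M" and g: "g \<in> L2 S"
    and u: "is_solution \<Omega> R \<alpha> \<delta> f g u" and v: "is_solution \<Omega> R \<alpha> \<delta> f g v"
  shows "AE x in M. v x = u x"
proof -
  have uL: "u \<in> L2 M" "AE x in M. K.nl_op u x = rhs f g x" and vL: "v \<in> L2 M" "AE x in M. K.nl_op v x = rhs f g x"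
    using u v by (auto simp: is_solution_iff[OF f g])
  have "AE x in M. K.nl_op v x = K.nl_op u x" using uL(2) vL(2) by eventually_elim simp
  then show ?thesis by (rule K.solution_unique[OF vL(1) uL(1)])
qed

text \<open>Schur's test, in the form that the mass of the kernel in its first variable is at most \<open>A\<close>.\<close>

lemma nn_Schur:
  assumes N: "finite_measure N" and [measurable]: "(\<lambda>z. \<kappa> (fst z) (snd z)) \<in> borel_measurable (M \<Otimes>\<^sub>M N)" "h \<in> borel_measurable N"
    and A: "\<And>y. (\<integral>\<^sup>+x. \<kappa> x y \<partial>M) \<le> A"
  shows "(\<integral>\<^sup>+x. \<integral>\<^sup>+y. \<kappa> x y * h y \<partial>N \<partial>M) \<le> A * (\<integral>\<^sup>+y. h y \<partial>N)"
proof -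
  interpret N: finite_measure N by fact
  interpret P: pair_sigma_finite M N ..
  have [measurable]: "(\<lambda>x. \<kappa> x y) \<in> borel_measurable M" if "y \<in> space N" for y
    using measurable_compose[OF measurable_Pair2'[OF that, of M], of "\<lambda>z. \<kappa> (fst z) (snd z)" borel] by simp
  have "(\<integral>\<^sup>+x. \<integral>\<^sup>+y. \<kappa> x y * h y \<partial>N \<partial>M) = (\<integral>\<^sup>+y. \<integral>\<^sup>+x. \<kappa> x y * h y \<partial>M \<partial>N)"
    by (rule P.Fubini'[symmetric]) (simp add: case_prod_beta')
  also have "\<dots> = (\<integral>\<^sup>+y. (\<integral>\<^sup>+x. \<kappa> x y \<partial>M) * h y \<partial>N)"
    by (intro nn_integral_cong nn_integral_multc) simp
  also have "\<dots> \<le> (\<integral>\<^sup>+y. A * h y \<partial>N)" by (intro nn_integral_mono mult_right_mono A) simp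
  also have "\<dots> = A * (\<integral>\<^sup>+y. h y \<partial>N)" by (rule nn_integral_cmult) measurable
  finally show ?thesis .
qed

lemma kb_Schur:
  assumes N: "finite_measure N" and snd [measurable]: "snd \<in> M \<Otimes>\<^sub>M N \<rightarrow>\<^sub>M borel" and kb_N: "\<And>x. kb x \<in> borel_measurable N"
    and h: "integrable N h" "\<And>y. 0 \<le> h y"
  shows "integrable M (\<lambda>x. LINT y|N. kb x y * h y)" "(LINT x|M. LINT y|N. kb x y * h y) \<le> (LINT y|N. h y)"
proof -
  interpret N: finite_measure N by fact
  have [measurable]: "h \<in> borel_measurable N" using h by auto
  have "(\<lambda>z. kb (fst z) (snd z) * h (snd z)) \<in> borel_measurable (M \<Otimes>\<^sub>M N)" by measurable
  then have m: "(\<lambda>x. LINT y|N. kb x y * h y) \<in> borel_measurable M"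
    using N.borel_measurable_lebesgue_integral[of "\<lambda>x y. kb x y * h y" M] by (simp add: case_prod_beta')
  have nn: "0 \<le> (LINT y|N. kb x y * h y)" for x
    by (intro Bochner_Integration.integral_nonneg mult_nonneg_nonneg kb_nonneg h)
  have "(\<integral>\<^sup>+x. ennreal (LINT y|N. kb x y * h y) \<partial>M) = (\<integral>\<^sup>+x. \<integral>\<^sup>+y. ennreal (kb x y) * ennreal (h y) \<partial>N \<partial>M)"
  proof (rule nn_integral_cong)
    fix x
    have "integrable N (\<lambda>y. kb x y * h y)"
      by (rule bounded_kernel_mult_integrable[of _ _ _ "a * M\<^sub>0"]) (use h kb_nonneg kb_le kb_N in auto)
    then show "ennreal (LINT y|N. kb x y * h y) = (\<integral>\<^sup>+y. ennreal (kb x y) * ennreal (h y) \<partial>N)"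
      using h kb_nonneg by (subst nn_integral_eq_integral[symmetric]) (auto simp: ennreal_mult)
  qed
  also have "\<dots> \<le> 1 * (\<integral>\<^sup>+y. ennreal (h y) \<partial>N)"
    by (rule nn_Schur[OF N]) (measurable, use nn_integral_kb_le_1 in \<open>simp add: kb_sym[of _ y for y]\<close>)
  also have "\<dots> = ennreal (LINT y|N. h y)" using h by (simp add: nn_integral_eq_integral)
  finally have le: "(\<integral>\<^sup>+x. ennreal (LINT y|N. kb x y * h y) \<partial>M) \<le> ennreal (LINT y|N. h y)" .
  show i: "integrable M (\<lambda>x. LINT y|N. kb x y * h y)"
  proof (rule integrableI_nonneg[OF m])
    show "(\<integral>\<^sup>+x. ennreal (LINT y|N. kb x y * h y) \<partial>M) < \<infinity>" by (rule le_less_trans[OF le]) simp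
  qed (use nn in auto)
  have "ennreal (LINT x|M. LINT y|N. kb x y * h y) \<le> ennreal (LINT y|N. h y)"
    using le nn_integral_eq_integral[OF i] nn by simp
  then show "(LINT x|M. LINT y|N. kb x y * h y) \<le> (LINT y|N. h y)"
    using h by (subst (asm) ennreal_le_iff) (auto intro: Bochner_Integration.integral_nonneg)
qed

text \<open>
  The equation is tested with \<open>u\<close> itself.  Young's inequality bounds the terms with \<open>g\<close> and \<open>f\<close>, up to the data, by half of the
  boundary part of the form and, through coercivity, by a quarter of the form, respectively;
  three quarters of the form are absorbed.
\<close>

theorem energy_estimate:
  assumes f: "f \<in> L2 M" and g: "g \<in> L2 S" and u: "u \<in> L2 M" and eq: "AE x in M. K.nl_op u x = rhs f g x"
  shows "K.form u \<le> 4 * (\<delta> * (LINT y|S. (g y)\<^sup>2) + \<delta>\<^sup>2 * P\<^sub>0 * (LINT y|M. (f y)\<^sup>2))"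
proof -
  define G where "G = (\<lambda>x. LINT y|S. kb x y * (g y)\<^sup>2)"
  define H where "H = (\<lambda>x. LINT y|M. kb x y * (f y)\<^sup>2)"
  have G: "integrable M G" "(LINT x|M. G x) \<le> (LINT y|S. (g y)\<^sup>2)"
    unfolding G_def by (rule kb_Schur; use S_L2[OF g] in \<open>auto intro: S.finite_measure_axioms\<close>)+
  have H: "integrable M H" "(LINT x|M. H x) \<le> (LINT y|M. (f y)\<^sup>2)"
    unfolding H_def by (rule kb_Schur; use M_L2[OF f] in \<open>auto intro: M.finite_measure_axioms\<close>)+
  have pt: "u x * rhs f g x \<le> \<sigma> x * (u x)\<^sup>2 / 2 + \<delta> * G x + (\<delta>\<^sup>2 / (4 * P\<^sub>0) * (u x)\<^sup>2 + \<delta>\<^sup>2 * P\<^sub>0 * H x)" for x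
  proof -
    have i1: "integrable S (\<lambda>y. kb x y * (g y)\<^sup>2)" by (intro kb_mult_integrable_S S_L2 g)
    have i2: "integrable M (\<lambda>y. kb x y * (f y)\<^sup>2)" by (intro kb_mult_integrable_M M_L2 f)
    have "2 * u x * (LINT y|S. kb x y * g y) = (LINT y|S. kb x y * (2 * u x * g y))"
      by (subst Bochner_Integration.integral_mult_right_zero[symmetric]) (simp add: mult_ac)
    also have "\<dots> \<le> (LINT y|S. kb x y * (u x)\<^sup>2 + kb x y * (g y)\<^sup>2)"
    proof (rule integral_mono)
      show "integrable S (\<lambda>y. kb x y * (2 * u x * g y))" by (intro kb_mult_integrable_S integrable_mult_right S_L2 g)
      show "integrable S (\<lambda>y. kb x y * (u x)\<^sup>2 + kb x y * (g y)\<^sup>2)" using i1 kb_integrable_S by auto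
      show "kb x y * (2 * u x * g y) \<le> kb x y * (u x)\<^sup>2 + kb x y * (g y)\<^sup>2" for y
        using mult_left_mono[OF sum_squares_bound[of "u x" "g y"] kb_nonneg[of x y]] by (simp add: distrib_left)
    qed
    also have "\<dots> = (LINT y|S. kb x y) * (u x)\<^sup>2 + G x"
      using i1 kb_integrable_S by (simp add: G_def)
    finally have "\<delta> * (2 * u x * (LINT y|S. kb x y * g y)) \<le> \<delta> * ((LINT y|S. kb x y) * (u x)\<^sup>2 + G x)"
      using \<delta>_pos by (intro mult_left_mono) auto
    then have 1: "u x * (2 * \<delta> * (LINT y|S. kb x y * g y)) \<le> \<sigma> x * (u x)\<^sup>2 / 2 + \<delta> * G x"
      by (simp add: \<sigma>_def algebra_simps)
    have "u x * (LINT y|M. kb x y * f y) = (LINT y|M. kb x y * (u x * f y))"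
      by (subst Bochner_Integration.integral_mult_right_zero[symmetric]) (simp add: mult_ac)
    also have "\<dots> \<le> (LINT y|M. kb x y * (1 / (4 * P\<^sub>0) * (u x)\<^sup>2) + P\<^sub>0 * (kb x y * (f y)\<^sup>2))"
    proof (rule integral_mono)
      show "integrable M (\<lambda>y. kb x y * (u x * f y))" by (intro kb_mult_integrable_M integrable_mult_right M_L2 f)
      show "integrable M (\<lambda>y. kb x y * (1 / (4 * P\<^sub>0) * (u x)\<^sup>2) + P\<^sub>0 * (kb x y * (f y)\<^sup>2))"
        using i2 kb_integrable_M by auto
      fix y
      have "u x * f y \<le> 1 / (4 * P\<^sub>0) * (u x)\<^sup>2 + P\<^sub>0 * (f y)\<^sup>2"
      proof -
        have "0 \<le> (u x - 2 * P\<^sub>0 * f y)\<^sup>2 / (4 * P\<^sub>0)" using P0_pos by simp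
        also have "\<dots> = 1 / (4 * P\<^sub>0) * (u x)\<^sup>2 + P\<^sub>0 * (f y)\<^sup>2 - u x * f y"
          using P0_pos by (simp add: power2_eq_square field_simps)
        finally show ?thesis by simp
      qed
      from mult_left_mono[OF this kb_nonneg[of x y]]
      show "kb x y * (u x * f y) \<le> kb x y * (1 / (4 * P\<^sub>0) * (u x)\<^sup>2) + P\<^sub>0 * (kb x y * (f y)\<^sup>2)"
        by (simp add: distrib_left mult_ac)
    qed
    also have "\<dots> = (LINT y|M. kb x y) * (1 / (4 * P\<^sub>0) * (u x)\<^sup>2) + P\<^sub>0 * H x"
      using i2 kb_integrable_M by (simp add: H_def)
    also have "\<dots> \<le> 1 * (1 / (4 * P\<^sub>0) * (u x)\<^sup>2) + P\<^sub>0 * H x"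
      using P0_pos by (intro add_right_mono mult_right_mono integral_kb_le_1) auto
    finally have "\<delta>\<^sup>2 * (u x * (LINT y|M. kb x y * f y)) \<le> \<delta>\<^sup>2 * (1 * (1 / (4 * P\<^sub>0) * (u x)\<^sup>2) + P\<^sub>0 * H x)"
      by (intro mult_left_mono) auto
    then have 2: "u x * (\<delta>\<^sup>2 * (LINT y|M. kb x y * f y)) \<le> \<delta>\<^sup>2 / (4 * P\<^sub>0) * (u x)\<^sup>2 + \<delta>\<^sup>2 * P\<^sub>0 * H x"
      by (simp add: distrib_left mult_ac)
    show ?thesis using 1 2 unfolding rhs_def by (simp add: distrib_left)
  qed
  note u2 = M_L2(3)[OF u]
  note \<sigma>u2 = K.sigma_square_integrable[OF u]
  have "K.form u = (LINT x|M. u x * K.nl_op u x)" by (rule K.energy_identity[OF u, symmetric])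
  also have "\<dots> = (LINT x|M. u x * rhs f g x)"
    using eq by (intro integral_cong_AE borel_measurable_times M_L2 u K.nl_op_L2 rhs_L2 f g) auto
  also have "\<dots> \<le> (LINT x|M. \<sigma> x * (u x)\<^sup>2 / 2 + \<delta> * G x + (\<delta>\<^sup>2 / (4 * P\<^sub>0) * (u x)\<^sup>2 + \<delta>\<^sup>2 * P\<^sub>0 * H x))"
    using u2 \<sigma>u2 G(1) H(1) pt by (intro integral_mono K.L2_mult_integrable u rhs_L2 f g) auto
  also have "\<dots> = (LINT x|M. \<sigma> x * (u x)\<^sup>2) / 2 + \<delta> * (LINT x|M. G x)
      + (\<delta>\<^sup>2 / (4 * P\<^sub>0) * (LINT x|M. (u x)\<^sup>2) + \<delta>\<^sup>2 * P\<^sub>0 * (LINT x|M. H x))"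
    using u2 \<sigma>u2 G(1) H(1) by simp
  also have "\<dots> \<le> K.form u / 2 + \<delta> * (LINT y|S. (g y)\<^sup>2)
      + (\<delta>\<^sup>2 / (4 * P\<^sub>0) * (P\<^sub>0 / \<delta>\<^sup>2 * K.form u) + \<delta>\<^sup>2 * P\<^sub>0 * (LINT y|M. (f y)\<^sup>2))"
  proof (intro add_mono mult_left_mono G(2) H(2) K.coercive[OF u] divide_right_mono)
    have "0 \<le> (LINT x|M. LINT y|M. k x y * (u x - u y)\<^sup>2)"
      by (intro Bochner_Integration.integral_nonneg mult_nonneg_nonneg k_nonneg) auto
    then show "(LINT x|M. \<sigma> x * (u x)\<^sup>2) \<le> K.form u" by (simp add: K.form_def)
  qed (use \<delta>_pos P0_pos in auto)
  also have "\<delta>\<^sup>2 / (4 * P\<^sub>0) * (P\<^sub>0 / \<delta>\<^sup>2 * K.form u) = K.form u / 4"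
    using \<delta>_pos P0_pos by simp
  finally show ?thesis by simp
qed

lemma form_parts_le:
  "(LINT x|M. \<sigma> x * (u x)\<^sup>2) \<le> K.form u" "(LINT x|M. LINT y|M. k x y * (u x - u y)\<^sup>2) \<le> 2 * K.form u"
proof -
  have "0 \<le> (LINT x|M. LINT y|M. k x y * (u x - u y)\<^sup>2)" "0 \<le> (LINT x|M. \<sigma> x * (u x)\<^sup>2)"
    by (intro Bochner_Integration.integral_nonneg mult_nonneg_nonneg k_nonneg \<sigma>_bounds; simp)+
  then show "(LINT x|M. \<sigma> x * (u x)\<^sup>2) \<le> K.form u" "(LINT x|M. LINT y|M. k x y * (u x - u y)\<^sup>2) \<le> 2 * K.form u"
    by (simp_all add: K.form_def)
qed

end

section \<open>The gradient of the solution\<close>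

context scaled_problem
begin

text \<open>
  The derivatives of the two kernels in the direction \<open>b\<close> of the first argument; \<open>- R\<close> appears as the
  derivative of \<open>Rbar\<close>.
\<close>

definition dk :: "'a \<Rightarrow> 'a \<Rightarrow> 'a \<Rightarrow> real" where
  "dk b x y = scaled_kernel \<alpha> R' \<delta> x y * ((x - y) \<bullet> b / (2 * \<delta>\<^sup>2))"

definition dkb :: "'a \<Rightarrow> 'a \<Rightarrow> 'a \<Rightarrow> real" where
  "dkb b x y = scaled_kernel \<alpha> (\<lambda>r. - R r) \<delta> x y * ((x - y) \<bullet> b / (2 * \<delta>\<^sup>2))"

lemma dk_measurable [measurable (raw)]:
  assumes [measurable]: "f \<in> N \<rightarrow>\<^sub>M borel" "g \<in> N \<rightarrow>\<^sub>M borel"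
  shows "(\<lambda>z. dk b (f z) (g z)) \<in> borel_measurable N"
proof -
  have [measurable]: "(\<lambda>z. scaled_kernel \<alpha> R' \<delta> (f z) (g z)) \<in> borel_measurable N"
    by (rule scaled_kernel_borel[OF R'_cont]) measurable
  show ?thesis unfolding dk_def by measurable
qed

lemma dkb_measurable [measurable (raw)]:
  assumes [measurable]: "f \<in> N \<rightarrow>\<^sub>M borel" "g \<in> N \<rightarrow>\<^sub>M borel"
  shows "(\<lambda>z. dkb b (f z) (g z)) \<in> borel_measurable N"
proof -
  have [measurable]: "(\<lambda>z. scaled_kernel \<alpha> (\<lambda>r. - R r) \<delta> (f z) (g z)) \<in> borel_measurable N"
    by (rule scaled_kernel_borel[OF continuous_on_minus[OF R_cont]]) measurable
  show ?thesis unfolding dkb_def by measurable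
qed

lemma dk_section_measurable [measurable]:
  "dk b x \<in> borel_measurable M" "dkb b x \<in> borel_measurable M" "dkb b x \<in> borel_measurable S"
proof -
  have 1: "dk b x \<in> borel_measurable borel"
    by (rule dk_measurable[of "\<lambda>_. x" borel "\<lambda>y. y"]) (rule measurable_const measurable_ident[unfolded id_def]; simp)+
  have 2: "dkb b x \<in> borel_measurable borel"
    by (rule dkb_measurable[of "\<lambda>_. x" borel "\<lambda>y. y"]) (rule measurable_const measurable_ident[unfolded id_def]; simp)+
  show "dk b x \<in> borel_measurable M" by (rule borel_measurable_lebesgue_on_borel[OF 1])
  show "dkb b x \<in> borel_measurable M" by (rule borel_measurable_lebesgue_on_borel[OF 2])
  show "dkb b x \<in> borel_measurable S" by (rule borel_measurable_surface[OF 2])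
qed

lemma direction_factor_le:
  assumes "b \<in> Basis" "dist x y \<le> 2 * \<delta>"
  shows "\<bar>(x - y) \<bullet> b / (2 * \<delta>\<^sup>2)\<bar> \<le> 1 / \<delta>"
proof -
  have "\<bar>(x - y) \<bullet> b\<bar> \<le> 2 * \<delta>" using Basis_le_norm[OF assms(1), of "x - y"] assms(2) by (simp add: dist_norm)
  then have "\<bar>(x - y) \<bullet> b\<bar> / (2 * \<delta>\<^sup>2) \<le> 2 * \<delta> / (2 * \<delta>\<^sup>2)" using \<delta>_pos by (intro divide_right_mono) auto
  then show ?thesis using \<delta>_pos by (simp add: power2_eq_square)
qed

lemma dk_bound:
  assumes b: "b \<in> Basis"
  shows "\<bar>dk b x y\<bar> \<le> a * M\<^sub>1 / \<delta> * indicator (cball x (2 * \<delta>)) y"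
proof (cases "dist x y \<le> 2 * \<delta>")
  case True
  have "\<bar>scaled_kernel \<alpha> R' \<delta> x y\<bar> \<le> a * M\<^sub>1"
    using a_pos R'_le[OF kernel_argument(1), of x y]
    by (simp add: scaled_kernel_def a_def[symmetric] abs_mult)
  then have "\<bar>dk b x y\<bar> \<le> a * M\<^sub>1 * (1 / \<delta>)"
    unfolding dk_def abs_mult using direction_factor_le[OF b True] a_pos M_nonneg
    by (intro mult_mono) auto
  then show ?thesis using True by simp
next
  case False
  then have "scaled_kernel \<alpha> R' \<delta> x y = 0"
    using R'_zero[OF kernel_argument(2), of x y] by (simp add: scaled_kernel_def)
  then show ?thesis using False by (simp add: dk_def)
qed

lemma dkb_bound:
  assumes b: "b \<in> Basis"
  shows "\<bar>dkb b x y\<bar> \<le> k x y / \<delta>"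
proof -
  have eq: "scaled_kernel \<alpha> (\<lambda>r. - R r) \<delta> x y = - k x y" by (simp add: k_def scaled_kernel_def)
  show ?thesis
  proof (cases "dist x y \<le> 2 * \<delta>")
    case True
    have "\<bar>dkb b x y\<bar> \<le> k x y * (1 / \<delta>)"
      unfolding dkb_def eq abs_mult using direction_factor_le[OF b True] k_nonneg[of x y]
      by (intro mult_mono) auto
    then show ?thesis by simp
  qed (simp add: dkb_def eq k_zero)
qed

lemma DERIV_kernels:
  "((\<lambda>s. k (x + s *\<^sub>R b) y) has_real_derivative dk b (x + t *\<^sub>R b) y) (at t)"
  "((\<lambda>s. kb (x + s *\<^sub>R b) y) has_real_derivative dkb b (x + t *\<^sub>R b) y) (at t)"
  unfolding k_def kb_def dk_def dkb_def
  by (rule scaled_kernel_DERIV[OF R_deriv \<delta>_pos] scaled_kernel_DERIV[OF Rbar_deriv \<delta>_pos]; assumption)+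

lemma DERIV_integral_k:
  assumes b: "b \<in> Basis" and h: "integrable M h"
  shows "((\<lambda>s. LINT y|M. k (x + s *\<^sub>R b) y * h y) has_real_derivative (LINT y|M. dk b x y * h y)) (at 0)"
proof -
  define C where "C = max (a * M\<^sub>0) (a * M\<^sub>1 / \<delta>)"
  have "((\<lambda>s. LINT y|M. k (x + s *\<^sub>R b) y * h y) has_real_derivative (LINT y|M. dk b (x + 0 *\<^sub>R b) y * h y)) (at 0)"
  proof (rule DERIV_under_integral[OF h, where C = C])
    show "\<bar>k (x + t *\<^sub>R b) y\<bar> \<le> C" for t y
      using k_nonneg[of "x + t *\<^sub>R b" y] k_le[of "x + t *\<^sub>R b" y] by (simp add: C_def)
    show "\<bar>dk b (x + t *\<^sub>R b) y\<bar> \<le> C" for t y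
    proof -
      have "\<bar>dk b (x + t *\<^sub>R b) y\<bar> \<le> a * M\<^sub>1 / \<delta> * 1"
        using a_pos M_nonneg \<delta>_pos
        by (intro order_trans[OF dk_bound[OF b]] mult_left_mono) (auto simp: indicator_def)
      then show ?thesis by (simp add: C_def)
    qed
  qed (rule kernel_section_measurable dk_section_measurable DERIV_kernels)+
  then show ?thesis by simp
qed

lemma DERIV_integral_kb:
  assumes b: "b \<in> Basis" and h: "integrable N h"
    and m: "\<And>x. kb x \<in> borel_measurable N" "\<And>x. dkb b x \<in> borel_measurable N"
  shows "((\<lambda>s. LINT y|N. kb (x + s *\<^sub>R b) y * h y) has_real_derivative (LINT y|N. dkb b x y * h y)) (at 0)"
proof -
  define C where "C = max (a * M\<^sub>0) (a * M\<^sub>0 / \<delta>)"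
  have "((\<lambda>s. LINT y|N. kb (x + s *\<^sub>R b) y * h y) has_real_derivative (LINT y|N. dkb b (x + 0 *\<^sub>R b) y * h y)) (at 0)"
  proof (rule DERIV_under_integral[OF h, where C = C])
    show "\<bar>kb (x + t *\<^sub>R b) y\<bar> \<le> C" for t y
      using kb_nonneg[of "x + t *\<^sub>R b" y] kb_le[of "x + t *\<^sub>R b" y] by (simp add: C_def)
    show "\<bar>dkb b (x + t *\<^sub>R b) y\<bar> \<le> C" for t y
    proof -
      have "\<bar>dkb b (x + t *\<^sub>R b) y\<bar> \<le> a * M\<^sub>0 / \<delta>"
        using \<delta>_pos by (intro order_trans[OF dkb_bound[OF b]] divide_right_mono k_le) auto
      then show ?thesis by (simp add: C_def)
    qed
  qed (rule m DERIV_kernels)+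
  then show ?thesis by simp
qed

text \<open>
  The constants \<open>\<omega>\<close>, \<open>A\<^sub>0\<close> and \<open>A\<^sub>S\<close> below do not depend on \<open>\<delta>\<close>: balls of radius \<open>2 \<delta>\<close> have volume
  \<open>\<omega> \<delta>\<^sup>n\<close> and surface measure at most \<open>A\<^sub>S \<delta>\<^sup>n\<^sup>-\<^sup>1\<close>, and the kernel has mass at most \<open>A\<^sub>0\<close>.
\<close>

definition \<omega> :: real where "\<omega> = unit_ball_vol (real DIM('a)) * 2 ^ DIM('a)"

lemma \<omega>_nonneg: "\<omega> \<ge> 0"
  by (simp add: \<omega>_def)

lemma nn_integral_ball_le:
  "(\<integral>\<^sup>+y. ennreal (indicator (cball x (2 * \<delta>)) y) \<partial>M) \<le> ennreal (\<omega> * \<delta> ^ DIM('a))"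
proof -
  have "(\<integral>\<^sup>+y. ennreal (indicator (cball x (2 * \<delta>)) y) \<partial>M)
      = (\<integral>\<^sup>+y. indicator \<Omega> y * ennreal (indicator (cball x (2 * \<delta>)) y) \<partial>lborel)"
    by (rule nn_integral_lebesgue_on_borel) simp
  also have "\<dots> \<le> (\<integral>\<^sup>+y. indicator (cball x (2 * \<delta>)) y \<partial>lborel)"
    by (intro nn_integral_mono) (auto simp: indicator_def)
  also have "\<dots> = ennreal (\<omega> * \<delta> ^ DIM('a))"
    using \<delta>_pos by (simp add: emeasure_cball \<omega>_def power_mult_distrib mult_ac)
  finally show ?thesis .
qed

definition A\<^sub>0 :: real where "A\<^sub>0 = \<alpha> * M\<^sub>0 * \<omega>"

lemma A0_nonneg: "A\<^sub>0 \<ge> 0"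
  using \<alpha>_pos M_nonneg \<omega>_nonneg by (simp add: A\<^sub>0_def)

lemma cball_indicator_borel: "(\<lambda>y. indicator (cball x r) y :: real) \<in> borel_measurable borel"
  by (intro borel_measurable_indicator borel_closed closed_cball)

lemma nn_integral_const_ball_le:
  assumes "C \<ge> 0"
  shows "(\<integral>\<^sup>+y. ennreal (a * C * indicator (cball x (2 * \<delta>)) y) \<partial>M) \<le> ennreal (\<alpha> * C * \<omega>)"
proof -
  have [measurable]: "(\<lambda>y. indicator (cball x (2 * \<delta>)) y :: real) \<in> borel_measurable M"
    by (rule borel_measurable_lebesgue_on_borel[OF cball_indicator_borel])
  have "(\<integral>\<^sup>+y. ennreal (a * C * indicator (cball x (2 * \<delta>)) y) \<partial>M)
      = ennreal (a * C) * (\<integral>\<^sup>+y. ennreal (indicator (cball x (2 * \<delta>)) y) \<partial>M)"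
    using a_pos assms by (subst nn_integral_cmult[symmetric]) (auto simp: ennreal_mult)
  also have "\<dots> \<le> ennreal (a * C) * ennreal (\<omega> * \<delta> ^ DIM('a))"
    by (intro mult_left_mono nn_integral_ball_le) simp
  also have "\<dots> = ennreal (a * C * (\<omega> * \<delta> ^ DIM('a)))"
    using a_pos assms \<omega>_nonneg \<delta>_pos by (intro ennreal_mult[symmetric]) auto
  also have "a * C * (\<omega> * \<delta> ^ DIM('a)) = \<alpha> * C * \<omega>" using \<delta>_pos by (simp add: a_def)
  finally show ?thesis .
qed

lemma k_le_ball: "k x y \<le> a * M\<^sub>0 * indicator (cball x (2 * \<delta>)) y"
  using k_le[of x y] k_zero[of x y] by (auto simp: indicator_def)

lemma nn_integral_k_le: "(\<integral>\<^sup>+y. ennreal (k x y) \<partial>M) \<le> ennreal A\<^sub>0"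
proof -
  have "(\<integral>\<^sup>+y. ennreal (k x y) \<partial>M) \<le> (\<integral>\<^sup>+y. ennreal (a * M\<^sub>0 * indicator (cball x (2 * \<delta>)) y) \<partial>M)"
    by (intro nn_integral_mono ennreal_leI k_le_ball)
  then show ?thesis
    unfolding A\<^sub>0_def by (rule order_trans[OF _ nn_integral_const_ball_le[OF M_nonneg(1)]])
qed

definition A\<^sub>S :: real where "A\<^sub>S = C\<^sub>S * 2 ^ (DIM('a) - 1)"

lemma AS_nonneg: "A\<^sub>S \<ge> 0"
  using CS_nonneg by (simp add: A\<^sub>S_def)

lemma power_dim: "\<delta> ^ DIM('a) = \<delta> * \<delta> ^ (DIM('a) - 1)"
  using DIM_positive[where 'a='a] by (metis Suc_diff_1 power_Suc)

lemma surface_ball_le: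
  "(\<integral>\<^sup>+y. ennreal (indicator (cball x (2 * \<delta>)) y) \<partial>S) \<le> ennreal (A\<^sub>S * \<delta> ^ (DIM('a) - 1))"
proof -
  have "(\<lambda>y. y) -` cball x (2 * \<delta>) \<inter> space S \<in> sets S" by (rule measurable_sets[OF id_S]) simp
  then have s: "frontier \<Omega> \<inter> cball x (2 * \<delta>) \<in> sets S" by (simp add: Int_commute)
  have "(\<integral>\<^sup>+y. ennreal (indicator (cball x (2 * \<delta>)) y) \<partial>S)
      = (\<integral>\<^sup>+y. indicator (frontier \<Omega> \<inter> cball x (2 * \<delta>)) y \<partial>S)"
    by (intro nn_integral_cong) (auto simp: indicator_def)
  also have "\<dots> = emeasure S (frontier \<Omega> \<inter> cball x (2 * \<delta>))" using s by simp
  also have "\<dots> = hausdorff_outer (DIM('a) - 1) (frontier \<Omega> \<inter> cball x (2 * \<delta>))"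
    by (rule emeasure_surface_measure) simp
  also have "\<dots> \<le> ennreal (C\<^sub>S * (2 * \<delta>) ^ (DIM('a) - 1))"
    by (rule surface) (use \<delta>_pos in simp)
  finally show ?thesis by (simp add: A\<^sub>S_def power_mult_distrib mult_ac)
qed

lemma nn_integral_surface_const_ball_le:
  assumes "C \<ge> 0"
  shows "(\<integral>\<^sup>+y. ennreal (a * C * indicator (cball x (2 * \<delta>)) y) \<partial>S) \<le> ennreal (\<alpha> * C * A\<^sub>S / \<delta>)"
proof -
  have [measurable]: "(\<lambda>y. indicator (cball x (2 * \<delta>)) y :: real) \<in> borel_measurable S"
    by (rule borel_measurable_surface[OF cball_indicator_borel])
  have "(\<integral>\<^sup>+y. ennreal (a * C * indicator (cball x (2 * \<delta>)) y) \<partial>S)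
      = ennreal (a * C) * (\<integral>\<^sup>+y. ennreal (indicator (cball x (2 * \<delta>)) y) \<partial>S)"
    using a_pos assms by (subst nn_integral_cmult[symmetric]) (auto simp: ennreal_mult)
  also have "\<dots> \<le> ennreal (a * C) * ennreal (A\<^sub>S * \<delta> ^ (DIM('a) - 1))"
    by (intro mult_left_mono surface_ball_le) simp
  also have "\<dots> = ennreal (a * C * (A\<^sub>S * \<delta> ^ (DIM('a) - 1)))"
    using a_pos assms AS_nonneg \<delta>_pos by (intro ennreal_mult[symmetric]) auto
  also have "a * C * (A\<^sub>S * \<delta> ^ (DIM('a) - 1)) = \<alpha> * C * A\<^sub>S / \<delta>"
    using \<delta>_pos by (simp add: a_def power_dim)
  finally show ?thesis .
qed

text \<open>
  The square of the boundary term that is multiplied by \<open>u\<close> is controlled by \<open>\<sigma> / \<delta>\<^sup>2\<close>, hence by the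
  form.  This is where \<open>R\<^sup>2\<close> has to be compared with \<open>Rbar\<close>.
\<close>

lemma boundary_gradient_le:
  assumes b: "b \<in> Basis"
  shows "(2 * \<delta> * (LINT y|S. dkb b x y))\<^sup>2 \<le> 4 * A\<^sub>S * \<alpha> * M\<^sub>1 / \<delta>\<^sup>2 * \<sigma> x"
proof -
  let ?p = "\<lambda>y. indicator (cball x (2 * \<delta>)) y :: real"
  have [measurable]: "?p \<in> borel_measurable S" by (rule borel_measurable_surface[OF cball_indicator_borel])
  have "ennreal ((LINT y|S. dkb b x y)\<^sup>2) \<le> (\<integral>\<^sup>+y. ennreal (?p y) \<partial>S) * (\<integral>\<^sup>+y. ennreal (?p y * (k x y / \<delta>)\<^sup>2) \<partial>S)"
  proof (rule nn_Cauchy_Schwarz_weighted)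
    fix y
    show "\<bar>dkb b x y\<bar> \<le> ?p y * \<bar>k x y / \<delta>\<bar>"
      using dkb_bound[OF b, of x y] k_zero[of x y] k_nonneg[of x y] \<delta>_pos by (auto simp: indicator_def)
  qed measurable
  also have "\<dots> \<le> ennreal (A\<^sub>S * \<delta> ^ (DIM('a) - 1)) * (\<integral>\<^sup>+y. ennreal (2 * M\<^sub>1 * a / \<delta>\<^sup>2 * kb x y) \<partial>S)"
  proof -
    have q: "?p y * (k x y / \<delta>)\<^sup>2 \<le> 2 * M\<^sub>1 * a / \<delta>\<^sup>2 * kb x y" for y
    proof -
    have "?p y * (k x y / \<delta>)\<^sup>2 \<le> (k x y)\<^sup>2 / \<delta>\<^sup>2" by (auto simp: indicator_def power_divide)
    also have "\<dots> \<le> 2 * M\<^sub>1 * a * kb x y / \<delta>\<^sup>2" by (intro divide_right_mono k_square_le) auto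
    finally show ?thesis by simp
    qed
    show ?thesis by (intro mult_mono surface_ball_le nn_integral_mono ennreal_leI q) auto
  qed
  also have "(\<integral>\<^sup>+y. ennreal (2 * M\<^sub>1 * a / \<delta>\<^sup>2 * kb x y) \<partial>S) = ennreal (LINT y|S. 2 * M\<^sub>1 * a / \<delta>\<^sup>2 * kb x y)"
    using M_nonneg a_pos by (intro nn_integral_eq_integral integrable_mult_right kb_integrable_S) (auto simp: kb_nonneg)
  also have "ennreal (A\<^sub>S * \<delta> ^ (DIM('a) - 1)) * ennreal (LINT y|S. 2 * M\<^sub>1 * a / \<delta>\<^sup>2 * kb x y)
      = ennreal (A\<^sub>S * \<delta> ^ (DIM('a) - 1) * (LINT y|S. 2 * M\<^sub>1 * a / \<delta>\<^sup>2 * kb x y))"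
    using AS_nonneg \<delta>_pos M_nonneg a_pos
    by (intro ennreal_mult[symmetric] Bochner_Integration.integral_nonneg) (auto simp: kb_nonneg)
  finally have "(LINT y|S. dkb b x y)\<^sup>2 \<le> A\<^sub>S * \<delta> ^ (DIM('a) - 1) * (LINT y|S. 2 * M\<^sub>1 * a / \<delta>\<^sup>2 * kb x y)"
    using AS_nonneg \<delta>_pos M_nonneg a_pos
    by (subst (asm) ennreal_le_iff) (auto intro!: mult_nonneg_nonneg Bochner_Integration.integral_nonneg simp: kb_nonneg)
  then have "(2 * \<delta>)\<^sup>2 * (LINT y|S. dkb b x y)\<^sup>2 \<le> (2 * \<delta>)\<^sup>2 * (A\<^sub>S * \<delta> ^ (DIM('a) - 1) * (LINT y|S. 2 * M\<^sub>1 * a / \<delta>\<^sup>2 * kb x y))"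
    by (intro mult_left_mono) auto
  also have "\<dots> = 4 * A\<^sub>S * \<alpha> * M\<^sub>1 / \<delta>\<^sup>2 * \<sigma> x"
    using \<delta>_pos by (simp add: \<sigma>_def a_def power_dim power2_eq_square field_simps)
  finally show ?thesis by (simp add: power_mult_distrib)
qed

text \<open>
  The equation solved for \<open>u x\<close>.  On the right-hand side \<open>x\<close> enters only through the kernels, so this is a
  differentiable representative of a solution.
\<close>

definition regularized :: "('a \<Rightarrow> real) \<Rightarrow> ('a \<Rightarrow> real) \<Rightarrow> ('a \<Rightarrow> real) \<Rightarrow> 'a \<Rightarrow> real" where
  "regularized f g u x = (K.avg u x + rhs f g x) / (K.weight x + \<sigma> x)"

text \<open>
  The derivative of \<open>regularized\<close> by the quotient rule, in the form \<open>(N / m)' = (N' - (N / m) m') / m\<close>.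
\<close>

definition grad :: "('a \<Rightarrow> real) \<Rightarrow> ('a \<Rightarrow> real) \<Rightarrow> ('a \<Rightarrow> real) \<Rightarrow> 'a \<Rightarrow> 'a \<Rightarrow> real" where
  "grad f g u b x =
     ((LINT y|M. dk b x y * u y) + (2 * \<delta> * (LINT y|S. dkb b x y * g y) + \<delta>\<^sup>2 * (LINT y|M. dkb b x y * f y))
       - regularized f g u x * ((LINT y|M. dk b x y) + 2 * \<delta> * (LINT y|S. dkb b x y)))
     / (K.weight x + \<sigma> x)"

lemma denominator_ge: "x \<in> \<Omega> \<Longrightarrow> c \<le> K.weight x + \<sigma> x"
  using weight_lower[of x] \<sigma>_bounds(1)[of x] by (simp add: K.weight_def)

lemma regularized_eq:
  assumes f: "f \<in> L2 M" and g: "g \<in> L2 S" and eq: "AE x in M. K.nl_op u x = rhs f g x"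
  shows "AE x in M. u x = regularized f g u x"
  using eq AE_space
proof eventually_elim
  case (elim x)
  then have "K.weight x + \<sigma> x > 0" using denominator_ge[of x] c_pos by (simp add: space_restrict_space)
  then show ?case using elim by (simp add: regularized_def K.nl_op_def field_simps)
qed

lemma weight_borel [measurable]: "K.weight \<in> borel_measurable borel"
  unfolding K.weight_def by measurable

lemma regularized_borel:
  assumes f: "f \<in> L2 M" and g: "g \<in> L2 S" and u: "u \<in> L2 M"
  shows "regularized f g u \<in> borel_measurable borel"
proof -
  note [measurable] = rhs_borel[OF f g] M_L2(1)[OF u]
  have [measurable]: "K.avg u \<in> borel_measurable borel" unfolding K.avg_def by measurable
  show ?thesis unfolding regularized_def by measurable
qed

lemma grad_borel:
  assumes f: "f \<in> L2 M" and g: "g \<in> L2 S" and u: "u \<in> L2 M"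
  shows "grad f g u b \<in> borel_measurable borel"
proof -
  note [measurable] = regularized_borel[OF f g u] M_L2(1)[OF u] M_L2(1)[OF f] S_L2(1)[OF g]
  show ?thesis unfolding grad_def by measurable
qed

lemma DERIV_regularized:
  assumes f: "f \<in> L2 M" and g: "g \<in> L2 S" and u: "u \<in> L2 M" and b: "b \<in> Basis" and x: "x \<in> \<Omega>"
  shows "((\<lambda>t. regularized f g u (x + t *\<^sub>R b)) has_real_derivative grad f g u b x) (at 0)"
proof -
  define m where "m = K.weight x + \<sigma> x"
  have m: "m \<noteq> 0" using denominator_ge[OF x] c_pos by (simp add: m_def)
  define N' where "N' = (LINT y|M. dk b x y * u y)
      + (2 * \<delta> * (LINT y|S. dkb b x y * g y) + \<delta>\<^sup>2 * (LINT y|M. dkb b x y * f y))"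
  define m' where "m' = (LINT y|M. dk b x y) + 2 * \<delta> * (LINT y|S. dkb b x y)"
  have 1: "integrable M (\<lambda>_. 1::real)" "integrable S (\<lambda>_. 1::real)" by simp_all
  have N: "((\<lambda>t. K.avg u (x + t *\<^sub>R b) + rhs f g (x + t *\<^sub>R b)) has_real_derivative N') (at 0)"
    unfolding K.avg_def rhs_def N'_def
    by (intro DERIV_add DERIV_cmult DERIV_integral_k DERIV_integral_kb b M_L2(2) S_L2(2) u f g
        kernel_section_measurable dk_section_measurable)
  have "((\<lambda>t. (LINT y|M. k (x + t *\<^sub>R b) y * 1) + 2 * \<delta> * (LINT y|S. kb (x + t *\<^sub>R b) y * 1))
      has_real_derivative (LINT y|M. dk b x y * 1) + 2 * \<delta> * (LINT y|S. dkb b x y * 1)) (at 0)"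
    by (intro DERIV_add DERIV_cmult DERIV_integral_k DERIV_integral_kb b 1
        kernel_section_measurable dk_section_measurable)
  then have D: "((\<lambda>t. K.weight (x + t *\<^sub>R b) + \<sigma> (x + t *\<^sub>R b)) has_real_derivative m') (at 0)"
    unfolding K.weight_def \<sigma>_def m'_def by simp
  have "((\<lambda>t. (K.avg u (x + t *\<^sub>R b) + rhs f g (x + t *\<^sub>R b)) / (K.weight (x + t *\<^sub>R b) + \<sigma> (x + t *\<^sub>R b)))
      has_real_derivative (N' * m - (K.avg u x + rhs f g x) * m') / (m * m)) (at 0)"
    using DERIV_divide[OF N D] m by (simp add: m_def)
  moreover have "(N' * m - (K.avg u x + rhs f g x) * m') / (m * m) = grad f g u b x"
  proof -
    have r: "K.avg u x + rhs f g x = regularized f g u x * m" using m by (simp add: regularized_def m_def)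
    have "grad f g u b x = (N' - regularized f g u x * m') / m"
      unfolding grad_def N'_def m'_def m_def ..
    then have "N' = grad f g u b x * m + regularized f g u x * m'" using m by (simp add: field_simps)
    then have "N' * m - (K.avg u x + rhs f g x) * m' = grad f g u b x * (m * m)"
      unfolding r by (simp add: algebra_simps)
    then show ?thesis using m by simp
  qed
  ultimately show ?thesis unfolding regularized_def by simp
qed

lemma regularized_bounded:
  assumes f: "f \<in> L2 M" and g: "g \<in> L2 S" and u: "u \<in> L2 M" and b: "b \<in> Basis"
  obtains C where "\<And>x. x \<in> \<Omega> \<Longrightarrow> \<bar>regularized f g u x\<bar> \<le> C" "\<And>x. x \<in> \<Omega> \<Longrightarrow> \<bar>grad f g u b x\<bar> \<le> C"
proof -
  have int: "\<bar>LINT y|N. \<kappa> y * h y\<bar> \<le> C * (LINT y|N. \<bar>h y\<bar>)"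
    if h: "integrable N h" and \<kappa>: "\<And>y. \<bar>\<kappa> y\<bar> \<le> C" for N :: "'a measure" and \<kappa> h :: "'a \<Rightarrow> real" and C
  proof (cases "integrable N (\<lambda>y. \<kappa> y * h y)")
    case True
    have "\<bar>LINT y|N. \<kappa> y * h y\<bar> \<le> (LINT y|N. \<bar>\<kappa> y * h y\<bar>)"
      using integral_norm_bound[of N "\<lambda>y. \<kappa> y * h y"] by simp
    also have "\<dots> \<le> (LINT y|N. C * \<bar>h y\<bar>)"
      using h \<kappa> by (intro integral_mono integrable_abs[OF True]) (auto simp: abs_mult intro!: mult_right_mono)
    finally show ?thesis by simp
  next
    case False
    have "0 \<le> C" using \<kappa>[of undefined] by linarith
    then show ?thesis using False by (simp add: not_integrable_integral_eq Bochner_Integration.integral_nonneg)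
  qed
  define C where "C = max (a * M\<^sub>0) (max (a * M\<^sub>1 / \<delta>) (a * M\<^sub>0 / \<delta>))"
  have k: "\<bar>k x y\<bar> \<le> C" "\<bar>kb x y\<bar> \<le> C" for x y
    using k_nonneg[of x y] k_le[of x y] kb_nonneg[of x y] kb_le[of x y] by (auto simp: C_def)
  have dk: "\<bar>dk b x y\<bar> \<le> C" for x y
  proof -
    have "\<bar>dk b x y\<bar> \<le> a * M\<^sub>1 / \<delta> * 1"
      using a_pos M_nonneg \<delta>_pos by (intro order_trans[OF dk_bound[OF b]] mult_left_mono) (auto simp: indicator_def)
    then show ?thesis by (simp add: C_def)
  qed
  have dkb: "\<bar>dkb b x y\<bar> \<le> C" for x y
  proof -
    have "\<bar>dkb b x y\<bar> \<le> a * M\<^sub>0 / \<delta>"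
      using \<delta>_pos by (intro order_trans[OF dkb_bound[OF b]] divide_right_mono k_le) auto
    then show ?thesis by (simp add: C_def)
  qed
  define U where "U = (LINT y|M. \<bar>u y\<bar>)"
  define F where "F = (LINT y|M. \<bar>f y\<bar>)"
  define G where "G = (LINT y|S. \<bar>g y\<bar>)"
  note iu = M_L2(2)[OF u] and i_f = M_L2(2)[OF f] and ig = S_L2(2)[OF g]
  have 1: "integrable M (\<lambda>_. 1::real)" "integrable S (\<lambda>_. 1::real)" by simp_all
  have div: "\<bar>z / (K.weight x + \<sigma> x)\<bar> \<le> \<bar>z\<bar> / c" if "x \<in> \<Omega>" for x z
    using denominator_ge[OF that] c_pos by (auto simp: abs_divide intro!: divide_left_mono)
  define C\<^sub>1 where "C\<^sub>1 = (C * U + (2 * \<delta> * (C * G) + \<delta>\<^sup>2 * (C * F))) / c"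
  have b1: "\<bar>regularized f g u x\<bar> \<le> C\<^sub>1" if x: "x \<in> \<Omega>" for x
  proof -
    have "\<bar>K.avg u x + rhs f g x\<bar> \<le> \<bar>LINT y|M. k x y * u y\<bar> + (2 * \<delta> * \<bar>LINT y|S. kb x y * g y\<bar> + \<delta>\<^sup>2 * \<bar>LINT y|M. kb x y * f y\<bar>)"
      unfolding K.avg_def rhs_def using \<delta>_pos
      by (intro order_trans[OF abs_triangle_ineq] add_left_mono) (simp add: abs_mult)
    also have "\<dots> \<le> C * U + (2 * \<delta> * (C * G) + \<delta>\<^sup>2 * (C * F))"
      unfolding U_def F_def G_def using \<delta>_pos
      by (intro add_mono mult_left_mono int iu i_f ig k) auto
    finally have "\<bar>K.avg u x + rhs f g x\<bar> / c \<le> C\<^sub>1" unfolding C\<^sub>1_def using c_pos by (intro divide_right_mono) auto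
    then show ?thesis unfolding regularized_def using div[OF x] by (rule order_trans[rotated])
  qed
  define m\<^sub>M where "m\<^sub>M = (LINT y|M. \<bar>1::real\<bar>)"
  define m\<^sub>S where "m\<^sub>S = (LINT y|S. \<bar>1::real\<bar>)"
  define C\<^sub>2 where "C\<^sub>2 = (C * U + (2 * \<delta> * (C * G) + \<delta>\<^sup>2 * (C * F)) + C\<^sub>1 * (C * m\<^sub>M + 2 * \<delta> * (C * m\<^sub>S))) / c"
  have b2: "\<bar>grad f g u b x\<bar> \<le> C\<^sub>2" if x: "x \<in> \<Omega>" for x
  proof -
    have mm: "\<bar>LINT y|M. dk b x y\<bar> \<le> C * m\<^sub>M" "\<bar>LINT y|S. dkb b x y\<bar> \<le> C * m\<^sub>S"
      using int[OF 1(1) dk[of x]] int[OF 1(2) dkb[of x]] by (simp_all add: m\<^sub>M_def m\<^sub>S_def)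
    have C1: "0 \<le> C\<^sub>1" using b1[OF x] by linarith
    have "\<bar>(LINT y|M. dk b x y * u y) + (2 * \<delta> * (LINT y|S. dkb b x y * g y) + \<delta>\<^sup>2 * (LINT y|M. dkb b x y * f y))
       - regularized f g u x * ((LINT y|M. dk b x y) + 2 * \<delta> * (LINT y|S. dkb b x y))\<bar>
      \<le> \<bar>LINT y|M. dk b x y * u y\<bar> + (2 * \<delta> * \<bar>LINT y|S. dkb b x y * g y\<bar> + \<delta>\<^sup>2 * \<bar>LINT y|M. dkb b x y * f y\<bar>)
       + \<bar>regularized f g u x\<bar> * (\<bar>LINT y|M. dk b x y\<bar> + 2 * \<delta> * \<bar>LINT y|S. dkb b x y\<bar>)"
    proof -
      have t: "\<bar>p + (q + s) - z * (v + w)\<bar> \<le> \<bar>p\<bar> + (\<bar>q\<bar> + \<bar>s\<bar>) + \<bar>z\<bar> * (\<bar>v\<bar> + \<bar>w\<bar>)" for p q s z v w :: real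
      proof -
        have "\<bar>z * (v + w)\<bar> \<le> \<bar>z\<bar> * (\<bar>v\<bar> + \<bar>w\<bar>)" unfolding abs_mult by (intro mult_left_mono) auto
        then show ?thesis by linarith
      qed
      show ?thesis
        by (rule order_trans[OF t]) (use \<delta>_pos in \<open>simp add: abs_mult\<close>)
    qed
    also have "\<dots> \<le> C * U + (2 * \<delta> * (C * G) + \<delta>\<^sup>2 * (C * F)) + C\<^sub>1 * (C * m\<^sub>M + 2 * \<delta> * (C * m\<^sub>S))"
      unfolding U_def F_def G_def using \<delta>_pos b1[OF x] C1
      by (intro add_mono mult_mono mult_left_mono int iu i_f ig dk dkb mm) (auto intro: mm)
    finally have "\<bar>(LINT y|M. dk b x y * u y) + (2 * \<delta> * (LINT y|S. dkb b x y * g y) + \<delta>\<^sup>2 * (LINT y|M. dkb b x y * f y))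
       - regularized f g u x * ((LINT y|M. dk b x y) + 2 * \<delta> * (LINT y|S. dkb b x y))\<bar> / c \<le> C\<^sub>2"
      unfolding C\<^sub>2_def using c_pos by (intro divide_right_mono) auto
    then show ?thesis unfolding grad_def using div[OF x] by (rule order_trans[rotated])
  qed
  show ?thesis
    by (rule that[of "max C\<^sub>1 C\<^sub>2"]) (use b1 b2 in \<open>force simp: max_def\<close>)+
qed

end

context scaled_problem
begin

text \<open>
  The coefficients of the contributions of the interior, the boundary and \<open>g\<close> to the squared
  gradient, before they are scaled by powers of \<open>\<delta>\<close>.
\<close>

definition G\<^sub>1 :: real where "G\<^sub>1 = 2 * \<alpha> * \<omega> * M\<^sub>1\<^sup>2 * C\<^sub>D / \<gamma>"
definition G\<^sub>2 :: real where "G\<^sub>2 = 4 * A\<^sub>S * \<alpha> * M\<^sub>1"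
definition G\<^sub>3 :: real where "G\<^sub>3 = 4 * \<alpha> * M\<^sub>0 * A\<^sub>S * A\<^sub>0"

lemma G_nonneg: "G\<^sub>1 \<ge> 0" "G\<^sub>2 \<ge> 0" "G\<^sub>3 \<ge> 0"
  using \<alpha>_pos \<omega>_nonneg CD_nonneg \<gamma>_pos AS_nonneg M_nonneg A0_nonneg
  by (simp_all add: G\<^sub>1_def G\<^sub>2_def G\<^sub>3_def)

text \<open>
  The derivative of the kernel is supported in balls of radius \<open>2 \<delta>\<close>, but the form controls differences
  only up to distance \<open>\<delta>\<close>; the doubling inequality fills the gap.
\<close>

lemma nn_integral_wide_energy:
  assumes u: "u \<in> L2 M"
  shows "(\<integral>\<^sup>+x. \<integral>\<^sup>+y. ennreal (indicator (cball x (2 * \<delta>)) y * (u y - u x)\<^sup>2) \<partial>M \<partial>M)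
    \<le> ennreal (C\<^sub>D * \<delta> ^ DIM('a) * (2 / (\<alpha> * \<gamma>)) * K.form u)"
proof -
  obtain u' where u': "u' \<in> borel_measurable borel" and eq: "AE x in M. u x = u' x"
    using L2_representative[OF u] .
  note [measurable] = u'
  have "(\<integral>\<^sup>+x. \<integral>\<^sup>+y. ennreal (indicator (cball x (2 * \<delta>)) y * (u y - u x)\<^sup>2) \<partial>M \<partial>M)
      = (\<integral>\<^sup>+x. \<integral>\<^sup>+y. ennreal (indicator (cball x (2 * \<delta>)) y * (u' y - u' x)\<^sup>2) \<partial>M \<partial>M)"
  proof (rule nn_integral_cong_AE)
    show "AE x in M. (\<integral>\<^sup>+y. ennreal (indicator (cball x (2 * \<delta>)) y * (u y - u x)\<^sup>2) \<partial>M)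
        = (\<integral>\<^sup>+y. ennreal (indicator (cball x (2 * \<delta>)) y * (u' y - u' x)\<^sup>2) \<partial>M)"
      using eq
    proof eventually_elim
      case x: (elim x)
      show ?case by (rule nn_integral_cong_AE) (use eq in eventually_elim, simp add: x)
    qed
  qed
  also have "\<dots> = (\<integral>\<^sup>+x. indicator \<Omega> x * (\<integral>\<^sup>+y. indicator \<Omega> y * ennreal (indicator (cball x (2 * \<delta>)) y * (u' y - u' x)\<^sup>2) \<partial>lborel) \<partial>lborel)"
    by (simp add: nn_integral_lebesgue_on_borel)
  also have "\<dots> = diff_energy (near_pairs \<Omega> (2 * \<delta>)) u'"
    unfolding diff_energy_def
  proof (rule nn_integral_cong)
    fix x
    show "indicator \<Omega> x * (\<integral>\<^sup>+y. indicator \<Omega> y * ennreal (indicator (cball x (2 * \<delta>)) y * (u' y - u' x)\<^sup>2) \<partial>lborel)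
        = (\<integral>\<^sup>+y. indicator (near_pairs \<Omega> (2 * \<delta>)) (x, y) * ennreal ((u' x - u' y)\<^sup>2) \<partial>lborel)"
    proof (cases "x \<in> \<Omega>")
      case True
      then show ?thesis
        by (auto simp: near_pairs_def indicator_def power2_commute intro!: nn_integral_cong)
    next
      case False
      then have "(\<lambda>y. indicator (near_pairs \<Omega> (2 * \<delta>)) (x, y) * ennreal ((u' x - u' y)\<^sup>2)) = (\<lambda>y. 0)"
        by (auto simp: near_pairs_def)
      then show ?thesis using False by simp
    qed
  qed
  also have "\<dots> \<le> ennreal (C\<^sub>D * \<delta> ^ DIM('a)) * nl_energy \<Omega> \<delta> u'" by (rule doubling[OF u'])
  also have "\<dots> \<le> ennreal (C\<^sub>D * \<delta> ^ DIM('a)) * (ennreal (1 / (\<alpha> * \<gamma>)) * ennreal (2 * K.form u))"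
    by (intro mult_left_mono order_trans[OF nl_energy_le[OF u u' eq]] ennreal_leI form_parts_le) auto
  also have "\<dots> = ennreal (C\<^sub>D * \<delta> ^ DIM('a) * (1 / (\<alpha> * \<gamma>) * (2 * K.form u)))"
  proof -
    have "0 \<le> K.form u" using form_parts_le(1)[of u]
      by (rule order_trans[rotated]) (intro Bochner_Integration.integral_nonneg mult_nonneg_nonneg \<sigma>_bounds; simp)
    then show ?thesis
      using CD_nonneg \<delta>_pos \<alpha>_pos \<gamma>_pos
      by (simp add: ennreal_mult[symmetric] del: times_divide_eq_left times_divide_eq_right)
  qed
  finally show ?thesis by (simp add: mult_ac)
qed

lemma form_nonneg: "0 \<le> K.form u"
  using form_parts_le(1)[of u]
  by (rule order_trans[rotated]) (intro Bochner_Integration.integral_nonneg mult_nonneg_nonneg \<sigma>_bounds; simp)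

text \<open>
  The interior contribution: after subtracting \<open>r x\<close>, the derivative of the kernel, of order
  \<open>\<delta>\<^sup>-\<^sup>n\<^sup>-\<^sup>1\<close> on a ball of radius \<open>2 \<delta>\<close>, acts on differences of \<open>u\<close>.
\<close>

lemma gradient_term_1:
  assumes u: "u \<in> L2 M" and r: "r \<in> borel_measurable borel" and eq: "AE x in M. u x = r x" and b: "b \<in> Basis"
  shows "(\<integral>\<^sup>+x. ennreal ((LINT y|M. dk b x y * (u y - r x))\<^sup>2) \<partial>M) \<le> ennreal (G\<^sub>1 / \<delta>\<^sup>2 * K.form u)"
proof -
  note [measurable] = M_L2(1)[OF u]
  have [measurable]: "(\<lambda>y. indicator (cball x (2 * \<delta>)) y :: real) \<in> borel_measurable M" for x
    by (rule borel_measurable_lebesgue_on_borel[OF cball_indicator_borel])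
  let ?p = "\<lambda>x y. a * (M\<^sub>1 / \<delta>) * indicator (cball x (2 * \<delta>)) y :: real"
  have "(\<integral>\<^sup>+x. ennreal ((LINT y|M. dk b x y * (u y - r x))\<^sup>2) \<partial>M)
      \<le> (\<integral>\<^sup>+x. ennreal (\<alpha> * (M\<^sub>1 / \<delta>) * \<omega>) * (ennreal (a * (M\<^sub>1 / \<delta>)) * (\<integral>\<^sup>+y. ennreal (indicator (cball x (2 * \<delta>)) y * (u y - r x)\<^sup>2) \<partial>M)) \<partial>M)"
  proof (rule nn_integral_mono)
    fix x
    have "ennreal ((LINT y|M. dk b x y * (u y - r x))\<^sup>2)
        \<le> (\<integral>\<^sup>+y. ennreal (?p x y) \<partial>M) * (\<integral>\<^sup>+y. ennreal (?p x y * (u y - r x)\<^sup>2) \<partial>M)"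
    proof (rule nn_Cauchy_Schwarz_weighted)
      fix y
      show "\<bar>dk b x y * (u y - r x)\<bar> \<le> ?p x y * \<bar>u y - r x\<bar>"
        unfolding abs_mult using dk_bound[OF b, of x y] by (intro mult_right_mono) auto
      show "0 \<le> ?p x y" using a_pos M_nonneg \<delta>_pos by simp
    qed measurable
    also have "\<dots> \<le> ennreal (\<alpha> * (M\<^sub>1 / \<delta>) * \<omega>) * (\<integral>\<^sup>+y. ennreal (?p x y * (u y - r x)\<^sup>2) \<partial>M)"
      using M_nonneg \<delta>_pos by (intro mult_right_mono nn_integral_const_ball_le) auto
    also have "(\<integral>\<^sup>+y. ennreal (?p x y * (u y - r x)\<^sup>2) \<partial>M)
        = (\<integral>\<^sup>+y. ennreal (a * (M\<^sub>1 / \<delta>)) * ennreal (indicator (cball x (2 * \<delta>)) y * (u y - r x)\<^sup>2) \<partial>M)"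
    proof (rule nn_integral_cong)
      fix y
      have "0 \<le> a * (M\<^sub>1 / \<delta>)" using a_pos M_nonneg \<delta>_pos by simp
      then have "ennreal (a * (M\<^sub>1 / \<delta>)) * ennreal (indicator (cball x (2 * \<delta>)) y * (u y - r x)\<^sup>2)
          = ennreal (a * (M\<^sub>1 / \<delta>) * (indicator (cball x (2 * \<delta>)) y * (u y - r x)\<^sup>2))"
        by (intro ennreal_mult[symmetric]) auto
      then show "ennreal (?p x y * (u y - r x)\<^sup>2) = ennreal (a * (M\<^sub>1 / \<delta>)) * ennreal (indicator (cball x (2 * \<delta>)) y * (u y - r x)\<^sup>2)"
        by (simp only: mult.assoc)
    qed
    also have "\<dots> = ennreal (a * (M\<^sub>1 / \<delta>)) * (\<integral>\<^sup>+y. ennreal (indicator (cball x (2 * \<delta>)) y * (u y - r x)\<^sup>2) \<partial>M)"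
      by (rule nn_integral_cmult) measurable
    finally show "ennreal ((LINT y|M. dk b x y * (u y - r x))\<^sup>2)
        \<le> ennreal (\<alpha> * (M\<^sub>1 / \<delta>) * \<omega>) * (ennreal (a * (M\<^sub>1 / \<delta>)) * (\<integral>\<^sup>+y. ennreal (indicator (cball x (2 * \<delta>)) y * (u y - r x)\<^sup>2) \<partial>M))" .
  qed
  also have "\<dots> = (\<integral>\<^sup>+x. ennreal (\<alpha> * (M\<^sub>1 / \<delta>) * \<omega>) * ennreal (a * (M\<^sub>1 / \<delta>)) * (\<integral>\<^sup>+y. ennreal (indicator (cball x (2 * \<delta>)) y * (u y - u x)\<^sup>2) \<partial>M) \<partial>M)"
    by (rule nn_integral_cong_AE) (use eq in eventually_elim, simp add: mult.assoc)
  also have "\<dots> \<le> ennreal (\<alpha> * (M\<^sub>1 / \<delta>) * \<omega>) * ennreal (a * (M\<^sub>1 / \<delta>)) * ennreal (C\<^sub>D * \<delta> ^ DIM('a) * (2 / (\<alpha> * \<gamma>)) * K.form u)"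
  proof -
    have m: "(\<lambda>x. \<integral>\<^sup>+y. ennreal (indicator (cball x (2 * \<delta>)) y * (u y - u x)\<^sup>2) \<partial>M) \<in> borel_measurable M"
    proof -
      have "(\<lambda>z. ennreal ((if dist (fst z) (snd z) \<le> 2 * \<delta> then 1 else 0) * (u (snd z) - u (fst z))\<^sup>2)) \<in> borel_measurable (M \<Otimes>\<^sub>M M)"
        by measurable
      then have "(\<lambda>x. \<integral>\<^sup>+y. ennreal ((if dist x y \<le> 2 * \<delta> then 1 else 0) * (u y - u x)\<^sup>2) \<partial>M) \<in> borel_measurable M"
        using M.borel_measurable_nn_integral[of "\<lambda>x y. ennreal ((if dist x y \<le> 2 * \<delta> then 1 else 0) * (u y - u x)\<^sup>2)" M]
        by (simp add: case_prod_beta')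
      then show ?thesis by (simp add: indicator_def of_bool_def)
    qed
    show ?thesis
      by (subst nn_integral_cmult[OF m]) (intro mult_left_mono nn_integral_wide_energy[OF u]; simp)
  qed
  also have "\<dots> = ennreal (\<alpha> * (M\<^sub>1 / \<delta>) * \<omega> * (a * (M\<^sub>1 / \<delta>)) * (C\<^sub>D * \<delta> ^ DIM('a) * (2 / (\<alpha> * \<gamma>)) * K.form u))"
    using \<alpha>_pos M_nonneg \<delta>_pos \<omega>_nonneg a_pos CD_nonneg \<gamma>_pos form_nonneg[of u]
    by (simp add: ennreal_mult[symmetric] del: times_divide_eq_left times_divide_eq_right)
  also have "\<alpha> * (M\<^sub>1 / \<delta>) * \<omega> * (a * (M\<^sub>1 / \<delta>)) * (C\<^sub>D * \<delta> ^ DIM('a) * (2 / (\<alpha> * \<gamma>)) * K.form u) = G\<^sub>1 / \<delta>\<^sup>2 * K.form u"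
    using \<alpha>_pos \<delta>_pos \<gamma>_pos by (simp add: G\<^sub>1_def a_def power2_eq_square field_simps)
  finally show ?thesis .
qed

lemma gradient_term_2:
  assumes u: "u \<in> L2 M" and r: "r \<in> borel_measurable borel" and eq: "AE x in M. u x = r x" and b: "b \<in> Basis"
  shows "(\<integral>\<^sup>+x. ennreal ((r x * (2 * \<delta> * (LINT y|S. dkb b x y)))\<^sup>2) \<partial>M) \<le> ennreal (G\<^sub>2 / \<delta>\<^sup>2 * K.form u)"
proof -
  have "(\<integral>\<^sup>+x. ennreal ((r x * (2 * \<delta> * (LINT y|S. dkb b x y)))\<^sup>2) \<partial>M) \<le> (\<integral>\<^sup>+x. ennreal (G\<^sub>2 / \<delta>\<^sup>2 * (\<sigma> x * (u x)\<^sup>2)) \<partial>M)"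
  proof (rule nn_integral_mono_AE, use eq in eventually_elim)
    case (elim x)
    have "(r x * (2 * \<delta> * (LINT y|S. dkb b x y)))\<^sup>2 = (u x)\<^sup>2 * (2 * \<delta> * (LINT y|S. dkb b x y))\<^sup>2"
      using elim by (simp add: power_mult_distrib)
    also have "\<dots> \<le> (u x)\<^sup>2 * (4 * A\<^sub>S * \<alpha> * M\<^sub>1 / \<delta>\<^sup>2 * \<sigma> x)"
      by (intro mult_left_mono boundary_gradient_le b) auto
    finally show ?case by (intro ennreal_leI) (simp add: G\<^sub>2_def mult_ac)
  qed
  also have "\<dots> = ennreal (LINT x|M. G\<^sub>2 / \<delta>\<^sup>2 * (\<sigma> x * (u x)\<^sup>2))"
    using G_nonneg \<sigma>_bounds(1) by (intro nn_integral_eq_integral integrable_mult_right K.sigma_square_integrable u) auto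
  also have "\<dots> \<le> ennreal (G\<^sub>2 / \<delta>\<^sup>2 * K.form u)"
  proof (rule ennreal_leI)
    have "G\<^sub>2 / \<delta>\<^sup>2 * (LINT x|M. \<sigma> x * (u x)\<^sup>2) \<le> G\<^sub>2 / \<delta>\<^sup>2 * K.form u"
      using G_nonneg by (intro mult_left_mono form_parts_le) auto
    then show "(LINT x|M. G\<^sub>2 / \<delta>\<^sup>2 * (\<sigma> x * (u x)\<^sup>2)) \<le> G\<^sub>2 / \<delta>\<^sup>2 * K.form u" by simp
  qed
  finally show ?thesis .
qed

text \<open>The boundary data and the volume data are treated alike; only the mass \<open>A\<close> of the kernel differs.\<close>

lemma gradient_data_term:
  assumes N: "finite_measure N" and snd: "snd \<in> M \<Otimes>\<^sub>M N \<rightarrow>\<^sub>M borel"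
    and m [measurable]: "\<And>x. k x \<in> borel_measurable N" "\<And>x. dkb b x \<in> borel_measurable N"
    and h: "h \<in> borel_measurable N" "integrable N (\<lambda>y. (h y)\<^sup>2)" and b: "b \<in> Basis"
    and A: "A \<ge> 0" "\<And>x. (\<integral>\<^sup>+y. ennreal (k x y / \<delta>) \<partial>N) \<le> ennreal A"
  shows "(\<integral>\<^sup>+x. ennreal ((LINT y|N. dkb b x y * h y)\<^sup>2) \<partial>M) \<le> ennreal (A * A\<^sub>0 / \<delta> * (LINT y|N. (h y)\<^sup>2))"
proof -
  note [measurable] = h(1)
  have km: "(\<lambda>z. ennreal (k (fst z) (snd z) / \<delta>)) \<in> borel_measurable (M \<Otimes>\<^sub>M N)"
    by (intro measurable_compose[OF _ measurable_ennreal] borel_measurable_divide k_measurable fst_M snd borel_measurable_const)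
  have hm: "(\<lambda>y. ennreal ((h y)\<^sup>2)) \<in> borel_measurable N" by measurable
  have hm': "(\<lambda>z. ennreal ((h (snd z))\<^sup>2)) \<in> borel_measurable (M \<Otimes>\<^sub>M N)"
    by (rule measurable_compose[OF measurable_snd hm])
  have "(\<integral>\<^sup>+x. ennreal ((LINT y|N. dkb b x y * h y)\<^sup>2) \<partial>M)
      \<le> (\<integral>\<^sup>+x. ennreal A * (\<integral>\<^sup>+y. ennreal (k x y / \<delta>) * ennreal ((h y)\<^sup>2) \<partial>N) \<partial>M)"
  proof (rule nn_integral_mono)
    fix x
    have "ennreal ((LINT y|N. dkb b x y * h y)\<^sup>2)
        \<le> (\<integral>\<^sup>+y. ennreal (k x y / \<delta>) \<partial>N) * (\<integral>\<^sup>+y. ennreal (k x y / \<delta> * (h y)\<^sup>2) \<partial>N)"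
    proof (rule nn_Cauchy_Schwarz_weighted)
      fix y
      show "\<bar>dkb b x y * h y\<bar> \<le> k x y / \<delta> * \<bar>h y\<bar>"
        unfolding abs_mult by (intro mult_right_mono dkb_bound b) auto
      show "0 \<le> k x y / \<delta>" using k_nonneg \<delta>_pos by simp
    qed measurable
    also have "\<dots> \<le> ennreal A * (\<integral>\<^sup>+y. ennreal (k x y / \<delta> * (h y)\<^sup>2) \<partial>N)"
      by (intro mult_right_mono A) simp
    also have "(\<integral>\<^sup>+y. ennreal (k x y / \<delta> * (h y)\<^sup>2) \<partial>N) = (\<integral>\<^sup>+y. ennreal (k x y / \<delta>) * ennreal ((h y)\<^sup>2) \<partial>N)"
      using k_nonneg \<delta>_pos by (intro nn_integral_cong ennreal_mult) auto
    finally show "ennreal ((LINT y|N. dkb b x y * h y)\<^sup>2)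
        \<le> ennreal A * (\<integral>\<^sup>+y. ennreal (k x y / \<delta>) * ennreal ((h y)\<^sup>2) \<partial>N)" .
  qed
  also have "\<dots> = ennreal A * (\<integral>\<^sup>+x. \<integral>\<^sup>+y. ennreal (k x y / \<delta>) * ennreal ((h y)\<^sup>2) \<partial>N \<partial>M)"
  proof (rule nn_integral_cmult)
    interpret N: finite_measure N by fact
    have "(\<lambda>z. ennreal (k (fst z) (snd z) / \<delta>) * ennreal ((h (snd z))\<^sup>2)) \<in> borel_measurable (M \<Otimes>\<^sub>M N)"
      by (rule borel_measurable_times_ennreal[OF km hm'])
    then show "(\<lambda>x. \<integral>\<^sup>+y. ennreal (k x y / \<delta>) * ennreal ((h y)\<^sup>2) \<partial>N) \<in> borel_measurable M"
      using N.borel_measurable_nn_integral[of "\<lambda>x y. ennreal (k x y / \<delta>) * ennreal ((h y)\<^sup>2)" M] by (simp add: case_prod_beta')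
  qed
  also have "\<dots> \<le> ennreal A * (ennreal (A\<^sub>0 / \<delta>) * (\<integral>\<^sup>+y. ennreal ((h y)\<^sup>2) \<partial>N))"
  proof (intro mult_left_mono nn_Schur[OF N km hm])
    fix y
    have "(\<integral>\<^sup>+x. ennreal (k x y / \<delta>) \<partial>M) = (\<integral>\<^sup>+x. ennreal (1 / \<delta>) * ennreal (k y x) \<partial>M)"
      using \<delta>_pos k_nonneg by (intro nn_integral_cong) (simp add: ennreal_mult[symmetric] k_sym[of y])
    also have "\<dots> = ennreal (1 / \<delta>) * (\<integral>\<^sup>+x. ennreal (k y x) \<partial>M)"
      by (rule nn_integral_cmult) (simp add: kernel_section_measurable)
    also have "\<dots> \<le> ennreal (1 / \<delta>) * ennreal A\<^sub>0" by (intro mult_left_mono nn_integral_k_le) simp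
    finally show "(\<integral>\<^sup>+x. ennreal (k x y / \<delta>) \<partial>M) \<le> ennreal (A\<^sub>0 / \<delta>)"
      using \<delta>_pos A0_nonneg by (simp add: ennreal_mult[symmetric])
  qed simp_all
  also have "(\<integral>\<^sup>+y. ennreal ((h y)\<^sup>2) \<partial>N) = ennreal (LINT y|N. (h y)\<^sup>2)"
    by (rule nn_integral_eq_integral[OF h(2)]) simp
  also have "ennreal A * (ennreal (A\<^sub>0 / \<delta>) * ennreal (LINT y|N. (h y)\<^sup>2)) = ennreal (A * (A\<^sub>0 / \<delta> * (LINT y|N. (h y)\<^sup>2)))"
    using A A0_nonneg \<delta>_pos
    by (simp add: ennreal_mult[symmetric] Bochner_Integration.integral_nonneg del: times_divide_eq_left times_divide_eq_right)
  finally show ?thesis by (simp add: mult.assoc)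
qed

lemma square_sum4_le: "(p + q + r + s)\<^sup>2 \<le> 4 * (p\<^sup>2 + q\<^sup>2 + r\<^sup>2 + s\<^sup>2)" for p q r s :: real
proof -
  have "(p + q + r + s)\<^sup>2 \<le> 2 * (p + q)\<^sup>2 + 2 * (r + s)\<^sup>2"
    using square_diff_le[of "p + q" "- (r + s)" 0] by (simp add: algebra_simps)
  moreover have "(p + q)\<^sup>2 \<le> 2 * p\<^sup>2 + 2 * q\<^sup>2" "(r + s)\<^sup>2 \<le> 2 * r\<^sup>2 + 2 * s\<^sup>2"
    using square_diff_le[of p "- q" 0] square_diff_le[of r "- s" 0] by simp_all
  ultimately show ?thesis by (simp add: algebra_simps)
qed

lemma bounded_L2:
  assumes [measurable]: "h \<in> borel_measurable borel" and "\<And>x. x \<in> \<Omega> \<Longrightarrow> \<bar>h x\<bar> \<le> C"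
  shows "h \<in> L2 M"
proof (rule K.L2_affine_bound[of "\<lambda>_. 0" _ C 0])
  show "h \<in> borel_measurable M" by (rule borel_measurable_lebesgue_on_borel) measurable
qed (use assms(2) in \<open>auto simp: L2_def space_restrict_space\<close>)

text \<open>
  In the quotient rule \<open>r = u\<close> multiplies the derivatives of the mass and of \<open>\<sigma>\<close>.  The first is combined
  with the derivative of the average into an integral of differences (\<open>T\<^sub>1\<close>), the second is the
  boundary term (\<open>T\<^sub>2\<close>); the other two come from \<open>g\<close> and \<open>f\<close>.
\<close>

theorem gradient_estimate:
  assumes f: "f \<in> L2 M" and g: "g \<in> L2 S" and u: "u \<in> L2 M" and eq: "AE x in M. K.nl_op u x = rhs f g x"
    and b: "b \<in> Basis"
  shows "grad f g u b \<in> L2 M"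
    "(LINT x|M. (grad f g u b x)\<^sup>2) \<le> 4 / c\<^sup>2 * (G\<^sub>1 / \<delta>\<^sup>2 * K.form u + G\<^sub>2 / \<delta>\<^sup>2 * K.form u
        + G\<^sub>3 / \<delta> * (LINT y|S. (g y)\<^sup>2) + \<delta>\<^sup>2 * A\<^sub>0\<^sup>2 * (LINT y|M. (f y)\<^sup>2))"
proof -
  define r where "r = regularized f g u"
  have rb: "r \<in> borel_measurable borel" unfolding r_def by (rule regularized_borel[OF f g u])
  have req: "AE x in M. u x = r x" unfolding r_def by (rule regularized_eq[OF f g eq])
  note gb [measurable] = grad_borel[OF f g u, of b]
  obtain C where "\<And>x. x \<in> \<Omega> \<Longrightarrow> \<bar>grad f g u b x\<bar> \<le> C" using regularized_bounded[OF f g u b] by blast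
  then show L: "grad f g u b \<in> L2 M" by (rule bounded_L2[OF gb])
  define T\<^sub>1 where "T\<^sub>1 = (\<lambda>x. LINT y|M. dk b x y * (u y - r x))"
  define T\<^sub>2 where "T\<^sub>2 = (\<lambda>x. r x * (2 * \<delta> * (LINT y|S. dkb b x y)))"
  define T\<^sub>3 where "T\<^sub>3 = (\<lambda>x. LINT y|S. dkb b x y * g y)"
  define T\<^sub>4 where "T\<^sub>4 = (\<lambda>x. LINT y|M. dkb b x y * f y)"
  have meas: "T\<^sub>1 \<in> borel_measurable M" "T\<^sub>2 \<in> borel_measurable M" "T\<^sub>3 \<in> borel_measurable M" "T\<^sub>4 \<in> borel_measurable M"
  proof -
    note [measurable] = rb M_L2(1)[OF u] M_L2(1)[OF f] S_L2(1)[OF g]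
    show "T\<^sub>1 \<in> borel_measurable M" "T\<^sub>2 \<in> borel_measurable M" "T\<^sub>3 \<in> borel_measurable M" "T\<^sub>4 \<in> borel_measurable M"
      unfolding T\<^sub>1_def T\<^sub>2_def T\<^sub>3_def T\<^sub>4_def by (rule borel_measurable_lebesgue_on_borel, measurable)+
  qed
  have pt: "(grad f g u b x)\<^sup>2 \<le> 4 / c\<^sup>2 * ((T\<^sub>1 x)\<^sup>2 + (T\<^sub>2 x)\<^sup>2 + (2 * \<delta>)\<^sup>2 * (T\<^sub>3 x)\<^sup>2 + (\<delta>\<^sup>2)\<^sup>2 * (T\<^sub>4 x)\<^sup>2)" if x: "x \<in> \<Omega>" for x
  proof -
    have dki: "integrable M (\<lambda>y. dk b x y * h y)" if h: "integrable M h" for h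
    proof (rule Bochner_Integration.integrable_bound[OF integrable_mult_right[OF integrable_abs[OF h], of "a * M\<^sub>1 / \<delta>"]])
      have "\<bar>dk b x y\<bar> * \<bar>h y\<bar> \<le> a * M\<^sub>1 / \<delta> * \<bar>h y\<bar>" for y
      proof (rule mult_right_mono)
        show "\<bar>dk b x y\<bar> \<le> a * M\<^sub>1 / \<delta>"
          using a_pos M_nonneg \<delta>_pos
          by (intro order_trans[OF dk_bound[OF b] mult_left_le]) (auto simp: indicator_def)
      qed simp
      then show "AE y in M. norm (dk b x y * h y) \<le> norm (a * M\<^sub>1 / \<delta> * \<bar>h y\<bar>)"
        using a_pos M_nonneg \<delta>_pos by (intro AE_I2) (simp add: abs_mult)
      show "(\<lambda>y. dk b x y * h y) \<in> borel_measurable M"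
        by (intro borel_measurable_times dk_section_measurable borel_measurable_integrable[OF h])
    qed
    have "T\<^sub>1 x = (LINT y|M. dk b x y * u y - dk b x y * r x)"
      unfolding T\<^sub>1_def by (simp add: right_diff_distrib)
    also have "\<dots> = (LINT y|M. dk b x y * u y) - (LINT y|M. dk b x y * r x)"
      by (rule Bochner_Integration.integral_diff; rule dki) (use M_L2(2)[OF u] in simp_all)
    also have "(LINT y|M. dk b x y * r x) = r x * (LINT y|M. dk b x y)" by simp
    finally have T1: "T\<^sub>1 x = (LINT y|M. dk b x y * u y) - r x * (LINT y|M. dk b x y)" .
    have "grad f g u b x = (T\<^sub>1 x + - T\<^sub>2 x + 2 * \<delta> * T\<^sub>3 x + \<delta>\<^sup>2 * T\<^sub>4 x) / (K.weight x + \<sigma> x)"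
      unfolding grad_def T1 T\<^sub>2_def T\<^sub>3_def T\<^sub>4_def r_def[symmetric] by (simp add: algebra_simps)
    then have "(grad f g u b x)\<^sup>2 = (T\<^sub>1 x + - T\<^sub>2 x + 2 * \<delta> * T\<^sub>3 x + \<delta>\<^sup>2 * T\<^sub>4 x)\<^sup>2 / (K.weight x + \<sigma> x)\<^sup>2"
      by (simp add: power_divide)
    also have "\<dots> \<le> (T\<^sub>1 x + - T\<^sub>2 x + 2 * \<delta> * T\<^sub>3 x + \<delta>\<^sup>2 * T\<^sub>4 x)\<^sup>2 / c\<^sup>2"
      using denominator_ge[OF x] c_pos by (intro divide_left_mono power_mono) auto
    also have "\<dots> \<le> 4 * ((T\<^sub>1 x)\<^sup>2 + (- T\<^sub>2 x)\<^sup>2 + (2 * \<delta> * T\<^sub>3 x)\<^sup>2 + (\<delta>\<^sup>2 * T\<^sub>4 x)\<^sup>2) / c\<^sup>2"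
      by (intro divide_right_mono square_sum4_le) auto
    finally show ?thesis by (simp add: power_mult_distrib)
  qed
  have i1: "(\<integral>\<^sup>+x. ennreal ((T\<^sub>1 x)\<^sup>2) \<partial>M) \<le> ennreal (G\<^sub>1 / \<delta>\<^sup>2 * K.form u)"
    unfolding T\<^sub>1_def by (rule gradient_term_1[OF u rb req b])
  have i2: "(\<integral>\<^sup>+x. ennreal ((T\<^sub>2 x)\<^sup>2) \<partial>M) \<le> ennreal (G\<^sub>2 / \<delta>\<^sup>2 * K.form u)"
    unfolding T\<^sub>2_def by (rule gradient_term_2[OF u rb req b])
  have kS: "(\<integral>\<^sup>+y. ennreal (k x y / \<delta>) \<partial>S) \<le> ennreal (\<alpha> * (M\<^sub>0 / \<delta>) * A\<^sub>S / \<delta>)" for x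
  proof -
    have "(\<integral>\<^sup>+y. ennreal (k x y / \<delta>) \<partial>S) \<le> (\<integral>\<^sup>+y. ennreal (a * (M\<^sub>0 / \<delta>) * indicator (cball x (2 * \<delta>)) y) \<partial>S)"
    proof (intro nn_integral_mono ennreal_leI)
      fix y
      have "k x y / \<delta> \<le> a * M\<^sub>0 * indicator (cball x (2 * \<delta>)) y / \<delta>"
        using \<delta>_pos by (intro divide_right_mono k_le_ball) auto
      then show "k x y / \<delta> \<le> a * (M\<^sub>0 / \<delta>) * indicator (cball x (2 * \<delta>)) y" by simp
    qed
    also have "\<dots> \<le> ennreal (\<alpha> * (M\<^sub>0 / \<delta>) * A\<^sub>S / \<delta>)"
      using M_nonneg \<delta>_pos by (intro nn_integral_surface_const_ball_le) auto
    finally show ?thesis .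
  qed
  have kM: "(\<integral>\<^sup>+y. ennreal (k x y / \<delta>) \<partial>M) \<le> ennreal (A\<^sub>0 / \<delta>)" for x
  proof -
    have "(\<integral>\<^sup>+y. ennreal (k x y / \<delta>) \<partial>M) = (\<integral>\<^sup>+y. ennreal (1 / \<delta>) * ennreal (k x y) \<partial>M)"
      using \<delta>_pos k_nonneg by (intro nn_integral_cong) (simp add: ennreal_mult[symmetric])
    also have "\<dots> = ennreal (1 / \<delta>) * (\<integral>\<^sup>+y. ennreal (k x y) \<partial>M)"
      by (rule nn_integral_cmult) (simp add: kernel_section_measurable)
    also have "\<dots> \<le> ennreal (1 / \<delta>) * ennreal A\<^sub>0" by (intro mult_left_mono nn_integral_k_le) simp
    finally show ?thesis using \<delta>_pos A0_nonneg by (simp add: ennreal_mult[symmetric])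
  qed
  have i3: "(\<integral>\<^sup>+x. ennreal ((T\<^sub>3 x)\<^sup>2) \<partial>M) \<le> ennreal (\<alpha> * (M\<^sub>0 / \<delta>) * A\<^sub>S / \<delta> * A\<^sub>0 / \<delta> * (LINT y|S. (g y)\<^sup>2))"
    unfolding T\<^sub>3_def
    by (rule gradient_data_term[OF S.finite_measure_axioms snd_S _ _ S_L2(1,3)[OF g] b _ kS])
       (use \<alpha>_pos M_nonneg \<delta>_pos AS_nonneg in \<open>auto simp: kernel_section_measurable dk_section_measurable\<close>)
  have i4: "(\<integral>\<^sup>+x. ennreal ((T\<^sub>4 x)\<^sup>2) \<partial>M) \<le> ennreal (A\<^sub>0 / \<delta> * A\<^sub>0 / \<delta> * (LINT y|M. (f y)\<^sup>2))"
    unfolding T\<^sub>4_def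
    by (rule gradient_data_term[OF M.finite_measure_axioms snd_M _ _ M_L2(1,3)[OF f] b _ kM])
       (use A0_nonneg \<delta>_pos in \<open>auto simp: kernel_section_measurable dk_section_measurable\<close>)
  note [measurable] = meas
  define Z\<^sub>1 where "Z\<^sub>1 = G\<^sub>1 / \<delta>\<^sup>2 * K.form u"
  define Z\<^sub>2 where "Z\<^sub>2 = G\<^sub>2 / \<delta>\<^sup>2 * K.form u"
  define Z\<^sub>3 where "Z\<^sub>3 = \<alpha> * (M\<^sub>0 / \<delta>) * A\<^sub>S / \<delta> * A\<^sub>0 / \<delta> * (LINT y|S. (g y)\<^sup>2)"
  define Z\<^sub>4 where "Z\<^sub>4 = A\<^sub>0 / \<delta> * A\<^sub>0 / \<delta> * (LINT y|M. (f y)\<^sup>2)"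
  have Z: "Z\<^sub>1 \<ge> 0" "Z\<^sub>2 \<ge> 0" "Z\<^sub>3 \<ge> 0" "Z\<^sub>4 \<ge> 0"
    unfolding Z\<^sub>1_def Z\<^sub>2_def Z\<^sub>3_def Z\<^sub>4_def
    using G_nonneg form_nonneg[of u] \<alpha>_pos M_nonneg \<delta>_pos AS_nonneg A0_nonneg
    by (auto intro!: mult_nonneg_nonneg divide_nonneg_nonneg Bochner_Integration.integral_nonneg)
  have "ennreal (LINT x|M. (grad f g u b x)\<^sup>2) = (\<integral>\<^sup>+x. ennreal ((grad f g u b x)\<^sup>2) \<partial>M)"
    by (rule nn_integral_eq_integral[OF M_L2(3)[OF L], symmetric]) simp
  also have "\<dots> \<le> (\<integral>\<^sup>+x. ennreal (4 / c\<^sup>2) * (ennreal ((T\<^sub>1 x)\<^sup>2) + ennreal ((T\<^sub>2 x)\<^sup>2)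
      + ennreal ((2 * \<delta>)\<^sup>2) * ennreal ((T\<^sub>3 x)\<^sup>2) + ennreal ((\<delta>\<^sup>2)\<^sup>2) * ennreal ((T\<^sub>4 x)\<^sup>2)) \<partial>M)"
  proof (rule nn_integral_mono)
    fix x assume "x \<in> space M"
    then have "x \<in> \<Omega>" by (simp add: space_restrict_space)
    have "ennreal (4 / c\<^sup>2) * (ennreal ((T\<^sub>1 x)\<^sup>2) + ennreal ((T\<^sub>2 x)\<^sup>2)
      + ennreal ((2 * \<delta>)\<^sup>2) * ennreal ((T\<^sub>3 x)\<^sup>2) + ennreal ((\<delta>\<^sup>2)\<^sup>2) * ennreal ((T\<^sub>4 x)\<^sup>2))
      = ennreal (4 / c\<^sup>2 * ((T\<^sub>1 x)\<^sup>2 + (T\<^sub>2 x)\<^sup>2 + (2 * \<delta>)\<^sup>2 * (T\<^sub>3 x)\<^sup>2 + (\<delta>\<^sup>2)\<^sup>2 * (T\<^sub>4 x)\<^sup>2))"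
      by (simp add: ennreal_mult[symmetric] ennreal_plus[symmetric] del: ennreal_plus times_divide_eq_left)
    then show "ennreal ((grad f g u b x)\<^sup>2) \<le> ennreal (4 / c\<^sup>2) * (ennreal ((T\<^sub>1 x)\<^sup>2) + ennreal ((T\<^sub>2 x)\<^sup>2)
      + ennreal ((2 * \<delta>)\<^sup>2) * ennreal ((T\<^sub>3 x)\<^sup>2) + ennreal ((\<delta>\<^sup>2)\<^sup>2) * ennreal ((T\<^sub>4 x)\<^sup>2))"
      using ennreal_leI[OF pt[OF \<open>x \<in> \<Omega>\<close>]] by simp
  qed
  also have "\<dots> = ennreal (4 / c\<^sup>2) * ((\<integral>\<^sup>+x. ennreal ((T\<^sub>1 x)\<^sup>2) \<partial>M) + (\<integral>\<^sup>+x. ennreal ((T\<^sub>2 x)\<^sup>2) \<partial>M)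
      + ennreal ((2 * \<delta>)\<^sup>2) * (\<integral>\<^sup>+x. ennreal ((T\<^sub>3 x)\<^sup>2) \<partial>M) + ennreal ((\<delta>\<^sup>2)\<^sup>2) * (\<integral>\<^sup>+x. ennreal ((T\<^sub>4 x)\<^sup>2) \<partial>M))"
    by (simp add: nn_integral_cmult nn_integral_add)
  also have "\<dots> \<le> ennreal (4 / c\<^sup>2) * (ennreal Z\<^sub>1 + ennreal Z\<^sub>2 + ennreal ((2 * \<delta>)\<^sup>2) * ennreal Z\<^sub>3 + ennreal ((\<delta>\<^sup>2)\<^sup>2) * ennreal Z\<^sub>4)"
    unfolding Z\<^sub>1_def Z\<^sub>2_def Z\<^sub>3_def Z\<^sub>4_def by (intro mult_left_mono add_mono i1 i2 i3 i4) auto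
  also have "\<dots> = ennreal (4 / c\<^sup>2 * (Z\<^sub>1 + Z\<^sub>2 + (2 * \<delta>)\<^sup>2 * Z\<^sub>3 + (\<delta>\<^sup>2)\<^sup>2 * Z\<^sub>4))"
    using Z by (simp add: ennreal_mult[symmetric] ennreal_plus[symmetric] del: ennreal_plus times_divide_eq_left)
  finally have "(LINT x|M. (grad f g u b x)\<^sup>2) \<le> 4 / c\<^sup>2 * (Z\<^sub>1 + Z\<^sub>2 + (2 * \<delta>)\<^sup>2 * Z\<^sub>3 + (\<delta>\<^sup>2)\<^sup>2 * Z\<^sub>4)"
    using Z by (subst (asm) ennreal_le_iff) auto
  also have "(2 * \<delta>)\<^sup>2 * Z\<^sub>3 = G\<^sub>3 / \<delta> * (LINT y|S. (g y)\<^sup>2)"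
    using \<delta>_pos by (simp add: Z\<^sub>3_def G\<^sub>3_def power2_eq_square)
  also have "(\<delta>\<^sup>2)\<^sup>2 * Z\<^sub>4 = \<delta>\<^sup>2 * A\<^sub>0\<^sup>2 * (LINT y|M. (f y)\<^sup>2)"
    using \<delta>_pos by (simp add: Z\<^sub>4_def power2_eq_square)
  finally show "(LINT x|M. (grad f g u b x)\<^sup>2) \<le> 4 / c\<^sup>2 * (G\<^sub>1 / \<delta>\<^sup>2 * K.form u + G\<^sub>2 / \<delta>\<^sup>2 * K.form u
        + G\<^sub>3 / \<delta> * (LINT y|S. (g y)\<^sup>2) + \<delta>\<^sup>2 * A\<^sub>0\<^sup>2 * (LINT y|M. (f y)\<^sup>2))"
    by (simp add: Z\<^sub>1_def Z\<^sub>2_def)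
qed

end

section \<open>Regularity of the solution, uniformly in the scale\<close>

lemma square_le_mono_sqrt:
  fixes x y :: real
  assumes "x \<le> C\<^sup>2 * y\<^sup>2" "0 \<le> C" "0 \<le> y"
  shows "sqrt x \<le> C * y"
  using assms by (intro real_le_lsqrt) (auto simp: power_mult_distrib)

context scaled_problem
begin

lemma weak_partial_regularized:
  assumes f: "f \<in> L2 M" and g: "g \<in> L2 S" and u: "u \<in> L2 M" and b: "b \<in> Basis"
  shows "is_weak_partial \<Omega> b (regularized f g u) (grad f g u b)"
proof -
  obtain C where C: "\<And>x. x \<in> \<Omega> \<Longrightarrow> \<bar>regularized f g u x\<bar> \<le> C" "\<And>x. x \<in> \<Omega> \<Longrightarrow> \<bar>grad f g u b x\<bar> \<le> C"
    by (rule regularized_bounded[OF f g u b]) (rule that)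
  show ?thesis
    by (rule weak_partial_of_directional_derivative[OF op bd b regularized_borel[OF f g u] grad_borel[OF f g u]
          DERIV_regularized[OF f g u b] C])
qed

lemma is_weak_partial_cong_AE:
  assumes u: "u \<in> borel_measurable M" and v: "v \<in> borel_measurable M" and eq: "AE x in M. u x = v x"
    and b: "b \<in> Basis" and w: "is_weak_partial \<Omega> b v w"
  shows "is_weak_partial \<Omega> b u w"
  unfolding is_weak_partial_def
proof
  fix \<phi> assume \<phi>: "\<phi> \<in> test_functions \<Omega>"
  have "(LINT x|M. u x * frechet_derivative \<phi> (at x) b) = (LINT x|M. v x * frechet_derivative \<phi> (at x) b)"
  proof (rule integral_cong_AE)
    have "Ck_on 1 UNIV \<phi>" using \<phi> by (simp add: test_functions_def)
    then have "continuous_on UNIV (\<lambda>x. frechet_derivative \<phi> (at x) b)" using b by simp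
    then have d: "(\<lambda>x. frechet_derivative \<phi> (at x) b) \<in> borel_measurable M"
      by (intro borel_measurable_lebesgue_on_borel borel_measurable_continuous_onI)
    show "(\<lambda>x. u x * frechet_derivative \<phi> (at x) b) \<in> borel_measurable M"
      "(\<lambda>x. v x * frechet_derivative \<phi> (at x) b) \<in> borel_measurable M"
      using u v d by (auto intro: borel_measurable_times)
    show "AE x in M. u x * frechet_derivative \<phi> (at x) b = v x * frechet_derivative \<phi> (at x) b"
      using eq by eventually_elim simp
  qed
  then show "(LINT x|M. u x * frechet_derivative \<phi> (at x) b) = - (LINT x|M. w x * \<phi> x)"
    using w \<phi> by (simp add: is_weak_partial_def)
qed

text \<open>
  The constant depends on \<open>\<delta>\<close> only through its upper bound \<open>t\<close>; this is what makes the final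
  estimate uniform.
\<close>

definition regularity_const :: "real \<Rightarrow> real" where
  "regularity_const t = sqrt (4 * P\<^sub>0 * (1 + P\<^sub>0)
     + real DIM('a) * (4 / c\<^sup>2 * (4 * (G\<^sub>1 + G\<^sub>2) * (1 + P\<^sub>0) + G\<^sub>3 + t\<^sup>2 * A\<^sub>0\<^sup>2)))"

text \<open>
  With \<open>N = \<parallel>f\<parallel>\<^sup>2 + \<parallel>g\<parallel>\<^sup>2 / \<delta>\<close>, the energy estimate gives \<open>form u / \<delta>\<^sup>2 \<le> 4 (1 + P\<^sub>0) N\<close>; coercivity and the
  gradient estimate turn this into bounds for \<open>u\<close> and for the pointwise derivative, which represents
  every weak derivative.
\<close>

theorem solution_H1:
  assumes f: "f \<in> L2 M" and g: "g \<in> L2 S" and sol: "is_solution \<Omega> R \<alpha> \<delta> f g u"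
  shows "u \<in> H1 \<Omega>"
    and "\<delta> \<le> t \<Longrightarrow> H1_norm \<Omega> u \<le> regularity_const t * (L2_norm M f + L2_norm S g / sqrt \<delta>)"
proof -
  have u: "u \<in> L2 M" and eq: "AE x in M. K.nl_op u x = rhs f g x"
    using sol by (auto simp: is_solution_iff[OF f g])
  have wp: "is_weak_partial \<Omega> b u (grad f g u b)" if "b \<in> Basis" for b
    by (rule is_weak_partial_cong_AE[OF M_L2(1)[OF u]
          borel_measurable_lebesgue_on_borel[OF regularized_borel[OF f g u]] regularized_eq[OF f g eq] that weak_partial_regularized[OF f g u that]])
  have gL: "grad f g u b \<in> L2 M" if "b \<in> Basis" for b
    by (rule gradient_estimate(1)[OF f g u eq that])
  show "u \<in> H1 \<Omega>" unfolding H1_def using u wp gL by auto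
  assume t: "\<delta> \<le> t"
  define F where "F = (LINT y|M. (f y)\<^sup>2)"
  define G where "G = (LINT y|S. (g y)\<^sup>2)"
  have F: "F \<ge> 0" and G: "G \<ge> 0" by (simp_all add: F_def G_def)
  define N where "N = F + G / \<delta>"
  have N: "F \<le> N" "G / \<delta> \<le> N" "0 \<le> N" using F G \<delta>_pos by (auto simp: N_def)
  have P: "P\<^sub>0 > 0" using CP_pos \<alpha>_pos \<gamma>_pos by (simp add: P\<^sub>0_def)
  define E where "E = K.form u / \<delta>\<^sup>2"
  have E0: "0 \<le> E" using form_nonneg[of u] by (simp add: E_def)
  have E: "E \<le> 4 * (1 + P\<^sub>0) * N"
  proof -
    have "E \<le> 4 * (\<delta> * G + \<delta>\<^sup>2 * P\<^sub>0 * F) / \<delta>\<^sup>2"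
      unfolding E_def F_def G_def by (intro divide_right_mono energy_estimate f g u eq) simp
    also have "\<dots> = 4 * (G / \<delta> + P\<^sub>0 * F)" using \<delta>_pos by (simp add: field_simps power2_eq_square)
    also have "\<dots> \<le> 4 * (N + P\<^sub>0 * N)"
      using N P by (intro mult_left_mono add_mono) auto
    finally show ?thesis by (simp add: algebra_simps)
  qed
  have u2: "(LINT x|M. (u x)\<^sup>2) \<le> 4 * P\<^sub>0 * (1 + P\<^sub>0) * N"
  proof -
    have "(LINT x|M. (u x)\<^sup>2) \<le> P\<^sub>0 * E" using K.coercive[OF u] by (simp add: E_def)
    also have "\<dots> \<le> P\<^sub>0 * (4 * (1 + P\<^sub>0) * N)" using E P by (intro mult_left_mono) auto
    finally show ?thesis by (simp only: mult.assoc mult.left_commute)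
  qed
  define L where "L = 4 / c\<^sup>2 * (4 * (G\<^sub>1 + G\<^sub>2) * (1 + P\<^sub>0) + G\<^sub>3 + t\<^sup>2 * A\<^sub>0\<^sup>2)"
  have g2: "(LINT x|M. (weak_partial \<Omega> b u x)\<^sup>2) \<le> L * N" if b: "b \<in> Basis" for b
  proof -
    have "weak_partial \<Omega> b u \<in> L2 M \<and> is_weak_partial \<Omega> b u (weak_partial \<Omega> b u)"
      unfolding weak_partial_def by (rule someI[of _ "grad f g u b"]) (use wp[OF b] gL[OF b] in simp)
    then have w: "weak_partial \<Omega> b u \<in> L2 M" "is_weak_partial \<Omega> b u (weak_partial \<Omega> b u)" by auto
    have "AE x in M. weak_partial \<Omega> b u x = grad f g u b x"
      by (rule weak_partial_unique[OF op bd w(1) gL[OF b] w(2) wp[OF b]])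
    then have sq: "AE x in M. (weak_partial \<Omega> b u x)\<^sup>2 = (grad f g u b x)\<^sup>2" by eventually_elim simp
    have "(LINT x|M. (weak_partial \<Omega> b u x)\<^sup>2) = (LINT x|M. (grad f g u b x)\<^sup>2)"
      by (intro integral_cong_AE borel_measurable_power M_L2(1) w gL b sq)
    also have "\<dots> \<le> 4 / c\<^sup>2 * (G\<^sub>1 * E + G\<^sub>2 * E + G\<^sub>3 * (G / \<delta>) + \<delta>\<^sup>2 * A\<^sub>0\<^sup>2 * F)"
      using gradient_estimate(2)[OF f g u eq b] by (simp add: E_def F_def G_def)
    also have "\<dots> \<le> 4 / c\<^sup>2 * (G\<^sub>1 * (4 * (1 + P\<^sub>0) * N) + G\<^sub>2 * (4 * (1 + P\<^sub>0) * N) + G\<^sub>3 * N + t\<^sup>2 * A\<^sub>0\<^sup>2 * N)"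
      using G_nonneg E N F t \<delta>_pos A0_nonneg
      by (intro mult_left_mono add_mono mult_mono power_mono mult_nonneg_nonneg) auto
    also have "\<dots> = L * N" unfolding L_def by (simp add: algebra_simps add_divide_distrib)
    finally show ?thesis .
  qed
  have C0: "0 \<le> 4 * P\<^sub>0 * (1 + P\<^sub>0) + real DIM('a) * L"
    unfolding L_def using P G_nonneg by (intro add_nonneg_nonneg mult_nonneg_nonneg divide_nonneg_nonneg) auto
  have NN: "N \<le> (L2_norm M f + L2_norm S g / sqrt \<delta>)\<^sup>2"
  proof -
    have "0 \<le> 2 * L2_norm M f * (L2_norm S g / sqrt \<delta>)"
      unfolding L2_norm_def using \<delta>_pos by (intro mult_nonneg_nonneg divide_nonneg_nonneg) auto
    moreover have "N = (L2_norm M f)\<^sup>2 + (L2_norm S g / sqrt \<delta>)\<^sup>2"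
      using F G \<delta>_pos by (simp add: N_def L2_norm_def F_def G_def power_divide)
    ultimately show ?thesis by (simp add: power2_sum)
  qed
  have "(L2_norm M u)\<^sup>2 + (\<Sum>b\<in>Basis. (L2_norm M (weak_partial \<Omega> b u))\<^sup>2)
      = (LINT x|M. (u x)\<^sup>2) + (\<Sum>b\<in>Basis. LINT x|M. (weak_partial \<Omega> b u x)\<^sup>2)"
    by (simp add: L2_norm_def)
  also have "\<dots> \<le> 4 * P\<^sub>0 * (1 + P\<^sub>0) * N + (\<Sum>b\<in>(Basis::'a set). L * N)"
    by (intro add_mono sum_mono u2 g2)
  also have "\<dots> = (4 * P\<^sub>0 * (1 + P\<^sub>0) + real DIM('a) * L) * N" by (simp add: algebra_simps)
  also have "\<dots> \<le> (4 * P\<^sub>0 * (1 + P\<^sub>0) + real DIM('a) * L) * (L2_norm M f + L2_norm S g / sqrt \<delta>)\<^sup>2"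
    by (intro mult_left_mono NN C0)
  also have "4 * P\<^sub>0 * (1 + P\<^sub>0) + real DIM('a) * L = (regularity_const t)\<^sup>2"
    unfolding regularity_const_def L_def[symmetric] using C0 by simp
  finally show "H1_norm \<Omega> u \<le> regularity_const t * (L2_norm M f + L2_norm S g / sqrt \<delta>)"
    unfolding H1_norm_def
  proof (rule square_le_mono_sqrt)
    show "0 \<le> regularity_const t" using C0 by (simp only: regularity_const_def L_def[symmetric] real_sqrt_ge_zero)
    show "0 \<le> L2_norm M f + L2_norm S g / sqrt \<delta>" using \<delta>_pos by (simp add: L2_norm_def)
  qed
qed

end

text \<open>
  For scales up to a given bound the hypotheses of the scaled problem hold with constants that do
  not depend on the scale.
\<close>

lemma scaled_problem_uniform:
  fixes \<Omega> :: "'a::euclidean_space set"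
  assumes op: "open \<Omega>" and conn: "connected \<Omega>" and bd: "bounded \<Omega>" and ne: "\<Omega> \<noteq> {}" and Ck: "Ck_boundary 1 \<Omega>"
    and R: "C1_halfline R" "\<forall>r\<ge>0. R r \<ge> 0" "\<forall>r>1. R r = 0" "\<exists>\<gamma>\<^sub>0>0. \<forall>r. 0 \<le> r \<and> r \<le> 1 / 2 \<longrightarrow> R r \<ge> \<gamma>\<^sub>0"
    and \<alpha>: "\<alpha> > 0" and nrm: "\<forall>\<delta>>0. \<forall>x::'a. (LINT y|lborel. scaled_kernel \<alpha> (Rbar R) \<delta> x y) = 1"
    and \<delta>\<^sub>0: "\<delta>\<^sub>0 > 0"
  obtains R' M\<^sub>0 M\<^sub>1 \<gamma> C\<^sub>S C\<^sub>P C\<^sub>D c\<^sub>W where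
    "\<And>\<delta>. 0 < \<delta> \<Longrightarrow> \<delta> \<le> \<delta>\<^sub>0 \<Longrightarrow> scaled_problem R R' M\<^sub>0 M\<^sub>1 \<gamma> \<Omega> \<alpha> \<delta> C\<^sub>S C\<^sub>P C\<^sub>D c\<^sub>W"
proof -
  obtain R' M\<^sub>0 M\<^sub>1 \<gamma> where kp: "kernel_profile R R' M\<^sub>0 M\<^sub>1 \<gamma>" using kernel_profile_exists[OF R] .
  have cone: "cone_condition \<Omega>" by (rule C1_boundary_imp_cone_condition[OF op Ck])
  obtain c\<^sub>W where W: "measure_density \<Omega> \<delta>\<^sub>0 c\<^sub>W" using cone_condition_measure_density[OF cone bd op \<delta>\<^sub>0] .
  obtain C\<^sub>S where S: "C\<^sub>S \<ge> 0" "\<And>x \<rho>. \<rho> > 0 \<Longrightarrow>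
      hausdorff_outer (DIM('a) - 1) (frontier \<Omega> \<inter> cball x \<rho>) \<le> ennreal (C\<^sub>S * \<rho> ^ (DIM('a) - 1))"
    by (rule surface_upper_regular[OF op bd Ck]) (rule that, assumption, blast)
  obtain C\<^sub>D where D: "C\<^sub>D \<ge> 0" "\<And>\<delta> u. 0 < \<delta> \<Longrightarrow> \<delta> \<le> \<delta>\<^sub>0 \<Longrightarrow> u \<in> borel_measurable borel \<Longrightarrow>
      diff_energy (near_pairs \<Omega> (2 * \<delta>)) u \<le> ennreal (C\<^sub>D * \<delta> ^ DIM('a)) * nl_energy \<Omega> \<delta> u"
    by (rule nl_energy_doubling[OF cone op bd conn \<delta>\<^sub>0]) (rule that, assumption, blast)
  obtain C where P: "C \<ge> 0" "\<And>\<delta> u \<sigma>. 0 < \<delta> \<Longrightarrow> \<delta> \<le> \<delta>\<^sub>0 \<Longrightarrow> u \<in> borel_measurable borel \<Longrightarrow> \<sigma> \<in> borel_measurable borel \<Longrightarrow>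
      (\<And>x. x \<in> \<Omega> \<Longrightarrow> hausdorff_outer (DIM('a) - 1) (frontier \<Omega> \<inter> cball x \<delta>) \<le> \<sigma> x) \<Longrightarrow>
      (\<integral>\<^sup>+x. indicator \<Omega> x * ennreal ((u x)\<^sup>2) \<partial>lborel)
      \<le> ennreal (C / \<delta>\<^sup>2) * (nl_energy \<Omega> \<delta> u
            + ennreal (1 / \<delta> ^ (DIM('a) - 1)) * (\<integral>\<^sup>+x. indicator \<Omega> x * (\<sigma> x * ennreal ((u x)\<^sup>2)) \<partial>lborel))"
    by (rule nonlocal_Poincare_boundary[OF op bd conn ne Ck \<delta>\<^sub>0]) (rule that, assumption, blast)
  have "scaled_problem R R' M\<^sub>0 M\<^sub>1 \<gamma> \<Omega> \<alpha> \<delta> C\<^sub>S (C + 1) C\<^sub>D c\<^sub>W" if \<delta>: "0 < \<delta>" "\<delta> \<le> \<delta>\<^sub>0" for \<delta>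
  proof (intro scaled_problem.intro[OF kp] scaled_problem_axioms.intro)
    show "open \<Omega>" "bounded \<Omega>" "\<delta> > 0" "\<alpha> > 0" "C\<^sub>S \<ge> 0" "C\<^sub>D \<ge> 0" "C + 1 > 0"
      using op bd \<delta> \<alpha> S(1) D(1) P(1) by auto
    show "c\<^sub>W > 0" using W by (simp add: measure_density_def)
    show "(LINT y|lborel. scaled_kernel \<alpha> (Rbar R) \<delta> x y) = 1" for x :: 'a using nrm \<delta> by simp
    show "hausdorff_outer (DIM('a) - 1) (frontier \<Omega> \<inter> cball x \<rho>) \<le> ennreal (C\<^sub>S * \<rho> ^ (DIM('a) - 1))"
      if "\<rho> > 0" for x \<rho> by (rule S(2)[OF that])
    show "diff_energy (near_pairs \<Omega> (2 * \<delta>)) u \<le> ennreal (C\<^sub>D * \<delta> ^ DIM('a)) * nl_energy \<Omega> \<delta> u"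
      if "u \<in> borel_measurable borel" for u by (rule D(2)[OF \<delta> that])
    show "ennreal (c\<^sub>W * \<delta> ^ DIM('a)) \<le> emeasure lborel (\<Omega> \<inter> cball x (\<delta> / 2))" if "x \<in> \<Omega>" for x
      using W \<delta> that by (simp add: measure_density_def)
    fix u :: "'a \<Rightarrow> real" and s :: "'a \<Rightarrow> ennreal"
    assume us: "u \<in> borel_measurable borel" "s \<in> borel_measurable borel"
      and s: "\<And>x. x \<in> \<Omega> \<Longrightarrow> hausdorff_outer (DIM('a) - 1) (frontier \<Omega> \<inter> cball x \<delta>) \<le> s x"
    show "(\<integral>\<^sup>+x. indicator \<Omega> x * ennreal ((u x)\<^sup>2) \<partial>lborel)
      \<le> ennreal ((C + 1) / \<delta>\<^sup>2) * (nl_energy \<Omega> \<delta> u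
            + ennreal (1 / \<delta> ^ (DIM('a) - 1)) * (\<integral>\<^sup>+x. indicator \<Omega> x * (s x * ennreal ((u x)\<^sup>2)) \<partial>lborel))"
      by (rule order_trans[OF P(2)[OF \<delta> us s]], assumption)
         (intro mult_right_mono ennreal_leI divide_right_mono; simp)
  qed
  then show ?thesis by (rule that)
qed

theorem theorem2p1:
  fixes \<Omega> :: "'a::euclidean_space set" and R :: "real \<Rightarrow> real" and \<alpha> :: real
  assumes "open \<Omega>" and "connected \<Omega>" and "bounded \<Omega>" and "\<Omega> \<noteq> {}"
    and "Ck_boundary 1 \<Omega>"
    and "C1_halfline R"
    and "\<forall>r\<ge>0. R r \<ge> 0"
    and "\<forall>r>1. R r = 0"
    and "\<exists>\<gamma>\<^sub>0>0. \<forall>r. 0 \<le> r \<and> r \<le> 1 / 2 \<longrightarrow> R r \<ge> \<gamma>\<^sub>0"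
    and "\<alpha> > 0"
    and "\<forall>\<delta>>0. \<forall>x::'a. (LINT y|lborel. scaled_kernel \<alpha> (Rbar R) \<delta> x y) = 1"
  shows "(\<forall>\<delta>>0. \<forall>f\<in>L2 (lebesgue_on \<Omega>). \<forall>g\<in>L2 (surface_measure \<Omega>).
            \<exists>u. is_solution \<Omega> R \<alpha> \<delta> f g u \<and> u \<in> H1 \<Omega> \<and>
                (\<forall>v. is_solution \<Omega> R \<alpha> \<delta> f g v \<longrightarrow> (AE x in lebesgue_on \<Omega>. v x = u x)))
       \<and> (\<forall>\<delta>\<^sub>0>0. \<exists>C>0. \<forall>\<delta>. 0 < \<delta> \<and> \<delta> \<le> \<delta>\<^sub>0 \<longrightarrow>
            (\<forall>f\<in>L2 (lebesgue_on \<Omega>). \<forall>g\<in>L2 (surface_measure \<Omega>). \<forall>u.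
               is_solution \<Omega> R \<alpha> \<delta> f g u \<longrightarrow>
               H1_norm \<Omega> u \<le> C * L2_norm (lebesgue_on \<Omega>) f
                              + C / sqrt \<delta> * L2_norm (surface_measure \<Omega>) g))"
proof (intro conjI allI impI ballI)
  fix \<delta> :: real and f g assume \<delta>: "\<delta> > 0" and f: "f \<in> L2 (lebesgue_on \<Omega>)" and g: "g \<in> L2 (surface_measure \<Omega>)"
  obtain R' M\<^sub>0 M\<^sub>1 \<gamma> C\<^sub>S C\<^sub>P C\<^sub>D c\<^sub>W where
    sp: "\<And>\<delta>'. 0 < \<delta>' \<Longrightarrow> \<delta>' \<le> \<delta> \<Longrightarrow> scaled_problem R R' M\<^sub>0 M\<^sub>1 \<gamma> \<Omega> \<alpha> \<delta>' C\<^sub>S C\<^sub>P C\<^sub>D c\<^sub>W"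
    by (rule scaled_problem_uniform[OF assms \<delta>]) (rule that)
  interpret scaled_problem R R' M\<^sub>0 M\<^sub>1 \<gamma> \<Omega> \<alpha> \<delta> C\<^sub>S C\<^sub>P C\<^sub>D c\<^sub>W by (rule sp[OF \<delta> order_refl])
  obtain u where u: "is_solution \<Omega> R \<alpha> \<delta> f g u" by (rule solution_exists[OF f g])
  show "\<exists>u. is_solution \<Omega> R \<alpha> \<delta> f g u \<and> u \<in> H1 \<Omega> \<and>
      (\<forall>v. is_solution \<Omega> R \<alpha> \<delta> f g v \<longrightarrow> (AE x in lebesgue_on \<Omega>. v x = u x))"
    using u solution_H1(1)[OF f g u] solution_unique[OF f g u] by (intro exI[of _ u] conjI allI impI)
next
  fix \<delta>\<^sub>0 :: real assume \<delta>\<^sub>0: "\<delta>\<^sub>0 > 0"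
  obtain R' M\<^sub>0 M\<^sub>1 \<gamma> C\<^sub>S C\<^sub>P C\<^sub>D c\<^sub>W where
    sp: "\<And>\<delta>. 0 < \<delta> \<Longrightarrow> \<delta> \<le> \<delta>\<^sub>0 \<Longrightarrow> scaled_problem R R' M\<^sub>0 M\<^sub>1 \<gamma> \<Omega> \<alpha> \<delta> C\<^sub>S C\<^sub>P C\<^sub>D c\<^sub>W"
    by (rule scaled_problem_uniform[OF assms \<delta>\<^sub>0]) (rule that)
  \<comment> \<open>The absolute value and the summand 1 below make the constant positive.\<close>
  define C where "C = scaled_problem.regularity_const TYPE('a) M\<^sub>0 M\<^sub>1 \<gamma> \<alpha> C\<^sub>S C\<^sub>P C\<^sub>D c\<^sub>W \<delta>\<^sub>0"
  have "H1_norm \<Omega> u \<le> (\<bar>C\<bar> + 1) * L2_norm (lebesgue_on \<Omega>) f + (\<bar>C\<bar> + 1) / sqrt \<delta> * L2_norm (surface_measure \<Omega>) g"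
    if \<delta>: "0 < \<delta>" "\<delta> \<le> \<delta>\<^sub>0" and f: "f \<in> L2 (lebesgue_on \<Omega>)" and g: "g \<in> L2 (surface_measure \<Omega>)"
      and u: "is_solution \<Omega> R \<alpha> \<delta> f g u" for \<delta> f g u
  proof -
    have "0 \<le> L2_norm (lebesgue_on \<Omega>) f + L2_norm (surface_measure \<Omega>) g / sqrt \<delta>"
      using \<delta> by (simp add: L2_norm_def)
    then have "C * (L2_norm (lebesgue_on \<Omega>) f + L2_norm (surface_measure \<Omega>) g / sqrt \<delta>)
        \<le> (\<bar>C\<bar> + 1) * (L2_norm (lebesgue_on \<Omega>) f + L2_norm (surface_measure \<Omega>) g / sqrt \<delta>)"
      by (intro mult_right_mono) auto
    with scaled_problem.solution_H1(2)[OF sp[OF \<delta>] f g u \<delta>(2)] show ?thesis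
      by (simp add: C_def[symmetric] distrib_left)
  qed
  then show "\<exists>C>0. \<forall>\<delta>. 0 < \<delta> \<and> \<delta> \<le> \<delta>\<^sub>0 \<longrightarrow>
      (\<forall>f\<in>L2 (lebesgue_on \<Omega>). \<forall>g\<in>L2 (surface_measure \<Omega>). \<forall>u.
         is_solution \<Omega> R \<alpha> \<delta> f g u \<longrightarrow>
         H1_norm \<Omega> u \<le> C * L2_norm (lebesgue_on \<Omega>) f + C / sqrt \<delta> * L2_norm (surface_measure \<Omega>) g)"
    by (intro exI[of _ "\<bar>C\<bar> + 1"] conjI) auto
qed

end
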